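(* Let $G=\mathrm{SO}(2,n)$ with $n\ge3$, realized as in the context. Let $H$ be a closed, connected subgroup of $AN$, with Lie algebra $\mathfrak h$, that is compatible with $A$. Assume that $H\ne(H\cap A)\ltimes(H\cap N)$ and that $H\cap N$ is not a Cartan-decomposition subgroup of $G$. Then $H$ is a Cartan-decomposition subgroup of $G$ if and only if $H$ is abelian and there exists $\omega\in\{\beta,\alpha+\beta\}$ such that $A\cap(HN)=\ker\omega$, $\mathfrak h\cap\mathfrak u_\omega\neq0$, and $\mathfrak h\subset\mathfrak t+\mathfrak u_\omega+\mathfrak u_{\alpha+2\beta}$, where $\mathfrak t$ is the Lie algebra of $A\cap(HN)$.
   Context: A closed subgroup $H$ of $G$ is a Cartan-decomposition subgroup of $G$ if $H$ is connected and there is a compact subset $C$ of $G$ with $CHC=G$. $\mathrm{SO}(2,n)$ is the group of determinant-one linear isometries of $\langle v\mid v\rangle=2v_1v_{n+2}+2v_2v_{n+1}+\sum_{i=3}^n v_i^2$ on $\mathbb{R}^{n+2}$. $A$ is the group of diagonal matrices in $\mathrm{SO}(2,n)$ with positive entries, i.e. $a=\mathrm{diag}(a_1,a_2,1,\dots,1,a_2^{-1},a_1^{-1})$, and $N$ is the group of upper-triangular matrices in $\mathrm{SO}(2,n)$ with all diagonal entries $1$. The Lie algebra $\mathfrak n$ of $N$ consists of the matrices (block sizes $1,1,n-2,1,1$) $$\begin{pmatrix}0&\phi&x&\eta&0\\0&0&y&0&-\eta\\0&0&0&-y^T&-x^T\\0&0&0&0&-\phi\\0&0&0&0&0\end{pmatrix},\qquad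 \phi,\eta\in\mathbb{R},\ x,y\in\mathbb{R}^{n-2}.$$ The simple roots are $\alpha(a)=a_1/a_2$ and $\beta(a)=a_2$; the positive roots are $\alpha,\beta,\alpha+\beta,\alpha+2\beta$ (written additively), with root spaces: $\mathfrak u_\alpha$ = $\phi$-axis, $\mathfrak u_\beta$ = $y$-subspace, $\mathfrak u_{\alpha+\beta}$ = $x$-subspace, $\mathfrak u_{\alpha+2\beta}$ = $\eta$-axis. $\ker\omega$ is the kernel of $\omega$ in $A$. A subgroup $H$ of $AN$ is compatible with $A$ if $H\subset T\,U\,C_N(T)$, where $T=A\cap(HN)$, $U=H\cap N$, and $C_N(T)$ is the centralizer of $T$ in $N$. *)

theory Defs
  imports "HOL-Analysis.Analysis" "HOL-Algebra.Coset"
begin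

(* Square matrices of size n + 2 are elements of 'm sqmat = real^'m^'m for a finite linearly ordered index
   type 'm with CARD('m) = n + 2; the order on 'm is what makes "upper triangular" and the row and
   column numbers 1, ..., n + 2 meaningful.  Only CARD('m) >= 5, i.e. n >= 3, is of interest.
   Matrix multiplication is ** throughout (the type-class * on vectors is componentwise). *)

type_synonym 'm sqmat = "((real, 'm) vec, 'm) vec"

definition pos :: "'m::{finite,linorder} \<Rightarrow> nat" where
  "pos i = card {..i}"

definition idx :: "nat \<Rightarrow> 'm::{finite,linorder}" where
  "idx k = (THE i. pos i = k)"

definition qform :: "(real, 'm::{finite,linorder}) vec \<Rightarrow> real" where
  "qform v = 2 * v $ idx 1 * v $ idx CARD('m)
           + 2 * v $ idx 2 * v $ idx (CARD('m) - 1)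
           + (\<Sum>k = 3..CARD('m) - 2. (v $ idx k)\<^sup>2)"

definition SO2 :: "'m::{finite,linorder} sqmat monoid" where
  "SO2 = \<lparr>carrier = {g. det g = 1 \<and> (\<forall>v. qform (g *v v) = qform v)},
          mult = (**), one = mat 1\<rparr>"

definition Agrp :: "'m::{finite,linorder} sqmat set" where
  "Agrp = {a \<in> carrier SO2. (\<forall>i j. i \<noteq> j \<longrightarrow> a $ i $ j = 0) \<and> (\<forall>i. a $ i $ i > 0)}"

definition Ngrp :: "'m::{finite,linorder} sqmat set" where
  "Ngrp = {u \<in> carrier SO2. (\<forall>i j. j < i \<longrightarrow> u $ i $ j = 0) \<and> (\<forall>i. u $ i $ i = 1)}"

abbreviation ANgrp :: "'m::{finite,linorder} sqmat set" where
  "ANgrp \<equiv> Agrp <#>\<^bsub>SO2\<^esub> Ngrp"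

definition cartan_decomposition_subgroup :: "'m::{finite,linorder} sqmat set \<Rightarrow> bool" where
  "cartan_decomposition_subgroup H \<longleftrightarrow>
     subgroup H SO2 \<and> closedin (top_of_set (carrier SO2)) H \<and> connected H \<and>
     (\<exists>C \<subseteq> carrier SO2. compact C \<and> C <#>\<^bsub>SO2\<^esub> H <#>\<^bsub>SO2\<^esub> C = carrier SO2)"

definition centralizer_in ::
    "'m::{finite,linorder} sqmat set \<Rightarrow> 'm sqmat set \<Rightarrow> 'm sqmat set" where
  "centralizer_in K T = {g \<in> K. \<forall>t\<in>T. g ** t = t ** g}"

(* A \<inter> (HN), the projection of H to A when H is a subgroup of AN *)
definition Tpart :: "'m::{finite,linorder} sqmat set \<Rightarrow> 'm sqmat set" where
  "Tpart H = Agrp \<inter> (H <#>\<^bsub>SO2\<^esub> Ngrp)"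

definition compatible_with_A :: "'m::{finite,linorder} sqmat set \<Rightarrow> bool" where
  "compatible_with_A H \<longleftrightarrow>
     H \<subseteq> Tpart H <#>\<^bsub>SO2\<^esub> (H \<inter> Ngrp) <#>\<^bsub>SO2\<^esub> centralizer_in Ngrp (Tpart H)"

definition matrix_exp :: "'m::finite sqmat \<Rightarrow> 'm sqmat" where
  "matrix_exp X = (\<Sum>k. (1 / fact k) *\<^sub>R (((**) X ^^ k) (mat 1)))"

(* For a closed subgroup of a matrix group this is its Lie algebra as a set of matrices. *)
definition lie_algebra :: "'m::finite sqmat set \<Rightarrow> 'm sqmat set" where
  "lie_algebra H = {X. \<forall>t. matrix_exp (t *\<^sub>R X) \<in> H}"

(* The general element of the Lie algebra of N; the components of the vectors x and y are
   x 1, ..., x (n - 2) and y 1, ..., y (n - 2), other values of x and y being irrelevant.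
   Below, m = n + 2. *)
definition nmat :: "real \<Rightarrow> (nat \<Rightarrow> real) \<Rightarrow> (nat \<Rightarrow> real) \<Rightarrow> real \<Rightarrow> 'm::{finite,linorder} sqmat" where
  "nmat \<phi> x y \<eta> = (\<chi> i j.
     let m = CARD('m); r = pos i; c = pos j in
       if r = 1 \<and> c = 2 then \<phi>
       else if r = 1 \<and> 3 \<le> c \<and> c \<le> m - 2 then x (c - 2)
       else if r = 1 \<and> c = m - 1 then \<eta>
       else if r = 2 \<and> 3 \<le> c \<and> c \<le> m - 2 then y (c - 2)
       else if r = 2 \<and> c = m then - \<eta>
       else if 3 \<le> r \<and> r \<le> m - 2 \<and> c = m - 1 then - y (r - 2)
       else if 3 \<le> r \<and> r \<le> m - 2 \<and> c = m then - x (r - 2)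
       else if r = m - 1 \<and> c = m then - \<phi>
       else 0)"

datatype pos_root = Root_alpha | Root_beta | Root_alpha_beta | Root_alpha_2beta

(* Roots are characters of A with positive real values; addition of roots is multiplication of
   characters, so p alpha + q beta is (a1 / a2)^p * a2^q. *)
fun root_char :: "pos_root \<Rightarrow> 'm::{finite,linorder} sqmat \<Rightarrow> real" where
  "root_char Root_alpha a = a $ idx 1 $ idx 1 / a $ idx 2 $ idx 2"
| "root_char Root_beta a = a $ idx 2 $ idx 2"
| "root_char Root_alpha_beta a = (a $ idx 1 $ idx 1 / a $ idx 2 $ idx 2) * a $ idx 2 $ idx 2"
| "root_char Root_alpha_2beta a = (a $ idx 1 $ idx 1 / a $ idx 2 $ idx 2) * (a $ idx 2 $ idx 2)\<^sup>2"

definition root_ker :: "pos_root \<Rightarrow> 'm::{finite,linorder} sqmat set" where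
  "root_ker \<omega> = {a \<in> Agrp. root_char \<omega> a = 1}"

fun root_space :: "pos_root \<Rightarrow> 'm::{finite,linorder} sqmat set" where
  "root_space Root_alpha = {nmat \<phi> (\<lambda>_. 0) (\<lambda>_. 0) 0 |\<phi>. True}"
| "root_space Root_beta = {nmat 0 (\<lambda>_. 0) y 0 |y. True}"
| "root_space Root_alpha_beta = {nmat 0 x (\<lambda>_. 0) 0 |x. True}"
| "root_space Root_alpha_2beta = {nmat 0 (\<lambda>_. 0) (\<lambda>_. 0) \<eta> |\<eta>. True}"

end

theory Submission
  imports Defs
begin

text \<open>
  Write the elements of G in KAK form with Cartan projection (r, s), r \<ge> s \<ge> 0.  Up to bounded factors
  exp r is the size of g and exp (r + s) the size of its matrix of 2 by 2 minors, so a subgroup is a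
  Cartan-decomposition subgroup exactly when these two sizes, taken over the subgroup, reach every
  point of the chamber up to a bounded error.

  If H is not a semidirect product, the centralizer of T = A \<inter> (HN) in N is nontrivial, so T is the kernel of
  a positive root.  Compatibility then provides a generator Z = T0 + X0 of the Lie algebra of H modulo
  its nilpotent part, with T0 spanning the Lie algebra of T and X0 a nonzero vector of the root space.
  The action of Z splits the Lie algebra of H \<inter> N into root components, and since H \<inter> N misses a part of the
  chamber, pairs of components that would fill it are excluded.  In the remaining cases
  H lies at bounded distance from an explicit family.  Because s X0 grows linearly while the torus part exp (s T0)
  grows exponentially, such a family stays logarithmically close to or far from a wall, unless
  the nilpotent part lies in the same short root space as X0.
\<close>

section \<open>The exponential of matrices\<close>

text \<open>Distance from the walls r = s and s = 0 is measured by \<open>N1\<close>^2 /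
  \<open>N2\<close>, about exp (r - s), and by \<open>N2\<close> / \<open>N1\<close>, about exp s. A
  family misses part of the chamber as soon as one of these ratios is at least a multiple of a
  quantity \<rho> that also bounds \<open>N1\<close>: near that wall \<rho>, hence
  \<open>N1\<close>, is then bounded. Constants do not matter, but powers of s do.

  A short root vector of length L contributes about 2 ln L to one Cartan coordinate. If the
  nilpotent part contains v in the root space of X0, the length of s X0 + c v can be prescribed
  above a linear function of s, so the drift caused by X0 can be undone. In every other case it
  cannot.

  Two obstacles shape the argument. Compatibility speaks of group elements; it passes to the Lie
  algebra only by removing components of nonzero weight height by height. And ad Z need not be
  diagonalizable, because of X0, so root components have to be extracted from combinations of
  iterated brackets, the excluded pairs disposing of the nilpotent remainders. The Weyl group then
  reduces the surviving cases to four families.\<close>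

typedef 'n endo = "UNIV :: ((real, 'n::finite) vec \<Rightarrow>\<^sub>L (real, 'n) vec) set"
  by simp

setup_lifting type_definition_endo

instantiation endo :: (finite) real_vector
begin

lift_definition zero_endo :: "'a endo" is 0 .
lift_definition plus_endo :: "'a endo \<Rightarrow> 'a endo \<Rightarrow> 'a endo" is "(+)" .
lift_definition minus_endo :: "'a endo \<Rightarrow> 'a endo \<Rightarrow> 'a endo" is "(-)" .
lift_definition uminus_endo :: "'a endo \<Rightarrow> 'a endo" is uminus .
lift_definition scaleR_endo :: "real \<Rightarrow> 'a endo \<Rightarrow> 'a endo" is scaleR .

instance
  by standard (transfer; simp add: algebra_simps)+

end

text \<open>The series \<open>exp\<close> is taken in a Banach algebra, while multiplication on
  \<open>sqmat\<close> is componentwise. Bounded operators under composition, with the operator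
  norm, form such an algebra in a type of their own; \<open>endo_of\<close> and
  \<open>mat_of\<close> carry results back and forth.\<close>

instantiation endo :: (finite) real_normed_algebra_1
begin

lift_definition one_endo :: "'a endo" is id_blinfun .
lift_definition times_endo :: "'a endo \<Rightarrow> 'a endo \<Rightarrow> 'a endo" is "(o\<^sub>L)" .
lift_definition norm_endo :: "'a endo \<Rightarrow> real" is norm .
definition dist_endo :: "'a endo \<Rightarrow> 'a endo \<Rightarrow> real" where "dist_endo a b = norm (a - b)"
definition sgn_endo :: "'a endo \<Rightarrow> 'a endo" where "sgn_endo x = x /\<^sub>R norm x"
definition uniformity_endo :: "('a endo \<times> 'a endo) filter"
  where "uniformity_endo = (INF e\<in>{0<..}. principal {(x, y). dist x y < e})"
definition open_endo :: "'a endo set \<Rightarrow> bool"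
  where "open_endo S = (\<forall>x\<in>S. \<forall>\<^sub>F (x', y) in uniformity. x' = x \<longrightarrow> y \<in> S)"

instance
proof
  fix a b c :: "'a endo" and r s :: real
  show "dist a b = norm (a - b)" by (rule dist_endo_def)
  show "sgn a = a /\<^sub>R norm a" by (rule sgn_endo_def)
  show "(uniformity :: ('a endo \<times> 'a endo) filter) = (INF e\<in>{0<..}. principal {(x, y). dist x y < e})"
    by (rule uniformity_endo_def)
  show "open U = (\<forall>x\<in>U. \<forall>\<^sub>F (x', y) in uniformity. x' = x \<longrightarrow> y \<in> U)" for U :: "'a endo set"
    by (rule open_endo_def)
  show "(norm a = 0) = (a = 0)" "norm (a + b) \<le> norm a + norm b" "norm (r *\<^sub>R a) = \<bar>r\<bar> * norm a"
    by (transfer; simp add: norm_triangle_ineq)+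
  show "a * b * c = a * (b * c)"
    by transfer (simp add: blinfun_eqI)
  show "(a + b) * c = a * c + b * c" "a * (b + c) = a * b + a * c"
    by (transfer; rule blinfun_eqI; simp add: blinfun.bilinear_simps)+
  show "(r *\<^sub>R a) * b = r *\<^sub>R (a * b)" "a * (r *\<^sub>R b) = r *\<^sub>R (a * b)"
    by (transfer; rule blinfun_eqI; simp add: blinfun.bilinear_simps)+
  show "1 * a = a" "a * 1 = a"
    by (transfer; rule blinfun_eqI; simp)+
  show "(0::'a endo) \<noteq> 1"
  proof transfer
    obtain x :: "(real, 'a) vec" where "x \<noteq> 0" by (metis axis_eq_0_iff zero_neq_one)
    then show "(0 :: (real, 'a) vec \<Rightarrow>\<^sub>L (real, 'a) vec) \<noteq> id_blinfun"
      by (metis blinfun.zero_left id_blinfun.rep_eq id_apply)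
  qed
  show "norm (a * b) \<le> norm a * norm b"
    by transfer (rule norm_blinfun_compose)
  show "norm (1 :: 'a endo) = 1"
    by transfer (rule norm_blinfun_id)
qed

end

instance endo :: (finite) banach
proof
  fix X :: "nat \<Rightarrow> 'a endo"
  assume X: "Cauchy X"
  have d: "dist x y = dist (Rep_endo x) (Rep_endo y)" for x y :: "'a endo"
    by (simp add: dist_endo_def dist_norm norm_endo.rep_eq minus_endo.rep_eq)
  have "Cauchy (\<lambda>k. Rep_endo (X k))"
    using X unfolding Cauchy_def by (simp add: d)
  then obtain L where "(\<lambda>k. Rep_endo (X k)) \<longlonglongrightarrow> L"
    using Cauchy_convergent_iff convergent_def by blast
  then have "X \<longlonglongrightarrow> Abs_endo L"
    by (simp add: tendsto_iff d Abs_endo_inverse)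
  then show "convergent X" by (rule convergentI)
qed

lift_definition endo_of :: "'n::finite sqmat \<Rightarrow> 'n endo" is "\<lambda>A. Blinfun ((*v) A)" .
lift_definition mat_of :: "'n::finite endo \<Rightarrow> 'n sqmat" is "\<lambda>f. matrix (blinfun_apply f)" .

lemma mat_of_endo_of [simp]: "mat_of (endo_of A) = A"
  by transfer (simp add: bounded_linear_Blinfun_apply matrix_vector_mul_bounded_linear matrix_of_matrix_vector_mul)

lemma endo_of_mat_of [simp]: "endo_of (mat_of f) = f"
proof transfer
  fix f :: "(real, 'a) vec \<Rightarrow>\<^sub>L (real, 'a) vec"
  have "linear (blinfun_apply f)" by (simp add: blinfun.bounded_linear_right bounded_linear.linear)
  then have "(*v) (matrix (blinfun_apply f)) = blinfun_apply f" by (simp add: matrix_works fun_eq_iff)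
  then show "Blinfun ((*v) (matrix (blinfun_apply f))) = f" by (simp add: blinfun_apply_inverse)
qed

lemma endo_of_mult: "endo_of (A ** B) = endo_of A * endo_of B"
  by transfer (rule blinfun_eqI, simp add: bounded_linear_Blinfun_apply matrix_vector_mul_bounded_linear matrix_vector_mul_assoc)

lemma endo_of_one [simp]: "endo_of (mat 1) = 1"
  by transfer (rule blinfun_eqI, simp add: bounded_linear_Blinfun_apply matrix_vector_mul_bounded_linear)

lemma endo_of_add: "endo_of (A + B) = endo_of A + endo_of B"
  by transfer (rule blinfun_eqI, simp add: bounded_linear_Blinfun_apply matrix_vector_mul_bounded_linear matrix_vector_mult_add_rdistrib plus_blinfun.rep_eq)

lemma endo_of_scaleR: "endo_of (r *\<^sub>R A) = r *\<^sub>R endo_of A"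
  by transfer (rule blinfun_eqI, simp add: bounded_linear_Blinfun_apply matrix_vector_mul_bounded_linear scaleR_matrix_vector_assoc scaleR_blinfun.rep_eq)

lemma linear_endo_of: "linear endo_of"
  by (rule linearI) (simp_all add: endo_of_add endo_of_scaleR)

lemma bounded_linear_endo_of: "bounded_linear endo_of"
  using linear_endo_of by (rule linear_conv_bounded_linear[THEN iffD1])

lemma mat_of_add: "mat_of (f + g) = mat_of f + mat_of g"
  by (metis endo_of_add endo_of_mat_of mat_of_endo_of)

lemma mat_of_scaleR: "mat_of (r *\<^sub>R f) = r *\<^sub>R mat_of f"
  by (metis endo_of_scaleR endo_of_mat_of mat_of_endo_of)

lemma mat_of_mult: "mat_of (f * g) = mat_of f ** mat_of g"
  by (metis endo_of_mult endo_of_mat_of mat_of_endo_of)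

lemma mat_of_one [simp]: "mat_of 1 = mat 1"
  by (metis endo_of_one mat_of_endo_of)

lemma norm_le_norm_endo: "norm (mat_of f *v v) \<le> norm f * norm v"
proof transfer
  fix f :: "(real, 'a) vec \<Rightarrow>\<^sub>L (real, 'a) vec" and v
  have "linear (blinfun_apply f)" by (simp add: blinfun.bounded_linear_right bounded_linear.linear)
  then show "norm (matrix (blinfun_apply f) *v v) \<le> norm f * norm v"
    by (simp add: matrix_works norm_blinfun)
qed

lemma bounded_linear_mat_of: "bounded_linear (mat_of :: 'n::finite endo \<Rightarrow> 'n sqmat)"
proof (rule bounded_linear_intro[where K = "real CARD('n) * real CARD('n)"])
  fix f :: "'n endo"
  have "norm (mat_of f $ i $ j) \<le> norm f" for i j
  proof -
    have "mat_of f $ i $ j = (mat_of f *v axis j 1) $ i"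
      by (simp add: matrix_vector_mul_component inner_axis)
    also have "norm \<dots> \<le> norm (mat_of f *v axis j 1)"
      by (metis component_le_norm_cart real_norm_def)
    also have "\<dots> \<le> norm f" using norm_le_norm_endo[of f "axis j 1"] by simp
    finally show ?thesis .
  qed
  then have "(\<Sum>i\<in>UNIV. \<Sum>j\<in>UNIV. norm (mat_of f $ i $ j)) \<le> (\<Sum>i\<in>(UNIV::'n set). \<Sum>j\<in>(UNIV::'n set). norm f)"
    by (intro sum_mono)
  moreover have "norm (mat_of f) \<le> (\<Sum>i\<in>UNIV. \<Sum>j\<in>UNIV. norm (mat_of f $ i $ j))"
    using norm_le_l1_cart sum_mono norm_vec_def L2_set_le_sum
    by (smt (verit, ccfv_SIG) norm_ge_zero real_norm_def sum_mono)
  ultimately show "norm (mat_of f) \<le> norm f * (real CARD('n) * real CARD('n))"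
    by (simp add: mult_ac)
qed (simp_all add: mat_of_add mat_of_scaleR)

lemma endo_of_funpow: "endo_of (((**) X ^^ k) (mat 1)) = endo_of X ^ k"
  by (induction k) (simp_all add: endo_of_mult)

lemma endo_of_matrix_exp: "endo_of (matrix_exp X) = exp (endo_of X)"
proof -
  have "(\<lambda>k. mat_of (endo_of X ^ k /\<^sub>R fact k)) sums mat_of (exp (endo_of X))"
    by (rule bounded_linear.sums[OF bounded_linear_mat_of exp_converges])
  moreover have "mat_of (endo_of X ^ k /\<^sub>R fact k) = (1 / fact k) *\<^sub>R (((**) X ^^ k) (mat 1))" for k
    by (simp add: endo_of_funpow[symmetric] mat_of_scaleR divide_inverse)
  ultimately have "matrix_exp X = mat_of (exp (endo_of X))"
    unfolding matrix_exp_def by (simp add: sums_iff)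
  then show ?thesis by simp
qed

lemma matrix_exp_eq: "matrix_exp X = mat_of (exp (endo_of X))"
  by (simp flip: endo_of_matrix_exp)

lemma matrix_exp_add_commuting: "X ** Y = Y ** X \<Longrightarrow> matrix_exp (X + Y) = matrix_exp X ** matrix_exp Y"
  by (simp add: matrix_exp_eq endo_of_add exp_add_commuting flip: mat_of_mult endo_of_mult)

lemma matrix_exp_0 [simp]: "matrix_exp 0 = mat 1"
  by (simp add: matrix_exp_eq linear_0[OF linear_endo_of])

lemma matrix_exp_scaleR_add: "matrix_exp ((s + t) *\<^sub>R X) = matrix_exp (s *\<^sub>R X) ** matrix_exp (t *\<^sub>R X)"
  unfolding scaleR_add_left
  by (rule matrix_exp_add_commuting) (simp add: scalar_matrix_assoc[symmetric] matrix_scalar_ac mult.commute)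

lemma matrix_exp_minus: "matrix_exp X ** matrix_exp (- X) = mat 1" "matrix_exp (- X) ** matrix_exp X = mat 1"
  using matrix_exp_scaleR_add[of 1 "-1" X] matrix_exp_scaleR_add[of "-1" 1 X] by simp_all

text \<open>The partial sums converge uniformly on the ball of radius \<open>norm x + 1\<close>,
  dominated by the exponential series of that radius, and \<open>x\<close> is interior to the
  ball.\<close>

lemma isCont_exp_banach: "isCont exp (x :: 'a::{real_normed_algebra_1, banach})"
proof -
  define r where "r = norm x + 1"
  have "uniform_limit (cball 0 r) (\<lambda>n y. \<Sum>k<n. (y :: 'a) ^ k /\<^sub>R fact k) (\<lambda>y. \<Sum>k. y ^ k /\<^sub>R fact k) sequentially"
  proof (rule Weierstrass_m_test)
    fix n and y :: 'a assume "y \<in> cball 0 r"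
    then have "norm (y ^ n) \<le> r ^ n"
      using norm_power_ineq[of y n] power_mono[of "norm y" r n] by (simp add: order_trans)
    then show "norm (y ^ n /\<^sub>R fact n) \<le> r ^ n /\<^sub>R fact n"
      by (simp add: divide_right_mono field_simps)
  next
    show "summable (\<lambda>n. r ^ n /\<^sub>R fact n)" by (rule summable_exp_generic)
  qed
  then have "continuous_on (cball 0 r) (\<lambda>y :: 'a. \<Sum>k. y ^ k /\<^sub>R fact k)"
    by (rule uniform_limit_theorem[rotated]) (auto intro!: always_eventually continuous_intros)
  moreover have "x \<in> interior (cball 0 r)" by (simp add: r_def)
  ultimately show ?thesis unfolding exp_def by (rule continuous_on_interior)
qed

lemma continuous_matrix_exp: "continuous_on UNIV (matrix_exp :: 'n::finite sqmat \<Rightarrow> _)"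
proof -
  have "isCont (\<lambda>x. exp x :: 'n endo) x" for x :: "'n endo" by (rule isCont_exp_banach)
  then have "continuous_on UNIV (exp :: 'n endo \<Rightarrow> _)" by (simp add: continuous_on_eq_continuous_at)
  then have "continuous_on UNIV (\<lambda>X. mat_of (exp (endo_of X :: 'n endo)))"
    by (intro bounded_linear.continuous_on[OF bounded_linear_mat_of]
        continuous_on_compose2[of UNIV "exp :: 'n endo \<Rightarrow> _" UNIV endo_of]
        bounded_linear.continuous_on[OF bounded_linear_endo_of] continuous_intros) auto
  then show ?thesis by (simp add: matrix_exp_eq)
qed

lemma tendsto_matrix_exp:
  "(f \<longlongrightarrow> X) F \<Longrightarrow> ((\<lambda>k. matrix_exp (f k)) \<longlongrightarrow> matrix_exp X) F"
  using continuous_matrix_exp isCont_tendsto_compose continuous_on_eq_continuous_at[OF open_UNIV] by blast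

lemma matrix_exp_has_vector_derivative_0:
  "((\<lambda>t. matrix_exp (t *\<^sub>R X)) has_vector_derivative X) (at 0)"
proof -
  have "((\<lambda>t. exp (t *\<^sub>R endo_of X)) has_vector_derivative exp (0 *\<^sub>R endo_of X) * endo_of X) (at 0)"
    by (rule exp_scaleR_has_vector_derivative_right)
  then have "((\<lambda>t. mat_of (exp (t *\<^sub>R endo_of X))) has_vector_derivative mat_of (exp (0 *\<^sub>R endo_of X) * endo_of X)) (at 0)"
    by (rule bounded_linear.has_vector_derivative[OF bounded_linear_mat_of])
  then show ?thesis by (simp add: matrix_exp_eq endo_of_scaleR)
qed

text \<open>After two terms the tail is dominated by \<open>norm x\<close>^2 times the series of exp
  1, because (k + 2)! is at least k! and \<open>norm x\<close> is at most 1.\<close>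

lemma norm_exp_minus_linear:
  fixes x :: "'a::{real_normed_algebra_1, banach}"
  assumes "norm x \<le> 1"
  shows "norm (exp x - 1 - x) \<le> exp 1 * (norm x)\<^sup>2"
proof -
  have "(\<lambda>k. x ^ (k + 2) /\<^sub>R fact (k + 2)) sums (exp x - (\<Sum>i<2. x ^ i /\<^sub>R fact i))"
    using sums_split_initial_segment[OF exp_converges[of x], of 2] by simp
  moreover have "(\<Sum>i<2. x ^ i /\<^sub>R fact i) = 1 + x"
    by (simp add: eval_nat_numeral)
  ultimately have sm: "(\<lambda>k. x ^ (k + 2) /\<^sub>R fact (k + 2)) sums (exp x - 1 - x)"
    by (simp add: algebra_simps)
  have le: "norm (x ^ (k + 2) /\<^sub>R fact (k + 2)) \<le> (norm x)\<^sup>2 * (1 ^ k /\<^sub>R fact k)" for k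
  proof -
    have "norm (x ^ (k + 2)) \<le> (norm x) ^ (k + 2)" by (rule norm_power_ineq)
    also have "\<dots> \<le> (norm x)\<^sup>2 * 1 ^ k"
      using assms mult_left_le[of "norm x ^ k" "(norm x)\<^sup>2"]
      by (simp add: power_add power_le_one power2_eq_square mult_ac)
    finally have 1: "norm (x ^ (k + 2)) \<le> (norm x)\<^sup>2" by simp
    have "(fact k :: real) \<le> fact (k + 2)" by (rule fact_mono) simp
    then have "1 / fact (k + 2) \<le> (1 / fact k :: real)" by (simp add: frac_le)
    then have "norm (x ^ (k + 2)) * (1 / fact (k + 2)) \<le> (norm x)\<^sup>2 * (1 / fact k)"
      using 1 by (intro mult_mono) auto
    then show ?thesis by (simp add: divide_inverse mult.commute)
  qed
  have s2: "(\<lambda>k. (norm x)\<^sup>2 * (1 ^ k /\<^sub>R fact k)) sums ((norm x)\<^sup>2 * exp (1::real))"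
    by (intro sums_mult exp_converges)
  have "norm (\<Sum>k. x ^ (k + 2) /\<^sub>R fact (k + 2)) \<le> (\<Sum>k. (norm x)\<^sup>2 * (1 ^ k /\<^sub>R fact k))"
    by (rule norm_suminf_le[OF le sums_summable[OF s2]])
  then have "norm (exp x - 1 - x) \<le> (norm x)\<^sup>2 * exp (1::real)"
    by (simp only: sums_unique[OF sm, symmetric] sums_unique[OF s2, symmetric])
  then show ?thesis by (simp add: mult.commute)
qed

text \<open>Besides the derivative at 0 this explicit quadratic error is what
  \<open>local_log\<close> needs to compare logarithms with differences.\<close>

lemma matrix_exp_quadratic:
  obtains r C where "r > 0" "C > 0"
    "\<And>X :: 'n::finite sqmat. norm X \<le> r \<Longrightarrow> norm (matrix_exp X - mat 1 - X) \<le> C * (norm X)\<^sup>2"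
proof -
  obtain K where K: "K > 0" "\<And>X :: 'n sqmat. norm (endo_of X) \<le> norm X * K"
    using bounded_linear.pos_bounded[OF bounded_linear_endo_of] by blast
  obtain L where L: "L > 0" "\<And>f :: 'n endo. norm (mat_of f) \<le> norm f * L"
    using bounded_linear.pos_bounded[OF bounded_linear_mat_of] by blast
  show ?thesis
  proof
    show "1 / K > 0" using K by simp
    show "L * exp 1 * K\<^sup>2 > 0" using K L by simp
    fix X :: "'n sqmat" assume X: "norm X \<le> 1 / K"
    then have "norm (endo_of X) \<le> 1" using K(2)[of X] K(1) by (simp add: field_simps)
    then have 1: "norm (exp (endo_of X) - 1 - endo_of X) \<le> exp 1 * (norm (endo_of X))\<^sup>2"
      by (rule norm_exp_minus_linear)
    have "(norm (endo_of X))\<^sup>2 \<le> (norm X * K)\<^sup>2"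
      using K(2) by (intro power_mono) auto
    with 1 have 2: "norm (exp (endo_of X) - 1 - endo_of X) \<le> exp 1 * (norm X * K)\<^sup>2"
      by (smt (verit) exp_gt_zero mult_left_mono)
    have "matrix_exp X - mat 1 - X = mat_of (exp (endo_of X) - 1 - endo_of X)"
      by (simp add: matrix_exp_eq linear_diff[OF bounded_linear.linear[OF bounded_linear_mat_of]])
    then have "norm (matrix_exp X - mat 1 - X) \<le> norm (exp (endo_of X) - 1 - endo_of X) * L"
      using L(2) by simp
    also have "\<dots> \<le> (exp 1 * (norm X * K)\<^sup>2) * L" using 2 L(1) by (intro mult_right_mono) auto
    finally show "norm (matrix_exp X - mat 1 - X) \<le> L * exp 1 * K\<^sup>2 * (norm X)\<^sup>2"
      by (simp add: power_mult_distrib mult_ac)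
  qed
qed

lemma matrix_exp_has_derivative_0: "(matrix_exp has_derivative (\<lambda>X. X)) (at (0 :: 'n::finite sqmat))"
proof -
  obtain r C where rC: "r > 0" "C > 0"
    and b: "\<And>X :: 'n sqmat. norm X \<le> r \<Longrightarrow> norm (matrix_exp X - mat 1 - X) \<le> C * (norm X)\<^sup>2"
    by (rule matrix_exp_quadratic) blast
  show ?thesis
    unfolding has_derivative_at_alt
  proof (intro conjI allI impI)
    fix e :: real assume e: "e > 0"
    show "\<exists>d>0. \<forall>y :: 'n sqmat. norm (y - 0) < d \<longrightarrow> norm (matrix_exp y - matrix_exp 0 - (y - 0)) \<le> e * norm (y - 0)"
    proof (intro exI[of _ "min r (e / C)"] conjI allI impI)
      show "0 < min r (e / C)" using rC e by simp
      fix y :: "'n sqmat" assume y: "norm (y - 0) < min r (e / C)"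
      then have "norm (matrix_exp y - mat 1 - y) \<le> C * (norm y)\<^sup>2" using b by simp
      also have "\<dots> \<le> e * norm y"
      proof -
        have "C * norm y \<le> e" using y rC by (simp add: field_simps)
        then show ?thesis by (simp add: power2_eq_square mult_right_mono flip: mult.assoc)
      qed
      finally show "norm (matrix_exp y - matrix_exp 0 - (y - 0)) \<le> e * norm (y - 0)" by simp
    qed
  qed simp
qed

lemma matrix_exp_conj:
  fixes P Q X :: "'n::finite sqmat"
  assumes "P ** Q = mat 1" "Q ** P = mat 1"
  shows "matrix_exp (P ** X ** Q) = P ** matrix_exp X ** Q"
proof -
  have 1: "((**) (P ** X ** Q) ^^ k) (mat 1) = P ** ((**) X ^^ k) (mat 1) ** Q" for k
  proof (induction k)
    case 0 then show ?case using assms by simp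
  next
    case (Suc k)
    have "(P ** X ** Q) ** (P ** ((**) X ^^ k) (mat 1) ** Q) = P ** X ** (Q ** P) ** ((**) X ^^ k) (mat 1) ** Q"
      by (simp add: matrix_mul_assoc)
    then show ?case using Suc assms by (simp add: matrix_mul_assoc)
  qed
  have 2: "endo_of (P ** X ** Q) ^ k = endo_of P * endo_of X ^ k * endo_of Q" for k
    using arg_cong[OF 1[of k], of endo_of] by (simp only: endo_of_mult endo_of_funpow)
  have "(\<lambda>k. endo_of (P ** X ** Q) ^ k /\<^sub>R fact k) sums (endo_of P * exp (endo_of X) * endo_of Q)"
    using sums_mult2[OF sums_mult[OF exp_converges[of "endo_of X"], of "endo_of P"], of "endo_of Q"]
    by (simp add: 2)
  then have "exp (endo_of (P ** X ** Q)) = endo_of P * exp (endo_of X) * endo_of Q"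
    using exp_converges sums_unique2 by blast
  then show ?thesis by (simp add: matrix_exp_eq mat_of_mult)
qed

lemma matrix_exp_eq_suminf:
  "(\<lambda>k. (1 / fact k) *\<^sub>R (((**) X ^^ k) (mat 1))) sums matrix_exp X"
proof -
  have "(\<lambda>k. mat_of (endo_of X ^ k /\<^sub>R fact k)) sums mat_of (exp (endo_of X))"
    by (rule bounded_linear.sums[OF bounded_linear_mat_of exp_converges])
  moreover have "mat_of (endo_of X ^ k /\<^sub>R fact k) = (1 / fact k) *\<^sub>R (((**) X ^^ k) (mat 1))" for k
    by (simp add: endo_of_funpow[symmetric] mat_of_scaleR divide_inverse)
  ultimately show ?thesis by (simp add: matrix_exp_eq)
qed

text \<open>The operators \<open>wedge u v\<close> with \<open>u\<close> isotropic and orthogonal to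
  \<open>v\<close> have cube zero, so their exponentials are the quadratic polynomials
  \<open>eich u v\<close>.\<close>

lemma matrix_exp_cube_zero:
  assumes "X ** X ** X = 0"
  shows "matrix_exp X = mat 1 + X + (1/2) *\<^sub>R (X ** X)"
proof -
  have z: "((**) X ^^ k) (mat 1) = 0" if "k \<ge> 3" for k
    using that
  proof (induction k rule: dec_induct)
    case base
    then show ?case using assms by (simp add: eval_nat_numeral matrix_mul_assoc)
  next
    case (step n) then show ?case by simp
  qed
  have "(\<lambda>k. (1 / fact k) *\<^sub>R (((**) X ^^ k) (mat 1))) sums (\<Sum>k<3. (1 / fact k) *\<^sub>R (((**) X ^^ k) (mat 1)))"
    by (rule sums_finite) (auto simp: z)
  then have "matrix_exp X = (\<Sum>k<3. (1 / fact k) *\<^sub>R (((**) X ^^ k) (mat 1)))"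
    using matrix_exp_eq_suminf sums_unique2 by blast
  then show ?thesis by (simp add: eval_nat_numeral)
qed

text \<open>\<open>P\<close> stands for a set of matrices closed under products on which one
  diagonal entry is multiplicative; in the application, the upper triangular matrices.\<close>

lemma matrix_exp_diag_entry:
  assumes mult: "\<And>A B. P A \<Longrightarrow> P B \<Longrightarrow> P (A ** B) \<and> (A ** B) $ i $ i = A $ i $ i * B $ i $ i"
    and "P (mat 1)" "P X"
  shows "matrix_exp X $ i $ i = exp (X $ i $ i)"
proof -
  have "P (((**) X ^^ k) (mat 1)) \<and> (((**) X ^^ k) (mat 1)) $ i $ i = (X $ i $ i) ^ k" for k
    using assms by (induction k) (auto simp: mat_def)
  moreover have "(\<lambda>k. ((1 / fact k) *\<^sub>R (((**) X ^^ k) (mat 1))) $ i $ i) sums (matrix_exp X $ i $ i)"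
    by (intro bounded_linear.sums[OF bounded_linear_vec_nth] matrix_exp_eq_suminf)
  ultimately have "(\<lambda>k. (X $ i $ i) ^ k /\<^sub>R fact k) sums (matrix_exp X $ i $ i)"
    by (simp add: divide_inverse)
  then show ?thesis using exp_converges sums_unique2 by blast
qed

section \<open>Closed matrix groups\<close>

lemma bounded_bilinear_matrix_mult:
  "bounded_bilinear ((**) :: 'n::finite sqmat \<Rightarrow> 'n sqmat \<Rightarrow> 'n sqmat)"
  unfolding bilinear_conv_bounded_bilinear[symmetric] bilinear_def
  by (auto intro!: linearI simp: matrix_add_ldistrib matrix_scalar_ac scalar_matrix_assoc
      matrix_matrix_mult_def vec_eq_iff sum.distrib distrib_left distrib_right sum_distrib_left mult_ac)

lemmas tendsto_matrix_mult = bounded_bilinear.tendsto[OF bounded_bilinear_matrix_mult]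
lemmas continuous_on_matrix_mult = bounded_bilinear.continuous_on[OF bounded_bilinear_matrix_mult]

lemma matrix_mult_scaleR [simp]:
  fixes A B :: "'n::finite sqmat"
  shows "(r *\<^sub>R A) ** B = r *\<^sub>R (A ** B)" "A ** (r *\<^sub>R B) = r *\<^sub>R (A ** B)"
  by (simp_all add: scalar_matrix_assoc matrix_scalar_ac)

lemma matrix_mult_minus [simp]:
  fixes A B :: "'n::finite sqmat"
  shows "(- A) ** B = - (A ** B)" "A ** (- B) = - (A ** B)"
  using matrix_mult_scaleR(1)[of "-1" A B] matrix_mult_scaleR(2)[of A "-1" B] by simp_all

lemma matrix_inverse_unique:
  fixes A :: "'n::finite sqmat"
  shows "A ** B = mat 1 \<Longrightarrow> C ** A = mat 1 \<Longrightarrow> B = C"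
  by (metis matrix_mul_assoc matrix_mul_lid matrix_mul_rid)

text \<open>Words grow on the right, so that a path to a word is extended by one factor at a time in
  \<open>connected_mgen_exp\<close>. For a set of generators closed under inverses this is the
  generated subgroup, by \<open>mgen_inverse\<close>.\<close>

inductive_set mgen :: "'n::finite sqmat set \<Rightarrow> 'n sqmat set" for E where
  one: "mat 1 \<in> mgen E"
| step: "A \<in> mgen E \<Longrightarrow> B \<in> E \<Longrightarrow> A ** B \<in> mgen E"

lemma mgen_base: "B \<in> E \<Longrightarrow> B \<in> mgen E"
  using mgen.step[OF mgen.one, of B E] by simp

lemma mgen_mult: "A \<in> mgen E \<Longrightarrow> B \<in> mgen E \<Longrightarrow> A ** B \<in> mgen E"
  by (rotate_tac 1, induction B rule: mgen.induct) (auto simp: matrix_mul_assoc intro: mgen.intros)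

lemma mgen_inverse:
  assumes "\<And>A. A \<in> E \<Longrightarrow> \<exists>B\<in>E. A ** B = mat 1 \<and> B ** A = mat 1" "A \<in> mgen E"
  shows "\<exists>B\<in>mgen E. A ** B = mat 1 \<and> B ** A = mat 1"
  using assms(2)
proof induction
  case one then show ?case using mgen.one by force
next
  case (step A B)
  then obtain A' B' where *: "A' \<in> mgen E" "A ** A' = mat 1" "A' ** A = mat 1" "B' \<in> E" "B ** B' = mat 1" "B' ** B = mat 1"
    using assms(1) by blast
  have "(A ** B) ** (B' ** A') = A ** (B ** B') ** A'" "(B' ** A') ** (A ** B) = B' ** (A' ** A) ** B"
    by (simp_all add: matrix_mul_assoc)
  then have "(A ** B) ** (B' ** A') = mat 1" "(B' ** A') ** (A ** B) = mat 1"
    by (simp_all add: *)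
  moreover have "B' ** A' \<in> mgen E" using * mgen_mult mgen_base by blast
  ultimately show ?case by blast
qed

lemma connected_mgen_exp:
  assumes "\<And>t Y. Y \<in> V \<Longrightarrow> t *\<^sub>R Y \<in> V"
  shows "connected (mgen (matrix_exp ` V))"
proof -
  let ?S = "mgen (matrix_exp ` V)"
  have "connected_component ?S (mat 1) A" if "A \<in> ?S" for A
    using that
  proof induction
    case one then show ?case by (simp add: mgen.one)
  next
    case (step A B)
    then obtain Y where Y: "Y \<in> V" "B = matrix_exp Y" by auto
    let ?P = "(\<lambda>t. A ** matrix_exp (t *\<^sub>R Y)) ` {0..1}"
    have "connected ?P"
      by (intro connected_continuous_image continuous_on_matrix_mult continuous_intros
          continuous_on_compose2[OF continuous_matrix_exp]) auto
    moreover have "?P \<subseteq> ?S" using step Y assms by (auto intro!: mgen.step)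
    moreover have "A \<in> ?P" by (rule image_eqI[of _ _ 0]) auto
    moreover have "A ** B \<in> ?P" by (rule image_eqI[of _ _ 1]) (auto simp: Y)
    ultimately have "connected_component ?S A (A ** B)"
      unfolding connected_component_def by blast
    then show ?case using step by (meson connected_component_trans)
  qed
  then have "connected_component ?S A B" if "A \<in> ?S" "B \<in> ?S" for A B
    using that connected_component_sym[of ?S "mat 1" A] connected_component_trans[of ?S A "mat 1" B] by blast
  then show ?thesis by (simp add: connected_iff_connected_component)
qed

text \<open>Sussmann's open mapping theorem asks for continuity and for differentiability at the one
  point 0, so the derivative of the exponential is needed at 0 only.\<close>

lemma local_surjectivity:
  fixes f :: "'a::euclidean_space \<Rightarrow> 'a"
  assumes "continuous_on UNIV f" "(f has_derivative (\<lambda>x. x)) (at 0)" "e > 0"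
  shows "\<exists>d>0. ball (f 0) d \<subseteq> f ` ball 0 e"
proof -
  have "f 0 \<in> interior (f ` ball 0 e)"
    by (rule sussmann_open_mapping[OF open_UNIV assms(1) _ assms(2), where g' = "\<lambda>x. x"])
      (use assms(3) in \<open>auto simp: fun_eq_iff\<close>)
  then show ?thesis by (auto simp: mem_interior)
qed

lemma has_vector_derivative_quotient:
  assumes "(f has_vector_derivative D) (at (0::real))"
  shows "((\<lambda>h. (f h - f 0) /\<^sub>R h) \<longlongrightarrow> D) (at 0)"
proof -
  have "((\<lambda>h. norm (f (0 + h) - f 0 - h *\<^sub>R D) / norm h) \<longlongrightarrow> 0) (at 0)"
    using assms unfolding has_vector_derivative_def has_derivative_at by blast
  moreover have "\<forall>\<^sub>F h in at 0. norm (f (0 + h) - f 0 - h *\<^sub>R D) / norm h = norm ((f h - f 0) /\<^sub>R h - D)"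
  proof (rule eventually_at_filter[THEN iffD2], intro always_eventually allI impI)
    fix h :: real assume "h \<noteq> 0"
    then have "(f h - f 0) /\<^sub>R h - D = (f (0 + h) - f 0 - h *\<^sub>R D) /\<^sub>R h"
      by (simp add: scaleR_diff_right)
    then show "norm (f (0 + h) - f 0 - h *\<^sub>R D) / norm h = norm ((f h - f 0) /\<^sub>R h - D)"
      by (simp add: divide_inverse mult.commute)
  qed
  ultimately have "((\<lambda>h. norm ((f h - f 0) /\<^sub>R h - D)) \<longlongrightarrow> 0) (at 0)"
    by (rule Lim_transform_eventually)
  then show ?thesis using LIM_zero_iff tendsto_norm_zero_iff by blast
qed

lemma subspace_has_vector_derivative:
  fixes S :: "'a::euclidean_space set"
  assumes "subspace S" "(f has_vector_derivative D) (at (0::real))" "\<And>t. f t - f 0 \<in> S"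
  shows "D \<in> S"
proof (rule Lim_in_closed_set[OF closed_subspace[OF assms(1)] _ _ has_vector_derivative_quotient[OF assms(2)]])
  show "\<forall>\<^sub>F h in at 0. (f h - f 0) /\<^sub>R h \<in> S"
    using assms(1,3) by (simp add: subspace_scale)
qed simp

section \<open>The Lie algebra of a closed matrix group and charts given by it\<close>

locale closed_matrix_group =
  fixes H :: "'n::finite sqmat set"
  assumes closed_H: "closed H" and one_H: "mat 1 \<in> H"
    and mult_H: "A \<in> H \<Longrightarrow> B \<in> H \<Longrightarrow> A ** B \<in> H"
    and inv_H: "A \<in> H \<Longrightarrow> \<exists>B\<in>H. A ** B = mat 1 \<and> B ** A = mat 1"
begin

lemma inverse_H: "A \<in> H \<Longrightarrow> A ** B = mat 1 \<Longrightarrow> B \<in> H"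
  using inv_H matrix_inverse_unique by metis

lemma matrix_exp_nat_H:
  assumes "matrix_exp W \<in> H"
  shows "matrix_exp (real n *\<^sub>R W) \<in> H"
proof (induction n)
  case (Suc n)
  have "matrix_exp (real (Suc n) *\<^sub>R W) = matrix_exp (real n *\<^sub>R W) ** matrix_exp W"
    using matrix_exp_scaleR_add[of "real n" 1 W] by (simp add: add.commute)
  then show ?case using Suc assms mult_H by simp
qed (simp add: one_H)

lemma lie_algebraI:
  assumes "\<And>t. t \<ge> 0 \<Longrightarrow> matrix_exp (t *\<^sub>R X) \<in> H"
  shows "X \<in> lie_algebra H"
  unfolding lie_algebra_def
proof (intro CollectI allI)
  fix t
  show "matrix_exp (t *\<^sub>R X) \<in> H"
  proof (cases "t \<ge> 0")
    case False
    then have "matrix_exp (-(t *\<^sub>R X)) \<in> H" using assms[of "- t"] by simp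
    then show ?thesis using inverse_H matrix_exp_minus(2) by metis
  qed (use assms in auto)
qed

lemma lie_algebra_exp: "X \<in> lie_algebra H \<Longrightarrow> matrix_exp (t *\<^sub>R X) \<in> H"
  by (simp add: lie_algebra_def)

lemma lie_algebra_exp1: "X \<in> lie_algebra H \<Longrightarrow> matrix_exp X \<in> H"
  using lie_algebra_exp[of X 1] by simp

lemma lie_algebra_scaleR: "X \<in> lie_algebra H \<Longrightarrow> r *\<^sub>R X \<in> lie_algebra H"
  by (simp add: lie_algebra_def)

lemma lie_algebra_0: "0 \<in> lie_algebra H"
  by (simp add: lie_algebra_def one_H)

text \<open>Integer powers of \<open>matrix_exp (W k)\<close> stay in \<open>H\<close>. Replacing
  the real multiple \<open>t * c k\<close> by its integer part costs at most
  \<open>norm (W k)\<close>, which tends to 0, and closedness of \<open>H\<close> keeps the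
  limit.\<close>

lemma lie_algebra_limit:
  fixes W :: "nat \<Rightarrow> 'n sqmat" and c :: "nat \<Rightarrow> real"
  assumes "W \<longlonglongrightarrow> 0" "\<And>k. matrix_exp (W k) \<in> H" "\<And>k. c k \<ge> 0" "(\<lambda>k. c k *\<^sub>R W k) \<longlonglongrightarrow> V"
  shows "V \<in> lie_algebra H"
proof (rule lie_algebraI)
  fix t :: real assume t: "t \<ge> 0"
  define n where "n k = nat \<lfloor>t * c k\<rfloor>" for k
  have n: "real (n k) = real_of_int \<lfloor>t * c k\<rfloor>" for k
    using t assms(3)[of k] by (simp add: n_def)
  have "(\<lambda>k. t *\<^sub>R (c k *\<^sub>R W k) - (t * c k - real (n k)) *\<^sub>R W k) \<longlonglongrightarrow> t *\<^sub>R V - 0"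
  proof (intro tendsto_diff tendsto_scaleR tendsto_const assms(4))
    show "(\<lambda>k. (t * c k - real (n k)) *\<^sub>R W k) \<longlonglongrightarrow> 0"
    proof (rule tendsto_norm_zero_cancel, rule tendsto_sandwich[of "\<lambda>_. 0"])
      have "norm ((t * c k - real (n k)) *\<^sub>R W k) \<le> norm (W k)" for k
      proof -
        have "\<bar>t * c k - real (n k)\<bar> \<le> 1" unfolding n by linarith
        then show ?thesis by (simp add: mult_left_le_one_le)
      qed
      then show "\<forall>\<^sub>F k in sequentially. norm ((t * c k - real (n k)) *\<^sub>R W k) \<le> norm (W k)" by simp
      show "(\<lambda>k. norm (W k)) \<longlonglongrightarrow> 0" using assms(1) tendsto_norm_zero by blast
    qed auto
  qed
  then have "(\<lambda>k. real (n k) *\<^sub>R W k) \<longlonglongrightarrow> t *\<^sub>R V"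
    by (simp add: scaleR_left_diff_distrib)
  then have "(\<lambda>k. matrix_exp (real (n k) *\<^sub>R W k)) \<longlonglongrightarrow> matrix_exp (t *\<^sub>R V)"
    by (rule tendsto_matrix_exp)
  then show "matrix_exp (t *\<^sub>R V) \<in> H"
    by (rule closed_sequentially[OF closed_H matrix_exp_nat_H[OF assms(2)]])
qed

text \<open>Surjectivity of \<open>matrix_exp\<close> near 0 provides the logarithm, and the
  quadratic remainder of \<open>matrix_exp\<close> becomes a quadratic remainder of the
  logarithm.\<close>

lemma local_log:
  "\<exists>d>0. \<exists>C. \<forall>g :: 'n sqmat. norm (g - mat 1) < d \<longrightarrow>
     (\<exists>W. matrix_exp W = g \<and> norm W \<le> 2 * norm (g - mat 1) \<and> norm (W - (g - mat 1)) \<le> C * (norm (g - mat 1))\<^sup>2)"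
proof -
  obtain r C where rC: "r > 0" "C > 0"
    and b: "\<And>X :: 'n sqmat. norm X \<le> r \<Longrightarrow> norm (matrix_exp X - mat 1 - X) \<le> C * (norm X)\<^sup>2"
    by (rule matrix_exp_quadratic) blast
  \<comment> \<open>The bound 1 / (2 C) makes the quadratic remainder at most half of
    \<open>norm W\<close>, so \<open>W\<close> is controlled by \<open>g - mat 1\<close> with the
    factor 2.\<close>
  define e where "e = min r (1 / (2 * C))"
  have e: "e > 0" using rC by (simp add: e_def)
  obtain d where d: "d > 0" "ball (matrix_exp 0) d \<subseteq> matrix_exp ` ball (0 :: 'n sqmat) e"
    using local_surjectivity[OF continuous_matrix_exp matrix_exp_has_derivative_0 e] by blast
  show ?thesis
  proof (rule exI[of _ d], intro conjI exI[of _ "4 * C"] allI impI d(1))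
    fix g :: "'n sqmat" assume g: "norm (g - mat 1) < d"
    then have "g \<in> ball (matrix_exp 0) d" by (simp add: dist_norm norm_minus_commute)
    then obtain W where W: "norm W < e" "g = matrix_exp W" using d(2) by auto
    have 1: "norm (g - mat 1 - W) \<le> C * (norm W)\<^sup>2" using b[of W] W by (simp add: e_def)
    also have "\<dots> \<le> norm W / 2"
    proof -
      have "C * norm W \<le> 1 / 2" using W rC by (simp add: e_def field_simps)
      then show ?thesis using mult_right_mono[of "C * norm W" "1/2" "norm W"] by (simp add: power2_eq_square mult.assoc)
    qed
    finally have 2: "norm W \<le> 2 * norm (g - mat 1)"
      using norm_triangle_ineq2[of W "g - mat 1"] by (simp add: norm_minus_commute)
    have "(norm W)\<^sup>2 \<le> (2 * norm (g - mat 1))\<^sup>2" using 2 by (intro power_mono) auto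
    then have "C * (norm W)\<^sup>2 \<le> C * (4 * (norm (g - mat 1))\<^sup>2)"
      using rC by (simp add: power_mult_distrib)
    with 1 2 W show "\<exists>W. matrix_exp W = g \<and> norm W \<le> 2 * norm (g - mat 1) \<and> norm (W - (g - mat 1)) \<le> 4 * C * (norm (g - mat 1))\<^sup>2"
      by (intro exI[of _ W]) (simp add: norm_minus_commute mult.assoc)
  qed
qed

text \<open>The local logarithms differ from \<open>g k - mat 1\<close> by a quadratic term. After
  scaling by \<open>c k\<close> one of its two factors converges and the other tends to 0, so
  \<open>lie_algebra_limit\<close> applies to the logarithms.\<close>

lemma lie_algebra_curve:
  fixes g :: "nat \<Rightarrow> 'n sqmat" and c :: "nat \<Rightarrow> real"
  assumes "\<And>k. g k \<in> H" "g \<longlonglongrightarrow> mat 1" "\<And>k. c k \<ge> 0" "(\<lambda>k. c k *\<^sub>R (g k - mat 1)) \<longlonglongrightarrow> V"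
  shows "V \<in> lie_algebra H"
proof -
  obtain d C where d: "d > 0" and dC: "\<And>h :: 'n sqmat. norm (h - mat 1) < d \<Longrightarrow>
     (\<exists>W. matrix_exp W = h \<and> norm W \<le> 2 * norm (h - mat 1) \<and> norm (W - (h - mat 1)) \<le> C * (norm (h - mat 1))\<^sup>2)"
    using local_log by blast
  have g0: "(\<lambda>k. g k - mat 1) \<longlonglongrightarrow> 0" using assms(2) LIM_zero by blast
  obtain N where N: "\<And>k. k \<ge> N \<Longrightarrow> norm (g k - mat 1) < d"
    using g0 d LIMSEQ_D[OF g0 d] by auto
  have "\<forall>k. \<exists>W. matrix_exp W = g (k + N) \<and> norm W \<le> 2 * norm (g (k + N) - mat 1) \<and> norm (W - (g (k + N) - mat 1)) \<le> C * (norm (g (k + N) - mat 1))\<^sup>2"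
    using dC N by simp
  then obtain W where W: "\<And>k. matrix_exp (W k) = g (k + N)" "\<And>k. norm (W k) \<le> 2 * norm (g (k + N) - mat 1)"
      "\<And>k. norm (W k - (g (k + N) - mat 1)) \<le> C * (norm (g (k + N) - mat 1))\<^sup>2"
    by metis
  have g0': "(\<lambda>k. g (k + N) - mat 1) \<longlonglongrightarrow> 0" using LIMSEQ_ignore_initial_segment[OF g0] .
  have V': "(\<lambda>k. c (k + N) *\<^sub>R (g (k + N) - mat 1)) \<longlonglongrightarrow> V" using LIMSEQ_ignore_initial_segment[OF assms(4)] .
  have "(\<lambda>k. 2 * norm (g (k + N) - mat 1)) \<longlonglongrightarrow> 2 * 0"
    by (intro tendsto_mult tendsto_const tendsto_norm_zero g0')
  then have "W \<longlonglongrightarrow> 0"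
    using Lim_null_comparison[OF always_eventually[OF allI[OF W(2)]]] by (simp only: mult_zero_right)
  moreover have "(\<lambda>k. c (k + N) *\<^sub>R W k) \<longlonglongrightarrow> V"
  proof -
    have "(\<lambda>k. c (k + N) *\<^sub>R (W k - (g (k + N) - mat 1))) \<longlonglongrightarrow> 0"
    proof (rule Lim_null_comparison)
      show "\<forall>\<^sub>F k in sequentially. norm (c (k + N) *\<^sub>R (W k - (g (k + N) - mat 1)))
          \<le> C * norm (c (k + N) *\<^sub>R (g (k + N) - mat 1)) * norm (g (k + N) - mat 1)"
      proof (intro always_eventually allI)
        fix k
        have "c (k + N) * norm (W k - (g (k + N) - mat 1)) \<le> c (k + N) * (C * (norm (g (k + N) - mat 1))\<^sup>2)"
          using W(3) assms(3) by (intro mult_left_mono) auto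
        then show "norm (c (k + N) *\<^sub>R (W k - (g (k + N) - mat 1)))
          \<le> C * norm (c (k + N) *\<^sub>R (g (k + N) - mat 1)) * norm (g (k + N) - mat 1)"
          using assms(3) by (simp add: power2_eq_square mult_ac)
      qed
      have "(\<lambda>k. C * norm (c (k + N) *\<^sub>R (g (k + N) - mat 1)) * norm (g (k + N) - mat 1)) \<longlonglongrightarrow> C * norm V * 0"
        by (intro tendsto_mult tendsto_const tendsto_norm V' tendsto_norm_zero g0')
      then show "(\<lambda>k. C * norm (c (k + N) *\<^sub>R (g (k + N) - mat 1)) * norm (g (k + N) - mat 1)) \<longlonglongrightarrow> 0" by simp
    qed
    from tendsto_add[OF this V'] show ?thesis by (simp add: algebra_simps)
  qed
  ultimately show ?thesis
    using lie_algebra_limit[of W "\<lambda>k. c (k + N)" V] W(1) assms by simp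
qed

text \<open>The curve exp (t X) exp (t Y) lies in \<open>H\<close> and has velocity X + Y at 0; no
  product formula for exponentials is involved.\<close>

lemma lie_algebra_add:
  assumes "X \<in> lie_algebra H" "Y \<in> lie_algebra H"
  shows "X + Y \<in> lie_algebra H"
proof -
  let ?F = "\<lambda>t. matrix_exp (t *\<^sub>R X) ** matrix_exp (t *\<^sub>R Y)"
  have D: "(?F has_vector_derivative (X + Y)) (at 0)"
    using bounded_bilinear.has_vector_derivative[OF bounded_bilinear_matrix_mult
        matrix_exp_has_vector_derivative_0[of X] matrix_exp_has_vector_derivative_0[of Y]]
    by (simp add: add.commute)
  define c where "c k = real (Suc k)" for k
  have lim0: "(\<lambda>k. inverse (c k)) \<longlonglongrightarrow> 0" unfolding c_def by (rule LIMSEQ_inverse_real_of_nat)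
  have lim: "filterlim (\<lambda>k. inverse (c k)) (at 0) sequentially"
    using lim0 by (simp add: filterlim_at c_def)
  show ?thesis
  proof (rule lie_algebra_curve)
    show "?F (inverse (c k)) \<in> H" for k using assms by (intro mult_H lie_algebra_exp)
    show "c k \<ge> 0" for k by (simp add: c_def)
    have "(\<lambda>k. ?F (inverse (c k))) \<longlonglongrightarrow> matrix_exp (0 *\<^sub>R X) ** matrix_exp (0 *\<^sub>R Y)"
      by (intro tendsto_matrix_mult tendsto_matrix_exp tendsto_scaleR lim0 tendsto_const)
    then show "(\<lambda>k. ?F (inverse (c k))) \<longlonglongrightarrow> mat 1" by simp
    show "(\<lambda>k. c k *\<^sub>R (?F (inverse (c k)) - mat 1)) \<longlonglongrightarrow> X + Y"
      using filterlim_compose[OF has_vector_derivative_quotient[OF D] lim] by (simp add: c_def)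
  qed
qed

lemma subspace_lie_algebra: "subspace (lie_algebra H)"
  by (rule subspaceI) (auto simp: lie_algebra_0 lie_algebra_add lie_algebra_scaleR)

lemma lie_algebra_conj:
  assumes "P \<in> H" "P ** Q = mat 1" "X \<in> lie_algebra H"
  shows "P ** X ** Q \<in> lie_algebra H"
proof -
  have QP: "Q ** P = mat 1" using assms(2) matrix_left_right_inverse by blast
  have "matrix_exp (t *\<^sub>R (P ** X ** Q)) \<in> H" for t
  proof -
    have "matrix_exp (t *\<^sub>R (P ** X ** Q)) = P ** matrix_exp (t *\<^sub>R X) ** Q"
      using matrix_exp_conj[OF assms(2) QP, of "t *\<^sub>R X"] by simp
    then show ?thesis using assms lie_algebra_exp inverse_H mult_H by metis
  qed
  then show ?thesis by (simp add: lie_algebra_def)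
qed

text \<open>The curve exp (t X) Y exp (- t X) stays in the Lie algebra, which as a subspace is
  closed, and its velocity at 0 is the bracket.\<close>

lemma lie_algebra_bracket:
  assumes "X \<in> lie_algebra H" "Y \<in> lie_algebra H"
  shows "X ** Y - Y ** X \<in> lie_algebra H"
proof -
  let ?F = "\<lambda>t. matrix_exp (t *\<^sub>R X) ** Y ** matrix_exp (t *\<^sub>R (- X))"
  have 1: "((\<lambda>t. matrix_exp (t *\<^sub>R X) ** Y) has_vector_derivative (X ** Y)) (at 0)"
    using bounded_bilinear.has_vector_derivative[OF bounded_bilinear_matrix_mult
        matrix_exp_has_vector_derivative_0[of X] has_vector_derivative_const[of Y]] by simp
  have D: "(?F has_vector_derivative (X ** Y - Y ** X)) (at 0)"
    using bounded_bilinear.has_vector_derivative[OF bounded_bilinear_matrix_mult 1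
        matrix_exp_has_vector_derivative_0[of "- X"]]
    by simp
  have F: "?F t \<in> lie_algebra H" for t
    using lie_algebra_conj[OF lie_algebra_exp[OF assms(1), of t] _ assms(2), of "matrix_exp (t *\<^sub>R (- X))"]
      matrix_exp_minus(1)[of "t *\<^sub>R X"] by simp
  show ?thesis
    by (rule subspace_has_vector_derivative[OF subspace_lie_algebra D])
      (intro subspace_diff[OF subspace_lie_algebra] F)
qed

text \<open>The closed subgroup theorem in product coordinates. With \<open>P\<close> a projection
  onto the Lie algebra, \<open>f\<close> multiplies exponentials from the direction of
  \<open>Z\<close>, from the kernel of \<open>l\<close> and from a complement. If elements of
  \<open>H\<close> arbitrarily near the identity had a nonzero complementary part, these parts
  \<open>W k\<close> would exponentiate into \<open>H\<close>, and a limit of their directions would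
  be a unit vector of the Lie algebra killed by \<open>P\<close>. The case that \<open>l\<close> is
  zero gives the ordinary exponential chart.\<close>

lemma product_chart:
  fixes l :: "'n sqmat \<Rightarrow> real"
  assumes l: "linear l" and Z: "Z \<in> lie_algebra H" "l Z = 1 \<or> l = (\<lambda>_. 0)"
  shows "\<exists>d>0. \<forall>g\<in>H. norm (g - mat 1) < d \<longrightarrow>
      (\<exists>s. \<exists>Y\<in>lie_algebra H. l Y = 0 \<and> g = matrix_exp (s *\<^sub>R Z) ** matrix_exp Y)"
proof -
  obtain P where P: "range P \<subseteq> lie_algebra H" "linear P" "\<And>X. X \<in> lie_algebra H \<Longrightarrow> P X = X"
    using linear_exists_left_inverse_on[OF linear_ident subspace_lie_algebra, of] by (auto simp: inj_on_def)
  define f where "f X = matrix_exp (l (P X) *\<^sub>R Z) ** matrix_exp (P X - l (P X) *\<^sub>R Z) ** matrix_exp (X - P X)" for X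
  have blP: "bounded_linear P" and bll: "bounded_linear l"
    using P(2) l linear_conv_bounded_linear by blast+
  have bl1: "bounded_linear (\<lambda>X. l (P X) *\<^sub>R Z)" "bounded_linear (\<lambda>X. P X - l (P X) *\<^sub>R Z)" "bounded_linear (\<lambda>X. X - P X)"
    by (intro bounded_linear_compose[OF bounded_linear_scaleR_left] bounded_linear_compose[OF bll]
        bounded_linear_sub blP bounded_linear_ident)+
  have cont: "continuous_on UNIV f"
    unfolding f_def
    by (intro continuous_on_matrix_mult continuous_on_compose2[OF continuous_matrix_exp]
        bounded_linear.continuous_on[OF bl1(1)] bounded_linear.continuous_on[OF bl1(2)]
        bounded_linear.continuous_on[OF bl1(3)] continuous_intros) auto
  have ex: "((\<lambda>X. matrix_exp (L X)) has_derivative L) (at 0)" if "bounded_linear L" for L :: "'n sqmat \<Rightarrow> 'n sqmat"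
  proof -
    have "(L has_derivative L) (at 0)" by (rule bounded_linear_imp_has_derivative[OF that])
    moreover have "(matrix_exp has_derivative (\<lambda>X. X)) (at (L 0))"
      using matrix_exp_has_derivative_0 linear_0[OF bounded_linear.linear[OF that]] by simp
    ultimately show ?thesis using diff_chain_at[of L L 0 matrix_exp "\<lambda>X. X"] by (simp add: o_def)
  qed
  have z: "P 0 = 0" "l 0 = 0" using linear_0 P(2) l by auto
  have der: "(f has_derivative (\<lambda>X. X)) (at 0)"
    unfolding f_def
    using bounded_bilinear.FDERIV[OF bounded_bilinear_matrix_mult
        bounded_bilinear.FDERIV[OF bounded_bilinear_matrix_mult ex[OF bl1(1)] ex[OF bl1(2)]] ex[OF bl1(3)]]
    by (simp add: z)
  have f0: "f 0 = mat 1" by (simp add: f_def z)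
  let ?S = "\<lambda>g. \<exists>s. \<exists>Y\<in>lie_algebra H. l Y = 0 \<and> g = matrix_exp (s *\<^sub>R Z) ** matrix_exp Y"
  show ?thesis
  proof (rule ccontr)
    assume "\<not> ?thesis"
    then have bad: "\<exists>g\<in>H. norm (g - mat 1) < d \<and> \<not> ?S g" if "d > 0" for d using that by blast
    have "\<exists>X. norm X < inverse (real (Suc k)) \<and> f X \<in> H \<and> \<not> ?S (f X)" for k
    proof -
      obtain d where d: "d > 0" "ball (f 0) d \<subseteq> f ` ball 0 (inverse (real (Suc k)))"
        using local_surjectivity[OF cont der, of "inverse (real (Suc k))"] by auto
      obtain g where g: "g \<in> H" "norm (g - mat 1) < d" "\<not> ?S g" using bad[OF d(1)] by blast
      then have "g \<in> ball (f 0) d" by (simp add: f0 dist_norm norm_minus_commute)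
      then obtain X where "norm X < inverse (real (Suc k))" "g = f X" using d(2) by auto
      then show ?thesis using g by blast
    qed
    then obtain X where X: "\<And>k. norm (X k) < inverse (real (Suc k))" "\<And>k. f (X k) \<in> H" "\<And>k. \<not> ?S (f (X k))"
      by metis
    define W where "W k = X k - P (X k)" for k
    have A: "l (P (X k)) *\<^sub>R Z \<in> lie_algebra H" "P (X k) - l (P (X k)) *\<^sub>R Z \<in> lie_algebra H" "l (P (X k) - l (P (X k)) *\<^sub>R Z) = 0" for k
    proof -
      show "l (P (X k)) *\<^sub>R Z \<in> lie_algebra H" using Z by (intro lie_algebra_scaleR)
      then show "P (X k) - l (P (X k)) *\<^sub>R Z \<in> lie_algebra H"
        using P(1) by (intro subspace_diff[OF subspace_lie_algebra]) auto
      show "l (P (X k) - l (P (X k)) *\<^sub>R Z) = 0"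
        using Z(2) by (auto simp: linear_diff[OF l] linear_scale[OF l])
    qed
    have WH: "matrix_exp (W k) \<in> H" for k
    proof -
      define a where "a = matrix_exp (l (P (X k)) *\<^sub>R Z) ** matrix_exp (P (X k) - l (P (X k)) *\<^sub>R Z)"
      have "a \<in> H" unfolding a_def using A by (intro mult_H lie_algebra_exp1)
      then obtain b where b: "b \<in> H" "b ** a = mat 1" using inv_H by blast
      have "b ** f (X k) = (b ** a) ** matrix_exp (W k)" unfolding f_def W_def a_def by (simp add: matrix_mul_assoc)
      then show ?thesis using b mult_H X(2)[of k] by (metis matrix_mul_lid)
    qed
    have W0: "W k \<noteq> 0" for k
    proof
      assume "W k = 0"
      then have "X k - P (X k) = 0" by (simp add: W_def)
      then have "f (X k) = matrix_exp (l (P (X k)) *\<^sub>R Z) ** matrix_exp (P (X k) - l (P (X k)) *\<^sub>R Z)"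
        unfolding f_def by simp
      then show False using X(3)[of k] A by blast
    qed
    have "X \<longlonglongrightarrow> 0"
      by (rule Lim_null_comparison[OF _ LIMSEQ_inverse_real_of_nat]) (use X(1) in \<open>auto intro!: always_eventually less_imp_le\<close>)
    then have "W \<longlonglongrightarrow> 0 - P 0" unfolding W_def
      by (intro tendsto_diff bounded_linear.tendsto[OF blP])
    then have Wlim: "W \<longlonglongrightarrow> 0" by (simp add: z)
    define V where "V k = inverse (norm (W k)) *\<^sub>R W k" for k
    have "V k \<in> sphere 0 1" for k using W0 by (simp add: V_def)
    then obtain v r where v: "v \<in> sphere 0 1" "strict_mono r" "(V \<circ> r) \<longlonglongrightarrow> v"
      using compact_sphere[of "0 :: 'n sqmat" 1] unfolding compact_def by metis
    have "v \<in> lie_algebra H"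
    proof (rule lie_algebra_limit)
      show "(W \<circ> r) \<longlonglongrightarrow> 0" using Wlim v(2) by (rule LIMSEQ_subseq_LIMSEQ)
      show "matrix_exp ((W \<circ> r) k) \<in> H" for k using WH by simp
      show "inverse (norm (W (r k))) \<ge> 0" for k by simp
      show "(\<lambda>k. inverse (norm (W (r k))) *\<^sub>R (W \<circ> r) k) \<longlonglongrightarrow> v" using v(3) by (simp add: V_def o_def)
    qed
    then have "P v = v" using P(3) by blast
    moreover have "P (V k) = 0" for k
    proof -
      have "P (P (X k)) = P (X k)" using P(1,3) by blast
      then show ?thesis by (simp add: V_def W_def linear_scale[OF P(2)] linear_diff[OF P(2)])
    qed
    then have "(\<lambda>k. P ((V \<circ> r) k)) \<longlonglongrightarrow> 0" by simp
    then have "P v = 0" using bounded_linear.tendsto[OF blP v(3)] LIMSEQ_unique by (simp add: o_def)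
    ultimately show False using v(1) by simp
  qed
qed

text \<open>A subgroup that contains a neighbourhood of the identity is open, and so is its
  complement, a union of cosets; connectedness leaves only the whole group.\<close>

lemma connected_subgroup_eq:
  assumes "connected H" "S \<subseteq> H" "mat 1 \<in> S" "\<And>A B. A \<in> S \<Longrightarrow> B \<in> S \<Longrightarrow> A ** B \<in> S"
    "\<And>A. A \<in> S \<Longrightarrow> \<exists>B\<in>S. A ** B = mat 1" "d > 0" "\<And>g. g \<in> H \<Longrightarrow> norm (g - mat 1) < d \<Longrightarrow> g \<in> S"
  shows "S = H"
proof -
  have near: "\<exists>e>0. \<forall>k\<in>H. dist k g < e \<longrightarrow> (\<exists>u\<in>S. k = g ** u)" if g: "g \<in> H" for g
  proof -
    obtain b where b: "b \<in> H" "b ** g = mat 1" "g ** b = mat 1" using inv_H g by blast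
    have "((\<lambda>k. b ** k) \<longlongrightarrow> b ** g) (at g)"
      by (intro tendsto_matrix_mult tendsto_const tendsto_ident_at)
    then obtain e where e: "e > 0" "\<And>k. k \<noteq> g \<Longrightarrow> dist k g < e \<Longrightarrow> dist (b ** k) (mat 1) < d"
      unfolding tendsto_iff eventually_at using assms(6) b by (metis UNIV_I)
    show ?thesis
    proof (intro exI[of _ e] conjI e(1) ballI impI)
      fix k assume k: "k \<in> H" "dist k g < e"
      have "norm (b ** k - mat 1) < d" using e(2)[of k] k b assms(6) by (cases "k = g") (auto simp: dist_norm)
      then have "b ** k \<in> S" using assms(7) b k mult_H by blast
      moreover have "k = g ** (b ** k)" by (simp add: matrix_mul_assoc b)
      ultimately show "\<exists>u\<in>S. k = g ** u" by blast
    qed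
  qed
  have "openin (top_of_set H) S"
    unfolding openin_euclidean_subtopology_iff
    using near assms(2,4) by (metis subsetD)
  moreover have "openin (top_of_set H) (H - S)"
    unfolding openin_euclidean_subtopology_iff
  proof (intro conjI ballI)
    fix g assume g: "g \<in> H - S"
    obtain e where e: "e > 0" "\<And>k. k \<in> H \<Longrightarrow> dist k g < e \<Longrightarrow> \<exists>u\<in>S. k = g ** u" using near g by blast
    show "\<exists>e>0. \<forall>x'\<in>H. dist x' g < e \<longrightarrow> x' \<in> H - S"
    proof (intro exI[of _ e] conjI e(1) ballI impI)
      fix k assume k: "k \<in> H" "dist k g < e"
      have "k \<notin> S"
      proof
        assume "k \<in> S"
        obtain u where u: "u \<in> S" "k = g ** u" using e(2) k by blast
        obtain v where v: "v \<in> S" "u ** v = mat 1" using assms(5) u by blast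
        have "g = k ** v" using u v by (simp add: matrix_mul_assoc[symmetric])
        then show False using g \<open>k \<in> S\<close> v assms(4) by blast
      qed
      then show "k \<in> H - S" using k by blast
    qed
  qed auto
  then have "closedin (top_of_set H) S"
    using assms(2) by (simp add: closedin_def)
  ultimately have "S = {} \<or> S = H" using assms(1) connected_clopen by blast
  then show ?thesis using assms(3) by auto
qed

lemma matrix_exp_symmetric:
  assumes "\<And>Y. Y \<in> V \<Longrightarrow> - Y \<in> V" "A \<in> matrix_exp ` V"
  shows "\<exists>B\<in>matrix_exp ` V. A ** B = mat 1 \<and> B ** A = mat 1"
  using assms matrix_exp_minus by (metis (no_types, lifting) image_iff)

lemma mgen_subset_H: "V \<subseteq> lie_algebra H \<Longrightarrow> mgen (matrix_exp ` V) \<subseteq> H"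
proof
  fix A assume V: "V \<subseteq> lie_algebra H" and "A \<in> mgen (matrix_exp ` V)"
  from this(2) show "A \<in> H"
    by induction (use V in \<open>auto intro!: one_H mult_H lie_algebra_exp1\<close>)
qed

lemma connected_generated:
  assumes "connected H"
  shows "H = mgen (matrix_exp ` lie_algebra H)"
proof -
  let ?S = "mgen (matrix_exp ` lie_algebra H)"
  obtain d where d: "d > 0" "\<And>g. g \<in> H \<Longrightarrow> norm (g - mat 1) < d \<Longrightarrow> \<exists>Y\<in>lie_algebra H. g = matrix_exp Y"
    using product_chart[of "\<lambda>_. 0" 0] lie_algebra_0 by (auto simp: linear_zero)
  have "?S = H"
  proof (rule connected_subgroup_eq[OF assms, where d = d])
    show "d > 0" by (rule d)
    show "g \<in> ?S" if "g \<in> H" "norm (g - mat 1) < d" for g using d(2)[OF that] mgen_base by blast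
    show "?S \<subseteq> H" by (rule mgen_subset_H) simp
    show "\<exists>B\<in>?S. A ** B = mat 1" if "A \<in> ?S" for A
      using mgen_inverse[OF matrix_exp_symmetric that] subspace_neg[OF subspace_lie_algebra] by blast
  qed (auto intro: mgen.one mgen_mult)
  then show ?thesis by simp
qed

text \<open>The chart exp(s Z) exp(Y) exhibits H as the product of a one-parameter group and the
  subgroup generated by an ideal of codimension one.\<close>

lemma connected_generated_ideal:
  fixes l :: "'n sqmat \<Rightarrow> real"
  assumes "connected H" and l: "linear l" and Z: "Z \<in> lie_algebra H" "l Z = 1"
    and inv: "\<And>P Q X. P \<in> H \<Longrightarrow> P ** Q = mat 1 \<Longrightarrow> X \<in> lie_algebra H \<Longrightarrow> l (P ** X ** Q) = l X"
  shows "H = {matrix_exp (s *\<^sub>R Z) ** u | s u. u \<in> mgen (matrix_exp ` {Y \<in> lie_algebra H. l Y = 0})}"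
proof -
  define V where "V = {Y \<in> lie_algebra H. l Y = 0}"
  define U where "U = mgen (matrix_exp ` V)"
  have VH: "V \<subseteq> lie_algebra H" by (auto simp: V_def)
  have UH: "U \<subseteq> H" unfolding U_def by (rule mgen_subset_H[OF VH])
  have Vsym: "- Y \<in> V" if "Y \<in> V" for Y
    using that subspace_neg[OF subspace_lie_algebra] by (auto simp: V_def linear_neg[OF l])
  have norm: "P ** u ** Q \<in> U" if P: "P \<in> H" "P ** Q = mat 1" and u: "u \<in> U" for P Q u
  proof -
    have QP: "Q ** P = mat 1" using P(2) matrix_left_right_inverse by blast
    show ?thesis using u unfolding U_def
    proof induction
      case one then show ?case using P by (simp add: mgen.one)
    next
      case (step A B)
      then obtain Y where Y: "Y \<in> V" "B = matrix_exp Y" by blast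
      have "P ** Y ** Q \<in> V"
        using Y inv[OF P] lie_algebra_conj[OF P] by (auto simp: V_def)
      then have "P ** B ** Q \<in> matrix_exp ` V"
        using matrix_exp_conj[OF P(2) QP, of Y] Y(2) by (metis image_eqI)
      moreover have "P ** (A ** B) ** Q = (P ** A ** Q) ** (P ** B ** Q)"
      proof -
        have "(P ** A ** Q) ** (P ** B ** Q) = P ** A ** (Q ** P) ** B ** Q" by (simp add: matrix_mul_assoc)
        then show ?thesis by (simp add: QP matrix_mul_assoc)
      qed
      ultimately show ?case using step by (auto intro: mgen.step)
    qed
  qed
  let ?S = "{matrix_exp (s *\<^sub>R Z) ** u | s u. u \<in> U}"
  have eH: "matrix_exp (s *\<^sub>R Z) \<in> H" for s using Z lie_algebra_exp by blast
  have einv: "matrix_exp ((-s) *\<^sub>R Z) ** matrix_exp (s *\<^sub>R Z) = mat 1" for s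
    using matrix_exp_minus(2)[of "s *\<^sub>R Z"] by simp
  have U_mult: "A ** B \<in> U" if "A \<in> U" "B \<in> U" for A B using that mgen_mult unfolding U_def by blast
  have mult: "(matrix_exp (s *\<^sub>R Z) ** u) ** (matrix_exp (r *\<^sub>R Z) ** v) \<in> ?S" if "u \<in> U" "v \<in> U" for s r u v
  proof -
    let ?e = "\<lambda>s. matrix_exp (s *\<^sub>R Z)"
    have "?e s ** ?e r ** (?e (-r) ** u ** ?e r) ** v = ?e s ** (?e r ** ?e (-r)) ** u ** ?e r ** v"
      by (simp add: matrix_mul_assoc)
    also have "?e r ** ?e (-r) = mat 1" using einv[of "-r"] by simp
    finally have "(?e s ** u) ** (?e r ** v) = ?e (s + r) ** ((?e (-r) ** u ** ?e r) ** v)"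
      by (simp add: matrix_exp_scaleR_add matrix_mul_assoc)
    moreover have "(?e (-r) ** u ** ?e r) ** v \<in> U"
      using norm[OF eH einv] that U_mult by blast
    ultimately show ?thesis by blast
  qed
  obtain d where d: "d > 0" "\<And>g. g \<in> H \<Longrightarrow> norm (g - mat 1) < d \<Longrightarrow>
     \<exists>s. \<exists>Y\<in>lie_algebra H. l Y = 0 \<and> g = matrix_exp (s *\<^sub>R Z) ** matrix_exp Y"
    using product_chart[OF l Z(1)] Z(2) by blast
  have "?S = H"
  proof (rule connected_subgroup_eq[OF assms(1), where d = d])
    show "d > 0" by (rule d)
    show "g \<in> ?S" if g: "g \<in> H" "norm (g - mat 1) < d" for g
    proof -
      obtain s Y where "Y \<in> V" "g = matrix_exp (s *\<^sub>R Z) ** matrix_exp Y"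
        using d(2)[OF g] unfolding V_def by blast
      moreover from this have "matrix_exp Y \<in> U" unfolding U_def by (intro mgen_base) blast
      ultimately show ?thesis by blast
    qed
    show "?S \<subseteq> H" using eH UH mult_H by blast
    have "mat 1 = matrix_exp (0 *\<^sub>R Z) ** mat 1" by simp
    then show "mat 1 \<in> ?S" using mgen.one unfolding U_def by blast
    show "A ** B \<in> ?S" if AB: "A \<in> ?S" "B \<in> ?S" for A B
    proof -
      obtain s u r v where "A = matrix_exp (s *\<^sub>R Z) ** u" "u \<in> U" "B = matrix_exp (r *\<^sub>R Z) ** v" "v \<in> U"
        using AB by blast
      then show ?thesis using mult by simp
    qed
    show "\<exists>B\<in>?S. A ** B = mat 1" if A: "A \<in> ?S" for A
    proof -
      obtain s u where su: "A = matrix_exp (s *\<^sub>R Z) ** u" "u \<in> U" using A by blast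
      obtain v where v: "v \<in> U" "u ** v = mat 1"
        using mgen_inverse[OF matrix_exp_symmetric] Vsym su(2) unfolding U_def by blast
      have "(matrix_exp (0 *\<^sub>R Z) ** v) ** (matrix_exp ((-s) *\<^sub>R Z) ** mat 1) \<in> ?S"
        by (rule mult) (use v mgen.one in \<open>auto simp: U_def\<close>)
      moreover have "A ** ((matrix_exp (0 *\<^sub>R Z) ** v) ** (matrix_exp ((-s) *\<^sub>R Z) ** mat 1))
          = matrix_exp (s *\<^sub>R Z) ** (u ** v) ** matrix_exp ((-s) *\<^sub>R Z)"
        by (simp add: su matrix_mul_assoc)
      then have "A ** ((matrix_exp (0 *\<^sub>R Z) ** v) ** (matrix_exp ((-s) *\<^sub>R Z) ** mat 1)) = mat 1"
        using v einv[of "-s"] by simp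
      ultimately show ?thesis by blast
    qed
  qed
  then show ?thesis unfolding U_def V_def by blast
qed

end

section \<open>Isometries of a split form\<close>

lemma matrix_eq_vec: "(\<And>x. A *v x = C *v x) \<Longrightarrow> A = (C :: 'm::finite sqmat)"
  by (simp add: matrix_eq)

abbreviation e :: "'m::finite \<Rightarrow> (real, 'm) vec" where "e i \<equiv> axis i 1"

text \<open>On the fixed points of \<open>\<tau>\<close> the form is a sum of squares, and each pair
  exchanged by \<open>\<tau>\<close> spans a hyperbolic plane. \<open>J\<close> is the Gram matrix,
  a symmetric involution whose eigenspaces for 1 and -1 are maximal positive and negative
  subspaces.\<close>

locale pairing =
  fixes \<tau> :: "'m::finite \<Rightarrow> 'm"
  assumes \<tau>_\<tau> [simp]: "\<tau> (\<tau> i) = i"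
begin

lemma \<tau>_eq_iff [simp]: "\<tau> i = \<tau> j \<longleftrightarrow> i = j"
  by (metis \<tau>_\<tau>)

lemma bij_\<tau>: "bij \<tau>"
  by (metis bijI' \<tau>_\<tau>)

definition J :: "(real, 'm) vec \<Rightarrow> (real, 'm) vec" where "J v = (\<chi> i. v $ \<tau> i)"
definition B :: "(real, 'm) vec \<Rightarrow> (real, 'm) vec \<Rightarrow> real" where "B v w = v \<bullet> J w"

lemma J_simps [simp]: "J (v + w) = J v + J w" "J (v - w) = J v - J w" "J (r *\<^sub>R v) = r *\<^sub>R J v"
  "J (- v) = - J v" "J 0 = 0" "J (J v) = v"
  by (simp_all add: J_def vec_eq_iff)

lemma J_axis [simp]: "J (axis i c) = axis (\<tau> i) c"
  by (auto simp: J_def axis_def vec_eq_iff)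

lemma J_nth [simp]: "J v $ i = v $ \<tau> i" by (simp add: J_def)

lemma inner_J: "J v \<bullet> w = v \<bullet> J w"
  unfolding inner_vec_def J_def
  by (rule sum.reindex_bij_witness[of _ \<tau> \<tau>]) auto

lemma norm_J [simp]: "norm (J v) = norm v"
  by (simp add: norm_eq_sqrt_inner inner_J)

lemma B_commute: "B v w = B w v"
  unfolding B_def by (metis inner_J inner_commute)

lemma B_bil: "B (v + w) x = B v x + B w x" "B (v - w) x = B v x - B w x" "B (r *\<^sub>R v) x = r * B v x"
  "B (- v) x = - B v x" "B 0 x = 0"
  "B x (v + w) = B x v + B x w" "B x (v - w) = B x v - B x w" "B x (r *\<^sub>R v) = r * B x v"
  "B x (- v) = - B x v" "B x 0 = 0"
  by (simp_all add: B_def inner_left_distrib inner_right_distrib inner_diff_left inner_diff_right)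

lemma B_axis: "B v (e i) = v $ \<tau> i" "B (e i) v = v $ \<tau> i"
  by (simp_all add: B_def inner_axis inner_axis')

lemma B_e_e: "B (e i) (e j) = (if j = \<tau> i then 1 else 0)"
  by (simp add: B_axis(1)) (auto simp: axis_def)

lemma B_eqI: "(\<And>w. B v w = B v' w) \<Longrightarrow> v = v'"
  by (metis B_axis(1) \<tau>_\<tau> vec_eq_iff)

definition Mid :: "(real, 'm) vec set" where "Mid = {v. \<forall>i. \<tau> i \<noteq> i \<longrightarrow> v $ i = 0}"

lemma subspace_Mid: "subspace Mid"
  by (auto simp: subspace_def Mid_def)

lemma J_Mid: "v \<in> Mid \<Longrightarrow> J v = v"
  by (auto simp: Mid_def vec_eq_iff) (metis \<tau>_\<tau>)

lemma B_Mid: "v \<in> Mid \<Longrightarrow> B w v = w \<bullet> v" "v \<in> Mid \<Longrightarrow> B v w = w \<bullet> v"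
proof -
  show 1: "v \<in> Mid \<Longrightarrow> B w v = w \<bullet> v" for v w by (simp add: B_def J_Mid)
  then show "v \<in> Mid \<Longrightarrow> B v w = w \<bullet> v" by (simp add: B_commute)
qed

lemma Mid_e: "v \<in> Mid \<Longrightarrow> \<tau> p \<noteq> p \<Longrightarrow> B v (e p) = 0" "v \<in> Mid \<Longrightarrow> \<tau> p \<noteq> p \<Longrightarrow> B (e p) v = 0"
  by (auto simp: B_axis Mid_def)

definition isom :: "'m sqmat \<Rightarrow> bool" where "isom g \<longleftrightarrow> (\<forall>v w. B (g *v v) (g *v w) = B v w)"

lemma isomD: "isom g \<Longrightarrow> B (g *v v) (g *v w) = B v w" by (simp add: isom_def)

lemma isom_mult: "isom g \<Longrightarrow> isom h \<Longrightarrow> isom (g ** h)"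
  by (simp add: isom_def flip: matrix_vector_mul_assoc)

lemma isom_one [simp]: "isom (mat 1)" by (simp add: isom_def)

text \<open>The adjoint with respect to \<open>B\<close>. It inverts isometries, so that inversion
  becomes a permutation of the matrix entries: linear in \<open>g\<close> and without effect on
  \<open>N1\<close>.\<close>

definition iv :: "'m sqmat \<Rightarrow> 'm sqmat" where "iv g = (\<chi> i j. g $ \<tau> j $ \<tau> i)"

lemma iv_iv [simp]: "iv (iv g) = g" by (simp add: iv_def vec_eq_iff)

lemma iv_adjoint: "B (iv g *v v) w = B v (g *v w)"
proof -
  have "B (iv g *v v) w = (\<Sum>i\<in>UNIV. \<Sum>j\<in>UNIV. g $ \<tau> j $ \<tau> i * v $ j * w $ \<tau> i)"
    by (simp add: B_def inner_vec_def iv_def matrix_vector_mult_def sum_distrib_right)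
  also have "\<dots> = (\<Sum>i\<in>UNIV. \<Sum>j\<in>UNIV. g $ \<tau> j $ i * v $ j * w $ i)"
    by (rule sum.reindex_bij_witness[of _ \<tau> \<tau>]) auto
  also have "\<dots> = (\<Sum>j\<in>UNIV. \<Sum>i\<in>UNIV. g $ \<tau> j $ i * v $ j * w $ i)"
    by (rule sum.swap)
  also have "\<dots> = B v (g *v w)"
    by (simp add: B_def inner_vec_def matrix_vector_mult_def sum_distrib_left mult_ac)
  finally show ?thesis .
qed

lemma isom_iv_left: "isom g \<Longrightarrow> iv g ** g = mat 1"
  by (rule matrix_eq_vec, rule B_eqI) (simp add: iv_adjoint isomD flip: matrix_vector_mul_assoc)

lemma isom_iv_right: "isom g \<Longrightarrow> g ** iv g = mat 1"
  using isom_iv_left matrix_left_right_inverse by blast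

lemma isom_iv: "isom g \<Longrightarrow> isom (iv g)"
  unfolding isom_def by (metis iv_adjoint isom_iv_right isom_def matrix_vector_mul_assoc matrix_vector_mul_lid)

lemma iv_mult: "iv (g ** h) = iv h ** iv g"
proof (rule matrix_eq_vec, rule B_eqI)
  show "B (iv (g ** h) *v x) w = B ((iv h ** iv g) *v x) w" for x w
    by (simp add: iv_adjoint flip: matrix_vector_mul_assoc)
qed

lemma isom_det: assumes "isom g" shows "(det g)\<^sup>2 = 1"
proof -
  let ?J = "matrix J"
  have "linear J" by (rule linearI) auto
  then have JM: "?J *v x = J x" for x by (simp add: matrix_works)
  have 1: "transpose g ** ?J ** g = ?J"
  proof (rule matrix_eq_vec)
    fix x
    have "((transpose g ** ?J ** g) *v x) \<bullet> y = (?J *v x) \<bullet> y" for y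
    proof -
      have "((transpose g ** ?J ** g) *v x) \<bullet> y = J (g *v x) \<bullet> (g *v y)"
        using dot_lmul_matrix[of "J (g *v x)" g y]
        by (simp add: JM transpose_matrix_vector del: vector_transpose_matrix flip: matrix_vector_mul_assoc)
      also have "\<dots> = J x \<bullet> y" using isomD[OF assms, of x y] by (simp add: B_def inner_J)
      finally show ?thesis by (simp add: JM)
    qed
    then show "(transpose g ** ?J ** g) *v x = ?J *v x" by (metis vector_eq_ldot inner_commute)
  qed
  have "?J ** ?J = mat 1"
    by (rule matrix_eq_vec) (simp add: JM flip: matrix_vector_mul_assoc)
  then have "det ?J * det ?J = 1" by (metis det_I det_mul)
  then have "det ?J \<noteq> 0" by auto
  moreover have "det g * det ?J * det g = det ?J" using arg_cong[OF 1, of det] by (simp add: det_mul)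
  ultimately show ?thesis by (simp add: power2_eq_square)
qed

definition G :: "'m sqmat set" where "G = {g. isom g \<and> det g = 1}"

lemma G_one [simp]: "mat 1 \<in> G" by (simp add: G_def)
lemma G_mult: "g \<in> G \<Longrightarrow> h \<in> G \<Longrightarrow> g ** h \<in> G" by (simp add: G_def isom_mult det_mul)
lemma G_isom: "g \<in> G \<Longrightarrow> isom g" by (simp add: G_def)
lemma G_iv: "g \<in> G \<Longrightarrow> iv g \<in> G"
proof -
  assume g: "g \<in> G"
  then have "det (iv g) * det g = 1" using isom_iv_left[of g] by (metis det_I det_mul G_isom)
  then show ?thesis using g isom_iv by (simp add: G_def)
qed
text \<open>Spares the computation of determinants: \<open>eich\<close> and \<open>tor\<close> have
  square roots of the same kind, so their determinants are squares of 1 or -1.\<close>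

lemma G_square: "isom h \<Longrightarrow> g = h ** h \<Longrightarrow> g \<in> G"
  using isom_det[of h] by (simp add: G_def isom_mult det_mul power2_eq_square)

text \<open>The bivector of \<open>u\<close> and \<open>v\<close> as a skew operator, under the
  usual identification of the orthogonal Lie algebra with the exterior square. Root vectors are
  wedges of isotropic axes with one another or with vectors of \<open>Mid\<close>.\<close>

definition wedge :: "(real, 'm) vec \<Rightarrow> (real, 'm) vec \<Rightarrow> 'm sqmat" where
  "wedge u v = matrix (\<lambda>w. B w v *\<^sub>R u - B w u *\<^sub>R v)"
text \<open>The Eichler transformation, also called Siegel transvection: the exponential of
  \<open>wedge u v\<close> when \<open>u\<close> is isotropic and orthogonal to
  \<open>v\<close>.\<close>

definition eich :: "(real, 'm) vec \<Rightarrow> (real, 'm) vec \<Rightarrow> 'm sqmat" where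
  "eich u v = matrix (\<lambda>w. w + B w v *\<^sub>R u - B w u *\<^sub>R v - (B v v / 2 * B w u) *\<^sub>R u)"
text \<open>For a hyperbolic pair this scales \<open>u\<close> by exp b and \<open>v\<close> by exp
  (- b) and fixes what is orthogonal to both. Expressed through \<open>B\<close>, it is conjugated
  by an isometry simply by moving \<open>u\<close> and \<open>v\<close>.\<close>

definition tor :: "(real, 'm) vec \<Rightarrow> (real, 'm) vec \<Rightarrow> real \<Rightarrow> 'm sqmat" where
  "tor u v b = matrix (\<lambda>w. w + ((exp b - 1) * B w v) *\<^sub>R u + ((exp (-b) - 1) * B w u) *\<^sub>R v)"

lemma wedge_apply: "wedge u v *v w = B w v *\<^sub>R u - B w u *\<^sub>R v"
proof -
  have "linear (\<lambda>w. B w v *\<^sub>R u - B w u *\<^sub>R v)"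
    by (rule linearI) (simp_all add: B_bil algebra_simps)
  then show ?thesis by (simp add: wedge_def matrix_works)
qed

lemma eich_apply: "eich u v *v w = w + B w v *\<^sub>R u - B w u *\<^sub>R v - (B v v / 2 * B w u) *\<^sub>R u"
proof -
  have "linear (\<lambda>w. w + B w v *\<^sub>R u - B w u *\<^sub>R v - (B v v / 2 * B w u) *\<^sub>R u)"
    by (rule linearI) (simp_all add: B_bil algebra_simps)
  then show ?thesis by (simp add: eich_def matrix_works)
qed

lemma tor_apply: "tor u v b *v w = w + ((exp b - 1) * B w v) *\<^sub>R u + ((exp (-b) - 1) * B w u) *\<^sub>R v"
proof -
  have "linear (\<lambda>w. w + ((exp b - 1) * B w v) *\<^sub>R u + ((exp (-b) - 1) * B w u) *\<^sub>R v)"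
    by (rule linearI) (simp_all add: B_bil algebra_simps)
  then show ?thesis by (simp add: tor_def matrix_works)
qed

lemma conj_wedge: "isom g \<Longrightarrow> g ** wedge u v = wedge (g *v u) (g *v v) ** g"
  by (rule matrix_eq_vec)
    (simp add: wedge_apply isomD matrix_vector_mult_diff_distrib matrix_vector_mult_scaleR flip: matrix_vector_mul_assoc)

lemma conj_eich: "isom g \<Longrightarrow> g ** eich u v = eich (g *v u) (g *v v) ** g"
  by (rule matrix_eq_vec)
    (simp add: eich_apply isomD matrix_vector_mult_diff_distrib matrix_vector_right_distrib matrix_vector_mult_scaleR flip: matrix_vector_mul_assoc)

lemma conj_tor: "isom g \<Longrightarrow> g ** tor u v b = tor (g *v u) (g *v v) b ** g"
  by (rule matrix_eq_vec)
    (simp add: tor_apply isomD matrix_vector_mult_diff_distrib matrix_vector_right_distrib matrix_vector_mult_scaleR flip: matrix_vector_mul_assoc)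

lemma wedge_bil: "wedge u (v + w) = wedge u v + wedge u w" "wedge u (r *\<^sub>R v) = r *\<^sub>R wedge u v"
  "wedge (u + x) v = wedge u v + wedge x v" "wedge (r *\<^sub>R u) v = r *\<^sub>R wedge u v" "wedge u 0 = 0" "wedge 0 u = 0"
  "wedge u (v - w) = wedge u v - wedge u w"
  by (rule matrix_eq_vec; simp add: wedge_apply B_bil matrix_vector_mult_add_rdistrib algebra_simps
      matrix_vector_mult_diff_rdistrib flip: scaleR_matrix_vector_assoc)+

lemma isom_eich:
  assumes "B u u = 0" "B u v = 0" shows "isom (eich u v)"
  unfolding isom_def
proof (intro allI)
  fix x y
  have c: "B u x = B x u" "B v x = B x v" "B u y = B y u" "B v y = B y v" "B v u = 0"
    using assms B_commute by metis+
  show "B (eich u v *v x) (eich u v *v y) = B x y"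
    by (simp add: eich_apply B_bil c assms) (simp add: field_simps)
qed

lemma eich_0 [simp]: "eich u 0 = mat 1"
  by (rule matrix_eq_vec) (simp add: eich_apply B_bil)

lemma eich_add:
  assumes "B u u = 0" "B u v = 0" "B u w = 0"
  shows "eich u v ** eich u w = eich u (v + w)"
proof (rule matrix_eq_vec)
  fix x
  show "(eich u v ** eich u w) *v x = eich u (v + w) *v x"
    using assms by (simp add: eich_apply B_bil B_commute[of v u] B_commute[of w u] B_commute[of w v]
        vec_eq_iff flip: matrix_vector_mul_assoc) (simp add: field_simps)
qed

lemma G_eich: assumes "B u u = 0" "B u v = 0" shows "eich u v \<in> G"
proof (rule G_square)
  show "isom (eich u ((1/2) *\<^sub>R v))" using assms by (intro isom_eich) (simp_all add: B_bil)
  show "eich u v = eich u ((1/2) *\<^sub>R v) ** eich u ((1/2) *\<^sub>R v)"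
    using assms by (subst eich_add) (simp_all add: B_bil flip: scaleR_add_left)
qed

lemma tor_add:
  assumes "B u u = 0" "B v v = 0" "B u v = 1"
  shows "tor u v a ** tor u v b = tor u v (a + b)"
proof (rule matrix_eq_vec)
  fix x
  define E F where "E = exp a" and "F = exp b"
  have E: "exp (-a) = 1 / E" "exp (-b) = 1 / F" "exp (a + b) = E * F" "exp (- (a + b)) = 1 / (E * F)" "E \<noteq> 0" "F \<noteq> 0"
    by (simp_all add: E_def F_def exp_add exp_minus divide_inverse exp_diff)
  have c: "B v u = 1" using assms B_commute by metis
  show "(tor u v a ** tor u v b) *v x = tor u v (a + b) *v x"
    by (simp only: tor_apply E flip: matrix_vector_mul_assoc E_def F_def)
      (simp add: B_bil assms c vec_eq_iff, simp add: E field_simps)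
qed

lemma tor_0 [simp]: "tor u v 0 = mat 1"
  by (rule matrix_eq_vec) (simp add: tor_apply)

lemma isom_tor:
  assumes "B u u = 0" "B v v = 0" "B u v = 1"
  shows "isom (tor u v b)"
  unfolding isom_def
proof (intro allI)
  fix x y
  have c: "B u x = B x u" "B v x = B x v" "B u y = B y u" "B v y = B y v" "B v u = 1"
    using assms B_commute by metis+
  define E where "E = exp b"
  have E: "exp (-b) = 1 / E" "E \<noteq> 0" by (simp_all add: E_def exp_minus divide_inverse)
  show "B (tor u v b *v x) (tor u v b *v y) = B x y"
    by (simp add: tor_apply B_bil c assms E flip: E_def) (simp add: E field_simps)
qed

lemma G_tor: assumes "B u u = 0" "B v v = 0" "B u v = 1" shows "tor u v b \<in> G"
  by (rule G_square[OF isom_tor[OF assms, of "b/2"]]) (simp add: tor_add[OF assms])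

lemma tor_commute:
  assumes "B u u = 0" "B v v = 0" "B u v = 1" "isom g" "g *v u = u" "g *v v = v"
  shows "g ** tor u v b = tor u v b ** g"
  using conj_tor[OF assms(4), of u v b] assms by simp

lemma eich_commute:
  assumes "isom g" "g *v u = u" "g *v v = v"
  shows "g ** eich u v = eich u v ** g"
  using conj_eich[OF assms(1), of u v] assms by simp

section \<open>Sizes of a matrix and of its second exterior power\<close>

definition N1 :: "'m sqmat \<Rightarrow> real" where "N1 g = (\<Sum>i\<in>UNIV. \<Sum>j\<in>UNIV. \<bar>g $ i $ j\<bar>)"
definition minor :: "'m sqmat \<Rightarrow> 'm \<Rightarrow> 'm \<Rightarrow> 'm \<Rightarrow> 'm \<Rightarrow> real" where
  "minor g i k j l = g $ i $ j * g $ k $ l - g $ i $ l * g $ k $ j"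
text \<open>Ordered pairs of rows and of columns are summed, so each minor is counted four times;
  the sizes matter up to bounded factors only.\<close>

definition N2 :: "'m sqmat \<Rightarrow> real" where
  "N2 g = (\<Sum>i\<in>UNIV. \<Sum>k\<in>UNIV. \<Sum>j\<in>UNIV. \<Sum>l\<in>UNIV. \<bar>minor g i k j l\<bar>)"

lemma N1_nonneg [simp]: "N1 g \<ge> 0" by (auto simp: N1_def intro!: sum_nonneg)
lemma N2_nonneg [simp]: "N2 g \<ge> 0" by (auto simp: N2_def intro!: sum_nonneg)

lemma N1_entry: "\<bar>g $ i $ j\<bar> \<le> N1 g"
proof -
  have "\<bar>g $ i $ j\<bar> \<le> (\<Sum>j\<in>UNIV. \<bar>g $ i $ j\<bar>)"
    by (rule member_le_sum) auto
  also have "\<dots> \<le> N1 g" unfolding N1_def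
    by (rule member_le_sum[of i UNIV "\<lambda>i. \<Sum>j\<in>UNIV. \<bar>g $ i $ j\<bar>"]) (auto intro: sum_nonneg)
  finally show ?thesis .
qed

lemma N2_minor: "\<bar>minor g i k j l\<bar> \<le> N2 g"
proof -
  have "\<bar>minor g i k j l\<bar> \<le> (\<Sum>l\<in>UNIV. \<bar>minor g i k j l\<bar>)"
    by (rule member_le_sum) auto
  also have "\<dots> \<le> (\<Sum>j\<in>UNIV. \<Sum>l\<in>UNIV. \<bar>minor g i k j l\<bar>)"
    by (rule member_le_sum[of j UNIV "\<lambda>j. \<Sum>l\<in>UNIV. \<bar>minor g i k j l\<bar>"]) (auto intro: sum_nonneg)
  also have "\<dots> \<le> (\<Sum>k\<in>UNIV. \<Sum>j\<in>UNIV. \<Sum>l\<in>UNIV. \<bar>minor g i k j l\<bar>)"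
    by (rule member_le_sum[of k UNIV "\<lambda>k. \<Sum>j\<in>UNIV. \<Sum>l\<in>UNIV. \<bar>minor g i k j l\<bar>"]) (auto intro!: sum_nonneg)
  also have "\<dots> \<le> N2 g" unfolding N2_def
    by (rule member_le_sum[of i UNIV "\<lambda>i. \<Sum>k\<in>UNIV. \<Sum>j\<in>UNIV. \<Sum>l\<in>UNIV. \<bar>minor g i k j l\<bar>"]) (auto intro!: sum_nonneg)
  finally show ?thesis .
qed

lemma N1_le: "(\<And>i j. \<bar>g $ i $ j\<bar> \<le> K) \<Longrightarrow> N1 g \<le> (real CARD('m))^2 * K"
  using sum_bounded_above[of UNIV "\<lambda>i. \<Sum>j\<in>UNIV. \<bar>g $ i $ j\<bar>" "real CARD('m) * K"]
    sum_bounded_above[of UNIV "\<lambda>j. \<bar>g $ _ $ j\<bar>" K]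
  unfolding N1_def by (simp add: power2_eq_square mult.assoc)

lemma N2_le: "(\<And>i k j l. \<bar>minor g i k j l\<bar> \<le> K) \<Longrightarrow> N2 g \<le> (real CARD('m))^4 * K"
proof -
  assume a: "\<And>i k j l. \<bar>minor g i k j l\<bar> \<le> K"
  have "N2 g \<le> (\<Sum>i\<in>(UNIV::'m set). \<Sum>k\<in>(UNIV::'m set). \<Sum>j\<in>(UNIV::'m set). \<Sum>l\<in>(UNIV::'m set). K)"
    unfolding N2_def by (intro sum_mono a)
  then show ?thesis by (simp add: eval_nat_numeral mult.assoc)
qed

lemma N1_mult: "N1 (g ** h) \<le> N1 g * N1 h"
proof -
  have "N1 (g ** h) \<le> (\<Sum>i\<in>UNIV. \<Sum>j\<in>UNIV. \<Sum>k\<in>UNIV. \<bar>g $ i $ k\<bar> * \<bar>h $ k $ j\<bar>)"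
    unfolding N1_def matrix_matrix_mult_def
    by (intro sum_mono) (simp add: order_trans[OF sum_abs] abs_mult)
  also have "\<dots> = (\<Sum>i\<in>UNIV. \<Sum>k\<in>UNIV. \<bar>g $ i $ k\<bar> * (\<Sum>j\<in>UNIV. \<bar>h $ k $ j\<bar>))"
    by (subst sum.swap) (simp add: sum_distrib_left)
  also have "\<dots> \<le> (\<Sum>i\<in>UNIV. \<Sum>k\<in>UNIV. \<bar>g $ i $ k\<bar> * N1 h)"
    unfolding N1_def
    by (intro sum_mono mult_left_mono member_le_sum[of _ UNIV "\<lambda>i. \<Sum>j\<in>UNIV. \<bar>h $ i $ j\<bar>"]) (auto intro: sum_nonneg)
  also have "\<dots> = N1 g * N1 h" by (simp add: N1_def sum_distrib_right)
  finally show ?thesis .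
qed

text \<open>The Cauchy-Binet formula for 2 by 2 minors; the factor 2 comes from summing over ordered
  pairs of intermediate indices.\<close>

lemma minor_mult: "2 * minor (g ** h) i k j l = (\<Sum>a\<in>UNIV. \<Sum>b\<in>UNIV. minor g i k a b * minor h a b j l)"
proof -
  let ?P = "\<lambda>a b. g $ i $ a * g $ k $ b * (h $ a $ j * h $ b $ l - h $ a $ l * h $ b $ j)"
  have "minor (g ** h) i k j l = (\<Sum>a\<in>UNIV. \<Sum>b\<in>UNIV. ?P a b)"
    unfolding minor_def matrix_matrix_mult_def
    by (simp add: sum_product sum_subtractf[symmetric] algebra_simps)
  moreover have "minor (g ** h) i k j l = (\<Sum>a\<in>UNIV. \<Sum>b\<in>UNIV. ?P b a)"
    unfolding calculation by (rule sum.swap)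
  ultimately have "2 * minor (g ** h) i k j l = (\<Sum>a\<in>UNIV. \<Sum>b\<in>UNIV. ?P a b + ?P b a)"
    by (simp add: sum.distrib)
  also have "\<dots> = (\<Sum>a\<in>UNIV. \<Sum>b\<in>UNIV. minor g i k a b * minor h a b j l)"
    by (simp add: minor_def algebra_simps)
  finally show ?thesis .
qed

lemma N2_mult: "N2 (g ** h) \<le> N2 g * N2 h"
proof -
  let ?r = "\<lambda>h a b. \<Sum>j\<in>UNIV. \<Sum>l\<in>UNIV. \<bar>minor h a b j l\<bar>"
  have le: "\<bar>minor (g ** h) i k j l\<bar> \<le> (\<Sum>a\<in>UNIV. \<Sum>b\<in>UNIV. \<bar>minor g i k a b\<bar> * \<bar>minor h a b j l\<bar>)" for i k j l
  proof -
    have "\<bar>2 * minor (g ** h) i k j l\<bar> \<le> (\<Sum>a\<in>UNIV. \<Sum>b\<in>UNIV. \<bar>minor g i k a b\<bar> * \<bar>minor h a b j l\<bar>)"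
      unfolding minor_mult by (intro order_trans[OF sum_abs] sum_mono) (simp add: abs_mult)
    then show ?thesis by simp
  qed
  have "?r (g ** h) i k \<le> (\<Sum>a\<in>UNIV. \<Sum>b\<in>UNIV. \<bar>minor g i k a b\<bar> * ?r h a b)" for i k
  proof -
    have "?r (g ** h) i k \<le> (\<Sum>j\<in>UNIV. \<Sum>l\<in>UNIV. \<Sum>a\<in>UNIV. \<Sum>b\<in>UNIV. \<bar>minor g i k a b\<bar> * \<bar>minor h a b j l\<bar>)"
      by (intro sum_mono le)
    also have "\<dots> = (\<Sum>j\<in>UNIV. \<Sum>a\<in>UNIV. \<Sum>l\<in>UNIV. \<Sum>b\<in>UNIV. \<bar>minor g i k a b\<bar> * \<bar>minor h a b j l\<bar>)"
      by (rule sum.cong[OF refl], rule sum.swap)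
    also have "\<dots> = (\<Sum>a\<in>UNIV. \<Sum>j\<in>UNIV. \<Sum>l\<in>UNIV. \<Sum>b\<in>UNIV. \<bar>minor g i k a b\<bar> * \<bar>minor h a b j l\<bar>)"
      by (rule sum.swap)
    also have "\<dots> = (\<Sum>a\<in>UNIV. \<Sum>j\<in>UNIV. \<Sum>b\<in>UNIV. \<Sum>l\<in>UNIV. \<bar>minor g i k a b\<bar> * \<bar>minor h a b j l\<bar>)"
      by (rule sum.cong[OF refl], rule sum.cong[OF refl], rule sum.swap)
    also have "\<dots> = (\<Sum>a\<in>UNIV. \<Sum>b\<in>UNIV. \<Sum>j\<in>UNIV. \<Sum>l\<in>UNIV. \<bar>minor g i k a b\<bar> * \<bar>minor h a b j l\<bar>)"
      by (rule sum.cong[OF refl], rule sum.swap)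
    finally show ?thesis by (simp add: sum_distrib_left)
  qed
  moreover have "?r h a b \<le> N2 h" for a b
  proof -
    have "?r h a b \<le> (\<Sum>k\<in>UNIV. ?r h a k)" by (rule member_le_sum[of b UNIV "\<lambda>b. ?r h a b"]) (auto intro!: sum_nonneg)
    also have "\<dots> \<le> N2 h" unfolding N2_def
      by (rule member_le_sum[of a UNIV "\<lambda>a. \<Sum>k\<in>UNIV. ?r h a k"]) (auto intro!: sum_nonneg)
    finally show ?thesis .
  qed
  ultimately have le2: "?r (g ** h) i k \<le> (\<Sum>a\<in>UNIV. \<Sum>b\<in>UNIV. \<bar>minor g i k a b\<bar> * N2 h)" for i k
    by (meson order_trans sum_mono mult_left_mono abs_ge_zero)
  have "N2 (g ** h) \<le> (\<Sum>i\<in>UNIV. \<Sum>k\<in>UNIV. \<Sum>a\<in>UNIV. \<Sum>b\<in>UNIV. \<bar>minor g i k a b\<bar> * N2 h)"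
    unfolding N2_def[of "g ** h"] by (rule sum_mono, rule sum_mono, rule le2)
  then show ?thesis by (simp add: N2_def[of g] sum_distrib_right)
qed

lemma N2_le_N1: "N2 g \<le> 2 * (real CARD('m))^4 * (N1 g)\<^sup>2"
proof -
  have "\<bar>minor g i k j l\<bar> \<le> 2 * (N1 g)\<^sup>2" for i k j l
  proof -
    have "\<bar>g $ i $ j * g $ k $ l\<bar> \<le> N1 g * N1 g" "\<bar>g $ i $ l * g $ k $ j\<bar> \<le> N1 g * N1 g"
      unfolding abs_mult by (intro mult_mono N1_entry; simp)+
    then show ?thesis unfolding minor_def power2_eq_square by linarith
  qed
  then show ?thesis using N2_le[of g "2 * (N1 g)\<^sup>2"] by (simp add: mult_ac)
qed

lemma N1_iv [simp]: "N1 (iv g) = N1 g"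
proof -
  have "N1 (iv g) = (\<Sum>i\<in>UNIV. \<Sum>j\<in>UNIV. \<bar>g $ \<tau> j $ \<tau> i\<bar>)" by (simp add: N1_def iv_def)
  also have "\<dots> = (\<Sum>i\<in>UNIV. \<Sum>j\<in>UNIV. \<bar>g $ \<tau> j $ i\<bar>)"
    by (rule sum.reindex_bij_witness[of _ \<tau> \<tau>]) auto
  also have "\<dots> = (\<Sum>j\<in>UNIV. \<Sum>i\<in>UNIV. \<bar>g $ \<tau> j $ i\<bar>)" by (rule sum.swap)
  also have "\<dots> = N1 g" unfolding N1_def by (rule sum.reindex_bij_witness[of _ \<tau> \<tau>]) auto
  finally show ?thesis .
qed

lemma N2_iv_le: "N2 (iv g) \<le> (real CARD('m))^4 * N2 g"
proof (rule N2_le)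
  fix i k j l
  have "minor (iv g) i k j l = minor g (\<tau> j) (\<tau> l) (\<tau> i) (\<tau> k)"
    by (simp add: minor_def iv_def algebra_simps)
  then show "\<bar>minor (iv g) i k j l\<bar> \<le> N2 g" using N2_minor by metis
qed

lemma N1_le_norm: "(\<And>v. norm (g *v v) \<le> K * norm v) \<Longrightarrow> N1 g \<le> (real CARD('m))^2 * K"
proof (rule N1_le)
  fix i j assume a: "\<And>v. norm (g *v v) \<le> K * norm v"
  have "\<bar>g $ i $ j\<bar> = \<bar>(g *v e j) $ i\<bar>" by (simp add: matrix_vector_mul_component inner_axis)
  also have "\<dots> \<le> norm (g *v e j)" by (rule component_le_norm_cart)
  also have "\<dots> \<le> K" using a[of "e j"] by simp
  finally show "\<bar>g $ i $ j\<bar> \<le> K" .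
qed

end

section \<open>Cartan decomposition\<close>

context pairing begin

definition K :: "'m sqmat set" where "K = {g. isom g \<and> (\<forall>v. norm (g *v v) = norm v)}"

lemma K_isom: "g \<in> K \<Longrightarrow> isom g" and K_norm: "g \<in> K \<Longrightarrow> norm (g *v v) = norm v"
  by (auto simp: K_def)

lemma K_inner: "g \<in> K \<Longrightarrow> (g *v v) \<bullet> (g *v w) = v \<bullet> w"
  using K_norm[of g "v + w"] K_norm[of g v] K_norm[of g w]
  by (simp add: matrix_vector_right_distrib norm_eq_sqrt_inner inner_add_left inner_add_right inner_commute)

lemma K_one: "mat 1 \<in> K" by (simp add: K_def)

lemma K_mult: "g \<in> K \<Longrightarrow> h \<in> K \<Longrightarrow> g ** h \<in> K"
  by (simp add: K_def isom_mult flip: matrix_vector_mul_assoc)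

lemma K_iv: "g \<in> K \<Longrightarrow> iv g \<in> K"
proof -
  assume g: "g \<in> K"
  have "norm (iv g *v v) = norm v" for v
  proof -
    have "norm (iv g *v v) = norm (g *v (iv g *v v))" using g K_norm by metis
    then show ?thesis using isom_iv_right[OF K_isom[OF g]] by (simp add: matrix_vector_mul_assoc)
  qed
  then show ?thesis using g isom_iv by (simp add: K_def)
qed

definition K_bound :: real where "K_bound = (real CARD('m))^2"

lemma K_N1: "g \<in> K \<Longrightarrow> N1 g \<le> K_bound"
  using N1_le_norm[of g 1] by (simp add: K_norm K_bound_def)

definition refl :: "(real, 'm) vec \<Rightarrow> 'm sqmat" where
  "refl w = matrix (\<lambda>x. x - (2 * (x \<bullet> w) / (w \<bullet> w)) *\<^sub>R w)"

lemma refl_apply: "refl w *v x = x - (2 * (x \<bullet> w) / (w \<bullet> w)) *\<^sub>R w"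
proof -
  have "linear (\<lambda>x. x - (2 * (x \<bullet> w) / (w \<bullet> w)) *\<^sub>R w)"
    by (rule linearI) (simp_all add: inner_add_left algebra_simps add_divide_distrib)
  then show ?thesis by (simp add: refl_def matrix_works)
qed

text \<open>A Euclidean reflection commutes with \<open>J\<close> when its axis is an eigenvector of
  \<open>J\<close>, and then it preserves \<open>B\<close> along with the inner product.\<close>

lemma refl_K:
  assumes "w \<noteq> 0" "J w = s *\<^sub>R w" "s * s = 1"
  shows "refl w \<in> K"
proof -
  have w: "w \<bullet> w \<noteq> 0" using assms by simp
  have i: "(refl w *v x) \<bullet> (refl w *v y) = x \<bullet> y" for x y
    using w by (simp add: refl_apply inner_diff_left inner_diff_right inner_commute field_simps)
  have Jr: "J (refl w *v y) = refl w *v J y" for y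
  proof -
    have "J y \<bullet> w = s * (y \<bullet> w)" using assms(2) by (simp add: inner_J)
    then show ?thesis using assms by (simp add: refl_apply mult_ac)
  qed
  have "B (refl w *v x) (refl w *v y) = B x y" for x y unfolding B_def Jr by (rule i)
  then show ?thesis unfolding K_def isom_def by (simp add: i norm_eq_sqrt_inner)
qed

lemma K_move:
  assumes "J u = s *\<^sub>R u" "J v = s *\<^sub>R v" "s * s = 1" "norm u = norm v"
  shows "\<exists>k\<in>K. k *v u = v \<and> (\<forall>x. x \<bullet> (u - v) = 0 \<longrightarrow> k *v x = x) \<and> (\<forall>x. J x = s *\<^sub>R x \<longrightarrow> J (k *v x) = s *\<^sub>R (k *v x))"
proof (cases "u = v")
  case True then show ?thesis by (intro bexI[OF _ K_one]) auto
next
  case False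
  let ?w = "u - v"
  have Jw: "J ?w = s *\<^sub>R ?w" using assms by (simp add: scaleR_diff_right)
  have "u \<bullet> u = v \<bullet> v" using assms(4) by (simp add: norm_eq_sqrt_inner)
  then have "?w \<bullet> ?w = 2 * (u \<bullet> ?w)" by (simp add: inner_diff_left inner_diff_right inner_commute)
  moreover have "?w \<bullet> ?w \<noteq> 0" using False by simp
  ultimately have "2 * (u \<bullet> ?w) / (?w \<bullet> ?w) = 1" by (metis divide_self)
  then have "refl ?w *v u = u - 1 *\<^sub>R ?w" by (simp only: refl_apply)
  then have "refl ?w *v u = v" by simp
  moreover have "J (refl ?w *v x) = s *\<^sub>R (refl ?w *v x)" if "J x = s *\<^sub>R x" for x
  proof -
    have "J (refl ?w *v x) = J x - (2 * (x \<bullet> ?w) / (?w \<bullet> ?w)) *\<^sub>R J ?w" by (simp only: refl_apply J_simps)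
    also have "\<dots> = s *\<^sub>R (refl ?w *v x)"
      unfolding that Jw refl_apply by (simp only: scaleR_diff_right scaleR_scaleR mult.commute)
    finally show ?thesis .
  qed
  ultimately show ?thesis
    using refl_K[of ?w s] Jw assms(3) False by (intro bexI[of _ "refl ?w"]) (auto simp: refl_apply)
qed

lemma inner_eigen:
  assumes "J x = s *\<^sub>R x" "J y = (- s) *\<^sub>R y" "s * s = 1"
  shows "x \<bullet> y = 0"
proof -
  have "s * (x \<bullet> y) = - s * (x \<bullet> y)" using inner_J[of x y] assms by simp
  then have "s * (s * (x \<bullet> y)) = s * (- s * (x \<bullet> y))" by simp
  then show ?thesis using assms(3) by (simp flip: mult.assoc)
qed

text \<open>Two reflections inside one eigenspace of \<open>J\<close>. The second one moves the
  image of \<open>p2\<close> along a vector orthogonal to the target of \<open>p1\<close> and so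
  does not disturb it. Both are trivial on the other eigenspace, which allows the positive and
  negative parts of a frame to be moved independently.\<close>

lemma K_move2:
  assumes s: "s * s = 1" and p: "J p1 = s *\<^sub>R p1" "J p2 = s *\<^sub>R p2" "p1 \<bullet> p2 = 0"
    and g: "J g1 = s *\<^sub>R g1" "J g2 = s *\<^sub>R g2" "norm g1 = 1" "norm g2 = 1" "g1 \<bullet> g2 = 0"
  shows "\<exists>k\<in>K. k *v p1 = norm p1 *\<^sub>R g1 \<and> k *v p2 = norm p2 *\<^sub>R g2 \<and> (\<forall>x. J x = (- s) *\<^sub>R x \<longrightarrow> k *v x = x)"
proof -
  let ?v1 = "norm p1 *\<^sub>R g1" and ?v2 = "norm p2 *\<^sub>R g2"
  have Jv: "J ?v1 = s *\<^sub>R ?v1" "J ?v2 = s *\<^sub>R ?v2" using g by simp_all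
  obtain k1 where k1: "k1 \<in> K" "k1 *v p1 = ?v1" "\<And>x. x \<bullet> (p1 - ?v1) = 0 \<Longrightarrow> k1 *v x = x"
    "\<And>x. J x = s *\<^sub>R x \<Longrightarrow> J (k1 *v x) = s *\<^sub>R (k1 *v x)"
    using K_move[OF p(1) Jv(1) s] g(3) by auto
  let ?q = "k1 *v p2"
  have Jq: "J ?q = s *\<^sub>R ?q" using k1(4) p(2) by blast
  have nq: "norm ?q = norm ?v2" using K_norm[OF k1(1)] g(4) by simp
  obtain k2 where k2: "k2 \<in> K" "k2 *v ?q = ?v2" "\<And>x. x \<bullet> (?q - ?v2) = 0 \<Longrightarrow> k2 *v x = x"
    using K_move[OF Jq Jv(2) s nq] by blast
  have "?v1 \<bullet> ?q = 0" using K_inner[OF k1(1), of p1 p2] p(3) k1(2) by simp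
  then have "?v1 \<bullet> (?q - ?v2) = 0" using g(5) by (simp add: inner_diff_right)
  then have "k2 *v ?v1 = ?v1" by (rule k2(3))
  moreover have "k2 *v (k1 *v x) = x" if x: "J x = (- s) *\<^sub>R x" for x
  proof -
    have o: "x \<bullet> y = 0" if "J y = s *\<^sub>R y" for y using inner_eigen[OF that x s] by (simp add: inner_commute)
    have "k1 *v x = x" by (rule k1(3), simp only: inner_diff_right o[OF p(1)] o[OF Jv(1)] diff_self)
    moreover have "k2 *v x = x" by (rule k2(3), simp only: inner_diff_right o[OF Jq] o[OF Jv(2)] diff_self)
    ultimately show ?thesis by simp
  qed
  ultimately show ?thesis
    using k1 k2 by (intro bexI[OF _ K_mult[OF k2(1) k1(1)]]) (auto simp flip: matrix_vector_mul_assoc)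
qed

definition a2 :: "'m \<Rightarrow> 'm \<Rightarrow> real \<Rightarrow> real \<Rightarrow> 'm sqmat" where
  "a2 p q r s = tor (e p) (e (\<tau> p)) r ** tor (e q) (e (\<tau> q)) s"

definition Cset :: "real \<Rightarrow> 'm sqmat set" where "Cset R = {g \<in> G. N1 g \<le> R}"

text \<open>The reason for this definition: a set which is ample is all of G up to left and right
  multiplication by a compact set.\<close>

definition ample :: "'m sqmat set \<Rightarrow> bool" where
  "ample S \<longleftrightarrow> (\<exists>R. \<forall>g\<in>G. \<exists>c1\<in>Cset R. \<exists>c2\<in>Cset R. \<exists>h\<in>S. g = c1 ** h ** c2)"

lemma closed_G: "closed G"
proof -
  have "closed {g. isom g}"
  proof -
    have "{g. isom g} = (\<Inter>v. \<Inter>w. {g. B (g *v v) (g *v w) = B v w})" by (auto simp: isom_def)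
    moreover have "closed {g. B (g *v v) (g *v w) = B v w}" for v w
    proof (rule closed_Collect_eq)
      have "continuous_on UNIV (\<lambda>g. \<Sum>i\<in>UNIV. (\<Sum>j\<in>UNIV. g $ i $ j * v $ j) * (\<Sum>j\<in>UNIV. g $ \<tau> i $ j * w $ j))"
        by (intro continuous_intros)
      then show "continuous_on UNIV (\<lambda>g :: 'm sqmat. B (g *v v) (g *v w))"
        by (simp add: B_def inner_vec_def matrix_vector_mult_def)
    qed (rule continuous_on_const)
    ultimately show ?thesis by (simp only:) (intro closed_INT ballI)
  qed
  moreover have "closed {g :: 'm sqmat. det g = 1}"
    by (intro closed_Collect_eq continuous_on_const) (simp add: det_def, intro continuous_intros)
  ultimately have "closed ({g. isom g} \<inter> {g. det g = 1})" by blast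
  also have "{g. isom g} \<inter> {g. det g = 1} = G" by (auto simp: G_def)
  finally show ?thesis .
qed

lemma compact_Cset: "compact (Cset R)"
proof -
  have "closed {g. N1 g \<le> R}"
    unfolding N1_def by (intro closed_Collect_le continuous_intros)
  with closed_G have "closed (G \<inter> {g. N1 g \<le> R})" by blast
  also have "G \<inter> {g. N1 g \<le> R} = Cset R" by (auto simp: Cset_def)
  finally have "closed (Cset R)" .
  moreover have "bounded (Cset R)"
  proof (rule boundedI)
    fix g assume "g \<in> Cset R"
    have "norm g \<le> (\<Sum>i\<in>UNIV. norm (g $ i))" unfolding norm_vec_def[of g] by (rule L2_set_le_sum) simp
    also have "\<dots> \<le> N1 g" unfolding N1_def by (intro sum_mono norm_le_l1_cart)
    also have "\<dots> \<le> R" using \<open>g \<in> Cset R\<close> by (simp add: Cset_def)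
    finally show "norm g \<le> R" .
  qed
  ultimately show ?thesis by (rule compact_eq_bounded_closed[THEN iffD2, OF conjI, rotated])
qed

end

text \<open>The expression has opposite signs at t = 0 and t = pi / 2. It serves to rotate an
  orthonormal pair of the negative plane until a quadratic form on it is diagonal.\<close>

lemma rotation_zero:
  fixes a b c :: real
  shows "\<exists>t. a * cos (2 * t) + b * sin (2 * t) = 0"
proof -
  let ?h = "\<lambda>t. a * cos (2 * t) + b * sin (2 * t)"
  have c: "continuous_on {0..pi/2} ?h" by (intro continuous_intros)
  have v: "?h 0 = a" "?h (pi/2) = - a" by simp_all
  show ?thesis
  proof (cases "a \<ge> 0")
    case True then show ?thesis using IVT2'[of ?h "pi/2" 0 0] c v by auto
  next
    case False then show ?thesis using IVT'[of ?h 0 0 "pi/2"] c v by auto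
  qed
qed

section \<open>Two hyperbolic planes, and the decomposition G = K A K\<close>

locale frame = pairing \<tau> for \<tau> :: "'m::finite \<Rightarrow> 'm" +
  fixes p q :: 'm
  assumes pq: "\<tau> p \<noteq> p" "\<tau> q \<noteq> q" "q \<noteq> p" "q \<noteq> \<tau> p"
begin

lemma pq' [simp]: "p \<noteq> \<tau> p" "q \<noteq> \<tau> q" "p \<noteq> q" "\<tau> p \<noteq> q" "p \<noteq> \<tau> q" "\<tau> q \<noteq> p" "\<tau> p \<noteq> p" "\<tau> q \<noteq> q" "q \<noteq> p" "q \<noteq> \<tau> p"
  using pq by auto

lemma B_frame [simp]:
  "B (e p) (e p) = 0" "B (e q) (e q) = 0" "B (e (\<tau> p)) (e (\<tau> p)) = 0" "B (e (\<tau> q)) (e (\<tau> q)) = 0"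
  "B (e p) (e (\<tau> p)) = 1" "B (e q) (e (\<tau> q)) = 1" "B (e (\<tau> p)) (e p) = 1" "B (e (\<tau> q)) (e q) = 1"
  "B (e p) (e q) = 0" "B (e p) (e (\<tau> q)) = 0" "B (e (\<tau> p)) (e q) = 0" "B (e (\<tau> p)) (e (\<tau> q)) = 0"
  "B (e q) (e p) = 0" "B (e (\<tau> q)) (e p) = 0" "B (e q) (e (\<tau> p)) = 0" "B (e (\<tau> q)) (e (\<tau> p)) = 0"
  by (simp_all add: B_e_e)

lemma B_Mid_frame [simp]:
  assumes "v \<in> Mid"
  shows "B v (e p) = 0" "B v (e q) = 0" "B v (e (\<tau> p)) = 0" "B v (e (\<tau> q)) = 0"
    "B (e p) v = 0" "B (e q) v = 0" "B (e (\<tau> p)) v = 0" "B (e (\<tau> q)) v = 0"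
  using assms by (auto intro!: Mid_e)

text \<open>The vectors \<open>f1\<close>, \<open>f2\<close> and \<open>u1\<close>,
  \<open>u2\<close> are orthonormal in the negative and positive parts of the two planes; the torus
  acts on each pair \<open>f1\<close>, \<open>u1\<close> and \<open>f2\<close>, \<open>u2\<close> by
  hyperbolic rotation.\<close>

definition f1 where "f1 = (1 / sqrt 2) *\<^sub>R (e p - e (\<tau> p))"
definition f2 where "f2 = (1 / sqrt 2) *\<^sub>R (e q - e (\<tau> q))"
definition u1 where "u1 = (1 / sqrt 2) *\<^sub>R (e p + e (\<tau> p))"
definition u2 where "u2 = (1 / sqrt 2) *\<^sub>R (e q + e (\<tau> q))"

lemma inner_e: "e i \<bullet> e j = (if i = j then 1 else 0)"
  by (auto simp: inner_axis_axis)

lemma frame_inner [simp]: "f1 \<bullet> f1 = 1" "f2 \<bullet> f2 = 1" "f1 \<bullet> f2 = 0" "f2 \<bullet> f1 = 0" "u1 \<bullet> u1 = 1" "u2 \<bullet> u2 = 1" "u1 \<bullet> u2 = 0"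
  by (simp_all add: f1_def f2_def u1_def u2_def inner_add_left inner_add_right inner_diff_left inner_diff_right inner_e)

lemma frame_J: "J f1 = (-1) *\<^sub>R f1" "J f2 = (-1) *\<^sub>R f2" "J u1 = 1 *\<^sub>R u1" "J u2 = 1 *\<^sub>R u2"
  by (simp_all add: f1_def f2_def u1_def u2_def algebra_simps)

lemma frame_norm: "norm f1 = 1" "norm f2 = 1" "norm u1 = 1" "norm u2 = 1"
  by (simp_all add: norm_eq_sqrt_inner)

lemma a2_f: "a2 p q r s *v f1 = cosh r *\<^sub>R f1 + sinh r *\<^sub>R u1" "a2 p q r s *v f2 = cosh s *\<^sub>R f2 + sinh s *\<^sub>R u2"
proof -
  have "tor (e p) (e (\<tau> p)) r *v e p = exp r *\<^sub>R e p" "tor (e p) (e (\<tau> p)) r *v e (\<tau> p) = exp (-r) *\<^sub>R e (\<tau> p)"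
    "tor (e q) (e (\<tau> q)) s *v e q = exp s *\<^sub>R e q" "tor (e q) (e (\<tau> q)) s *v e (\<tau> q) = exp (-s) *\<^sub>R e (\<tau> q)"
    "tor (e q) (e (\<tau> q)) s *v e p = e p" "tor (e q) (e (\<tau> q)) s *v e (\<tau> p) = e (\<tau> p)"
    "tor (e p) (e (\<tau> p)) r *v e q = e q" "tor (e p) (e (\<tau> p)) r *v e (\<tau> q) = e (\<tau> q)"
    by (simp_all add: tor_apply B_bil algebra_simps)
  note act = this
  define k where "k = 1 / sqrt 2"
  show "a2 p q r s *v f1 = cosh r *\<^sub>R f1 + sinh r *\<^sub>R u1" "a2 p q r s *v f2 = cosh s *\<^sub>R f2 + sinh s *\<^sub>R u2"
    unfolding a2_def f1_def f2_def u1_def u2_def k_def[symmetric]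
    by (simp_all add: cosh_field_def sinh_field_def matrix_vector_mult_scaleR act
        matrix_vector_mult_diff_distrib vec_eq_iff flip: matrix_vector_mul_assoc)
      (simp_all add: field_simps)
qed

lemma G_a2: "a2 p q r s \<in> G"
  unfolding a2_def by (intro G_mult G_tor) simp_all

end

text \<open>The two planes contain the whole negative part of the form. A fixed point of
  \<open>\<tau>\<close> supplies a reflection of determinant -1 that commutes with the
  torus.\<close>

locale full_frame = frame \<tau> p q for \<tau> :: "'m::finite \<Rightarrow> 'm" and p q :: 'm +
  assumes outer: "\<tau> i \<noteq> i \<Longrightarrow> i = p \<or> i = q \<or> i = \<tau> p \<or> i = \<tau> q"
    and middle: "\<exists>m. \<tau> m = m"
begin

lemma negative_plane:
  assumes "J w = (-1) *\<^sub>R w"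
  shows "w = (w \<bullet> f1) *\<^sub>R f1 + (w \<bullet> f2) *\<^sub>R f2"
proof -
  have J: "w $ \<tau> i = - (w $ i)" for i using arg_cong[OF assms, of "\<lambda>v. v $ i"] by simp
  have f: "w \<bullet> f1 = sqrt 2 * w $ p" "w \<bullet> f2 = sqrt 2 * w $ q"
    by (simp_all add: f1_def f2_def inner_diff_right inner_axis J real_sqrt_divide field_simps)
  have fi: "f1 $ i = (1 / sqrt 2) * ((if i = p then 1 else 0) - (if i = \<tau> p then 1 else 0))"
    "f2 $ i = (1 / sqrt 2) * ((if i = q then 1 else 0) - (if i = \<tau> q then 1 else 0))" for i
    by (simp_all add: f1_def f2_def axis_def)
  show ?thesis
  proof (subst vec_eq_iff, intro allI)
    fix i
    show "w $ i = ((w \<bullet> f1) *\<^sub>R f1 + (w \<bullet> f2) *\<^sub>R f2) $ i"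
    proof (cases "\<tau> i = i")
      case True
      then have "i \<noteq> p" "i \<noteq> q" "i \<noteq> \<tau> p" "i \<noteq> \<tau> q" using pq by auto
      then show ?thesis using J[of i] True by (simp add: fi)
    next
      case False
      then show ?thesis using outer[OF False] J[of p] J[of q]
        by (auto simp: f fi)
    qed
  qed
qed

text \<open>Norm and form differ only on the negative plane, spanned by \<open>f1\<close> and
  \<open>f2\<close>. Hence an isometry fixing these two vectors preserves the norm, which is
  \<open>K_if_fixes\<close>.\<close>

lemma norm_via_B: "v \<bullet> v = B v v + 2 * (B v f1)\<^sup>2 + 2 * (B v f2)\<^sup>2"
proof -
  let ?w = "v - J v"
  have "J ?w = (-1) *\<^sub>R ?w" by simp
  from negative_plane[OF this] have w: "?w = (?w \<bullet> f1) *\<^sub>R f1 + (?w \<bullet> f2) *\<^sub>R f2" .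
  have f: "?w \<bullet> f1 = - 2 * B v f1" "?w \<bullet> f2 = - 2 * B v f2"
    using frame_J by (simp_all add: B_def inner_diff_left inner_J)
  have "?w \<bullet> ?w = (?w \<bullet> f1)\<^sup>2 + (?w \<bullet> f2)\<^sup>2"
    by (subst w, subst (2) w) (simp add: inner_add_left inner_add_right power2_eq_square del: inner_diff_left)
  then have 1: "?w \<bullet> ?w = 4 * (B v f1)\<^sup>2 + 4 * (B v f2)\<^sup>2" by (simp add: f power_mult_distrib)
  have "?w \<bullet> ?w = 2 * (v \<bullet> v) - 2 * B v v"
    by (simp add: inner_diff_left inner_diff_right B_def inner_J inner_commute[of "J v" v])
  with 1 show ?thesis by simp
qed

lemma K_if_fixes: "isom g \<Longrightarrow> g *v f1 = f1 \<Longrightarrow> g *v f2 = f2 \<Longrightarrow> g \<in> K"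
proof -
  assume g: "isom g" "g *v f1 = f1" "g *v f2 = f2"
  have "(g *v v) \<bullet> (g *v v) = v \<bullet> v" for v
    using isomD[OF g(1), of v v] isomD[OF g(1), of v f1] isomD[OF g(1), of v f2] g
    by (simp add: norm_via_B[of v] norm_via_B[of "g *v v"])
  then show ?thesis using g by (simp add: K_def norm_eq_sqrt_inner)
qed

text \<open>A singular value decomposition on the negative plane. The images of an orthonormal basis
  \<open>h1\<close>, \<open>h2\<close> are split along the eigenspaces of \<open>J\<close> into
  \<open>P\<close> and \<open>Q\<close>. If \<open>Q h1\<close> and \<open>Q h2\<close> are
  orthogonal, so are \<open>P h1\<close> and \<open>P h2\<close>, and elements of \<open>K\<close>
  move these parts to those of the vectors \<open>a2 p q r s *v f1\<close> and
  \<open>a2 p q r s *v f2\<close>. The remaining factor fixes \<open>f1\<close> and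
  \<open>f2\<close>.\<close>

lemma KAK_isom:
  assumes g: "isom g"
  shows "\<exists>k\<in>K. \<exists>k'\<in>K. \<exists>r s. r \<ge> s \<and> s \<ge> 0 \<and> g = k ** a2 p q r s ** k'"
proof -
  define Q P where "Q v = (1/2) *\<^sub>R (g *v v + J (g *v v))" and "P v = (1/2) *\<^sub>R (g *v v - J (g *v v))" for v
  have gPQ: "g *v v = P v + Q v" for v by (simp add: P_def Q_def algebra_simps flip: scaleR_add_left)
  have JP: "J (P v) = (-1) *\<^sub>R P v" "J (Q v) = 1 *\<^sub>R Q v" for v by (simp_all add: P_def Q_def algebra_simps)
  have lin: "Q (x + y) = Q x + Q y" "Q (r *\<^sub>R x) = r *\<^sub>R Q x" "Q (x - y) = Q x - Q y" for x y r
    by (simp_all add: Q_def matrix_vector_right_distrib matrix_vector_mult_scaleR matrix_vector_mult_diff_distrib algebra_simps)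
  have PQ: "P v \<bullet> Q w = 0" "Q w \<bullet> P v = 0" for v w
    using inner_eigen[OF JP(2)[of w], of "P v"] JP(1)[of v] by (simp_all add: inner_commute)
  have Bg: "B v w = Q v \<bullet> Q w - P v \<bullet> P w" for v w
  proof -
    have "B v w = B (g *v v) (g *v w)" using isomD[OF g] by simp
    also have "\<dots> = (P v + Q v) \<bullet> (- P w + Q w)" unfolding gPQ B_def using JP by simp
    finally show ?thesis by (simp add: inner_add_left inner_add_right inner_diff_right PQ)
  qed
  have "\<exists>h1 h2. h1 \<bullet> h1 = 1 \<and> h2 \<bullet> h2 = 1 \<and> h1 \<bullet> h2 = 0 \<and> J h1 = (-1) *\<^sub>R h1 \<and> J h2 = (-1) *\<^sub>R h2 \<and> Q h1 \<bullet> Q h2 = 0"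
  proof -
    \<comment> \<open>After rotating \<open>f1\<close>, \<open>f2\<close> by t, the inner product of
      the two \<open>Q\<close> parts is this combination of cos (2 t) and sin (2 t).\<close>
    obtain t where t: "(Q f1 \<bullet> Q f2) * cos (2 * t) + ((Q f2 \<bullet> Q f2 - Q f1 \<bullet> Q f1) / 2) * sin (2 * t) = 0"
      using rotation_zero by blast
    have sc: "cos t * cos t = 1 - sin t * sin t" using sin_cos_squared_add[of t] by (simp add: power2_eq_square)
    show ?thesis
    proof (intro exI conjI)
      let ?h1 = "cos t *\<^sub>R f1 + sin t *\<^sub>R f2" and ?h2 = "cos t *\<^sub>R f2 - sin t *\<^sub>R f1"
      show "?h1 \<bullet> ?h1 = 1" "?h2 \<bullet> ?h2 = 1" "?h1 \<bullet> ?h2 = 0"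
        by (simp_all add: inner_add_left inner_add_right inner_diff_left inner_diff_right sc)
      show "J ?h1 = (-1) *\<^sub>R ?h1" "J ?h2 = (-1) *\<^sub>R ?h2" using frame_J by (simp_all add: algebra_simps)
      have "Q ?h1 \<bullet> Q ?h2 = (Q f1 \<bullet> Q f2) * (cos t * cos t - sin t * sin t) + (Q f2 \<bullet> Q f2 - Q f1 \<bullet> Q f1) * (sin t * cos t)"
        by (simp add: lin inner_add_left inner_add_right inner_diff_left inner_diff_right inner_commute[of "Q f2" "Q f1"] algebra_simps)
      also have "\<dots> = 0" using t unfolding cos_double sin_double by (simp add: power2_eq_square field_simps)
      finally show "Q ?h1 \<bullet> Q ?h2 = 0" .
    qed
  qed
  \<comment> \<open>The conditions are symmetric in \<open>h1\<close> and \<open>h2\<close>;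
    exchanging them if necessary arranges r >= s.\<close>
  then obtain h1 h2 where h: "h1 \<bullet> h1 = 1" "h2 \<bullet> h2 = 1" "h1 \<bullet> h2 = 0" "J h1 = (-1) *\<^sub>R h1" "J h2 = (-1) *\<^sub>R h2" "Q h1 \<bullet> Q h2 = 0"
      and le: "norm (Q h2) \<le> norm (Q h1)"
    by (metis inner_commute linear)
  have Bh: "B h1 h1 = -1" "B h2 h2 = -1" "B h1 h2 = 0" using h by (simp_all add: B_def)
  have P0: "P h1 \<bullet> P h2 = 0" using Bg[of h1 h2] Bh h by simp
  \<comment> \<open>The form is -1 on \<open>h1\<close> and \<open>h2\<close>, so
    \<open>norm (P h)\<close>^2 - \<open>norm (Q h)\<close>^2 = 1: the norms of the two parts are
    cosh and sinh of one number.\<close>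
  define r s where "r = arsinh (norm (Q h1))" and "s = arsinh (norm (Q h2))"
  have rs: "sinh r = norm (Q h1)" "sinh s = norm (Q h2)" by (simp_all add: r_def s_def sinh_arsinh_real)
  have cr: "cosh r = norm (P h1)" "cosh s = norm (P h2)"
  proof -
    have "(norm (P h1))\<^sup>2 = (cosh r)\<^sup>2" "(norm (P h2))\<^sup>2 = (cosh s)\<^sup>2"
      using Bg[of h1 h1] Bg[of h2 h2] Bh(1,2) unfolding cosh_square_eq rs power2_norm_eq_inner by simp_all
    then show "cosh r = norm (P h1)" "cosh s = norm (P h2)"
      by (metis cosh_real_nonneg norm_ge_zero power2_eq_imp_eq)+
  qed
  have "s \<ge> 0" using rs(2) by (metis norm_ge_zero sinh_real_nonneg_iff)
  have "r \<ge> s" using le rs by (metis sinh_real_le_iff)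
  obtain k1 where k1: "k1 \<in> K" "k1 *v P h1 = norm (P h1) *\<^sub>R f1" "k1 *v P h2 = norm (P h2) *\<^sub>R f2"
      "\<And>x. J x = 1 *\<^sub>R x \<Longrightarrow> k1 *v x = x"
    using K_move2[of "-1" "P h1" "P h2" f1 f2] JP P0 frame_J frame_norm by auto
  obtain k2 where k2: "k2 \<in> K" "k2 *v Q h1 = norm (Q h1) *\<^sub>R u1" "k2 *v Q h2 = norm (Q h2) *\<^sub>R u2"
      "\<And>x. J x = (-1) *\<^sub>R x \<Longrightarrow> k2 *v x = x"
    using K_move2[of "1" "Q h1" "Q h2" u1 u2] JP h(6) frame_J frame_norm by auto
  obtain k3 where k3: "k3 \<in> K" "k3 *v h1 = f1" "k3 *v h2 = f2"
    using K_move2[of "-1" h1 h2 f1 f2] h frame_J frame_norm by (auto simp: norm_eq_sqrt_inner)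
  have k12: "(k2 ** k1) *v (g *v h1) = a2 p q r s *v f1" "(k2 ** k1) *v (g *v h2) = a2 p q r s *v f2"
    using k1 k2 JP frame_J by (simp_all add: gPQ a2_f rs cr matrix_vector_right_distrib matrix_vector_mult_scaleR flip: matrix_vector_mul_assoc)
  have ia: "isom (a2 p q r s)" using G_a2 G_isom by blast
  define d where "d = iv (a2 p q r s) ** (k2 ** k1 ** g ** iv k3)"
  have d: "isom d" unfolding d_def
    using ia K_isom[OF k1(1)] K_isom[OF k2(1)] K_isom[OF k3(1)] g by (intro isom_mult isom_iv)
  have "iv k3 *v f1 = h1" "iv k3 *v f2 = h2"
    using k3 isom_iv_left[OF K_isom[OF k3(1)]] by (metis matrix_vector_mul_assoc matrix_vector_mul_lid)+
  then have "d *v f1 = f1" "d *v f2 = f2"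
    using k12 isom_iv_left[OF ia] unfolding d_def by (metis matrix_vector_mul_assoc matrix_vector_mul_lid)+
  then have dK: "d \<in> K" using d K_if_fixes by blast
  have "a2 p q r s ** d = k2 ** k1 ** g ** iv k3"
    unfolding d_def matrix_mul_assoc by (simp add: isom_iv_right[OF ia])
  then have "iv (k2 ** k1) ** a2 p q r s ** (d ** k3) = (iv (k2 ** k1) ** (k2 ** k1)) ** g ** (iv k3 ** k3)"
    by (metis matrix_mul_assoc)
  also have "\<dots> = g" using isom_iv_left K_isom K_mult k1 k2 k3 by simp
  finally show ?thesis
    using K_mult K_iv dK k1(1) k2(1) k3(1) \<open>r \<ge> s\<close> \<open>s \<ge> 0\<close> by metis
qed

text \<open>If both compact factors have determinant -1, the reflection in a middle axis is inserted
  on either side of the torus element, with which it commutes.\<close>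

lemma KAK:
  assumes g: "g \<in> G"
  shows "\<exists>k\<in>K \<inter> G. \<exists>k'\<in>K \<inter> G. \<exists>r s. r \<ge> s \<and> s \<ge> 0 \<and> g = k ** a2 p q r s ** k'"
proof -
  obtain k k' r s where k: "k \<in> K" "k' \<in> K" "r \<ge> s" "s \<ge> 0" "g = k ** a2 p q r s ** k'"
    using KAK_isom[OF G_isom[OF g]] by blast
  have det1: "det k * det k' = 1"
  proof -
    have "det g = 1" "det (a2 p q r s) = 1" using g G_a2 by (auto simp: G_def)
    then show ?thesis using k(5) by (simp add: det_mul)
  qed
  show ?thesis
  proof (cases "det k = 1")
    case True
    then have "k \<in> K \<inter> G" "k' \<in> K \<inter> G" using k det1 K_isom by (auto simp: G_def)
    then show ?thesis using k by blast
  next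
    case False
    then have dk: "det k = -1" "det k' = -1" using isom_det[OF K_isom[OF k(1)]] det1 by (auto simp: power2_eq_1_iff)
    obtain m where m: "\<tau> m = m" using middle by blast
    define o1 where "o1 = refl (e m)"
    have o1K: "o1 \<in> K" unfolding o1_def by (rule refl_K[of _ 1]) (auto simp: m axis_eq_0_iff)
    have o1_apply: "o1 *v x = x - (2 * x $ m) *\<^sub>R e m" for x by (simp add: o1_def refl_apply inner_axis)
    have "o1 = (\<chi> i j. if i = j then (if i = m then -1 else 1) else 0)"
    proof -
      have "o1 $ i $ j = (o1 *v e j) $ i" for i j by (simp add: matrix_vector_mul_component inner_axis)
      then show ?thesis by (simp add: o1_apply vec_eq_iff axis_def)
    qed
    then have "det o1 = (\<Prod>i\<in>UNIV. if i = m then -1 else 1)" by (subst det_diagonal) auto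
    then have do1: "det o1 = -1" by simp
    have o1o1: "o1 ** o1 = mat 1"
      by (rule matrix_eq_vec) (simp add: o1_apply axis_def vec_eq_iff flip: matrix_vector_mul_assoc)
    have ne: "m \<noteq> p" "m \<noteq> q" "m \<noteq> \<tau> p" "m \<noteq> \<tau> q" using m pq by auto
    have fx: "o1 *v e i = e i" if "i \<noteq> m" for i using that by (simp add: o1_apply axis_def)
    have comm: "o1 ** a2 p q r s = a2 p q r s ** o1"
      unfolding a2_def using ne fx K_isom[OF o1K]
      by (metis (no_types, lifting) B_frame matrix_mul_assoc tor_commute)
    have "g = (k ** o1) ** a2 p q r s ** (o1 ** k')"
    proof -
      have "(k ** o1) ** a2 p q r s ** (o1 ** k') = k ** (o1 ** a2 p q r s) ** o1 ** k'" by (simp add: matrix_mul_assoc)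
      also have "\<dots> = k ** a2 p q r s ** (o1 ** o1) ** k'" unfolding comm by (simp add: matrix_mul_assoc)
      finally show ?thesis using k o1o1 by simp
    qed
    moreover have "k ** o1 \<in> K \<inter> G" "o1 ** k' \<in> K \<inter> G"
      using k o1K dk do1 K_isom by (auto simp: G_def det_mul intro!: K_mult isom_mult)
    ultimately show ?thesis using k by blast
  qed
qed

text \<open>The decomposition G = K A K reduces ampleness to reaching the torus elements of one
  chamber; the compact factors are absorbed into a larger \<open>Cset\<close>.\<close>

lemma ampleI:
  assumes "\<And>r s. r \<ge> s \<Longrightarrow> s \<ge> 0 \<Longrightarrow> \<exists>h\<in>S. \<exists>c1\<in>Cset R. \<exists>c2\<in>Cset R. h = c1 ** a2 p q r s ** c2"
  shows "ample S"
  unfolding ample_def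
proof (intro exI[of _ "K_bound * R"] ballI)
  fix g assume "g \<in> G"
  then obtain k k' r s where k: "k \<in> K \<inter> G" "k' \<in> K \<inter> G" "r \<ge> s" "s \<ge> 0" "g = k ** a2 p q r s ** k'"
    using KAK by blast
  obtain h c1 c2 where h: "h \<in> S" "c1 \<in> Cset R" "c2 \<in> Cset R" "h = c1 ** a2 p q r s ** c2"
    using assms[OF k(3,4)] by blast
  have cG: "c1 \<in> G" "c2 \<in> G" "N1 c1 \<le> R" "N1 c2 \<le> R" using h by (auto simp: Cset_def)
  have "a2 p q r s = (iv c1 ** c1) ** a2 p q r s ** (c2 ** iv c2)"
    using cG by (simp add: isom_iv_left isom_iv_right G_isom)
  then have "k ** a2 p q r s ** k' = k ** ((iv c1 ** c1) ** a2 p q r s ** (c2 ** iv c2)) ** k'" by simp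
  then have "g = (k ** iv c1) ** h ** (iv c2 ** k')"
    unfolding k(5) h(4) by (simp add: matrix_mul_assoc)
  moreover have "R \<ge> 0" using cG N1_nonneg[of c1] by linarith
  then have "N1 (k ** iv c1) \<le> K_bound * R" "N1 (iv c2 ** k') \<le> K_bound * R"
    using k cG K_N1[of k] K_N1[of k'] N1_mult[of k "iv c1"] N1_mult[of "iv c2" k']
      mult_mono[of "N1 k" K_bound "N1 c1" R] mult_mono[of "N1 k'" K_bound "N1 c2" R]
    by (auto simp: K_bound_def mult.commute intro: order_trans)
  then have "k ** iv c1 \<in> Cset (K_bound * R)" "iv c2 ** k' \<in> Cset (K_bound * R)"
    using k cG by (auto simp: Cset_def intro!: G_mult G_iv)
  ultimately show "\<exists>c1\<in>Cset (K_bound * R). \<exists>c2\<in>Cset (K_bound * R). \<exists>h\<in>S. g = c1 ** h ** c2"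
    using h(1) by blast
qed

end

section \<open>Curves and surfaces that reach every Cartan projection\<close>

lemma norm_diff_mono:
  fixes a b :: "'a::real_normed_vector"
  shows "norm a \<le> r \<Longrightarrow> norm b \<le> s \<Longrightarrow> norm (a - b) \<le> r + s"
  using norm_triangle_ineq4[of a b] by linarith

context pairing begin

lemma Cset_mult: "c \<in> Cset R \<Longrightarrow> d \<in> Cset R' \<Longrightarrow> c ** d \<in> Cset (R * R')"
  using N1_mult[of c d] mult_mono[of "N1 c" R "N1 d" R'] N1_nonneg[of c] N1_nonneg[of d]
  by (auto simp: Cset_def G_mult intro: order_trans)

lemma Cset_iv: "c \<in> Cset R \<Longrightarrow> iv c \<in> Cset R"
  by (auto simp: Cset_def G_iv)

lemma Cset_mono: "c \<in> Cset R \<Longrightarrow> R \<le> R' \<Longrightarrow> c \<in> Cset R'"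
  by (auto simp: Cset_def)

lemma B_le: "\<bar>B v w\<bar> \<le> norm v * norm w"
  unfolding B_def using Cauchy_Schwarz_ineq2[of v "J w"] by simp

lemma N1_eich: "N1 (eich (e i) v) \<le> K_bound * (1 + norm v)\<^sup>2"
  unfolding K_bound_def
proof (rule N1_le_norm)
  fix w :: "(real, 'm) vec"
  let ?n = "norm w" and ?v = "norm v"
  have "norm (eich (e i) v *v w) \<le> ?n + \<bar>B w v\<bar> + \<bar>B w (e i)\<bar> * ?v + \<bar>B v v / 2 * B w (e i)\<bar>"
    unfolding eich_apply by (intro norm_diff_mono norm_triangle_mono) simp_all
  moreover have "\<bar>B w v\<bar> \<le> ?n * ?v" "\<bar>B w (e i)\<bar> * ?v \<le> ?n * ?v"
    using B_le[of w v] B_le[of w "e i"] by (auto intro: mult_right_mono)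
  moreover have "\<bar>B v v / 2 * B w (e i)\<bar> \<le> (?v * ?v) * ?n"
  proof -
    have "\<bar>B v v\<bar> * \<bar>B w (e i)\<bar> \<le> (?v * ?v) * ?n"
      using B_le[of v v] B_le[of w "e i"] by (intro mult_mono) auto
    moreover have "0 \<le> \<bar>B v v\<bar> * \<bar>B w (e i)\<bar>" by simp
    moreover have "\<bar>B v v / 2 * B w (e i)\<bar> = \<bar>B v v\<bar> * \<bar>B w (e i)\<bar> / 2" by (simp add: abs_mult)
    ultimately show ?thesis by linarith
  qed
  ultimately show "norm (eich (e i) v *v w) \<le> (1 + ?v)\<^sup>2 * ?n"
    by (simp add: power2_eq_square algebra_simps)
qed

lemma Cset_eich:
  assumes "\<tau> i \<noteq> i" "B (e i) v = 0" "norm v \<le> 2"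
  shows "eich (e i) v \<in> Cset (9 * K_bound)"
proof -
  have "K_bound * (1 + norm v)\<^sup>2 \<le> K_bound * 3\<^sup>2"
    using assms(3) by (intro mult_left_mono power_mono) (auto simp: K_bound_def)
  then show ?thesis
    using assms N1_eich[of i v] by (auto simp: Cset_def B_e_e intro!: G_eich)
qed

text \<open>The rank one Cartan decomposition of a unipotent element; it comes from
  the matrix factorization (1 t; 0 1) = (1 0; 1/t 1) (t 0; 0 1/t) (1/t 1; -1 0).\<close>

lemma eich_factor:
  assumes "B u u = 0" "B u' u' = 0" "B u u' = 1" "B v u = 0" "B v u' = 0" "B v v = 2 * exp b"
  defines "k \<equiv> tor u u' (- b) ** eich u' (exp (- b) *\<^sub>R v) ** eich u v"
  shows "eich u v = eich u' (- (exp (- b) *\<^sub>R v)) ** tor u u' b ** k"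
    and "k *v w = w - B w u' *\<^sub>R u - B w u *\<^sub>R u' - (exp (- b) * B w v) *\<^sub>R v + (exp (- b) * B w v) *\<^sub>R u
      + B w u' *\<^sub>R (exp (- b) *\<^sub>R u - exp (- b) *\<^sub>R v - u') - B w u *\<^sub>R u"
    and "k \<in> G"
proof -
  have c: "B u' u = 1" "B u v = 0" "B u' v = 0" using assms B_commute by metis+
  have "eich u' (- (exp (- b) *\<^sub>R v)) ** eich u' (exp (- b) *\<^sub>R v) = mat 1"
    using assms c by (subst eich_add) (simp_all add: B_bil)
  moreover have "tor u u' b ** tor u u' (- b) = mat 1"
    using assms by (subst tor_add) simp_all
  moreover have "eich u' (- (exp (- b) *\<^sub>R v)) ** tor u u' b ** k
    = eich u' (- (exp (- b) *\<^sub>R v)) ** (tor u u' b ** tor u u' (- b)) ** eich u' (exp (- b) *\<^sub>R v) ** eich u v"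
    unfolding k_def by (simp add: matrix_mul_assoc)
  ultimately show "eich u v = eich u' (- (exp (- b) *\<^sub>R v)) ** tor u u' b ** k" by simp
  show "k \<in> G" unfolding k_def using assms c by (intro G_mult G_tor G_eich) (simp_all add: B_bil)
  define E where "E = exp b"
  have E: "exp (- b) = 1 / E" "exp b = E" "E \<noteq> 0" "B v v = 2 * E" by (simp_all add: E_def exp_minus divide_inverse assms)
  show "k *v w = w - B w u' *\<^sub>R u - B w u *\<^sub>R u' - (exp (- b) * B w v) *\<^sub>R v + (exp (- b) * B w v) *\<^sub>R u
      + B w u' *\<^sub>R (exp (- b) *\<^sub>R u - exp (- b) *\<^sub>R v - u') - B w u *\<^sub>R u"
    unfolding k_def
    by (simp add: tor_apply eich_apply B_bil assms(1-5) c E flip: matrix_vector_mul_assoc)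
      (simp add: vec_eq_iff field_simps E)
qed

end

section \<open>Cartan projections of root unipotents\<close>

context frame begin

abbreviation Tp where "Tp \<equiv> tor (e p) (e (\<tau> p))"
abbreviation Tq where "Tq \<equiv> tor (e q) (e (\<tau> q))"

lemma Tp_Tq: "Tp r ** Tq s = Tq s ** Tp r"
  by (rule tor_commute) (simp_all add: isom_tor tor_apply)

text \<open>The Cartan projection is close to (b, 0). The explicit \<open>k\<close> of
  \<open>eich_factor\<close> is bounded because exp (- b) times \<open>norm x\<close>^2 equals 2.
  Since \<open>k\<close> is the identity on vectors orthogonal to the plane and to \<open>x\<close>,
  a factor belonging to the other plane can be moved past it.\<close>

lemma short_factor:
  assumes x: "x \<in> Mid" "x \<bullet> x = 2 * exp b" "b \<ge> 0"
  shows "\<exists>c. \<exists>k\<in>Cset (20 * K_bound). eich (e (\<tau> p)) (c *\<^sub>R x) \<in> Cset (20 * K_bound) \<and>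
    eich (e p) x = eich (e (\<tau> p)) (c *\<^sub>R x) ** Tp b ** k \<and>
    (\<forall>w. B w (e p) = 0 \<longrightarrow> B w (e (\<tau> p)) = 0 \<longrightarrow> B w x = 0 \<longrightarrow> k *v w = w)"
proof -
  define k where "k = Tp (- b) ** eich (e (\<tau> p)) (exp (- b) *\<^sub>R x) ** eich (e p) x"
  have Bx: "B x x = 2 * exp b" using x by (simp add: B_Mid)
  have 1: "eich (e p) x = eich (e (\<tau> p)) (- (exp (- b) *\<^sub>R x)) ** Tp b ** k"
    and 2: "k *v w = w - B w (e (\<tau> p)) *\<^sub>R e p - B w (e p) *\<^sub>R e (\<tau> p) - (exp (- b) * B w x) *\<^sub>R x + (exp (- b) * B w x) *\<^sub>R e p
      + B w (e (\<tau> p)) *\<^sub>R (exp (- b) *\<^sub>R e p - exp (- b) *\<^sub>R x - e (\<tau> p)) - B w (e p) *\<^sub>R e p"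
    and kG: "k \<in> G" for w
    unfolding k_def using eich_factor[OF _ _ _ _ _ Bx, of "e p" "e (\<tau> p)"] x by auto
  have nx: "norm x = sqrt (2 * exp b)" using x by (simp add: norm_eq_sqrt_inner)
  have ee: "exp (- b) * exp b = 1" by (simp flip: exp_add)
  have el: "exp (- b) \<le> 1" using x by simp
  have nz: "exp (- b) * norm x \<le> 2"
  proof -
    have "(exp (- b) * norm x)\<^sup>2 = 2 * exp (- b) * (exp (- b) * exp b)"
      by (simp add: nx power_mult_distrib power2_eq_square)
    also have "\<dots> \<le> 2" unfolding ee using el by linarith
    also have "(2::real) \<le> 2\<^sup>2" by simp
    finally show ?thesis by (rule power2_le_imp_le) simp
  qed
  have nz2: "exp (- b) * norm x * norm x = 2"
    using nx ee by (simp add: mult.assoc)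
  have kN: "norm (k *v w) \<le> 20 * norm w" for w
  proof -
    let ?n = "norm w"
    have b1: "\<bar>B w (e (\<tau> p))\<bar> \<le> ?n" "\<bar>B w (e p)\<bar> \<le> ?n" using B_le[of w] by (metis mult.right_neutral norm_axis_1)+
    have b2: "\<bar>exp (- b) * B w x\<bar> * norm x \<le> 2 * ?n"
    proof -
      have "\<bar>exp (- b) * B w x\<bar> * norm x \<le> exp (- b) * (?n * norm x) * norm x"
        using B_le[of w x] by (simp add: abs_mult mult_left_mono mult_right_mono)
      also have "\<dots> = (exp (- b) * norm x * norm x) * ?n" by (simp add: mult_ac)
      finally show ?thesis unfolding nz2 .
    qed
    have b3: "\<bar>exp (- b) * B w x\<bar> \<le> 2 * ?n"
    proof -
      have "\<bar>exp (- b) * B w x\<bar> \<le> exp (- b) * (?n * norm x)"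
        using B_le[of w x] by (simp add: abs_mult mult_left_mono)
      also have "\<dots> = (exp (- b) * norm x) * ?n" by (simp add: mult_ac)
      also have "\<dots> \<le> 2 * ?n" using nz by (intro mult_right_mono) auto
      finally show ?thesis .
    qed
    have b4: "norm (exp (- b) *\<^sub>R e p - exp (- b) *\<^sub>R x - e (\<tau> p)) \<le> 4"
    proof -
      have "norm (exp (- b) *\<^sub>R e p - exp (- b) *\<^sub>R x - e (\<tau> p)) \<le> norm (exp (- b) *\<^sub>R e p) + norm (exp (- b) *\<^sub>R x) + norm (e (\<tau> p))"
        by (intro norm_diff_mono order_refl)
      also have "\<dots> \<le> 4" unfolding norm_scaleR norm_axis_1 using el nz by (simp del: exp_le_one_iff)
      finally show ?thesis .
    qed
    have "norm (B w (e (\<tau> p)) *\<^sub>R (exp (- b) *\<^sub>R e p - exp (- b) *\<^sub>R x - e (\<tau> p))) \<le> ?n * 4"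
      unfolding norm_scaleR using b1 b4 by (intro mult_mono) auto
    moreover have "norm (B w (e (\<tau> p)) *\<^sub>R e p) \<le> ?n" "norm (B w (e p) *\<^sub>R e (\<tau> p)) \<le> ?n" "norm (B w (e p) *\<^sub>R e p) \<le> ?n"
      "norm ((exp (- b) * B w x) *\<^sub>R x) \<le> 2 * ?n" "norm ((exp (- b) * B w x) *\<^sub>R e p) \<le> 2 * ?n"
      using b1 b2 b3 by simp_all
    \<comment> \<open>The coefficients add up to 12; the constant 20 is common to this lemma and
      \<open>long_factor\<close> and also covers the 9 of \<open>Cset_eich\<close>.\<close>
    ultimately have "norm (k *v w) \<le> ?n + ?n + ?n + 2 * ?n + 2 * ?n + ?n * 4 + ?n"
      unfolding 2 by (intro norm_diff_mono norm_triangle_mono order_refl)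
    then show ?thesis using norm_ge_zero[of w] by linarith
  qed
  have kC: "k \<in> Cset (20 * K_bound)"
    using kG N1_le_norm[of k 20, OF kN] by (simp add: Cset_def K_bound_def mult.commute)
  have "eich (e (\<tau> p)) (- (exp (- b) *\<^sub>R x)) \<in> Cset (9 * K_bound)"
    by (rule Cset_eich) (use x nz in \<open>auto simp: B_bil\<close>)
  then have "eich (e (\<tau> p)) ((- exp (- b)) *\<^sub>R x) \<in> Cset (20 * K_bound)"
    by (auto intro: Cset_mono simp: K_bound_def)
  then show ?thesis
    using kC 1 2 by (intro exI[of _ "- exp (- b)"] bexI[of _ k]) auto
qed

text \<open>The vector has form value 2 \<alpha> \<beta>, hence exp b = \<alpha> \<beta> in the
  first plane. The factor left by \<open>eich_factor\<close> is still unbounded in the second plane,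
  where the torus element with exp \<rho> = \<alpha> / \<beta> brings it back to a bounded
  \<open>k2\<close>.\<close>

lemma long_factor:
  assumes ab: "\<alpha> \<ge> 1" "\<beta> \<ge> 1"
  shows "\<exists>c\<in>Cset (20 * K_bound). \<exists>k\<in>Cset (20 * K_bound).
    eich (e p) (\<alpha> *\<^sub>R e q + \<beta> *\<^sub>R e (\<tau> q)) = c ** a2 p q (ln \<alpha> + ln \<beta>) (ln \<alpha> - ln \<beta>) ** k"
proof -
  define b \<rho> v where "b = ln \<alpha> + ln \<beta>" and "\<rho> = ln \<alpha> - ln \<beta>" and "v = \<alpha> *\<^sub>R e q + \<beta> *\<^sub>R e (\<tau> q)"
  have pos: "\<alpha> \<noteq> 0" "\<beta> \<noteq> 0" "\<alpha> > 0" "\<beta> > 0" using ab by auto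
  have ex: "exp b = \<alpha> * \<beta>" "exp (- b) = 1 / (\<alpha> * \<beta>)" "exp (- \<rho>) = \<beta> / \<alpha>" "exp \<rho> = \<alpha> / \<beta>"
    using pos by (simp_all add: b_def \<rho>_def exp_add exp_diff exp_minus field_simps)
  define k where "k = Tp (- b) ** eich (e (\<tau> p)) (exp (- b) *\<^sub>R v) ** eich (e p) v"
  define k2 where "k2 = Tq (- \<rho>) ** k"
  have Bv: "B v v = 2 * exp b" by (simp add: v_def B_bil ex)
  have Bvp: "B v (e p) = 0" "B v (e (\<tau> p)) = 0" "B (e (\<tau> p)) v = 0" by (simp_all add: v_def B_bil)
  have 1: "eich (e p) v = eich (e (\<tau> p)) (- (exp (- b) *\<^sub>R v)) ** Tp b ** k"
    and 2: "k *v w = w - B w (e (\<tau> p)) *\<^sub>R e p - B w (e p) *\<^sub>R e (\<tau> p) - (exp (- b) * B w v) *\<^sub>R v + (exp (- b) * B w v) *\<^sub>R e p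
      + B w (e (\<tau> p)) *\<^sub>R (exp (- b) *\<^sub>R e p - exp (- b) *\<^sub>R v - e (\<tau> p)) - B w (e p) *\<^sub>R e p"
    and kG: "k \<in> G" for w
    unfolding k_def using eich_factor[OF _ _ _ Bvp(1,2) Bv] by auto
  have k2_apply: "k2 *v w = w - B w (e (\<tau> p)) *\<^sub>R e p - B w (e p) *\<^sub>R e (\<tau> p)
      - B w (e (\<tau> q)) *\<^sub>R e q - B w (e q) *\<^sub>R e (\<tau> q) - B w (e q) *\<^sub>R e q - B w (e (\<tau> q)) *\<^sub>R e (\<tau> q)
      + (B w (e q) / \<beta> + B w (e (\<tau> q)) / \<alpha>) *\<^sub>R e p
      + B w (e (\<tau> p)) *\<^sub>R ((1 / (\<alpha> * \<beta>)) *\<^sub>R e p - (1 / \<alpha>) *\<^sub>R e q - (1 / \<beta>) *\<^sub>R e (\<tau> q) - e (\<tau> p)) - B w (e p) *\<^sub>R e p" for w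
    unfolding k2_def
    by (simp add: 2 tor_apply B_bil v_def ex flip: matrix_vector_mul_assoc)
      (simp add: vec_eq_iff field_simps pos)
  have k2N: "norm (k2 *v w) \<le> 20 * norm w" for w
  proof -
    let ?n = "norm w"
    have b1: "\<bar>B w (e i)\<bar> \<le> ?n" for i using B_le[of w "e i"] by simp
    have l1: "1 / (\<alpha> * \<beta>) \<le> 1" "1 / \<alpha> \<le> 1" "1 / \<beta> \<le> 1" "1 / (\<alpha> * \<beta>) \<ge> 0" "1 / \<alpha> \<ge> 0" "1 / \<beta> \<ge> 0"
      using ab mult_mono[of 1 \<alpha> 1 \<beta>] by auto
    have b3: "norm ((B w (e q) / \<beta> + B w (e (\<tau> q)) / \<alpha>) *\<^sub>R e p) \<le> 2 * ?n"
    proof -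
      have "\<bar>B w (e q)\<bar> / \<beta> \<le> ?n / 1" "\<bar>B w (e (\<tau> q))\<bar> / \<alpha> \<le> ?n / 1"
        using b1 ab by (intro frac_le; simp)+
      then have "\<bar>B w (e q) / \<beta>\<bar> \<le> ?n" "\<bar>B w (e (\<tau> q)) / \<alpha>\<bar> \<le> ?n"
        using pos by (simp_all add: abs_divide)
      then have "\<bar>B w (e q) / \<beta> + B w (e (\<tau> q)) / \<alpha>\<bar> \<le> 2 * ?n"
        using abs_triangle_ineq[of "B w (e q) / \<beta>" "B w (e (\<tau> q)) / \<alpha>"] by linarith
      then show ?thesis by simp
    qed
    have b4: "norm ((1 / (\<alpha> * \<beta>)) *\<^sub>R e p - (1 / \<alpha>) *\<^sub>R e q - (1 / \<beta>) *\<^sub>R e (\<tau> q) - e (\<tau> p)) \<le> 4"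
    proof -
      have "norm ((1 / (\<alpha> * \<beta>)) *\<^sub>R e p - (1 / \<alpha>) *\<^sub>R e q - (1 / \<beta>) *\<^sub>R e (\<tau> q) - e (\<tau> p))
        \<le> norm ((1 / (\<alpha> * \<beta>)) *\<^sub>R e p) + norm ((1 / \<alpha>) *\<^sub>R e q) + norm ((1 / \<beta>) *\<^sub>R e (\<tau> q)) + norm (e (\<tau> p))"
        by (intro norm_diff_mono order_refl)
      also have "\<dots> \<le> 4" unfolding norm_scaleR norm_axis_1 using l1 by linarith
      finally show ?thesis .
    qed
    have "norm (B w (e (\<tau> p)) *\<^sub>R ((1 / (\<alpha> * \<beta>)) *\<^sub>R e p - (1 / \<alpha>) *\<^sub>R e q - (1 / \<beta>) *\<^sub>R e (\<tau> q) - e (\<tau> p))) \<le> ?n * 4"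
      unfolding norm_scaleR using b1 b4 by (intro mult_mono) auto
    moreover have "norm (B w (e i) *\<^sub>R e j) \<le> ?n" for i j using b1 by simp
    ultimately have "norm (k2 *v w) \<le> ?n + ?n + ?n + ?n + ?n + ?n + ?n + 2 * ?n + ?n * 4 + ?n"
      unfolding k2_apply using b3 by (intro norm_diff_mono norm_triangle_mono order_refl)
    then show ?thesis using norm_ge_zero[of w] by linarith
  qed
  have "k2 \<in> G" unfolding k2_def by (intro G_mult G_tor kG) simp_all
  then have k2C: "k2 \<in> Cset (20 * K_bound)"
    using N1_le_norm[of k2 20, OF k2N] by (simp add: Cset_def K_bound_def mult.commute)
  have nz: "norm (- (exp (- b) *\<^sub>R v)) \<le> 2"
  proof -
    have "- (exp (- b) *\<^sub>R v) = (- 1 / \<beta>) *\<^sub>R e q + (- 1 / \<alpha>) *\<^sub>R e (\<tau> q)"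
      unfolding v_def ex using pos by (simp add: vec_eq_iff field_simps)
    then have "norm (- (exp (- b) *\<^sub>R v)) \<le> norm ((- 1 / \<beta>) *\<^sub>R e q) + norm ((- 1 / \<alpha>) *\<^sub>R e (\<tau> q))"
      using norm_triangle_ineq by metis
    also have "\<dots> = 1 / \<beta> + 1 / \<alpha>" using pos by simp
    also have "1 / \<beta> \<le> 1" "1 / \<alpha> \<le> 1" using ab by simp_all
    then have "1 / \<beta> + 1 / \<alpha> \<le> 2" by linarith
    finally show ?thesis .
  qed
  have "eich (e (\<tau> p)) (- (exp (- b) *\<^sub>R v)) \<in> Cset (9 * K_bound)"
    by (rule Cset_eich) (use nz Bvp in \<open>auto simp: B_bil\<close>)
  then have cC: "eich (e (\<tau> p)) (- (exp (- b) *\<^sub>R v)) \<in> Cset (20 * K_bound)"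
    by (auto intro: Cset_mono simp: K_bound_def)
  have "Tq \<rho> ** Tq (- \<rho>) = mat 1" by (subst tor_add) simp_all
  then have "k = Tq \<rho> ** k2" unfolding k2_def by (simp add: matrix_mul_assoc)
  then have "eich (e p) v = eich (e (\<tau> p)) (- (exp (- b) *\<^sub>R v)) ** a2 p q b \<rho> ** k2"
    using 1 by (simp add: a2_def matrix_mul_assoc)
  then show ?thesis using cC k2C unfolding b_def \<rho>_def v_def by blast
qed

end

section \<open>Families that are ample\<close>

context full_frame begin

text \<open>Two orthogonal long roots have Cartan projections (ln \<alpha> + ln \<beta>, ln \<alpha>
  - ln \<beta>); solving for the exponents fills the chamber.\<close>

lemma ample_long_pair:
  assumes "\<And>\<alpha> \<beta>. eich (e p) (\<alpha> *\<^sub>R e q + \<beta> *\<^sub>R e (\<tau> q)) \<in> S"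
  shows "ample S"
proof (rule ampleI)
  fix r s :: real assume rs: "r \<ge> s" "s \<ge> 0"
  let ?a = "exp ((r + s) / 2)" and ?b = "exp ((r - s) / 2)"
  have "ln ?a + ln ?b = r" "ln ?a - ln ?b = s" by (simp_all add: field_simps)
  then show "\<exists>h\<in>S. \<exists>c1\<in>Cset (20 * K_bound). \<exists>c2\<in>Cset (20 * K_bound). h = c1 ** a2 p q r s ** c2"
    using long_factor[of ?a ?b] assms[of ?a ?b] rs by auto
qed

text \<open>Conjugation by an Eichler transformation of the second plane carries \<xi> + a
  \<open>e q\<close> to a \<open>e q\<close> + b \<open>e (\<tau> q)\<close>, the vector of
  \<open>long_factor\<close>. The conjugating element is bounded because b <= a for s >= 0.\<close>

lemma ample_short_long:
  assumes x: "x \<in> Mid" "x \<noteq> 0" and S: "\<And>c t. eich (e p) (c *\<^sub>R x + t *\<^sub>R e q) \<in> S"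
  shows "ample S"
proof (rule ampleI)
  fix r s :: real assume rs: "r \<ge> s" "s \<ge> 0"
  let ?a = "exp ((r + s) / 2)" and ?b = "exp ((r - s) / 2)"
  have ln: "ln ?a + ln ?b = r" "ln ?a - ln ?b = s" by (simp_all add: field_simps)
  obtain c k where ck: "c \<in> Cset (20 * K_bound)" "k \<in> Cset (20 * K_bound)"
    "eich (e p) (?a *\<^sub>R e q + ?b *\<^sub>R e (\<tau> q)) = c ** a2 p q r s ** k"
    using long_factor[of ?a ?b] rs unfolding ln by auto
  \<comment> \<open>The length is chosen so that \<xi> has the form value 2 a b of the target
    vector.\<close>
  define \<xi> where "\<xi> = (sqrt (2 * ?a * ?b) / norm x) *\<^sub>R x"
  have \<xi>: "\<xi> \<in> Mid" using x subspace_scale[OF subspace_Mid] by (simp add: \<xi>_def)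
  have n\<xi>: "norm \<xi> = sqrt (2 * ?a * ?b)" using x by (simp add: \<xi>_def)
  then have \<xi>\<xi>: "\<xi> \<bullet> \<xi> = 2 * ?a * ?b" by (simp flip: power2_norm_eq_inner)
  then have B\<xi>: "B \<xi> \<xi> = 2 * ?a * ?b" using B_Mid \<xi> by simp
  define g where "g = eich (e (\<tau> q)) ((1 / ?a) *\<^sub>R \<xi>)"
  have nz: "norm ((1 / ?a) *\<^sub>R \<xi>) \<le> 2"
  proof -
    have "(norm ((1 / ?a) *\<^sub>R \<xi>))\<^sup>2 = 2 * (?b / ?a)"
      by (simp add: n\<xi> power_mult_distrib power_divide) (simp add: power2_eq_square)
    also have "?b / ?a = exp ((r - s) / 2 - (r + s) / 2)" by (rule exp_diff[symmetric])
    also have "\<dots> \<le> 1" using rs by (simp add: field_simps)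
    finally have "(norm ((1 / ?a) *\<^sub>R \<xi>))\<^sup>2 \<le> 2\<^sup>2" by simp
    then show ?thesis by (rule power2_le_imp_le) simp
  qed
  have gC: "g \<in> Cset (9 * K_bound)" unfolding g_def
    by (rule Cset_eich) (use nz \<xi> in \<open>auto simp: B_bil\<close>)
  then have gi: "isom g" by (simp add: Cset_def G_def)
  have "g *v (\<xi> + ?a *\<^sub>R e q) = ?a *\<^sub>R e q + ?b *\<^sub>R e (\<tau> q)"
    using \<xi> by (simp add: g_def eich_apply B_bil B\<xi> vec_eq_iff)
  moreover have "g *v e p = e p" using \<xi> by (simp add: g_def eich_apply B_bil)
  ultimately have "g ** eich (e p) (\<xi> + ?a *\<^sub>R e q) = eich (e p) (?a *\<^sub>R e q + ?b *\<^sub>R e (\<tau> q)) ** g"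
    using conj_eich[OF gi] by simp
  then have "iv g ** (g ** eich (e p) (\<xi> + ?a *\<^sub>R e q)) = (iv g ** c) ** a2 p q r s ** (k ** g)"
    unfolding ck(3) by (simp add: matrix_mul_assoc)
  then have "eich (e p) (\<xi> + ?a *\<^sub>R e q) = (iv g ** c) ** a2 p q r s ** (k ** g)"
    by (simp add: matrix_mul_assoc isom_iv_left[OF gi])
  moreover have "eich (e p) (\<xi> + ?a *\<^sub>R e q) \<in> S" unfolding \<xi>_def by (rule S)
  moreover have "iv g ** c \<in> Cset ((9 * K_bound) * (20 * K_bound))" by (intro Cset_mult Cset_iv gC ck)
  moreover have "k ** g \<in> Cset ((9 * K_bound) * (20 * K_bound))"
    using Cset_mult[OF ck(2) gC] by (simp add: mult.commute)
  ultimately show "\<exists>h\<in>S. \<exists>c1\<in>Cset ((9 * K_bound) * (20 * K_bound)). \<exists>c2\<in>Cset ((9 * K_bound) * (20 * K_bound)). h = c1 ** a2 p q r s ** c2"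
    by blast
qed

end

lemma (in full_frame) swap: "full_frame \<tau> q p"
  by unfold_locales (use pq outer middle in auto)

lemma (in full_frame) swap_sign: "full_frame \<tau> p (\<tau> q)"
  by unfold_locales (use pq outer middle in auto)

context full_frame begin

text \<open>The short root at \<open>p\<close> along \<open>x\<close> contributes r and the one at
  \<open>q\<close> along the orthogonal vector \<open>y\<close> contributes s; orthogonality lets
  the bounded factors commute past each other. The tail \<eta> \<open>e q\<close> is removed by
  conjugation with an element that does not depend on r and s.\<close>

lemma ample_orthogonal_shorts:
  assumes x: "x \<in> Mid" "x \<noteq> 0" and y: "y \<in> Mid" "y \<noteq> 0" and xy: "x \<bullet> y = 0"
    and S: "\<And>c d. eich (e p) (c *\<^sub>R (x + \<eta> *\<^sub>R e q)) ** eich (e q) (d *\<^sub>R y) \<in> S"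
  shows "ample S"
proof -
  interpret sw: full_frame \<tau> q p by (rule swap)
  \<comment> \<open>Chosen so that \<open>x\<close> goes to \<open>x\<close> minus \<eta>
    \<open>e q\<close>.\<close>
  define g where "g = eich (e q) ((- \<eta> / (x \<bullet> x)) *\<^sub>R x)"
  have gG: "g \<in> G" unfolding g_def using x by (intro G_eich) (simp_all add: B_bil)
  then have gi: "isom g" by (rule G_isom)
  define R where "R = N1 g"
  have gC: "g \<in> Cset R" using gG by (simp add: Cset_def R_def)
  let ?R = "20 * K_bound"
  show ?thesis
  proof (rule ampleI)
    fix r s :: real assume rs: "r \<ge> s" "s \<ge> 0"
    define c where "c = sqrt (2 * exp r) / norm x"
    define d where "d = sqrt (2 * exp s) / norm y"
    have m: "c *\<^sub>R x \<in> Mid" "d *\<^sub>R y \<in> Mid" using x y subspace_scale[OF subspace_Mid] by auto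
    have n: "(c *\<^sub>R x) \<bullet> (c *\<^sub>R x) = 2 * exp r" "(d *\<^sub>R y) \<bullet> (d *\<^sub>R y) = 2 * exp s"
      using x y by (simp_all add: c_def d_def power2_norm_eq_inner[symmetric] power2_eq_square[symmetric] flip: power2_norm_eq_inner)
    obtain c1 k where ck: "k \<in> Cset ?R" "eich (e (\<tau> p)) (c1 *\<^sub>R c *\<^sub>R x) \<in> Cset ?R"
      "eich (e p) (c *\<^sub>R x) = eich (e (\<tau> p)) (c1 *\<^sub>R c *\<^sub>R x) ** Tp r ** k"
      "\<And>w. B w (e p) = 0 \<Longrightarrow> B w (e (\<tau> p)) = 0 \<Longrightarrow> B w (c *\<^sub>R x) = 0 \<Longrightarrow> k *v w = w"
      using short_factor[OF m(1) n(1)] rs by auto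
    obtain d1 l where dl: "l \<in> Cset ?R" "eich (e (\<tau> q)) (d1 *\<^sub>R d *\<^sub>R y) \<in> Cset ?R"
      "eich (e q) (d *\<^sub>R y) = eich (e (\<tau> q)) (d1 *\<^sub>R d *\<^sub>R y) ** Tq s ** l"
      using sw.short_factor[OF m(2) n(2)] rs by auto
    let ?c = "eich (e (\<tau> p)) (c1 *\<^sub>R c *\<^sub>R x)" and ?d = "eich (e (\<tau> q)) (d1 *\<^sub>R d *\<^sub>R y)"
    have ki: "isom k" using ck by (simp add: Cset_def G_def)
    have Byx: "B y x = 0" using x xy by (simp add: B_Mid inner_commute)
    have kf: "k *v e q = e q" "k *v e (\<tau> q) = e (\<tau> q)" "k *v (d1 *\<^sub>R d *\<^sub>R y) = d1 *\<^sub>R d *\<^sub>R y"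
      using x y Byx by (auto intro!: ck(4) simp: B_bil)
    have kd: "k ** ?d = ?d ** k" by (rule eich_commute[OF ki kf(2,3)])
    have kT: "k ** Tq s = Tq s ** k" by (rule tor_commute) (simp_all add: ki kf)
    have Td: "Tp r ** ?d = ?d ** Tp r"
      by (rule eich_commute) (use y in \<open>simp_all add: isom_tor tor_apply B_bil\<close>)
    have "eich (e p) (c *\<^sub>R x) ** eich (e q) (d *\<^sub>R y) = ?c ** Tp r ** (k ** ?d) ** Tq s ** l"
      unfolding ck(3) dl(3) by (simp add: matrix_mul_assoc)
    also have "\<dots> = ?c ** (Tp r ** ?d) ** (k ** Tq s) ** l" unfolding kd by (simp add: matrix_mul_assoc)
    also have "\<dots> = (?c ** ?d) ** a2 p q r s ** (k ** l)" unfolding kT Td a2_def by (simp add: matrix_mul_assoc)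
    finally have 1: "eich (e p) (c *\<^sub>R x) ** eich (e q) (d *\<^sub>R y) = (?c ** ?d) ** a2 p q r s ** (k ** l)" .
    have Bxx: "B x x = x \<bullet> x" using x by (simp add: B_Mid)
    have "g *v (c *\<^sub>R (x + \<eta> *\<^sub>R e q)) = c *\<^sub>R x" "g *v e p = e p"
      using x Bxx by (simp_all add: g_def eich_apply B_bil vec_eq_iff algebra_simps)
    then have g1: "g ** eich (e p) (c *\<^sub>R (x + \<eta> *\<^sub>R e q)) = eich (e p) (c *\<^sub>R x) ** g"
      using conj_eich[OF gi] by simp
    have g2: "g ** eich (e q) (d *\<^sub>R y) = eich (e q) (d *\<^sub>R y) ** g"
      unfolding g_def using x y by (simp add: eich_add B_bil add.commute)
    let ?h = "eich (e p) (c *\<^sub>R (x + \<eta> *\<^sub>R e q)) ** eich (e q) (d *\<^sub>R y)"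
    have "g ** ?h = eich (e p) (c *\<^sub>R x) ** (g ** eich (e q) (d *\<^sub>R y))" using g1 by (simp add: matrix_mul_assoc)
    also have "\<dots> = (?c ** ?d) ** a2 p q r s ** (k ** l) ** g" unfolding g2 using 1 by (simp add: matrix_mul_assoc)
    finally have "iv g ** (g ** ?h) = (iv g ** (?c ** ?d)) ** a2 p q r s ** ((k ** l) ** g)" by (simp add: matrix_mul_assoc)
    then have "?h = (iv g ** (?c ** ?d)) ** a2 p q r s ** ((k ** l) ** g)"
      by (simp add: matrix_mul_assoc isom_iv_left[OF gi])
    moreover have "iv g ** (?c ** ?d) \<in> Cset (R * (?R * ?R))" by (intro Cset_mult Cset_iv gC ck dl)
    moreover have "(k ** l) ** g \<in> Cset (R * (?R * ?R))"
      using Cset_mult[OF Cset_mult[OF ck(1) dl(1)] gC] by (simp add: mult_ac)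
    ultimately show "\<exists>h\<in>S. \<exists>c1\<in>Cset (R * (?R * ?R)). \<exists>c2\<in>Cset (R * (?R * ?R)). h = c1 ** a2 p q r s ** c2"
      using S by blast
  qed
qed

text \<open>The source of the positive case. The torus provides s, and c tunes the length of s
  \<open>y0\<close> + c \<open>v\<close> to any value above s \<open>norm y0\<close>. The length
  needed grows like exp (r / 2) with r >= s, which beats the linear growth once it is enlarged by
  the constant \<kappa>.\<close>

lemma ample_torus_short:
  assumes v: "v \<in> Mid" "v \<noteq> 0" and y0: "y0 \<in> Mid"
    and S: "\<And>s c. Tq s ** eich (e p) (s *\<^sub>R y0 + c *\<^sub>R v) \<in> S"
  shows "ample S"
proof -
  \<comment> \<open>With exp \<kappa> = 1 + \<open>norm y0\<close>^2 the target 2 exp (r + \<kappa>)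
    is at least s^2 \<open>norm y0\<close>^2, since s^2 <= r^2 <= 2 exp r. The surplus
    \<open>Tp \<kappa>\<close> is a fixed factor.\<close>
  define \<kappa> where "\<kappa> = ln (1 + (norm y0)\<^sup>2)"
  have e\<kappa>: "exp \<kappa> = 1 + (norm y0)\<^sup>2" by (simp add: \<kappa>_def add_pos_nonneg)
  have \<kappa>0: "\<kappa> \<ge> 0" by (simp add: \<kappa>_def)
  let ?R = "20 * K_bound"
  define R where "R = N1 (Tp \<kappa>)"
  have TC: "Tp \<kappa> \<in> Cset R" by (simp add: Cset_def R_def G_tor)
  show ?thesis
  proof (rule ampleI)
    fix r s :: real assume rs: "r \<ge> s" "s \<ge> 0"
    let ?f = "\<lambda>c. norm (s *\<^sub>R y0 + c *\<^sub>R v)"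
    let ?t = "sqrt (2 * exp (r + \<kappa>))"
    have t0: "?t \<ge> 0" by simp
    have "?f 0 \<le> ?t"
    proof (rule power2_le_imp_le)
      have "s\<^sup>2 \<le> r\<^sup>2" using rs by (intro power_mono) auto
      also have "r\<^sup>2 \<le> 2 * exp r" using exp_lower_Taylor_quadratic[of r] rs by simp
      finally have "s\<^sup>2 * (norm y0)\<^sup>2 \<le> (2 * exp r) * (1 + (norm y0)\<^sup>2)" by (intro mult_mono) auto
      then show "(?f 0)\<^sup>2 \<le> ?t\<^sup>2" by (simp add: power_mult_distrib exp_add e\<kappa>)
    qed simp
    moreover define C where "C = (?t + norm (s *\<^sub>R y0)) / norm v"
    have "?t \<le> ?f C"
    proof -
      have "norm (C *\<^sub>R v) = ?t + norm (s *\<^sub>R y0)" using v by (simp add: C_def)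
      then show ?thesis using norm_triangle_ineq4[of "s *\<^sub>R y0 + C *\<^sub>R v" "s *\<^sub>R y0"] by simp
    qed
    moreover have "0 \<le> C" by (simp add: C_def)
    moreover have "continuous_on {0..C} ?f" by (intro continuous_intros)
    ultimately obtain c where c: "?f c = ?t" using IVT'[of ?f 0 ?t C] by auto
    define y where "y = s *\<^sub>R y0 + c *\<^sub>R v"
    have y: "y \<in> Mid" unfolding y_def using v y0 by (intro subspace_add[OF subspace_Mid] subspace_scale[OF subspace_Mid])
    have yy: "y \<bullet> y = 2 * exp (r + \<kappa>)" using c by (simp add: y_def flip: power2_norm_eq_inner)
    obtain c1 k where ck: "k \<in> Cset ?R" "eich (e (\<tau> p)) (c1 *\<^sub>R y) \<in> Cset ?R"
      "eich (e p) y = eich (e (\<tau> p)) (c1 *\<^sub>R y) ** Tp (r + \<kappa>) ** k"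
      using short_factor[OF y yy] rs \<kappa>0 by auto
    have comm: "Tq s ** eich (e (\<tau> p)) (c1 *\<^sub>R y) = eich (e (\<tau> p)) (c1 *\<^sub>R y) ** Tq s"
      by (rule eich_commute) (use y in \<open>simp_all add: isom_tor tor_apply B_bil\<close>)
    have "Tq s ** eich (e p) y = eich (e (\<tau> p)) (c1 *\<^sub>R y) ** (Tq s ** Tp (r + \<kappa>)) ** k"
      unfolding ck(3) using comm by (simp add: matrix_mul_assoc)
    also have "Tq s ** Tp (r + \<kappa>) = a2 p q r s ** Tp \<kappa>"
      unfolding a2_def Tp_Tq by (simp add: tor_add flip: matrix_mul_assoc)
    finally have "Tq s ** eich (e p) y = eich (e (\<tau> p)) (c1 *\<^sub>R y) ** a2 p q r s ** (Tp \<kappa> ** k)"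
      by (simp add: matrix_mul_assoc)
    moreover have "Tq s ** eich (e p) y \<in> S" unfolding y_def by (rule S)
    moreover have "eich (e (\<tau> p)) (c1 *\<^sub>R y) \<in> Cset (max ?R (R * ?R))" "Tp \<kappa> ** k \<in> Cset (max ?R (R * ?R))"
      using Cset_mono[OF ck(2)] Cset_mono[OF Cset_mult[OF TC ck(1)]] by auto
    ultimately show "\<exists>h\<in>S. \<exists>c1\<in>Cset (max ?R (R * ?R)). \<exists>c2\<in>Cset (max ?R (R * ?R)). h = c1 ** a2 p q r s ** c2"
      by blast
  qed
qed

end

section \<open>Families with restricted Cartan projections\<close>

context pairing begin

lemma entry_eq: "g $ i $ j = (g *v e j) $ i" for g :: "'m sqmat"
  by (simp add: matrix_vector_mul_component inner_axis)

lemma N2_le_products: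
  assumes "\<And>i k j l. i \<noteq> k \<Longrightarrow> j \<noteq> l \<Longrightarrow> \<bar>g $ i $ j * g $ k $ l\<bar> \<le> C" "C \<ge> 0"
  shows "N2 g \<le> (real CARD('m))^4 * (2 * C)"
proof (rule N2_le)
  fix i k j l
  show "\<bar>minor g i k j l\<bar> \<le> 2 * C"
  proof (cases "i = k \<or> j = l")
    case True then show ?thesis using assms(2) by (auto simp: minor_def)
  next
    case False
    then show ?thesis using assms(1)[of i k j l] assms(1)[of i k l j] unfolding minor_def by fastforce
  qed
qed

lemma N1_add: "N1 (g + h) \<le> N1 g + N1 h"
  unfolding N1_def by (simp add: sum.distrib[symmetric] sum_mono abs_triangle_ineq)

lemma N1_diff: "N1 (g - h) \<le> N1 g + N1 h"
  unfolding N1_def by (simp add: sum.distrib[symmetric] sum_mono abs_triangle_ineq4)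

lemma K_bound_ge: "K_bound \<ge> 1"
  unfolding K_bound_def by simp

lemma N1_one: "N1 (mat 1) \<le> K_bound"
  using K_N1[OF K_one] .

lemma N1_eich_long:
  assumes "B v v = 0" shows "N1 (eich (e i) v) \<le> K_bound * (1 + 2 * norm v)"
  unfolding K_bound_def
proof (rule N1_le_norm)
  fix w :: "(real, 'm) vec"
  have "norm (eich (e i) v *v w) \<le> norm w + \<bar>B w v\<bar> + \<bar>B w (e i)\<bar> * norm v + 0"
    unfolding eich_apply assms by (intro norm_diff_mono norm_triangle_mono) simp_all
  moreover have "\<bar>B w v\<bar> \<le> norm w * norm v" "\<bar>B w (e i)\<bar> * norm v \<le> norm w * norm v"
    using B_le[of w v] B_le[of w "e i"] by (auto intro: mult_right_mono)
  ultimately show "norm (eich (e i) v *v w) \<le> (1 + 2 * norm v) * norm w"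
    by (simp add: algebra_simps)
qed

definition sim :: "real \<Rightarrow> 'm sqmat \<Rightarrow> 'm sqmat \<Rightarrow> bool" where
  "sim R h k \<longleftrightarrow> isom h \<and> (\<exists>g. isom g \<and> N1 g \<le> R \<and> (h = iv g ** k ** g \<or> iv h = iv g ** k ** g))"

lemma N2_le_power: "N1 c \<le> R \<Longrightarrow> N2 c \<le> 2 * (real CARD('m))^4 * R\<^sup>2"
  by (rule order_trans[OF N2_le_N1]) (intro mult_left_mono power_mono; simp)

lemma conj_bounds:
  assumes "isom g" "N1 g \<le> R"
  shows "N1 (iv g ** k ** g) \<le> R\<^sup>2 * N1 k" "N2 (iv g ** k ** g) \<le> (2 * (real CARD('m))^4 * R\<^sup>2)\<^sup>2 * N2 k"
proof -
  have R: "R \<ge> 0" using assms(2) N1_nonneg[of g] by linarith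
  have "N1 (iv g ** k ** g) \<le> N1 (iv g) * N1 k * N1 g"
    by (rule order_trans[OF N1_mult]) (intro mult_right_mono N1_mult N1_nonneg)
  also have "\<dots> \<le> R * N1 k * R" using assms R by (intro mult_mono) auto
  finally show "N1 (iv g ** k ** g) \<le> R\<^sup>2 * N1 k" by (simp add: power2_eq_square mult_ac)
  let ?D = "2 * (real CARD('m))^4 * R\<^sup>2"
  have D: "N2 c \<le> ?D" if "N1 c \<le> R" for c
    by (rule N2_le_power[OF that])
  have "N2 (iv g ** k ** g) \<le> N2 (iv g) * N2 k * N2 g"
    by (rule order_trans[OF N2_mult]) (intro mult_right_mono N2_mult N2_nonneg)
  also have "\<dots> \<le> ?D * N2 k * ?D" using assms D R by (intro mult_mono) auto
  finally show "N2 (iv g ** k ** g) \<le> ?D\<^sup>2 * N2 k" by (simp add: power2_eq_square mult_ac)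
qed

lemma sim_bounds:
  "\<exists>L\<ge>1. \<forall>h k. sim R h k \<longrightarrow> N1 h \<le> L * N1 k \<and> N1 k \<le> L * N1 h \<and> N2 h \<le> L * N2 k \<and> N2 k \<le> L * N2 h"
proof -
  let ?D = "(2 * (real CARD('m))^4 * R\<^sup>2)\<^sup>2" and ?m = "(real CARD('m))^4"
  define L where "L = ?m * ?D + R\<^sup>2 + 1"
  have m1: "?m \<ge> 1" by simp
  have L: "L \<ge> 1" "R\<^sup>2 \<le> L" "?D \<le> L" "?m * ?D \<le> L"
  proof -
    have "0 \<le> ?D" "0 \<le> R\<^sup>2" by simp_all
    moreover have "?D \<le> ?m * ?D" using mult_right_mono[OF m1 \<open>0 \<le> ?D\<close>] by linarith
    ultimately show "L \<ge> 1" "R\<^sup>2 \<le> L" "?D \<le> L" "?m * ?D \<le> L" unfolding L_def by linarith+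
  qed
  have "N1 h \<le> L * N1 k \<and> N1 k \<le> L * N1 h \<and> N2 h \<le> L * N2 k \<and> N2 k \<le> L * N2 h" if hk: "sim R h k" for h k
  proof -
    obtain g h' where g: "isom g" "N1 g \<le> R" "h' = iv g ** k ** g" "h' = h \<or> h' = iv h"
      using hk unfolding sim_def by metis
    have "iv (iv g) ** h' ** iv g = (g ** iv g) ** k ** (g ** iv g)" unfolding g(3) by (simp add: matrix_mul_assoc)
    then have k: "k = iv (iv g) ** h' ** iv g" by (simp add: isom_iv_right[OF g(1)])
    have 1: "N1 h' \<le> R\<^sup>2 * N1 k" "N2 h' \<le> ?D * N2 k"
      using conj_bounds[OF g(1,2), of k] g(3) by auto
    have 2: "N1 k \<le> R\<^sup>2 * N1 h'" "N2 k \<le> ?D * N2 h'"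
      using conj_bounds[OF isom_iv[OF g(1)], of R h'] g(2) k by auto
    have 3: "N1 h' = N1 h" using g(4) by auto
    have 4: "N2 h \<le> ?m * N2 h'" "N2 h' \<le> ?m * N2 h"
      using g(4) N2_iv_le[of h] N2_iv_le[of "iv h"] m1 mult_right_mono[OF m1 N2_nonneg[of h]] by auto
    have "N1 h \<le> L * N1 k" "N1 k \<le> L * N1 h"
      using 1(1) 2(1) 3 mult_right_mono[OF L(2) N1_nonneg[of k]] mult_right_mono[OF L(2) N1_nonneg[of h]] by auto
    moreover have "N2 h \<le> L * N2 k"
    proof -
      have "N2 h \<le> ?m * (?D * N2 k)" using 4(1) mult_left_mono[OF 1(2), of ?m] m1 by linarith
      also have "\<dots> = (?m * ?D) * N2 k" by simp
      finally show ?thesis using mult_right_mono[OF L(4) N2_nonneg[of k]] by linarith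
    qed
    moreover have "N2 k \<le> L * N2 h"
    proof -
      have "N2 k \<le> ?D * (?m * N2 h)" using 2(2) mult_left_mono[OF 4(2) zero_le_power2[of "2 * (real CARD('m))^4 * R\<^sup>2"]] by linarith
      also have "\<dots> = (?m * ?D) * N2 h" by simp
      finally show ?thesis using mult_right_mono[OF L(4) N2_nonneg[of h]] by linarith
    qed
    ultimately show ?thesis by blast
  qed
  then show ?thesis using L(1) by blast
qed

end

section \<open>Sizes on ample sets and along the two walls\<close>

context frame begin

lemma a2_apply: "a2 p q r s *v w = w + ((exp r - 1) * w $ p) *\<^sub>R e p + ((exp (- r) - 1) * w $ \<tau> p) *\<^sub>R e (\<tau> p)
    + ((exp s - 1) * w $ q) *\<^sub>R e q + ((exp (- s) - 1) * w $ \<tau> q) *\<^sub>R e (\<tau> q)"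
  unfolding a2_def by (simp add: tor_apply B_bil flip: matrix_vector_mul_assoc) (simp add: B_axis algebra_simps)

definition dg :: "real \<Rightarrow> real \<Rightarrow> 'm \<Rightarrow> real" where
  "dg r s i = (if i = p then exp r else if i = \<tau> p then exp (- r) else if i = q then exp s else if i = \<tau> q then exp (- s) else 1)"

lemma a2_entry: "a2 p q r s $ i $ j = (if i = j then dg r s i else 0)"
  by (simp add: entry_eq a2_apply dg_def axis_def)

lemma dg_pos: "dg r s i > 0" by (simp add: dg_def)

lemma dg_le: "s \<le> r \<Longrightarrow> 0 \<le> s \<Longrightarrow> dg r s i \<le> exp r"
  by (auto simp: dg_def)

lemma dg_le2: "s \<le> r \<Longrightarrow> 0 \<le> s \<Longrightarrow> i \<noteq> k \<Longrightarrow> dg r s i * dg r s k \<le> exp (r + s)"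
  by (auto simp: dg_def simp flip: exp_add)

lemma N1_a2: "s \<le> r \<Longrightarrow> 0 \<le> s \<Longrightarrow> N1 (a2 p q r s) \<le> K_bound * exp r"
  unfolding K_bound_def
  by (rule N1_le) (use dg_le[of s r] dg_pos[of r s] in \<open>auto simp: a2_entry abs_of_pos\<close>)

lemma N2_a2: "s \<le> r \<Longrightarrow> 0 \<le> s \<Longrightarrow> N2 (a2 p q r s) \<le> (real CARD('m))^4 * (2 * exp (r + s))"
  by (rule N2_le_products) (use dg_le2[of s r] dg_pos[of r s] in \<open>auto simp: a2_entry abs_mult abs_of_pos\<close>)

text \<open>Both sizes are submultiplicative, and the factors in \<open>Cset\<close> have bounded
  inverses, so the sizes of \<open>a2 p q r s\<close> are inherited by some element of the
  set.\<close>

lemma ample_necessary: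
  assumes "ample S"
  shows "\<exists>K\<ge>1. \<forall>r s. s \<le> r \<longrightarrow> 0 \<le> s \<longrightarrow> (\<exists>h\<in>S. N1 h \<le> K * exp r \<and> exp r \<le> K * N1 h \<and>
    N2 h \<le> K * exp (r + s) \<and> exp (r + s) \<le> K * N2 h)"
proof -
  obtain R where R: "\<And>g. g \<in> G \<Longrightarrow> \<exists>c1\<in>Cset R. \<exists>c2\<in>Cset R. \<exists>h\<in>S. g = c1 ** h ** c2"
    using assms unfolding ample_def by blast
  let ?m = "(real CARD('m))^4"
  define D where "D = 2 * ?m * R\<^sup>2"
  define K where "K = R\<^sup>2 * K_bound + R\<^sup>2 + D\<^sup>2 * (2 * ?m) + D\<^sup>2 + 1"
  have K: "K \<ge> 1" "R\<^sup>2 * K_bound \<le> K" "R\<^sup>2 \<le> K" "D\<^sup>2 * (2 * ?m) \<le> K" "D\<^sup>2 \<le> K"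
    using K_bound_ge by (simp_all add: K_def add_nonneg_nonneg)
  show ?thesis
  proof (intro exI[of _ K] conjI K(1) allI impI)
    fix r s :: real assume rs: "s \<le> r" "0 \<le> s"
    let ?a = "a2 p q r s"
    obtain c1 c2 h where h: "c1 \<in> Cset R" "c2 \<in> Cset R" "h \<in> S" "?a = c1 ** h ** c2" using R[OF G_a2] by blast
    have ci: "isom c1" "isom c2" "N1 c1 \<le> R" "N1 c2 \<le> R" using h by (auto simp: Cset_def G_def)
    have R0: "R \<ge> 0" using ci N1_nonneg[of c1] by linarith
    have "iv c1 ** ?a ** iv c2 = (iv c1 ** c1) ** h ** (c2 ** iv c2)" unfolding h(4) by (simp add: matrix_mul_assoc)
    then have h2: "h = iv c1 ** ?a ** iv c2" using ci by (simp add: isom_iv_left isom_iv_right)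
    have b1: "N1 (a ** b ** c) \<le> R\<^sup>2 * N1 b" if "N1 a \<le> R" "N1 c \<le> R" for a b c
    proof -
      have "N1 (a ** b ** c) \<le> N1 a * N1 b * N1 c"
        by (rule order_trans[OF N1_mult]) (intro mult_right_mono N1_mult N1_nonneg)
      also have "\<dots> \<le> R * N1 b * R" using that R0 by (intro mult_mono) auto
      finally show ?thesis by (simp add: power2_eq_square mult_ac)
    qed
    have D: "N2 c \<le> D" if "N1 c \<le> R" for c
      unfolding D_def by (rule N2_le_power[OF that])
    have b2: "N2 (a ** b ** c) \<le> D\<^sup>2 * N2 b" if "N1 a \<le> R" "N1 c \<le> R" for a b c
    proof -
      have "N2 (a ** b ** c) \<le> N2 a * N2 b * N2 c"
        by (rule order_trans[OF N2_mult]) (intro mult_right_mono N2_mult N2_nonneg)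
      also have "\<dots> \<le> D * N2 b * D" using D that R0 by (intro mult_mono) (auto simp: D_def)
      finally show ?thesis by (simp add: power2_eq_square mult_ac)
    qed
    have lo1: "exp r \<le> N1 ?a" using N1_entry[of ?a p p] by (simp add: a2_entry dg_def)
    have lo2: "exp (r + s) \<le> N2 ?a"
      using N2_minor[of ?a p q p q] by (simp add: minor_def a2_entry dg_def exp_add)
    show "\<exists>h\<in>S. N1 h \<le> K * exp r \<and> exp r \<le> K * N1 h \<and> N2 h \<le> K * exp (r + s) \<and> exp (r + s) \<le> K * N2 h"
    proof (intro bexI[OF _ h(3)] conjI)
      have "N1 h \<le> R\<^sup>2 * (K_bound * exp r)"
        using b1[of "iv c1" "iv c2" ?a] ci h2 mult_left_mono[OF N1_a2[OF rs], of "R\<^sup>2"] by auto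
      also have "\<dots> \<le> K * exp r" using mult_right_mono[OF K(2), of "exp r"] by (simp add: mult.assoc)
      finally show "N1 h \<le> K * exp r" .
      show "exp r \<le> K * N1 h"
        using lo1 b1[of c1 c2 h] ci h(4) mult_right_mono[OF K(3) N1_nonneg[of h]] by auto
      have "N2 h \<le> D\<^sup>2 * (?m * (2 * exp (r + s)))"
        using b2[of "iv c1" "iv c2" ?a] ci h2 mult_left_mono[OF N2_a2[OF rs], of "D\<^sup>2"] by auto
      also have "\<dots> = (D\<^sup>2 * (2 * ?m)) * exp (r + s)" by simp
      also have "\<dots> \<le> K * exp (r + s)" using K(4) by (intro mult_right_mono) auto
      finally show "N2 h \<le> K * exp (r + s)" .
      show "exp (r + s) \<le> K * N2 h"
        using lo2 b2[of c1 c2 h] ci h(4) mult_right_mono[OF K(5) N2_nonneg[of h]] by auto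
    qed
  qed
qed

lemma exp_unbounded: "\<exists>r\<ge>0. exp r > (C::real)"
  by (rule exI[of _ "\<bar>C\<bar>"]) (use exp_ge_add_one_self[of "\<bar>C\<bar>"] in linarith)

text \<open>Along a = diag(exp r, exp r, ...) the ratio of the square of N1 to N2 is bounded.\<close>

lemma not_ample_ratio1:
  assumes c: "c > 0" and \<Psi>: "\<And>x y. 0 \<le> x \<Longrightarrow> x \<le> y \<Longrightarrow> \<Psi> x \<le> (\<Psi> y :: real)"
    and S: "\<And>h. h \<in> S \<Longrightarrow> \<exists>k. sim R h k \<and> (\<exists>\<rho>\<ge>0. c * \<rho> * N2 k \<le> (N1 k)\<^sup>2 \<and> N1 k \<le> \<Psi> \<rho>)"
  shows "\<not> ample S"
proof
  assume "ample S"
  then obtain K where K: "K \<ge> 1" and am: "\<And>r s. s \<le> r \<Longrightarrow> 0 \<le> s \<Longrightarrow> \<exists>h\<in>S. N1 h \<le> K * exp r \<and> exp r \<le> K * N1 h \<and>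
    N2 h \<le> K * exp (r + s) \<and> exp (r + s) \<le> K * N2 h"
    using ample_necessary by metis
  obtain L where L: "L \<ge> 1" "\<And>h k. sim R h k \<Longrightarrow> N1 h \<le> L * N1 k \<and> N1 k \<le> L * N1 h \<and> N2 h \<le> L * N2 k \<and> N2 k \<le> L * N2 h"
    using sim_bounds[of R] by blast
  \<comment> \<open>On the wall r = s the square of \<open>N1\<close> is at most a constant times
    \<open>N2\<close>. This bounds \<rho> by \<open>M\<close>, whatever r is, and then
    \<open>N1\<close> is bounded although r is arbitrary.\<close>
  define M where "M = L\<^sup>2 * K\<^sup>2 * K * L / c"
  have M0: "M \<ge> 0" using K L c by (simp add: M_def)
  obtain r where r: "r \<ge> 0" "exp r > K * (L * \<Psi> M)" using exp_unbounded by blast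
  obtain h where h: "h \<in> S" "N1 h \<le> K * exp r" "exp r \<le> K * N1 h" "exp (r + r) \<le> K * N2 h"
    using am[of r r] r(1) by blast
  obtain k \<rho> where k: "sim R h k" "\<rho> \<ge> 0" "c * \<rho> * N2 k \<le> (N1 k)\<^sup>2" "N1 k \<le> \<Psi> \<rho>" using S[OF h(1)] by blast
  note s = L(2)[OF k(1)]
  have "(N1 k)\<^sup>2 \<le> (L * (K * exp r))\<^sup>2"
    using s mult_left_mono[OF h(2), of L] L(1) by (intro power_mono N1_nonneg) linarith
  also have "\<dots> = L\<^sup>2 * K\<^sup>2 * exp (r + r)" by (simp only: power_mult_distrib exp_add power2_eq_square mult_ac)
  also have "\<dots> \<le> L\<^sup>2 * K\<^sup>2 * (K * (L * N2 k))"
  proof -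
    have "K * N2 h \<le> K * (L * N2 k)" using s K by (intro mult_left_mono) auto
    then have "exp (r + r) \<le> K * (L * N2 k)" using h(4) by linarith
    then show ?thesis by (intro mult_left_mono) auto
  qed
  finally have le: "c * \<rho> * N2 k \<le> (L\<^sup>2 * K\<^sup>2 * K * L) * N2 k" using k(3) by (simp add: mult_ac)
  have "N2 k > 0"
  proof -
    have "0 < K * N2 h" using h(4) by (meson exp_gt_zero less_le_trans)
    then have "N2 h > 0" using K by (simp add: zero_less_mult_iff)
    then have "0 < L * N2 k" using s by linarith
    then show ?thesis using L(1) by (simp add: zero_less_mult_iff)
  qed
  then have "c * \<rho> \<le> L\<^sup>2 * K\<^sup>2 * K * L" using le by (simp add: mult_le_cancel_right)
  then have "\<rho> \<le> M" using c by (simp add: M_def field_simps)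
  then have "N1 k \<le> \<Psi> M" using \<Psi>[OF k(2)] k(4) by fastforce
  then have "N1 h \<le> L * \<Psi> M" using s L(1) mult_left_mono[of "N1 k" "\<Psi> M" L] by linarith
  then have "exp r \<le> K * (L * \<Psi> M)" using h(3) K mult_left_mono[of "N1 h" "L * \<Psi> M" K] by linarith
  then show False using r by linarith
qed

text \<open>Along a = diag(exp r, 1, ...) the ratio of N2 to N1 is bounded.\<close>

lemma not_ample_ratio2:
  assumes c: "c > 0" and \<Psi>: "\<And>x y. 0 \<le> x \<Longrightarrow> x \<le> y \<Longrightarrow> \<Psi> x \<le> (\<Psi> y :: real)"
    and S: "\<And>h. h \<in> S \<Longrightarrow> \<exists>k. sim R h k \<and> (\<exists>\<rho>\<ge>0. c * \<rho> * N1 k \<le> N2 k \<and> N1 k \<le> \<Psi> \<rho>)"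
  shows "\<not> ample S"
proof
  assume "ample S"
  then obtain K where K: "K \<ge> 1" and am: "\<And>r s. s \<le> r \<Longrightarrow> 0 \<le> s \<Longrightarrow> \<exists>h\<in>S. N1 h \<le> K * exp r \<and> exp r \<le> K * N1 h \<and>
    N2 h \<le> K * exp (r + s) \<and> exp (r + s) \<le> K * N2 h"
    using ample_necessary by metis
  obtain L where L: "L \<ge> 1" "\<And>h k. sim R h k \<Longrightarrow> N1 h \<le> L * N1 k \<and> N1 k \<le> L * N1 h \<and> N2 h \<le> L * N2 k \<and> N2 k \<le> L * N2 h"
    using sim_bounds[of R] by blast
  \<comment> \<open>On the wall s = 0 it is \<open>N2\<close> that is at most a constant times
    \<open>N1\<close>, with the same consequence for \<rho>.\<close>
  define M where "M = L * K * K * L / c"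
  have M0: "M \<ge> 0" using K L c by (simp add: M_def)
  obtain r where r: "r \<ge> 0" "exp r > K * (L * \<Psi> M)" using exp_unbounded by blast
  obtain h where h: "h \<in> S" "exp r \<le> K * N1 h" "N2 h \<le> K * exp (r + 0)"
    using am[of 0 r] r(1) by blast
  obtain k \<rho> where k: "sim R h k" "\<rho> \<ge> 0" "c * \<rho> * N1 k \<le> N2 k" "N1 k \<le> \<Psi> \<rho>" using S[OF h(1)] by blast
  note s = L(2)[OF k(1)]
  have "N2 h \<le> K * exp r" using h(3) by simp
  then have "N2 k \<le> L * (K * exp r)"
    using s mult_left_mono[of "N2 h" "K * exp r" L] L(1) by linarith
  also have "\<dots> \<le> L * (K * (K * (L * N1 k)))"
  proof -
    have "K * N1 h \<le> K * (L * N1 k)" using s K by (intro mult_left_mono) auto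
    then have "exp r \<le> K * (L * N1 k)" using h(2) by linarith
    then show ?thesis using K L(1) by (intro mult_left_mono) auto
  qed
  finally have le: "c * \<rho> * N1 k \<le> (L * K * K * L) * N1 k" using k(3) by (simp add: mult_ac)
  have "N1 k > 0"
  proof -
    have "0 < K * N1 h" using h(2) by (meson exp_gt_zero less_le_trans)
    then have "N1 h > 0" using K by (simp add: zero_less_mult_iff)
    then have "0 < L * N1 k" using s by linarith
    then show ?thesis using L(1) by (simp add: zero_less_mult_iff)
  qed
  then have "c * \<rho> \<le> L * K * K * L" using le by (simp add: mult_le_cancel_right)
  then have "\<rho> \<le> M" using c by (simp add: M_def field_simps)
  then have "N1 k \<le> \<Psi> M" using \<Psi>[OF k(2)] k(4) by fastforce
  then have "N1 h \<le> L * \<Psi> M" using s L(1) mult_left_mono[of "N1 k" "\<Psi> M" L] by linarith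
  then have "exp r \<le> K * (L * \<Psi> M)" using h(2) K mult_left_mono[of "N1 h" "L * \<Psi> M" K] by linarith
  then show False using r by linarith
qed

lemma Mid_nth [simp]: "x \<in> Mid \<Longrightarrow> x $ p = 0" "x \<in> Mid \<Longrightarrow> x $ q = 0" "x \<in> Mid \<Longrightarrow> x $ \<tau> p = 0" "x \<in> Mid \<Longrightarrow> x $ \<tau> q = 0"
  by (simp_all add: Mid_def)

lemma axis_nth [simp]: "e i $ j = (if j = i then 1 else 0)"
  by (simp add: axis_def)

text \<open>The only entry of quadratic size stands in row \<open>p\<close> and column
  \<open>\<tau> p\<close>, and entries outside this row and this column are at most 1. Hence minors
  grow like \<open>norm x\<close>^2, not like its square.\<close>

lemma N2_eich_short:
  assumes x: "x \<in> Mid"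
  shows "N2 (eich (e p) x) \<le> (real CARD('m))^4 * (2 * (1 + (norm x)\<^sup>2))"
proof (rule N2_le_products)
  let ?g = "eich (e p) x" and ?M = "max 1 (norm x)"
  have ent: "?g $ i $ j = (if i = j then 1 else 0) + (if i = p then x $ j else 0) - (if j = \<tau> p then x $ i else 0)
      - (if i = p \<and> j = \<tau> p then (norm x)\<^sup>2 / 2 else 0)" for i j
  proof -
    have "x $ \<tau> j = x $ j" using J_Mid[OF x] by (metis J_nth)
    then have 1: "B (e j) x = x $ j" using B_axis(2)[of j x] by simp
    have 2: "B (e j) (e p) = (if j = \<tau> p then 1 else 0)" by (metis B_e_e \<tau>_\<tau>)
    have 3: "B x x = (norm x)\<^sup>2" using x by (simp add: B_Mid power2_norm_eq_inner)
    show ?thesis unfolding entry_eq eich_apply 1 2 3 by simp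
  qed
  have xj: "\<bar>x $ j\<bar> \<le> norm x" for j using component_le_norm_cart by auto
  have z: "x $ p = 0" "x $ \<tau> p = 0" using x by simp_all
  have e1: "\<bar>?g $ i $ j\<bar> \<le> ?M" if "\<not> (i = p \<and> j = \<tau> p)" for i j
    using that xj[of i] xj[of j] z by (auto simp: ent le_max_iff_disj)
  have e2: "\<bar>?g $ i $ j\<bar> \<le> 1" if "i \<noteq> p" "j \<noteq> \<tau> p" for i j
    using that by (auto simp: ent)
  have e3: "\<bar>?g $ i $ j\<bar> \<le> ?M\<^sup>2" for i j
  proof (cases "i = p \<and> j = \<tau> p")
    case True
    have "(norm x)\<^sup>2 \<le> ?M\<^sup>2" by (intro power_mono) auto
    then have "(norm x)\<^sup>2 / 2 \<le> ?M\<^sup>2" using zero_le_power2[of "norm x"] by linarith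
    then show ?thesis using True z by (auto simp: ent)
  next
    case False
    have "?M * 1 \<le> ?M * ?M" by (intro mult_left_mono) auto
    then show ?thesis using e1[OF False] unfolding power2_eq_square by linarith
  qed
  have M: "?M\<^sup>2 \<le> 1 + (norm x)\<^sup>2" by (auto simp: max_def power2_eq_square)
  fix i k j l :: 'm assume ne: "i \<noteq> k" "j \<noteq> l"
  have "\<bar>?g $ i $ j\<bar> * \<bar>?g $ k $ l\<bar> \<le> ?M\<^sup>2"
  proof (cases "i = p \<and> j = \<tau> p")
    case True
    then have "\<bar>?g $ i $ j\<bar> * \<bar>?g $ k $ l\<bar> \<le> ?M\<^sup>2 * 1" using ne e2[of k l] e3[of i j] by (intro mult_mono) auto
    then show ?thesis by simp
  next
    case F1: False
    show ?thesis
    proof (cases "k = p \<and> l = \<tau> p")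
      case True
      then have "\<bar>?g $ i $ j\<bar> * \<bar>?g $ k $ l\<bar> \<le> 1 * ?M\<^sup>2" using ne e2[of i j] e3[of k l] by (intro mult_mono) auto
      then show ?thesis by simp
    next
      case False
      then have "\<bar>?g $ i $ j\<bar> * \<bar>?g $ k $ l\<bar> \<le> ?M * ?M" using F1 e1[of i j] e1[of k l] by (intro mult_mono) auto
      then show ?thesis by (simp add: power2_eq_square)
    qed
  qed
  then show "\<bar>?g $ i $ j * ?g $ k $ l\<bar> \<le> 1 + (norm x)\<^sup>2" using M by (simp add: abs_mult)
qed simp

text \<open>Outside its row and column, the entry exp s times t meets only diagonal entries at most
  1 and the entry exp (- s) times t. Every product thus leaves room below exp (2 s) to absorb the
  linear growth of t, and the bound is free of t.\<close>

lemma N2_torus_root: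
  assumes s: "s \<ge> 0" and t: "\<bar>t\<bar> \<le> f * s" "f \<ge> 0"
  shows "N2 (a2 p q s s ** eich (e p) (t *\<^sub>R e (\<tau> q))) \<le> (real CARD('m))^4 * (2 * (2 * (1 + f)\<^sup>2 * exp (s + s)))"
proof (rule N2_le_products)
  let ?g = "a2 p q s s ** eich (e p) (t *\<^sub>R e (\<tau> q))"
  have ent: "?g $ i $ j = (if i = j then dg s s i else if i = p \<and> j = q then exp s * t
      else if i = \<tau> q \<and> j = \<tau> p then - exp (- s) * t else 0)" for i j
  proof -
    have "?g $ i $ j = dg s s i * (eich (e p) (t *\<^sub>R e (\<tau> q)) $ i $ j)"
      by (simp add: matrix_matrix_mult_def a2_entry if_distrib[of "\<lambda>c. c * _"] cong: if_cong)
    also have "eich (e p) (t *\<^sub>R e (\<tau> q)) $ i $ j = (if i = j then 1 else 0) + (if i = p \<and> j = q then t else 0)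
        - (if i = \<tau> q \<and> j = \<tau> p then t else 0)"
    proof -
      have 1: "B (e j) (e (\<tau> q)) = (if j = q then 1 else 0)" "B (e j) (e p) = (if j = \<tau> p then 1 else 0)"
        by (metis B_e_e \<tau>_\<tau>)+
      show ?thesis unfolding entry_eq eich_apply by (simp add: B_bil 1)
    qed
    finally show ?thesis by (auto simp: dg_def)
  qed
  have e1: "exp s \<ge> 1" "s \<le> exp s" using exp_ge_add_one_self[of s] s by linarith+
  have t1: "\<bar>t\<bar> \<le> f * exp s" using t e1 mult_left_mono[of s "exp s" f] by linarith
  have e2: "exp s \<le> exp (s + s)" using s by simp
  have f1: "1 \<le> 2 * (1 + f)\<^sup>2" "f \<le> 2 * (1 + f)\<^sup>2" "f\<^sup>2 \<le> 2 * (1 + f)\<^sup>2"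
    using t(2) by (auto simp: power2_eq_square algebra_simps intro: add_nonneg_nonneg)
  let ?C = "2 * (1 + f)\<^sup>2 * exp (s + s)"
  have C1: "exp (s + s) \<le> ?C" using f1(1) mult_right_mono[of 1 "2 * (1 + f)\<^sup>2" "exp (s + s)"] by simp
  have C2: "exp s * \<bar>t\<bar> \<le> ?C"
  proof -
    have "exp s * \<bar>t\<bar> \<le> exp s * (f * exp s)" using t1 by (intro mult_left_mono) auto
    also have "\<dots> = f * exp (s + s)" by (simp only: exp_add mult_ac)
    also have "\<dots> \<le> ?C" using f1(2) by (intro mult_right_mono) auto
    finally show ?thesis .
  qed
  have C3: "\<bar>t\<bar> \<le> ?C" using C2 e1(1) mult_right_mono[of 1 "exp s" "\<bar>t\<bar>"] by simp
  have C4: "exp s * \<bar>t\<bar> * (exp (- s) * \<bar>t\<bar>) \<le> ?C"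
  proof -
    have "exp s * \<bar>t\<bar> * (exp (- s) * \<bar>t\<bar>) = (exp s * exp (- s)) * (\<bar>t\<bar> * \<bar>t\<bar>)" by (simp only: mult_ac)
    also have "\<dots> = \<bar>t\<bar> * \<bar>t\<bar>" by (simp flip: exp_add)
    also have "\<dots> \<le> (f * exp s) * (f * exp s)" using t1 by (intro mult_mono) auto
    also have "\<dots> = f\<^sup>2 * exp (s + s)" by (simp only: power2_eq_square exp_add mult_ac)
    also have "\<dots> \<le> ?C" using f1(3) by (intro mult_right_mono) auto
    finally show ?thesis .
  qed
  have abs_dg: "\<bar>dg s s i\<bar> = dg s s i" for i by (simp add: dg_pos abs_of_pos)
  have d1: "dg s s i \<le> 1" if "i \<noteq> p" "i \<noteq> q" for i using that s by (auto simp: dg_def)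
  have C5: "dg s s i * (exp s * \<bar>t\<bar>) \<le> ?C" if "i \<noteq> p" "i \<noteq> q" for i
  proof -
    have "dg s s i * (exp s * \<bar>t\<bar>) \<le> 1 * (exp s * \<bar>t\<bar>)" using d1[OF that] by (intro mult_right_mono) auto
    then show ?thesis using C2 by linarith
  qed
  have C6: "dg s s i * (exp (- s) * \<bar>t\<bar>) \<le> ?C" for i
  proof -
    have "dg s s i * (exp (- s) * \<bar>t\<bar>) \<le> exp s * (exp (- s) * \<bar>t\<bar>)" using dg_le[of s s i] s by (intro mult_right_mono) auto
    also have "\<dots> = \<bar>t\<bar>" by (simp flip: exp_add mult.assoc)
    finally show ?thesis using C3 by linarith
  qed
  fix i k j l :: 'm assume ne: "i \<noteq> k" "j \<noteq> l"
  have dd: "dg s s i * dg s s k \<le> ?C" using ne s by (intro order_trans[OF dg_le2 C1]) auto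
  show "\<bar>?g $ i $ j * ?g $ k $ l\<bar> \<le> ?C"
    using ne dd C4 C5[of i] C5[of k] C6[of i] C6[of k]
    by (auto simp: ent abs_mult abs_dg mult.commute mult.left_commute)
qed simp

end

section \<open>Four model families\<close>

context frame begin

lemma N1_lower3: "\<bar>k $ i1 $ j1\<bar> \<ge> x \<Longrightarrow> \<bar>k $ i2 $ j2\<bar> \<ge> y \<Longrightarrow> \<bar>k $ i3 $ j3\<bar> \<ge> z \<Longrightarrow> x + y + z \<le> 3 * N1 k"
  using N1_entry[of k i1 j1] N1_entry[of k i2 j2] N1_entry[of k i3 j3] by linarith

lemma N2_lower3: "\<bar>minor k i1 i1' j1 j1'\<bar> \<ge> x \<Longrightarrow> \<bar>minor k i2 i2' j2 j2'\<bar> \<ge> y \<Longrightarrow> \<bar>minor k i3 i3' j3 j3'\<bar> \<ge> z \<Longrightarrow> x + y + z \<le> 3 * N2 k"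
  using N2_minor[of k i1 i1' j1 j1'] N2_minor[of k i2 i2' j2 j2'] N2_minor[of k i3 i3' j3 j3'] by linarith

text \<open>Each is the product of a torus element, the exponential of s times a vector in the root
  space that this torus centralizes, and a nilpotent part. In \<open>M1\<close> and
  \<open>M2\<close> the torus is the kernel of a long root, in \<open>M3\<close> and
  \<open>M4\<close> of a short one; the nilpotent part is short in \<open>M1\<close> and
  \<open>M3\<close>, long in \<open>M2\<close> and \<open>M4\<close>. Other cases arise from these
  by changing \<open>p\<close> and \<open>q\<close>.\<close>

definition M1 where "M1 \<phi> s x = a2 p q s s ** eich (e p) ((s * \<phi>) *\<^sub>R e (\<tau> q)) ** eich (e p) x"
definition M2 where "M2 \<phi> s \<eta> = a2 p q s s ** eich (e p) ((s * \<phi>) *\<^sub>R e (\<tau> q)) ** eich (e p) (\<eta> *\<^sub>R e q)"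
definition M3 where "M3 y s x = a2 p q s 0 ** eich (e q) (s *\<^sub>R y) ** eich (e p) x"
definition M4 where "M4 y s \<eta> = a2 p q s 0 ** eich (e q) (s *\<^sub>R y) ** eich (e p) (\<eta> *\<^sub>R e q)"

lemma M1_lower:
  assumes "x \<in> Mid" "s \<ge> 0"
  shows "exp s * (1 + s * \<bar>\<phi>\<bar> + (norm x)\<^sup>2 / 2) \<le> 3 * N1 (M1 \<phi> s x)"
proof -
  have Bx: "B x x = (norm x)\<^sup>2" using assms by (simp add: B_Mid power2_norm_eq_inner)
  have "M1 \<phi> s x $ p $ p = exp s" "M1 \<phi> s x $ p $ q = exp s * (s * \<phi>)" "M1 \<phi> s x $ p $ \<tau> p = - exp s * ((norm x)\<^sup>2 / 2)"
    using assms Bx unfolding entry_eq M1_def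
    by (simp_all add: a2_apply eich_apply B_bil algebra_simps flip: matrix_vector_mul_assoc)
  then have "exp s + exp s * (s * \<bar>\<phi>\<bar>) + exp s * ((norm x)\<^sup>2 / 2) \<le> 3 * N1 (M1 \<phi> s x)"
    using assms by (intro N1_lower3[of _ _ p p _ p q _ p "\<tau> p"]) (simp_all add: abs_mult)
  then show ?thesis by (simp add: algebra_simps)
qed

lemma M2_lower:
  "exp (s + s) * (1 + \<eta>\<^sup>2) \<le> 3 * N2 (M2 \<phi> s \<eta>)"
proof -
  have "M2 \<phi> s \<eta> $ p $ p = exp s" "M2 \<phi> s \<eta> $ q $ q = exp s" "M2 \<phi> s \<eta> $ q $ p = 0"
    "M2 \<phi> s \<eta> $ p $ \<tau> q = exp s * \<eta>" "M2 \<phi> s \<eta> $ q $ \<tau> p = - exp s * \<eta>" "M2 \<phi> s \<eta> $ q $ \<tau> q = 0"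
    unfolding entry_eq M2_def
    by (simp_all add: a2_apply eich_apply B_bil algebra_simps flip: matrix_vector_mul_assoc)
  then have "exp (s + s) + exp (s + s) * \<eta>\<^sup>2 + 0 \<le> 3 * N2 (M2 \<phi> s \<eta>)"
    unfolding exp_add[of s s]
    by (intro N2_lower3[of _ _ p q p q _ p q "\<tau> q" "\<tau> p"]) (simp_all add: minor_def power2_eq_square abs_mult mult_ac)
  then show ?thesis by (simp add: algebra_simps)
qed

lemma M3_lower:
  assumes "x \<in> Mid" "y \<in> Mid" "s \<ge> 0"
  shows "exp s * (1 + (norm x)\<^sup>2) \<le> 6 * N1 (M3 y s x)"
proof -
  have Bx: "B x x = (norm x)\<^sup>2" using assms by (simp add: B_Mid power2_norm_eq_inner)
  have "M3 y s x $ p $ p = exp s" "M3 y s x $ p $ \<tau> p = - exp s * ((norm x)\<^sup>2 / 2)"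
    using assms Bx unfolding entry_eq M3_def
    by (simp_all add: a2_apply eich_apply B_bil algebra_simps flip: matrix_vector_mul_assoc)
  then have "exp s + exp s * ((norm x)\<^sup>2 / 2) + 0 \<le> 3 * N1 (M3 y s x)"
    using assms by (intro N1_lower3[of _ _ p p _ p "\<tau> p"]) (simp_all add: abs_mult)
  moreover have "0 \<le> exp s" by simp
  moreover have "exp s * (1 + (norm x)\<^sup>2) = exp s + 2 * (exp s * ((norm x)\<^sup>2 / 2))" by (simp add: algebra_simps)
  ultimately show ?thesis by linarith
qed

lemma M4_lower:
  assumes "y \<in> Mid" "s \<ge> 0"
  shows "exp s * (1 + \<eta>\<^sup>2 + s\<^sup>2 * (norm y)\<^sup>2 / 2) \<le> 3 * N2 (M4 y s \<eta>)"
proof -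
  have By: "B y y = (norm y)\<^sup>2" using assms by (simp add: B_Mid power2_norm_eq_inner)
  have "M4 y s \<eta> $ p $ p = exp s" "M4 y s \<eta> $ q $ q = 1" "M4 y s \<eta> $ q $ p = 0" "M4 y s \<eta> $ p $ \<tau> p = 0"
    "M4 y s \<eta> $ p $ \<tau> q = exp s * \<eta>" "M4 y s \<eta> $ q $ \<tau> p = - \<eta>" "M4 y s \<eta> $ q $ \<tau> q = - (s\<^sup>2 * (norm y)\<^sup>2 / 2)"
    using assms By unfolding entry_eq M4_def
    by (simp_all add: a2_apply eich_apply B_bil algebra_simps power2_eq_square flip: matrix_vector_mul_assoc)
  then have "exp s + exp s * \<eta>\<^sup>2 + exp s * (s\<^sup>2 * (norm y)\<^sup>2 / 2) \<le> 3 * N2 (M4 y s \<eta>)"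
    by (intro N2_lower3[of _ _ p q p q _ p q "\<tau> q" "\<tau> p" _ p q p "\<tau> q"]) (auto simp: minor_def exp_add power2_eq_square abs_mult)
  then show ?thesis by (simp add: algebra_simps)
qed

lemma square_le_exp: "0 \<le> s \<Longrightarrow> s\<^sup>2 \<le> 8 * exp (s / 2)" for s :: real
  using exp_lower_Taylor_quadratic[of "s / 2"] by (simp add: power2_eq_square)

lemma one_plus_square: "(1 + a)\<^sup>2 \<le> 2 * (1 + a\<^sup>2)" for a :: real
  using zero_le_power2[of "1 - a"] by (simp add: power2_eq_square algebra_simps)

text \<open>With \<rho> = 1 + s + \<open>norm x\<close>^2, \<open>N1\<close> is at least of order
  exp s \<rho> and \<open>N2\<close> at most of order exp (2 s) \<rho>, so \<open>N1\<close>^2 /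
  \<open>N2\<close> is at least of order \<rho>. The linear growth of the long root vector keeps the
  family off the wall r = s.\<close>

lemma not_ample_M1:
  assumes \<phi>: "\<phi> \<noteq> 0" and S: "\<And>h. h \<in> S \<Longrightarrow> \<exists>s\<ge>0. \<exists>x\<in>Mid. sim R h (M1 \<phi> s x)"
  shows "\<not> ample S"
proof -
  define f where "f = \<bar>\<phi>\<bar>"
  define m0 where "m0 = min (1/2) f"
  have f: "f > 0" and m0: "m0 > 0" "m0 \<le> 1/2" "m0 \<le> f" using \<phi> by (auto simp: f_def m0_def)
  let ?m = "(real CARD('m))^4"
  define C where "C = ?m * (2 * (2 * (1 + f)\<^sup>2)) * (?m * 2)"
  have C: "C > 0" unfolding C_def using f by (intro mult_pos_pos) auto
  define c where "c = (m0 / 3)\<^sup>2 / C"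
  have c: "c > 0" using C m0 by (simp add: c_def)
  \<comment> \<open>Any increasing majorant of \<open>N1\<close> in terms of \<rho> will do; all
    that counts is that bounded \<rho> means bounded \<open>N1\<close>.\<close>
  define \<Psi> where "\<Psi> \<rho> = (K_bound * exp \<rho>) * (K_bound * (1 + f * \<rho>)\<^sup>2) * (K_bound * (2 * \<rho>))" for \<rho>
  have main: "c * (1 + s + (norm x)\<^sup>2) * N2 (M1 \<phi> s x) \<le> (N1 (M1 \<phi> s x))\<^sup>2 \<and> N1 (M1 \<phi> s x) \<le> \<Psi> (1 + s + (norm x)\<^sup>2)"
    if s: "s \<ge> 0" and x: "x \<in> Mid" for s x
  proof
    let ?\<rho> = "1 + s + (norm x)\<^sup>2" and ?k = "M1 \<phi> s x"
    have \<rho>1: "?\<rho> \<ge> 1" using s by simp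
    have t: "\<bar>s * \<phi>\<bar> \<le> f * s" using s by (simp add: f_def abs_mult)
    have lo: "exp s * (m0 * ?\<rho>) \<le> 3 * N1 ?k"
    proof -
      have "m0 * 1 \<le> 1" "m0 * s \<le> s * f" "m0 * (norm x)\<^sup>2 \<le> (norm x)\<^sup>2 / 2"
        using m0 mult_right_mono[OF m0(3) s] mult_right_mono[OF m0(2), of "(norm x)\<^sup>2"] by (auto simp: mult.commute)
      then have "m0 * ?\<rho> \<le> 1 + s * f + (norm x)\<^sup>2 / 2" by (simp add: distrib_left)
      then have "exp s * (m0 * ?\<rho>) \<le> exp s * (1 + s * \<bar>\<phi>\<bar> + (norm x)\<^sup>2 / 2)" by (simp add: f_def)
      then show ?thesis using M1_lower[OF x s, of \<phi>] by linarith
    qed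
    have up: "N2 ?k \<le> C * exp (s + s) * ?\<rho>"
    proof -
      have "N2 ?k \<le> N2 (a2 p q s s ** eich (e p) ((s * \<phi>) *\<^sub>R e (\<tau> q))) * N2 (eich (e p) x)"
        unfolding M1_def by (rule N2_mult)
      also have "\<dots> \<le> (?m * (2 * (2 * (1 + f)\<^sup>2 * exp (s + s)))) * (?m * (2 * (1 + (norm x)\<^sup>2)))"
        using N2_torus_root[OF s t] f N2_eich_short[OF x] by (intro mult_mono) auto
      also have "\<dots> = C * exp (s + s) * (1 + (norm x)\<^sup>2)" by (simp only: C_def mult_ac)
      also have "\<dots> \<le> C * exp (s + s) * ?\<rho>" using C s by (intro mult_left_mono) auto
      finally show ?thesis .
    qed
    have "c * ?\<rho> * N2 ?k \<le> c * ?\<rho> * (C * exp (s + s) * ?\<rho>)" using c \<rho>1 up by (intro mult_left_mono) auto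
    also have "\<dots> = (c * C) * exp (s + s) * ?\<rho>\<^sup>2" by (simp only: power2_eq_square mult_ac)
    also have "c * C = (m0 / 3)\<^sup>2" using C by (simp add: c_def)
    also have "(m0 / 3)\<^sup>2 * exp (s + s) * ?\<rho>\<^sup>2 = (exp s * (m0 * ?\<rho>) / 3)\<^sup>2"
      by (simp only: exp_add power_divide power_mult_distrib power2_eq_square) simp
    also have "\<dots> \<le> (N1 ?k)\<^sup>2" using lo m0 \<rho>1 by (intro power_mono) auto
    finally show "c * ?\<rho> * N2 ?k \<le> (N1 ?k)\<^sup>2" .
    have "N1 ?k \<le> N1 (a2 p q s s) * N1 (eich (e p) ((s * \<phi>) *\<^sub>R e (\<tau> q))) * N1 (eich (e p) x)"
      unfolding M1_def by (rule order_trans[OF N1_mult]) (intro mult_right_mono N1_mult N1_nonneg)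
    also have "\<dots> \<le> (K_bound * exp ?\<rho>) * (K_bound * (1 + f * ?\<rho>)\<^sup>2) * (K_bound * (2 * ?\<rho>))"
    proof (intro mult_mono)
      have "exp s \<le> exp ?\<rho>" by simp
      then show "N1 (a2 p q s s) \<le> K_bound * exp ?\<rho>"
        using N1_a2[of s s] s K_bound_ge mult_left_mono[of "exp s" "exp ?\<rho>" K_bound] by linarith
      have "f * s \<le> f * ?\<rho>" using f by (intro mult_left_mono) auto
      moreover have "norm ((s * \<phi>) *\<^sub>R e (\<tau> q)) = \<bar>s * \<phi>\<bar>" by simp
      ultimately have "norm ((s * \<phi>) *\<^sub>R e (\<tau> q)) \<le> f * ?\<rho>" using t by linarith
      then have "(1 + norm ((s * \<phi>) *\<^sub>R e (\<tau> q)))\<^sup>2 \<le> (1 + f * ?\<rho>)\<^sup>2" by (intro power_mono) (auto simp del: norm_scaleR)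
      then show "N1 (eich (e p) ((s * \<phi>) *\<^sub>R e (\<tau> q))) \<le> K_bound * (1 + f * ?\<rho>)\<^sup>2"
        using N1_eich[of p "(s * \<phi>) *\<^sub>R e (\<tau> q)"] K_bound_ge
          mult_left_mono[of "(1 + norm ((s * \<phi>) *\<^sub>R e (\<tau> q)))\<^sup>2" "(1 + f * ?\<rho>)\<^sup>2" K_bound] by linarith
      have "(1 + norm x)\<^sup>2 \<le> 2 * ?\<rho>" by (rule order_trans[OF one_plus_square]) (use s in simp)
      then show "N1 (eich (e p) x) \<le> K_bound * (2 * ?\<rho>)"
        using N1_eich[of p x] K_bound_ge mult_left_mono[of "(1 + norm x)\<^sup>2" "2 * ?\<rho>" K_bound] by linarith
    qed (use K_bound_ge \<rho>1 in auto)
    finally show "N1 ?k \<le> \<Psi> ?\<rho>" by (simp add: \<Psi>_def)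
  qed
  show ?thesis
  proof (rule not_ample_ratio1[OF c, where \<Psi> = \<Psi> and R = R])
    show "\<Psi> x \<le> \<Psi> y" if "0 \<le> x" "x \<le> y" for x y
      unfolding \<Psi>_def using that K_bound_ge f by (intro mult_mono power_mono add_mono) auto
    fix h assume "h \<in> S"
    then obtain s x where "s \<ge> 0" "x \<in> Mid" "sim R h (M1 \<phi> s x)" using S by blast
    then show "\<exists>k. sim R h k \<and> (\<exists>\<rho>\<ge>0. c * \<rho> * N2 k \<le> (N1 k)\<^sup>2 \<and> N1 k \<le> \<Psi> \<rho>)"
      using main by (intro exI[of _ "M1 \<phi> s x"] conjI exI[of _ "1 + s + (norm x)\<^sup>2"]) auto
  qed
qed

text \<open>\<open>N2\<close> is at least of order exp (2 s) (1 + \<eta>^2). Spending half an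
  exponential on the linear factor s, \<open>N1\<close> is at most of order exp (3 s / 2) (1 +
  |\<eta>|). The quotient is at least of order exp (s / 2) (1 + |\<eta>|), and the wall s = 0 is
  missed.\<close>

lemma not_ample_M2:
  assumes S: "\<And>h. h \<in> S \<Longrightarrow> \<exists>s\<ge>0. \<exists>\<eta>. sim R h (M2 \<phi> s \<eta>)"
  shows "\<not> ample S"
proof -
  define f where "f = \<bar>\<phi>\<bar>"
  have f: "f \<ge> 0" by (simp add: f_def)
  define C where "C = K_bound * (K_bound * (1 + 4 * f)) * (K_bound * 2)"
  have C: "C > 0" unfolding C_def using f K_bound_ge by (intro mult_pos_pos) auto
  define c where "c = 1 / (6 * C)"
  have c: "c > 0" using C by (simp add: c_def)
  have main: "c * (exp (s / 2) * (1 + \<bar>\<eta>\<bar>)) * N1 (M2 \<phi> s \<eta>) \<le> N2 (M2 \<phi> s \<eta>) \<and>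
      N1 (M2 \<phi> s \<eta>) \<le> C * (exp (s / 2) * (1 + \<bar>\<eta>\<bar>))^4"
    if s: "s \<ge> 0" for s \<eta>
  proof
    let ?E = "exp (s / 2)" and ?k = "M2 \<phi> s \<eta>" and ?n = "1 + \<bar>\<eta>\<bar>"
    have Es: "exp s = ?E * ?E" by (simp flip: exp_add)
    have E1: "?E \<ge> 1" using s by simp
    have up: "N1 ?k \<le> C * (?E * ?E * ?E * ?n)"
    proof -
      have "N1 ?k \<le> N1 (a2 p q s s) * N1 (eich (e p) ((s * \<phi>) *\<^sub>R e (\<tau> q))) * N1 (eich (e p) (\<eta> *\<^sub>R e q))"
        unfolding M2_def by (rule order_trans[OF N1_mult]) (intro mult_right_mono N1_mult N1_nonneg)
      also have "\<dots> \<le> (K_bound * (?E * ?E)) * (K_bound * ((1 + 4 * f) * ?E)) * (K_bound * (2 * ?n))"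
      proof (intro mult_mono)
        show "N1 (a2 p q s s) \<le> K_bound * (?E * ?E)" using N1_a2[of s s] s Es by simp
        have "s / 2 \<le> ?E" using exp_ge_add_one_self[of "s / 2"] by linarith
        then have "4 * f * (s / 2) \<le> 4 * f * ?E" using f by (intro mult_left_mono) auto
        then have "1 + 2 * norm ((s * \<phi>) *\<^sub>R e (\<tau> q)) \<le> (1 + 4 * f) * ?E"
          using E1 s by (simp add: f_def abs_mult distrib_right del: one_le_exp_iff)
        then show "N1 (eich (e p) ((s * \<phi>) *\<^sub>R e (\<tau> q))) \<le> K_bound * ((1 + 4 * f) * ?E)"
          by (intro order_trans[OF N1_eich_long mult_left_mono]) (use K_bound_ge in \<open>simp_all add: B_bil\<close>)
        have "1 + 2 * norm (\<eta> *\<^sub>R e q) \<le> 2 * ?n" by simp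
        then show "N1 (eich (e p) (\<eta> *\<^sub>R e q)) \<le> K_bound * (2 * ?n)"
          by (intro order_trans[OF N1_eich_long mult_left_mono]) (use K_bound_ge in \<open>simp_all add: B_bil\<close>)
      qed (use K_bound_ge f in auto)
      also have "\<dots> = C * (?E * ?E * ?E * ?n)" by (simp only: C_def mult_ac)
      finally show ?thesis .
    qed
    have n2: "?n * ?n \<le> 2 * (1 + \<eta>\<^sup>2)" using one_plus_square[of "\<bar>\<eta>\<bar>"] by (simp add: power2_eq_square)
    have "c * (?E * ?n) * N1 ?k \<le> c * (?E * ?n) * (C * (?E * ?E * ?E * ?n))"
      using c up by (intro mult_left_mono) auto
    also have "\<dots> = (c * C) * (exp s * exp s) * (?n * ?n)" by (simp only: Es mult_ac)
    also have "\<dots> = (1 / 6) * (exp (s + s) * (?n * ?n))" using C by (simp only: exp_add) (simp add: c_def)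
    also have "\<dots> \<le> (1 / 6) * (exp (s + s) * (2 * (1 + \<eta>\<^sup>2)))" using n2 by (intro mult_left_mono) auto
    also have "\<dots> = (exp (s + s) * (1 + \<eta>\<^sup>2)) / 3" by simp
    also have "\<dots> \<le> N2 ?k" using M2_lower[of s \<eta> \<phi>] by linarith
    finally show "c * (?E * ?n) * N1 ?k \<le> N2 ?k" .
    have "?E * ?E * ?E * ?n \<le> (?E * ?n)^4"
    proof -
      have "?E * ?E * ?E * ?n * 1 \<le> ?E * ?E * ?E * ?n * (?E * (?n * ?n * ?n))"
        using E1 by (intro mult_left_mono) (auto intro!: one_le_mult_iff[THEN iffD2] mult_ge1_I)
      then show ?thesis by (simp add: eval_nat_numeral mult_ac)
    qed
    then show "N1 ?k \<le> C * (?E * ?n)^4" using up C mult_left_mono[of "?E * ?E * ?E * ?n" "(?E * ?n)^4" C] by linarith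
  qed
  show ?thesis
  proof (rule not_ample_ratio2[OF c, where \<Psi> = "\<lambda>\<rho>. C * \<rho>^4" and R = R])
    show "C * x ^ 4 \<le> C * y ^ 4" if "0 \<le> x" "x \<le> y" for x y
      using that C by (intro mult_left_mono power_mono) auto
    fix h assume "h \<in> S"
    then obtain s \<eta> where "s \<ge> 0" "sim R h (M2 \<phi> s \<eta>)" using S by blast
    then show "\<exists>k. sim R h k \<and> (\<exists>\<rho>\<ge>0. c * \<rho> * N1 k \<le> N2 k \<and> N1 k \<le> C * \<rho>^4)"
      using main by (intro exI[of _ "M2 \<phi> s \<eta>"] conjI exI[of _ "exp (s / 2) * (1 + \<bar>\<eta>\<bar>)"]) auto
  qed
qed

end

lemma (in frame) swap_frame: "frame \<tau> q p"
  by unfold_locales simp_all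

context frame begin

text \<open>\<open>N1\<close> is at least of order exp s (1 + \<open>norm x\<close>^2). In
  \<open>N2\<close> the factor s^2 coming from the short root vector is absorbed by exp (s / 2), so
  \<open>N1\<close>^2 / \<open>N2\<close> is still at least of order exp (s / 2) (1 +
  \<open>norm x\<close>^2).\<close>

lemma not_ample_M3:
  assumes y: "y \<in> Mid" and S: "\<And>h. h \<in> S \<Longrightarrow> \<exists>s\<ge>0. \<exists>x\<in>Mid. sim R h (M3 y s x)"
  shows "\<not> ample S"
proof -
  interpret sw: frame \<tau> q p by (rule swap_frame)
  define g where "g = 1 + 8 * (norm y)\<^sup>2"
  have g: "g \<ge> 1" by (simp add: g_def)
  let ?m = "(real CARD('m))^4"
  define C where "C = ?m * 2 * (?m * 2) * (?m * 2) * g"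
  have C: "C > 0" unfolding C_def using g by (intro mult_pos_pos) auto
  define c where "c = 1 / (36 * C)"
  have c: "c > 0" using C by (simp add: c_def)
  define D where "D = K_bound * (K_bound * (2 * g)) * (K_bound * 2)"
  have D: "D > 0" unfolding D_def using g K_bound_ge by (intro mult_pos_pos) auto
  have main: "c * (exp (s / 2) * (1 + (norm x)\<^sup>2)) * N2 (M3 y s x) \<le> (N1 (M3 y s x))\<^sup>2 \<and>
      N1 (M3 y s x) \<le> D * (exp (s / 2) * (1 + (norm x)\<^sup>2))^4"
    if s: "s \<ge> 0" and x: "x \<in> Mid" for s x
  proof
    let ?E = "exp (s / 2)" and ?k = "M3 y s x" and ?n = "1 + (norm x)\<^sup>2"
    have Es: "exp s = ?E * ?E" by (simp flip: exp_add)
    have E1: "?E \<ge> 1" using s by simp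
    have sy: "s *\<^sub>R y \<in> Mid" using y subspace_scale[OF subspace_Mid] by blast
    have ny: "1 + (norm (s *\<^sub>R y))\<^sup>2 \<le> g * ?E"
    proof -
      have "s\<^sup>2 * (norm y)\<^sup>2 \<le> (8 * ?E) * (norm y)\<^sup>2" using square_le_exp[OF s] by (intro mult_right_mono) auto
      moreover have "g * ?E = ?E + (8 * ?E) * (norm y)\<^sup>2" by (simp add: g_def algebra_simps)
      moreover have "(norm (s *\<^sub>R y))\<^sup>2 = s\<^sup>2 * (norm y)\<^sup>2" by (simp add: power_mult_distrib)
      ultimately show ?thesis using E1 by linarith
    qed
    have up2: "N2 ?k \<le> C * (?E * ?E * ?E * ?n)"
    proof -
      have "N2 ?k \<le> N2 (a2 p q s 0) * N2 (eich (e q) (s *\<^sub>R y)) * N2 (eich (e p) x)"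
        unfolding M3_def by (rule order_trans[OF N2_mult]) (intro mult_right_mono N2_mult N2_nonneg)
      also have "\<dots> \<le> (?m * (2 * (?E * ?E))) * (?m * (2 * (g * ?E))) * (?m * (2 * ?n))"
      proof (intro mult_mono)
        show "N2 (a2 p q s 0) \<le> ?m * (2 * (?E * ?E))" using N2_a2[of 0 s] s Es by simp
        have "?m * (2 * (1 + (norm (s *\<^sub>R y))\<^sup>2)) \<le> ?m * (2 * (g * ?E))" using ny by (intro mult_left_mono) auto
        then show "N2 (eich (e q) (s *\<^sub>R y)) \<le> ?m * (2 * (g * ?E))"
          using sw.N2_eich_short[OF sy] by linarith
        show "N2 (eich (e p) x) \<le> ?m * (2 * ?n)" by (rule N2_eich_short[OF x])
      qed (use g in auto)
      also have "\<dots> = C * (?E * ?E * ?E * ?n)" by (simp only: C_def mult_ac)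
      finally show ?thesis .
    qed
    have "c * (?E * ?n) * N2 ?k \<le> c * (?E * ?n) * (C * (?E * ?E * ?E * ?n))"
      using c up2 by (intro mult_left_mono) (auto intro!: add_nonneg_nonneg)
    also have "\<dots> = (c * C) * (exp s * ?n)\<^sup>2" by (simp only: Es power2_eq_square mult_ac)
    also have "\<dots> = (exp s * ?n / 6)\<^sup>2" using C by (simp add: c_def power_divide)
    also have "\<dots> \<le> (N1 ?k)\<^sup>2" using M3_lower[OF x y s] by (intro power_mono) auto
    finally show "c * (?E * ?n) * N2 ?k \<le> (N1 ?k)\<^sup>2" .
    have "N1 ?k \<le> N1 (a2 p q s 0) * N1 (eich (e q) (s *\<^sub>R y)) * N1 (eich (e p) x)"
      unfolding M3_def by (rule order_trans[OF N1_mult]) (intro mult_right_mono N1_mult N1_nonneg)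
    also have "\<dots> \<le> (K_bound * (?E * ?E)) * (K_bound * (2 * (g * ?E))) * (K_bound * (2 * ?n))"
    proof (intro mult_mono)
      show "N1 (a2 p q s 0) \<le> K_bound * (?E * ?E)" using N1_a2[of 0 s] s Es by simp
      have "(1 + norm (s *\<^sub>R y))\<^sup>2 \<le> 2 * (g * ?E)"
        by (rule order_trans[OF one_plus_square mult_left_mono[OF ny]]) simp
      then show "N1 (eich (e q) (s *\<^sub>R y)) \<le> K_bound * (2 * (g * ?E))"
        using N1_eich[of q "s *\<^sub>R y"] K_bound_ge mult_left_mono[of "(1 + norm (s *\<^sub>R y))\<^sup>2" "2 * (g * ?E)" K_bound] by linarith
      show "N1 (eich (e p) x) \<le> K_bound * (2 * ?n)"
        using N1_eich[of p x] K_bound_ge one_plus_square[of "norm x"]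
          mult_left_mono[of "(1 + norm x)\<^sup>2" "2 * ?n" K_bound] by linarith
    qed (use K_bound_ge g in auto)
    also have "\<dots> = D * (?E * ?E * ?E * ?n)" by (simp only: D_def mult_ac)
    also have "\<dots> \<le> D * (?E * ?n)^4"
    proof (intro mult_left_mono)
      have "?E * ?E * ?E * ?n * 1 \<le> ?E * ?E * ?E * ?n * (?E * (?n * ?n * ?n))"
        using E1 by (intro mult_left_mono) (auto intro!: one_le_mult_iff[THEN iffD2] mult_ge1_I)
      then show "?E * ?E * ?E * ?n \<le> (?E * ?n)^4" by (simp add: eval_nat_numeral mult_ac)
    qed (use D in auto)
    finally show "N1 ?k \<le> D * (?E * ?n)^4" .
  qed
  show ?thesis
  proof (rule not_ample_ratio1[OF c, where \<Psi> = "\<lambda>\<rho>. D * \<rho>^4" and R = R])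
    show "D * x ^ 4 \<le> D * y ^ 4" if "0 \<le> x" "x \<le> y" for x y
      using that D by (intro mult_left_mono power_mono) auto
    fix h assume "h \<in> S"
    then obtain s x where "s \<ge> 0" "x \<in> Mid" "sim R h (M3 y s x)" using S by blast
    then show "\<exists>k. sim R h k \<and> (\<exists>\<rho>\<ge>0. c * \<rho> * N2 k \<le> (N1 k)\<^sup>2 \<and> N1 k \<le> D * \<rho>^4)"
      using main by (intro exI[of _ "M3 y s x"] conjI exI[of _ "exp (s / 2) * (1 + (norm x)\<^sup>2)"]) auto
  qed
qed

text \<open>The delicate family: \<open>N2\<close> exceeds \<open>N1\<close> by a polynomial factor
  only, exp s (1 + \<eta>^2 + s^2) against exp s (1 + |\<eta>|) up to constants. Multiplying the
  norms of the torus and short root factors would lose s^2, just what is gained, so these two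
  factors are estimated through a sum.\<close>

lemma not_ample_M4:
  assumes y: "y \<in> Mid" "y \<noteq> 0" and S: "\<And>h. h \<in> S \<Longrightarrow> \<exists>s\<ge>0. \<exists>\<eta>. sim R h (M4 y s \<eta>)"
  shows "\<not> ample S"
proof -
  define m1 where "m1 = min 1 ((norm y)\<^sup>2 / 2)"
  have m1: "m1 > 0" "m1 \<le> 1" "m1 \<le> (norm y)\<^sup>2 / 2" using y by (auto simp: m1_def)
  define D where "D = (K_bound * (2 + 4 * (norm y)\<^sup>2) + K_bound + K_bound) * (K_bound * 2)"
  have D: "D > 0" unfolding D_def using K_bound_ge by (intro mult_pos_pos add_nonneg_pos add_pos_pos add_nonneg_nonneg) auto
  define c where "c = m1 / (9 * D)"
  have c: "c > 0" using D m1 by (simp add: c_def)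
  have main: "c * (1 + s + \<bar>\<eta>\<bar>) * N1 (M4 y s \<eta>) \<le> N2 (M4 y s \<eta>) \<and>
      N1 (M4 y s \<eta>) \<le> D * (exp (1 + s + \<bar>\<eta>\<bar>) * (1 + s + \<bar>\<eta>\<bar>))"
    if s: "s \<ge> 0" for s \<eta>
  proof
    let ?k = "M4 y s \<eta>" and ?\<rho> = "1 + s + \<bar>\<eta>\<bar>"
    let ?A = "eich (e q) (s *\<^sub>R y)"
    have By: "B y (e p) = 0" using y by simp
    \<comment> \<open>The torus element moves only the plane of \<open>e p\<close> and
      \<open>e (\<tau> p)\<close>, the other factor only the orthogonal complement, so their
      deviations from 1 add up. The size is of order exp s + s^2 instead of exp s times s^2.\<close>
    have dec: "a2 p q s 0 ** ?A = ?A + a2 p q s 0 - mat 1"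
      by (rule matrix_eq_vec)
        (use y in \<open>simp add: a2_def tor_apply eich_apply B_bil matrix_vector_mult_add_rdistrib matrix_vector_mult_diff_rdistrib
          flip: matrix_vector_mul_assoc\<close>)
    have e1: "exp s \<ge> 1" using s by simp
    have s2: "s\<^sup>2 \<le> 2 * exp s" using exp_lower_Taylor_quadratic[OF s] s by linarith
    have NA: "N1 ?A \<le> K_bound * ((2 + 4 * (norm y)\<^sup>2) * exp s)"
    proof -
      have "s\<^sup>2 * (norm y)\<^sup>2 \<le> (2 * exp s) * (norm y)\<^sup>2" using s2 by (intro mult_right_mono) auto
      moreover have "(2 + 4 * (norm y)\<^sup>2) * exp s = 2 * exp s + 2 * ((2 * exp s) * (norm y)\<^sup>2)" by (simp add: algebra_simps)
      moreover have "(norm (s *\<^sub>R y))\<^sup>2 = s\<^sup>2 * (norm y)\<^sup>2" by (simp add: power_mult_distrib)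
      moreover from calculation(1) have "2 * (1 + s\<^sup>2 * (norm y)\<^sup>2) \<le> 2 * exp s + 2 * ((2 * exp s) * (norm y)\<^sup>2)"
        using e1 add_mono[of 2 "2 * exp s" "2 * (s\<^sup>2 * (norm y)\<^sup>2)" "2 * ((2 * exp s) * (norm y)\<^sup>2)"] by (simp only: distrib_left)
      ultimately have "2 * (1 + (norm (s *\<^sub>R y))\<^sup>2) \<le> (2 + 4 * (norm y)\<^sup>2) * exp s" by (simp only:)
      then have "(1 + norm (s *\<^sub>R y))\<^sup>2 \<le> (2 + 4 * (norm y)\<^sup>2) * exp s"
        by (rule order_trans[OF one_plus_square])
      then show ?thesis using N1_eich[of q "s *\<^sub>R y"] K_bound_ge
          mult_left_mono[of "(1 + norm (s *\<^sub>R y))\<^sup>2" "(2 + 4 * (norm y)\<^sup>2) * exp s" K_bound] by linarith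
    qed
    have NTA: "N1 (a2 p q s 0 ** ?A) \<le> (K_bound * (2 + 4 * (norm y)\<^sup>2) + K_bound + K_bound) * exp s"
    proof -
      have "N1 (a2 p q s 0 ** ?A) \<le> N1 ?A + N1 (a2 p q s 0) + N1 (mat 1)"
        unfolding dec using N1_diff[of "?A + a2 p q s 0" "mat 1"] N1_add[of ?A "a2 p q s 0"] by linarith
      moreover have "N1 (a2 p q s 0) \<le> K_bound * exp s" using N1_a2[of 0 s] s by simp
      moreover have "N1 (mat 1) \<le> K_bound * exp s"
        using N1_one K_bound_ge e1 mult_left_mono[of 1 "exp s" K_bound] by linarith
      ultimately show ?thesis using NA by (simp add: distrib_right mult.assoc)
    qed
    have up: "N1 ?k \<le> D * (exp s * (1 + \<bar>\<eta>\<bar>))"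
    proof -
      have "N1 ?k \<le> N1 (a2 p q s 0 ** ?A) * N1 (eich (e p) (\<eta> *\<^sub>R e q))" unfolding M4_def by (rule N1_mult)
      also have "\<dots> \<le> ((K_bound * (2 + 4 * (norm y)\<^sup>2) + K_bound + K_bound) * exp s) * (K_bound * (2 * (1 + \<bar>\<eta>\<bar>)))"
      proof (intro mult_mono NTA)
        have "1 + 2 * norm (\<eta> *\<^sub>R e q) \<le> 2 * (1 + \<bar>\<eta>\<bar>)" by simp
        then show "N1 (eich (e p) (\<eta> *\<^sub>R e q)) \<le> K_bound * (2 * (1 + \<bar>\<eta>\<bar>))"
          by (intro order_trans[OF N1_eich_long mult_left_mono]) (use K_bound_ge in \<open>simp_all add: B_bil\<close>)
      qed (use K_bound_ge in auto)
      also have "\<dots> = D * (exp s * (1 + \<bar>\<eta>\<bar>))" by (simp only: D_def mult_ac)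
      finally show ?thesis .
    qed
    \<comment> \<open>The inequality (1 + s + |\<eta>|)^2 <= 3 (1 + s^2 + \<eta>^2) turns the
      quadratic gain into a factor \<rho>.\<close>
    have "?\<rho> * (1 + \<bar>\<eta>\<bar>) \<le> ?\<rho> * ?\<rho>" using s by (intro mult_left_mono) auto
    also have "\<dots> \<le> 3 * (1 + s\<^sup>2 + \<eta>\<^sup>2)"
    proof -
      have "0 \<le> (1 - s)\<^sup>2 + (1 - \<bar>\<eta>\<bar>)\<^sup>2 + (s - \<bar>\<eta>\<bar>)\<^sup>2" by simp
      moreover have "\<bar>\<eta>\<bar> * \<bar>\<eta>\<bar> = \<eta>\<^sup>2" by (simp add: power2_eq_square)
      ultimately show ?thesis by (simp add: power2_eq_square algebra_simps)
    qed
    finally have \<rho>2: "?\<rho> * (1 + \<bar>\<eta>\<bar>) \<le> 3 * (1 + s\<^sup>2 + \<eta>\<^sup>2)" .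
    have "c * ?\<rho> * N1 ?k \<le> c * ?\<rho> * (D * (exp s * (1 + \<bar>\<eta>\<bar>)))" using c s up by (intro mult_left_mono) auto
    also have "\<dots> = (c * D) * exp s * (?\<rho> * (1 + \<bar>\<eta>\<bar>))" by (simp only: mult_ac)
    also have "\<dots> \<le> (c * D) * exp s * (3 * (1 + s\<^sup>2 + \<eta>\<^sup>2))" using c D \<rho>2 by (intro mult_left_mono) auto
    also have "\<dots> = exp s * (m1 * (1 + s\<^sup>2 + \<eta>\<^sup>2)) / 3" using D by (simp add: c_def)
    also have "\<dots> \<le> exp s * (1 + \<eta>\<^sup>2 + s\<^sup>2 * (norm y)\<^sup>2 / 2) / 3"
    proof -
      have "m1 * s\<^sup>2 \<le> ((norm y)\<^sup>2 / 2) * s\<^sup>2" "m1 * \<eta>\<^sup>2 \<le> 1 * \<eta>\<^sup>2" using m1 by (intro mult_right_mono; simp)+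
      then have "m1 * (1 + s\<^sup>2 + \<eta>\<^sup>2) \<le> 1 + \<eta>\<^sup>2 + s\<^sup>2 * (norm y)\<^sup>2 / 2" using m1 by (simp add: algebra_simps)
      then show ?thesis by (intro divide_right_mono mult_left_mono) auto
    qed
    also have "\<dots> \<le> 3 * N2 ?k / 3" using M4_lower[OF y(1) s, of \<eta>] by (rule divide_right_mono) simp
    also have "\<dots> = N2 ?k" by simp
    finally show "c * ?\<rho> * N1 ?k \<le> N2 ?k" .
    have "exp s * (1 + \<bar>\<eta>\<bar>) \<le> exp ?\<rho> * ?\<rho>" using s by (intro mult_mono) auto
    then show "N1 ?k \<le> D * (exp ?\<rho> * ?\<rho>)" using up D mult_left_mono[of "exp s * (1 + \<bar>\<eta>\<bar>)" "exp ?\<rho> * ?\<rho>" D] by linarith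
  qed
  show ?thesis
  proof (rule not_ample_ratio2[OF c, where \<Psi> = "\<lambda>\<rho>. D * (exp \<rho> * \<rho>)" and R = R])
    show "D * (exp x * x) \<le> D * (exp y * y)" if "0 \<le> x" "x \<le> y" for x y
      using that D by (intro mult_left_mono mult_mono) auto
    fix h assume "h \<in> S"
    then obtain s \<eta> where "s \<ge> 0" "sim R h (M4 y s \<eta>)" using S by blast
    then show "\<exists>k. sim R h k \<and> (\<exists>\<rho>\<ge>0. c * \<rho> * N1 k \<le> N2 k \<and> N1 k \<le> D * (exp \<rho> * \<rho>))"
      using main by (intro exI[of _ "M4 y s \<eta>"] conjI exI[of _ "1 + s + \<bar>\<eta>\<bar>"]) auto
  qed
qed

end

section \<open>The group SO(2,n) in coordinates\<close>

lemma pos_less_iff: "pos i < pos j \<longleftrightarrow> i < (j :: 'm::{finite,linorder})"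
proof -
  have mono: "pos i < pos j" if "i < j" for i j :: 'm
    unfolding pos_def by (rule psubset_card_mono) (use that in auto)
  show ?thesis using mono by (metis less_asym linorder_neqE)
qed

lemma pos_eq_iff: "pos i = pos j \<longleftrightarrow> i = (j :: 'm::{finite,linorder})"
  by (metis linorder_neqE nat_neq_iff pos_less_iff)

lemma pos_bij: "bij_betw pos (UNIV :: 'm::{finite,linorder} set) {1..CARD('m)}"
proof -
  have inj: "inj (pos :: 'm \<Rightarrow> nat)" by (simp add: inj_def pos_eq_iff)
  have "1 \<le> pos i \<and> pos i \<le> CARD('m)" for i :: 'm
  proof -
    have "card {i} \<le> pos i" unfolding pos_def by (rule card_mono) auto
    moreover have "pos i \<le> CARD('m)" unfolding pos_def by (rule card_mono) auto
    ultimately show ?thesis by simp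
  qed
  then have "range (pos :: 'm \<Rightarrow> nat) \<subseteq> {1..CARD('m)}" by auto
  moreover have "card (range (pos :: 'm \<Rightarrow> nat)) = card {1..CARD('m)}" using inj by (simp add: card_image)
  ultimately have "range (pos :: 'm \<Rightarrow> nat) = {1..CARD('m)}" by (intro card_subset_eq) auto
  then show ?thesis using inj by (simp add: bij_betw_def)
qed

lemma pos_range: "1 \<le> pos (i :: 'm::{finite,linorder})" "pos i \<le> CARD('m)"
  using bij_betwE[OF pos_bij] by (metis UNIV_I atLeastAtMost_iff)+

lemma idx_pos [simp]: "idx (pos i) = i"
  unfolding idx_def by (rule the_equality) (simp_all add: pos_eq_iff)

lemma pos_idx: "1 \<le> k \<Longrightarrow> k \<le> CARD('m) \<Longrightarrow> pos (idx k :: 'm::{finite,linorder}) = k"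
  using pos_bij[where 'm='m] unfolding bij_betw_def by (metis atLeastAtMost_iff idx_pos imageE)

text \<open>The pairing of the quadratic form: only the two outer coordinates at either end are
  reversed, while the middle ones, which enter as squares, are fixed.\<close>

definition flip :: "'m::{finite,linorder} \<Rightarrow> 'm" where
  "flip i = (if pos i \<in> {1, 2, CARD('m) - 1, CARD('m)} then idx (CARD('m) + 1 - pos i) else i)"

lemma SO2_mult [simp]: "A <#>\<^bsub>SO2\<^esub> C = {a ** c | a c. a \<in> A \<and> c \<in> C}"
  by (auto simp: set_mult_def SO2_def)

lemma SO2_ops [simp]: "mult SO2 = (**)" "one SO2 = mat 1"
  by (simp_all add: SO2_def)

lemma matrix_exp_in_subspace:
  fixes V :: "'n::finite sqmat set"
  assumes "subspace V" "mat 1 \<in> V" "X \<in> V" "\<And>A C. A \<in> V \<Longrightarrow> C \<in> V \<Longrightarrow> A ** C \<in> V"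
  shows "matrix_exp X \<in> V"
proof -
  have p: "((**) X ^^ k) (mat 1) \<in> V" for k by (induction k) (use assms in auto)
  have "(\<lambda>n. \<Sum>k<n. (1 / fact k) *\<^sub>R (((**) X ^^ k) (mat 1))) \<longlonglongrightarrow> matrix_exp X"
    using matrix_exp_eq_suminf unfolding sums_def .
  then show ?thesis
    by (rule closed_sequentially[OF closed_subspace[OF assms(1)], rotated])
      (intro subspace_sum[OF assms(1)] subspace_scale[OF assms(1)] p)
qed

text \<open>The parameter \<open>ty\<close> names the index type to which the cardinality assumption
  refers, so that the four outer indices become constants of that type.\<close>

locale so2 =
  fixes ty :: "'m::{finite,linorder} itself"
  assumes card: "CARD('m) \<ge> 5"
begin

definition i1 :: 'm where "i1 = idx 1"
definition i2 :: 'm where "i2 = idx 2"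
definition j2 :: 'm where "j2 = idx (CARD('m) - 1)"
definition j1 :: 'm where "j1 = idx (CARD('m))"

lemma eq_pos: "i = j \<longleftrightarrow> pos i = pos j" for i j :: 'm
  by (simp add: pos_eq_iff)

lemma less_pos: "i < j \<longleftrightarrow> pos i < pos j" for i j :: 'm
  by (simp add: pos_less_iff)

lemma pos_idxs: "pos i1 = 1" "pos i2 = 2" "pos j2 = CARD('m) - 1" "pos j1 = CARD('m)"
  using card by (auto simp: i1_def i2_def j2_def j1_def intro!: pos_idx)

lemma idxs_ne: "i1 \<noteq> i2" "i1 \<noteq> j2" "i1 \<noteq> j1" "i2 \<noteq> j2" "i2 \<noteq> j1" "j2 \<noteq> j1"
   "i2 \<noteq> i1" "j2 \<noteq> i1" "j1 \<noteq> i1" "j2 \<noteq> i2" "j1 \<noteq> i2" "j1 \<noteq> j2"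
  unfolding eq_pos pos_idxs using card by auto

lemma idxs_less: "i1 < i2" "i1 < j2" "i1 < j1" "i2 < j2" "i2 < j1" "j2 < j1"
  unfolding less_pos pos_idxs using card by auto

lemma flip_idxs [simp]: "flip i1 = j1" "flip i2 = j2" "flip j2 = i2" "flip j1 = i1"
proof -
  have "CARD('m) + 1 - (CARD('m) - 1) = 2" "CARD('m) + 1 - 2 = CARD('m) - 1" using card by auto
  then show "flip i1 = j1" "flip i2 = j2" "flip j2 = i2" "flip j1 = i1"
    unfolding flip_def pos_idxs using card by (simp_all add: i1_def i2_def j2_def j1_def)
qed

lemma flip_other: "i \<noteq> i1 \<Longrightarrow> i \<noteq> i2 \<Longrightarrow> i \<noteq> j1 \<Longrightarrow> i \<noteq> j2 \<Longrightarrow> flip i = i"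
  unfolding flip_def eq_pos pos_idxs by auto

lemma flip_flip: "flip (flip i) = (i :: 'm)"
  by (cases "i = i1 \<or> i = i2 \<or> i = j1 \<or> i = j2") (auto simp: flip_other)

lemma flip_neq: "flip i \<noteq> i \<longleftrightarrow> i = i1 \<or> i = i2 \<or> i = j1 \<or> i = j2"
  using flip_other[of i] idxs_ne by auto

lemma full_frame_flip: "full_frame flip i1 i2"
proof
  show "\<exists>m :: 'm. flip m = m"
  proof -
    have "pos (idx 3 :: 'm) = 3" using card by (intro pos_idx) auto
    then have "flip (idx 3 :: 'm) = idx 3" using card unfolding flip_def by auto
    then show ?thesis by blast
  qed
  show "flip (flip i) = i" for i :: 'm by (rule flip_flip)
  show "flip i1 \<noteq> i1" "flip i2 \<noteq> i2" "i2 \<noteq> i1" "i2 \<noteq> flip i1" using idxs_ne by simp_all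
  show "flip i \<noteq> i \<Longrightarrow> i = i1 \<or> i = i2 \<or> i = flip i1 \<or> i = flip i2" for i :: 'm
    using flip_neq[of i] by auto
qed

sublocale full_frame "flip :: 'm \<Rightarrow> 'm" i1 i2 by (rule full_frame_flip)

lemmas B_tab [simp] = B_frame[unfolded flip_idxs]

lemma Mid_tab [simp]:
  assumes "v \<in> Mid"
  shows "v $ i1 = 0" "v $ i2 = 0" "v $ j1 = 0" "v $ j2 = 0"
    "B v (e i1) = 0" "B v (e i2) = 0" "B v (e j1) = 0" "B v (e j2) = 0"
    "B (e i1) v = 0" "B (e i2) v = 0" "B (e j1) v = 0" "B (e j2) v = 0"
  using Mid_nth[OF assms] B_Mid_frame[OF assms] by simp_all

lemma midI: "i \<noteq> i1 \<Longrightarrow> i \<noteq> i2 \<Longrightarrow> i \<noteq> j1 \<Longrightarrow> i \<noteq> j2 \<Longrightarrow> i2 < i \<and> i < j2 \<and> i1 < i \<and> i < j1"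
  unfolding less_pos eq_pos pos_idxs using pos_range[of i] by auto

lemma not_mid_less: "\<not> i < i1" "i < i2 \<longleftrightarrow> i = i1" "\<not> j1 < i" "j2 < i \<longleftrightarrow> i = j1"
  unfolding less_pos eq_pos pos_idxs using pos_range[of i] card by auto

lemma qform_B: "qform v = B v v"
proof -
  let ?M = "{i. flip i = (i :: 'm)}"
  have "B v v = (\<Sum>i\<in>UNIV. v $ i * v $ flip i)" by (simp add: B_def inner_vec_def)
  also have "(UNIV :: 'm set) = {i1, i2, j2, j1} \<union> ?M" using flip_neq by auto
  also have "(\<Sum>i\<in>{i1, i2, j2, j1} \<union> ?M. v $ i * v $ flip i) = (\<Sum>i\<in>{i1, i2, j2, j1}. v $ i * v $ flip i) + (\<Sum>i\<in>?M. v $ i * v $ flip i)"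
    using idxs_ne by (intro sum.union_disjoint) (auto simp: flip_idxs)
  also have "(\<Sum>i\<in>?M. v $ i * v $ flip i) = (\<Sum>i\<in>?M. (v $ i)\<^sup>2)" by (intro sum.cong) (auto simp: power2_eq_square)
  also have "\<dots> = (\<Sum>k = 3..CARD('m) - 2. (v $ idx k)\<^sup>2)"
  proof (rule sum.reindex_bij_witness[of _ idx pos])
    fix i :: 'm assume "i \<in> ?M"
    then have "pos i \<noteq> 1" "pos i \<noteq> 2" "pos i \<noteq> CARD('m) - 1" "pos i \<noteq> CARD('m)"
      using flip_neq[of i] unfolding eq_pos pos_idxs by auto
    then show "pos i \<in> {3..CARD('m) - 2}" using pos_range[of i] by auto
  next
    fix k assume k: "k \<in> {3..CARD('m) - 2}"
    then have p: "pos (idx k :: 'm) = k" by (intro pos_idx) auto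
    show "pos (idx k :: 'm) = k" by (rule p)
    have "(idx k :: 'm) \<noteq> i1 \<and> (idx k :: 'm) \<noteq> i2 \<and> (idx k :: 'm) \<noteq> j1 \<and> (idx k :: 'm) \<noteq> j2"
      unfolding eq_pos pos_idxs p using k card by auto
    then show "idx k \<in> ?M" using flip_neq[of "idx k"] by blast
  qed auto
  finally show ?thesis
    unfolding qform_def i1_def[symmetric] i2_def[symmetric] j1_def[symmetric] j2_def[symmetric]
    using idxs_ne by (simp add: algebra_simps)
qed

text \<open>By polarization, preserving the quadratic form is the same as preserving
  \<open>B\<close>.\<close>

lemma carrier_SO2: "carrier SO2 = G"
proof -
  have "isom g \<longleftrightarrow> (\<forall>v. qform (g *v v) = qform v)" for g :: "'m sqmat"
  proof
    assume q: "\<forall>v. qform (g *v v) = qform v"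
    show "isom g" unfolding isom_def
    proof (intro allI)
      fix v w
      have "B (g *v (v + w)) (g *v (v + w)) = B (v + w) (v + w)" "B (g *v v) (g *v v) = B v v" "B (g *v w) (g *v w) = B w w"
        using q by (simp_all add: qform_B)
      then show "B (g *v v) (g *v w) = B v w"
        by (simp add: matrix_vector_right_distrib B_bil B_commute[of w v] B_commute[of "g *v w" "g *v v"])
    qed
  qed (simp add: qform_B isomD)
  then show ?thesis by (auto simp: SO2_def G_def)
qed

lemma group_SO2: "group (SO2 :: 'm sqmat monoid)"
  by (rule groupI) (auto simp: carrier_SO2 matrix_mul_assoc G_mult intro!: bexI[of _ "iv _"] isom_iv_left G_isom G_iv)

lemma inv_SO2: "g \<in> G \<Longrightarrow> inv\<^bsub>SO2\<^esub> g = iv g"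
  using group.inv_equality[OF group_SO2, of "iv g" g] by (simp add: carrier_SO2 G_iv isom_iv_left G_isom)

lemma subgroup_SO2_iff:
  "subgroup (H :: 'm sqmat set) SO2 \<longleftrightarrow> H \<subseteq> G \<and> mat 1 \<in> H \<and> (\<forall>a\<in>H. \<forall>b\<in>H. a ** b \<in> H) \<and> (\<forall>a\<in>H. iv a \<in> H)"
proof
  assume "subgroup H SO2"
  then interpret subgroup H SO2 .
  show "H \<subseteq> G \<and> mat 1 \<in> H \<and> (\<forall>a\<in>H. \<forall>b\<in>H. a ** b \<in> H) \<and> (\<forall>a\<in>H. iv a \<in> H)"
    using subset m_closed m_inv_closed one_closed inv_SO2 carrier_SO2 by (auto simp: subset_iff)
next
  assume a: "H \<subseteq> G \<and> mat 1 \<in> H \<and> (\<forall>a\<in>H. \<forall>b\<in>H. a ** b \<in> H) \<and> (\<forall>a\<in>H. iv a \<in> H)"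
  show "subgroup H SO2"
    by unfold_locales (use a inv_SO2 carrier_SO2 in \<open>auto simp: subset_iff\<close>)
qed

lemma N1_compact_bound:
  assumes "compact C" shows "\<exists>R. \<forall>g\<in>C. N1 g \<le> R"
proof -
  have "continuous_on C N1" unfolding N1_def by (intro continuous_intros)
  then have "bounded (N1 ` C)" using assms compact_continuous_image compact_imp_bounded by blast
  then obtain R where "\<And>x. x \<in> N1 ` C \<Longrightarrow> norm x \<le> R" unfolding bounded_iff by blast
  then have "\<forall>g\<in>C. N1 g \<le> R" by fastforce
  then show ?thesis by blast
qed

text \<open>\<open>N1\<close> is continuous, so a compact set lies in some \<open>Cset\<close>, and
  every \<open>Cset\<close> is compact. The compact set of the definition thus turns into a bound on
  sizes.\<close>

lemma cartan_iff_ample: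
  "cartan_decomposition_subgroup (H :: 'm sqmat set) \<longleftrightarrow>
    subgroup H SO2 \<and> closedin (top_of_set (carrier SO2)) H \<and> connected H \<and> ample H"
proof -
  have "(\<exists>C \<subseteq> carrier SO2. compact C \<and> C <#>\<^bsub>SO2\<^esub> H <#>\<^bsub>SO2\<^esub> C = carrier SO2) \<longleftrightarrow> ample H" if "subgroup H SO2"
  proof
    assume "\<exists>C \<subseteq> carrier SO2. compact C \<and> C <#>\<^bsub>SO2\<^esub> H <#>\<^bsub>SO2\<^esub> C = carrier SO2"
    then obtain C where C: "C \<subseteq> G" "compact C" "C <#>\<^bsub>SO2\<^esub> H <#>\<^bsub>SO2\<^esub> C = G" by (auto simp: carrier_SO2)
    obtain R where R: "\<And>g. g \<in> C \<Longrightarrow> N1 g \<le> R" using N1_compact_bound[OF C(2)] by blast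
    show "ample H" unfolding ample_def
    proof (intro exI[of _ R] ballI)
      fix g assume "g \<in> G"
      then have "g \<in> C <#>\<^bsub>SO2\<^esub> H <#>\<^bsub>SO2\<^esub> C" using C(3) by simp
      then obtain c h c' where "c \<in> C" "h \<in> H" "c' \<in> C" "g = c ** h ** c'" by auto
      then show "\<exists>c1\<in>Cset R. \<exists>c2\<in>Cset R. \<exists>h\<in>H. g = c1 ** h ** c2"
        using C(1) R by (auto simp: Cset_def)
    qed
  next
    assume "ample H"
    then obtain R where R: "\<And>g. g \<in> G \<Longrightarrow> \<exists>c1\<in>Cset R. \<exists>c2\<in>Cset R. \<exists>h\<in>H. g = c1 ** h ** c2"
      unfolding ample_def by blast
    have "Cset R \<subseteq> G" by (auto simp: Cset_def)
    moreover have "H \<subseteq> G" using that by (simp add: subgroup_SO2_iff)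
    ultimately have HG: "Cset R \<subseteq> G" "H \<subseteq> G" by blast+
    have "Cset R <#>\<^bsub>SO2\<^esub> H <#>\<^bsub>SO2\<^esub> Cset R = G"
    proof (intro equalityI subsetI)
      fix g assume "g \<in> Cset R <#>\<^bsub>SO2\<^esub> H <#>\<^bsub>SO2\<^esub> Cset R"
      then obtain c h c' where "c \<in> Cset R" "h \<in> H" "c' \<in> Cset R" "g = c ** h ** c'" by auto
      then show "g \<in> G" using HG by (auto intro!: G_mult)
    next
      fix g assume "g \<in> G"
      then obtain c h c' where "c \<in> Cset R" "h \<in> H" "c' \<in> Cset R" "g = c ** h ** c'" using R by blast
      then show "g \<in> Cset R <#>\<^bsub>SO2\<^esub> H <#>\<^bsub>SO2\<^esub> Cset R" by (simp only: SO2_mult) blast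
    qed
    then show "\<exists>C \<subseteq> carrier SO2. compact C \<and> C <#>\<^bsub>SO2\<^esub> H <#>\<^bsub>SO2\<^esub> C = carrier SO2"
      using compact_Cset HG(1) unfolding carrier_SO2 by blast
  qed
  then show ?thesis unfolding cartan_decomposition_subgroup_def by blast
qed

text \<open>In these coordinates the Lie algebras of A and N consist of the matrices zz and nn.\<close>

definition zz :: "real \<Rightarrow> real \<Rightarrow> 'm sqmat" where
  "zz a b = a *\<^sub>R wedge (e i1) (e j1) + b *\<^sub>R wedge (e i2) (e j2)"
definition nn :: "real \<Rightarrow> (real, 'm) vec \<Rightarrow> (real, 'm) vec \<Rightarrow> real \<Rightarrow> 'm sqmat" where
  "nn \<phi> x y \<eta> = wedge (e i1) (\<phi> *\<^sub>R e j2 + x + \<eta> *\<^sub>R e i2) + wedge (e i2) y"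

lemma zz_apply: "zz a b *v w = (a * w $ i1) *\<^sub>R e i1 - (a * w $ j1) *\<^sub>R e j1 + (b * w $ i2) *\<^sub>R e i2 - (b * w $ j2) *\<^sub>R e j2"
  by (simp add: zz_def matrix_vector_mult_add_rdistrib wedge_apply B_axis algebra_simps flip: scaleR_matrix_vector_assoc)

lemma nn_apply: "x \<in> Mid \<Longrightarrow> y \<in> Mid \<Longrightarrow> nn \<phi> x y \<eta> *v w =
    (\<phi> * w $ i2 + x \<bullet> w + \<eta> * w $ j2) *\<^sub>R e i1 + (y \<bullet> w - \<eta> * w $ j1) *\<^sub>R e i2
    - w $ j1 *\<^sub>R x - w $ j2 *\<^sub>R y - (\<phi> * w $ j1) *\<^sub>R e j2"
  by (simp add: nn_def matrix_vector_mult_add_rdistrib wedge_apply B_bil B_axis B_Mid inner_commute algebra_simps)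

lemma zz_nth: "zz a b $ i $ j = (if i = j then (if i = i1 then a else if i = i2 then b else if i = j2 then - b else if i = j1 then - a else 0) else 0)"
  using idxs_ne by (auto simp: entry_eq zz_apply)

lemma nn_nth:
  assumes "x \<in> Mid" "y \<in> Mid"
  shows "nn \<phi> x y \<eta> $ i $ j = (if i = i1 then (if j = i2 then \<phi> else if j = j2 then \<eta> else x $ j) else 0)
    + (if i = i2 then (if j = j1 then - \<eta> else y $ j) else 0)
    - (if j = j1 then x $ i else 0) - (if j = j2 then y $ i else 0) - (if i = j2 \<and> j = j1 then \<phi> else 0)"
  using idxs_ne assms by (auto simp: entry_eq nn_apply inner_axis)

text \<open>Translates from row and column numbers to wedges; subtracting 2 turns the positions 3,
  ..., n of the middle block into the component numbers 1, ..., n - 2.\<close>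

lemma nmat_nn:
  "nmat \<phi> x y \<eta> = nn \<phi> (\<chi> i. if flip i = i then x (pos i - 2) else 0) (\<chi> i. if flip i = i then y (pos i - 2) else 0) \<eta>"
    (is "_ = nn \<phi> ?x ?y \<eta>")
proof -
  have m: "?x \<in> Mid" "?y \<in> Mid" by (auto simp: Mid_def)
  have mid: "flip i = i \<longleftrightarrow> 3 \<le> pos i \<and> pos i \<le> CARD('m) - 2" for i :: 'm
    using flip_neq[of i] pos_range[of i] unfolding eq_pos pos_idxs by auto
  have eqs: "i = i1 \<longleftrightarrow> pos i = 1" "i = i2 \<longleftrightarrow> pos i = 2" "i = j2 \<longleftrightarrow> pos i = CARD('m) - 1" "i = j1 \<longleftrightarrow> pos i = CARD('m)" for i :: 'm
    unfolding eq_pos pos_idxs by auto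
  show ?thesis
  proof (subst vec_eq_iff, intro allI, subst vec_eq_iff, intro allI)
    fix i j :: 'm
    show "nmat \<phi> x y \<eta> $ i $ j = nn \<phi> ?x ?y \<eta> $ i $ j"
      unfolding nn_nth[OF m] nmat_def Let_def
      using card pos_range[of i] pos_range[of j] by (simp add: mid eqs) auto
  qed
qed

lemma root_space_nn:
  "root_space Root_alpha = {nn \<phi> 0 0 0 | \<phi>. True}"
  "root_space Root_beta = {nn 0 0 y 0 | y. y \<in> Mid}"
  "root_space Root_alpha_beta = {nn 0 x 0 0 | x. x \<in> Mid}"
  "root_space Root_alpha_2beta = {nn 0 0 0 \<eta> | \<eta>. True}"
proof -
  have z: "vec_lambda (\<lambda>i. 0) = (0 :: (real, 'm) vec)" by (simp add: vec_eq_iff)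
  have m: "(\<chi> i. if flip i = i then x (pos i - 2) else 0) \<in> Mid" for x by (auto simp: Mid_def)
  have r: "\<exists>x'. v = (\<chi> i. if flip i = i then x' (pos i - 2) else 0)" if "v \<in> Mid" for v
  proof
    have "v $ i = v $ idx (pos i - 2 + 2)" if "flip i = i" for i
    proof -
      have "i \<noteq> i1" using that flip_neq by blast
      then have "pos i \<noteq> 1" unfolding eq_pos pos_idxs .
      then have "pos i - 2 + 2 = pos i" using pos_range[of i] by simp
      then show ?thesis by simp
    qed
    then show "v = (\<chi> i. if flip i = i then (\<lambda>k. v $ idx (k + 2)) (pos i - 2) else 0)"
      using that by (auto simp: vec_eq_iff Mid_def)
  qed
  show "root_space Root_alpha = {nn \<phi> 0 0 0 | \<phi>. True}" "root_space Root_alpha_2beta = {nn 0 0 0 \<eta> | \<eta>. True}"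
    by (simp_all add: nmat_nn z)
  show "root_space Root_beta = {nn 0 0 y 0 | y. y \<in> Mid}" "root_space Root_alpha_beta = {nn 0 x 0 0 | x. x \<in> Mid}"
  proof -
    have "root_space Root_beta = range (\<lambda>y. nn 0 0 (\<chi> i. if flip i = i then y (pos i - 2) else 0) 0)"
      "root_space Root_alpha_beta = range (\<lambda>x. nn 0 (\<chi> i. if flip i = i then x (pos i - 2) else 0) 0 0)"
      by (auto simp: nmat_nn z)
    moreover have "Mid = range (\<lambda>x :: nat \<Rightarrow> real. \<chi> i. if flip i = i then x (pos i - 2) else 0)" using m r by blast
    ultimately show "root_space Root_beta = {nn 0 0 y 0 | y. y \<in> Mid}" "root_space Root_alpha_beta = {nn 0 x 0 0 | x. x \<in> Mid}"
      by (auto simp: image_def)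
  qed
qed

lemma nn_add: "x \<in> Mid \<Longrightarrow> y \<in> Mid \<Longrightarrow> x' \<in> Mid \<Longrightarrow> y' \<in> Mid \<Longrightarrow>
    nn \<phi> x y \<eta> + nn \<phi>' x' y' \<eta>' = nn (\<phi> + \<phi>') (x + x') (y + y') (\<eta> + \<eta>')"
  by (simp add: nn_def wedge_bil algebra_simps)

lemma nn_scale: "r *\<^sub>R nn \<phi> x y \<eta> = nn (r * \<phi>) (r *\<^sub>R x) (r *\<^sub>R y) (r * \<eta>)"
  by (simp add: nn_def wedge_bil algebra_simps)

lemma nn_diff: "nn \<phi> x y \<eta> - nn \<phi>' x' y' \<eta>' = nn (\<phi> - \<phi>') (x - x') (y - y') (\<eta> - \<eta>')"
  by (simp add: nn_def wedge_bil algebra_simps)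

lemma nn_zero [simp]: "nn 0 0 0 0 = 0"
  by (simp add: nn_def wedge_bil)

lemma zz_scale: "r *\<^sub>R zz a b = zz (r * a) (r * b)"
  by (simp add: zz_def algebra_simps)

lemma nn_inject:
  assumes "x \<in> Mid" "y \<in> Mid" "x' \<in> Mid" "y' \<in> Mid" "nn \<phi> x y \<eta> = nn \<phi>' x' y' \<eta>'"
  shows "\<phi> = \<phi>' \<and> x = x' \<and> y = y' \<and> \<eta> = \<eta>'"
proof -
  have e: "nn \<phi> x y \<eta> $ i $ j = nn \<phi>' x' y' \<eta>' $ i $ j" for i j using assms by simp
  have 1: "\<phi> = \<phi>'" "\<eta> = \<eta>'" using e[of i1 i2] e[of i1 j2] idxs_ne assms(1-4) by (simp_all add: nn_nth)
  have "x $ i = x' $ i" "y $ i = y' $ i" for i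
  proof -
    show "x $ i = x' $ i" using e[of i1 i] idxs_ne assms(1-4)
      by (cases "i = i1 \<or> i = i2 \<or> i = j1 \<or> i = j2") (auto simp: nn_nth)
    show "y $ i = y' $ i" using e[of i2 i] idxs_ne assms(1-4)
      by (cases "i = i1 \<or> i = i2 \<or> i = j1 \<or> i = j2") (auto simp: nn_nth)
  qed
  then show ?thesis using 1 by (simp add: vec_eq_iff)
qed

text \<open>The nonzero brackets of root spaces are alpha with beta and beta with alpha + beta; they
  land in alpha + beta and alpha + 2 beta.\<close>

lemma bracket_nn:
  assumes "x \<in> Mid" "y \<in> Mid" "x' \<in> Mid" "y' \<in> Mid"
  shows "nn \<phi> x y \<eta> ** nn \<phi>' x' y' \<eta>' - nn \<phi>' x' y' \<eta>' ** nn \<phi> x y \<eta>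
    = nn 0 (\<phi> *\<^sub>R y' - \<phi>' *\<^sub>R y) 0 (x' \<bullet> y - x \<bullet> y')"
proof (rule matrix_eq_vec)
  have m: "\<phi> *\<^sub>R y' - \<phi>' *\<^sub>R y \<in> Mid" "0 \<in> Mid"
    using assms by (auto intro!: subspace_diff[OF subspace_Mid] subspace_scale[OF subspace_Mid] subspace_0[OF subspace_Mid])
  have i: "v \<bullet> e k = v $ k" for v :: "(real, 'm) vec" and k by (simp add: inner_axis)
  fix w
  show "(nn \<phi> x y \<eta> ** nn \<phi>' x' y' \<eta>' - nn \<phi>' x' y' \<eta>' ** nn \<phi> x y \<eta>) *v w
    = nn 0 (\<phi> *\<^sub>R y' - \<phi>' *\<^sub>R y) 0 (x' \<bullet> y - x \<bullet> y') *v w"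
    using assms m idxs_ne
    by (simp add: matrix_vector_mult_diff_rdistrib nn_apply inner_add_right inner_diff_right inner_diff_left i
        flip: matrix_vector_mul_assoc) (simp add: vec_eq_iff inner_commute algebra_simps)
qed

lemma bracket_zz_nn:
  assumes "x \<in> Mid" "y \<in> Mid"
  shows "zz a b ** nn \<phi> x y \<eta> - nn \<phi> x y \<eta> ** zz a b = nn ((a - b) * \<phi>) (a *\<^sub>R x) (b *\<^sub>R y) ((a + b) * \<eta>)"
proof (rule matrix_eq_vec)
  have m: "a *\<^sub>R x \<in> Mid" "b *\<^sub>R y \<in> Mid"
    using assms by (auto intro!: subspace_scale[OF subspace_Mid])
  have i: "v \<bullet> e k = v $ k" for v :: "(real, 'm) vec" and k by (simp add: inner_axis)
  fix w
  show "(zz a b ** nn \<phi> x y \<eta> - nn \<phi> x y \<eta> ** zz a b) *v w = nn ((a - b) * \<phi>) (a *\<^sub>R x) (b *\<^sub>R y) ((a + b) * \<eta>) *v w"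
    using assms m idxs_ne
    by (simp add: matrix_vector_mult_diff_rdistrib nn_apply zz_apply inner_add_right inner_diff_right i
        flip: matrix_vector_mul_assoc) (simp add: vec_eq_iff algebra_simps)
qed

section \<open>Exponentials of root vectors and of the torus\<close>

lemma eich_wedge:
  assumes "B u u = 0" "B u v = 0"
  shows "wedge u v ** wedge u v ** wedge u v = 0"
    and "eich u v = mat 1 + wedge u v + (1/2) *\<^sub>R (wedge u v ** wedge u v)"
proof -
  have c: "B v u = 0" using assms B_commute by metis
  have 2: "(wedge u v ** wedge u v) *v w = (- (B w u * B v v)) *\<^sub>R u" for w
    by (simp add: wedge_apply B_bil assms c flip: matrix_vector_mul_assoc)
  show "wedge u v ** wedge u v ** wedge u v = 0"
    by (rule matrix_eq_vec) (simp add: 2 wedge_apply[of u v] B_bil assms c flip: matrix_vector_mul_assoc[of _ "wedge u v"])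
  show "eich u v = mat 1 + wedge u v + (1/2) *\<^sub>R (wedge u v ** wedge u v)"
    by (rule matrix_eq_vec) (simp add: matrix_vector_mult_add_rdistrib 2 wedge_apply eich_apply algebra_simps flip: scaleR_matrix_vector_assoc)
qed

lemma exp_wedge: "B u u = 0 \<Longrightarrow> B u v = 0 \<Longrightarrow> matrix_exp (wedge u v) = eich u v"
  by (simp add: eich_wedge matrix_exp_cube_zero)

lemma exp_nn1: "x \<in> Mid \<Longrightarrow> matrix_exp (nn \<phi> x 0 \<eta>) = eich (e i1) (\<phi> *\<^sub>R e j2 + x + \<eta> *\<^sub>R e i2)"
  using exp_wedge[of "e i1" "\<phi> *\<^sub>R e j2 + x + \<eta> *\<^sub>R e i2"] by (simp add: nn_def wedge_bil B_bil)

text \<open>The root vector for alpha + 2 beta is the wedge of \<open>e i1\<close> and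
  \<open>e i2\<close>. Read from \<open>e i2\<close> it joins \<open>y\<close> in one Eichler
  transformation, just as read from \<open>e i1\<close> it joins \<phi> and
  \<open>x\<close>.\<close>

lemma nn2_eq: "nn 0 0 y \<eta> = wedge (e i2) (y - \<eta> *\<^sub>R e i1)"
  by (rule matrix_eq_vec) (simp add: nn_def wedge_bil matrix_vector_mult_add_rdistrib wedge_apply B_bil algebra_simps flip: scaleR_matrix_vector_assoc)

lemma exp_nn2: "y \<in> Mid \<Longrightarrow> matrix_exp (nn 0 0 y \<eta>) = eich (e i2) (y - \<eta> *\<^sub>R e i1)"
  unfolding nn2_eq by (rule exp_wedge) (simp_all add: B_bil)

definition UT :: "'m sqmat set" where "UT = {X. \<forall>i j. j < i \<longrightarrow> X $ i $ j = 0}"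

lemma subspace_UT: "subspace UT"
  by (auto simp: subspace_def UT_def)

lemma UT_mult: assumes "X \<in> UT" "Y \<in> UT"
  shows "X ** Y \<in> UT" "(X ** Y) $ i $ i = X $ i $ i * Y $ i $ i"
proof -
  have z: "X $ i $ k * Y $ k $ j = 0" if "j < i \<or> (i = j \<and> k \<noteq> i)" for i j k
    using that assms unfolding UT_def by (metis (mono_tags, lifting) less_trans linorder_neqE mem_Collect_eq mult_eq_0_iff)
  show "X ** Y \<in> UT" using z by (auto simp: UT_def matrix_matrix_mult_def intro!: sum.neutral)
  have "(X ** Y) $ i $ i = X $ i $ i * Y $ i $ i + (\<Sum>k\<in>UNIV - {i}. X $ i $ k * Y $ k $ i)"
    by (simp add: matrix_matrix_mult_def sum.remove[of UNIV i])
  moreover have "(\<Sum>k\<in>UNIV - {i}. X $ i $ k * Y $ k $ i) = 0" by (intro sum.neutral ballI z) auto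
  ultimately show "(X ** Y) $ i $ i = X $ i $ i * Y $ i $ i" by simp
qed

lemma UT_one: "mat 1 \<in> UT" by (auto simp: UT_def mat_def)

lemma exp_UT: "X \<in> UT \<Longrightarrow> matrix_exp X \<in> UT" "X \<in> UT \<Longrightarrow> matrix_exp X $ i $ i = exp (X $ i $ i)"
proof -
  show "X \<in> UT \<Longrightarrow> matrix_exp X \<in> UT" by (rule matrix_exp_in_subspace[OF subspace_UT UT_one]) (auto intro: UT_mult(1))
  show "X \<in> UT \<Longrightarrow> matrix_exp X $ i $ i = exp (X $ i $ i)"
    by (rule matrix_exp_diag_entry[of "\<lambda>X. X \<in> UT"]) (auto intro: UT_mult UT_one)
qed

lemma a2_nth: "a2 i1 i2 a b $ i $ j = (if i = j then (if i = i1 then exp a else if i = i2 then exp b else if i = j2 then exp (- b) else if i = j1 then exp (- a) else 1) else 0)"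
  using idxs_ne by (auto simp: a2_entry dg_def)

lemma exp_zz: "matrix_exp (zz a b) = a2 i1 i2 a b"
proof -
  let ?V = "{X :: 'm sqmat. \<forall>i j. i \<noteq> j \<longrightarrow> X $ i $ j = 0}"
  have "matrix_exp (zz a b) \<in> ?V"
  proof (rule matrix_exp_in_subspace)
    show "A ** C \<in> ?V" if "A \<in> ?V" "C \<in> ?V" for A C
      using that by (auto simp: matrix_matrix_mult_def intro!: sum.neutral) metis
  qed (auto simp: subspace_def mat_def zz_nth)
  moreover have "matrix_exp (zz a b) $ i $ i = exp (zz a b $ i $ i)" for i
    by (rule exp_UT) (auto simp: UT_def zz_nth)
  ultimately show ?thesis by (auto simp: vec_eq_iff a2_nth zz_nth)
qed

end

section \<open>The groups A and N\<close>

context so2 begin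

lemma flip_eq_idxs [simp]: "flip i = j1 \<longleftrightarrow> i = i1" "flip i = j2 \<longleftrightarrow> i = i2" "flip i = i1 \<longleftrightarrow> i = j1" "flip i = i2 \<longleftrightarrow> i = j2"
  "j1 = flip i \<longleftrightarrow> i = i1" "j2 = flip i \<longleftrightarrow> i = i2" "i1 = flip i \<longleftrightarrow> i = j1" "i2 = flip i \<longleftrightarrow> i = j2"
  by (metis flip_flip flip_idxs)+

lemma a2_add: "a2 i1 i2 a b ** a2 i1 i2 c d = a2 i1 i2 (a + c) (b + d)"
proof -
  have "a2 i1 i2 a b ** a2 i1 i2 c d = (Tp a ** (Tq b ** Tp c)) ** Tq d" unfolding a2_def by (simp add: matrix_mul_assoc)
  also have "\<dots> = (Tp a ** Tp c) ** (Tq b ** Tq d)" unfolding Tp_Tq[symmetric] by (simp add: matrix_mul_assoc)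
  finally show ?thesis unfolding a2_def by (simp add: tor_add)
qed

lemma a2_00 [simp]: "a2 i1 i2 0 0 = mat 1" by (simp add: a2_def)

lemma a2_UT: "a2 i1 i2 a b \<in> UT" by (auto simp: UT_def a2_nth)

lemma Agrp_eq: "Agrp = {a2 i1 i2 a b | a b. True}"
proof (intro equalityI subsetI)
  fix g :: "'m sqmat" assume "g \<in> Agrp"
  then have g: "g \<in> G" "\<And>i j. i \<noteq> j \<Longrightarrow> g $ i $ j = 0" "\<And>i. g $ i $ i > 0"
    by (auto simp: Agrp_def carrier_SO2)
  have ge: "g *v e i = g $ i $ i *\<^sub>R e i" for i
    using g(2) by (auto simp: vec_eq_iff simp flip: entry_eq)
  have f: "g $ i $ i * g $ flip i $ flip i = 1" for i
    using isomD[OF G_isom[OF g(1)], of "e i" "e (flip i)"] by (simp add: ge B_bil B_e_e mult.commute)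
  have m: "g $ i $ i = 1" if "flip i = i" for i
  proof -
    have "(g $ i $ i)\<^sup>2 = 1" using f[of i] that by (simp add: power2_eq_square)
    then show ?thesis using g(3)[of i] by (auto simp: power2_eq_1_iff)
  qed
  have inv: "g $ j1 $ j1 = inverse (g $ i1 $ i1)" "g $ j2 $ j2 = inverse (g $ i2 $ i2)"
    using f[of i1] f[of i2] by (auto simp: inverse_unique)
  have "g = a2 i1 i2 (ln (g $ i1 $ i1)) (ln (g $ i2 $ i2))"
  proof (subst vec_eq_iff, intro allI, subst vec_eq_iff, intro allI)
    fix i j
    show "g $ i $ j = a2 i1 i2 (ln (g $ i1 $ i1)) (ln (g $ i2 $ i2)) $ i $ j"
      using g(2)[of i j] g(3) m[of i] inv flip_neq[of i] by (auto simp: a2_nth exp_minus)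
  qed
  then show "g \<in> {a2 i1 i2 a b | a b. True}" by blast
next
  fix g assume "g \<in> {a2 i1 i2 a b | a b. True}"
  then show "g \<in> Agrp" using G_a2 by (auto simp: Agrp_def carrier_SO2 a2_nth)
qed

lemma Ngrp_iff: "u \<in> Ngrp \<longleftrightarrow> u \<in> G \<and> u \<in> UT \<and> (\<forall>i. u $ i $ i = 1)"
  by (auto simp: Ngrp_def carrier_SO2 UT_def)

lemma N_mult: "u \<in> Ngrp \<Longrightarrow> v \<in> Ngrp \<Longrightarrow> u ** v \<in> Ngrp" for u v :: "'m sqmat"
  by (auto simp: Ngrp_iff G_mult UT_mult)

lemma closed_UT: "closed UT" by (rule closed_subspace[OF subspace_UT])

text \<open>Diagonal entries are asked to be nonnegative instead of positive. As products along
  \<open>flip\<close> are 1 this amounts to the same, and the conditions are visibly closed.\<close>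

lemma AN_eq: "ANgrp = {g \<in> G \<inter> UT. (\<forall>i. g $ i $ i \<ge> 0) \<and> (\<forall>i. g $ i $ i * g $ flip i $ flip i = 1)}" (is "_ = ?D")
proof (intro equalityI subsetI)
  fix g :: "'m sqmat" assume "g \<in> ANgrp"
  then obtain a b n where g: "g = a2 i1 i2 a b ** n" "n \<in> Ngrp" by (auto simp: Agrp_eq)
  have n: "n \<in> G" "n \<in> UT" "\<And>i. n $ i $ i = 1" using g by (auto simp: Ngrp_iff)
  have d: "g $ i $ i = a2 i1 i2 a b $ i $ i" for i using UT_mult(2)[OF a2_UT n(2), of a b i] n(3) g by simp
  have "a2 i1 i2 a b $ i $ i * a2 i1 i2 a b $ flip i $ flip i = 1" for i
    using idxs_ne flip_neq[of i] by (auto simp: a2_nth simp flip: exp_add)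
  then show "g \<in> ?D" using g n d UT_mult(1)[OF a2_UT n(2)] G_a2 G_mult by (auto simp: a2_nth)
next
  fix g assume g: "g \<in> ?D"
  then have pos: "g $ i $ i > 0" for i by (metis (mono_tags, lifting) less_eq_real_def mem_Collect_eq mult_eq_0_iff zero_neq_one)
  have m: "g $ i $ i = 1" if "flip i = i" for i
  proof -
    have "(g $ i $ i)\<^sup>2 = 1" using g that by (auto simp: power2_eq_square) (metis that)
    then show ?thesis using pos[of i] by (auto simp: power2_eq_1_iff)
  qed
  have inv: "g $ j1 $ j1 = inverse (g $ i1 $ i1)" "g $ j2 $ j2 = inverse (g $ i2 $ i2)"
    using g by (metis (mono_tags, lifting) flip_idxs inverse_unique mem_Collect_eq)+
  define a b where "a = ln (g $ i1 $ i1)" and "b = ln (g $ i2 $ i2)"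
  have e: "exp a = g $ i1 $ i1" "exp b = g $ i2 $ i2" using pos by (simp_all add: a_def b_def)
  define n where "n = a2 i1 i2 (- a) (- b) ** g"
  have "n \<in> Ngrp"
    unfolding Ngrp_iff
  proof (intro conjI allI)
    show "n \<in> G" "n \<in> UT" using g UT_mult(1)[OF a2_UT] G_a2 G_mult by (auto simp: n_def)
    fix i
    have "n $ i $ i = a2 i1 i2 (- a) (- b) $ i $ i * g $ i $ i" using UT_mult(2)[OF a2_UT] g by (simp add: n_def)
    also have "\<dots> = 1"
      using m[of i] flip_neq[of i] inv pos[of i] pos[of i1] pos[of i2] by (auto simp: a2_nth exp_minus e less_imp_neq[symmetric])
    finally show "n $ i $ i = 1" .
  qed
  moreover have "g = a2 i1 i2 a b ** n" unfolding n_def by (simp add: matrix_mul_assoc a2_add)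
  ultimately show "g \<in> ANgrp" by (auto simp: Agrp_eq)
qed

lemma closed_AN: "closed (ANgrp :: 'm sqmat set)"
proof -
  have "closed {g :: 'm sqmat. \<forall>i. g $ i $ i \<ge> 0}" "closed {g :: 'm sqmat. \<forall>i. g $ i $ i * g $ flip i $ flip i = 1}"
    by (intro closed_Collect_all closed_Collect_le closed_Collect_eq continuous_intros)+
  then have "closed (G \<inter> UT \<inter> {g :: 'm sqmat. \<forall>i. g $ i $ i \<ge> 0} \<inter> {g :: 'm sqmat. \<forall>i. g $ i $ i * g $ flip i $ flip i = 1})"
    using closed_G closed_UT by blast
  also have "\<dots> = ANgrp" unfolding AN_eq by blast
  finally show ?thesis .
qed

lemma closed_N: "closed (Ngrp :: 'm sqmat set)"
proof -
  have "closed {g :: 'm sqmat. \<forall>i. g $ i $ i = 1}" by (intro closed_Collect_all closed_Collect_eq continuous_intros)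
  then have "closed (G \<inter> UT \<inter> {g :: 'm sqmat. \<forall>i. g $ i $ i = 1})" using closed_G closed_UT by blast
  also have "\<dots> = Ngrp" using Ngrp_iff by blast
  finally show ?thesis .
qed

lemma AN_decomp:
  assumes "g \<in> ANgrp"
  shows "\<exists>n\<in>Ngrp. g = a2 i1 i2 (ln (g $ i1 $ i1)) (ln (g $ i2 $ i2)) ** n"
proof -
  obtain a b n where g: "g = a2 i1 i2 a b ** n" "n \<in> Ngrp" using assms by (auto simp: Agrp_eq)
  have "g $ i $ i = a2 i1 i2 a b $ i $ i" for i
    using UT_mult(2)[OF a2_UT, of n a b i] g by (simp add: Ngrp_iff)
  then have "g $ i1 $ i1 = exp a" "g $ i2 $ i2 = exp b" using idxs_ne by (simp_all add: a2_nth)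
  then show ?thesis using g by auto
qed

lemma AN_UT: "g \<in> ANgrp \<Longrightarrow> g \<in> UT" "g \<in> ANgrp \<Longrightarrow> g \<in> G"
  using AN_eq by blast+

lemma MidI4: "w $ i1 = 0 \<Longrightarrow> w $ i2 = 0 \<Longrightarrow> w $ j1 = 0 \<Longrightarrow> w $ j2 = 0 \<Longrightarrow> w \<in> Mid"
  unfolding Mid_def flip_neq by blast

lemma mid_norm_zero:
  assumes "w \<in> Mid" "B (w + e k) (w + e k) = 1" "w $ k = 0" "flip k = k"
  shows "w = 0"
proof -
  have "B w w + 2 * w $ k + 1 = 1"
    using assms(2,4) B_axis(1)[where v = w and i = k] B_axis(2)[where v = w and i = k] by (simp add: B_bil B_e_e)
  then show ?thesis using assms by (simp add: B_Mid)
qed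

text \<open>The entries for \<phi>, \<eta>, x and y are coordinates on N. If they vanish,
  triangularity gives the first two columns, and the later columns follow from their
  \<open>B\<close> values with themselves and with columns already known.\<close>

lemma N_trivial:
  assumes u: "u \<in> Ngrp" and z: "u $ i1 $ i2 = 0" "u $ i1 $ j2 = 0"
    "\<And>k. flip k = k \<Longrightarrow> u $ i1 $ k = 0" "\<And>k. flip k = k \<Longrightarrow> u $ i2 $ k = 0"
  shows "u = mat 1"
proof -
  have ug: "isom u" and ut: "\<And>i j. j < i \<Longrightarrow> u $ i $ j = 0" and ud: "\<And>i. u $ i $ i = 1"
    using u by (auto simp: Ngrp_iff UT_def G_isom)
  have col: "(u *v e j) $ i = u $ i $ j" for i j by (simp add: entry_eq)
  have Bu: "B (u *v e i) (u *v e j) = B (e i) (e j)" for i j by (rule isomD[OF ug])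
  have c1: "u *v e i1 = e i1"
  proof (subst vec_eq_iff, intro allI)
    fix i show "(u *v e i1) $ i = e i1 $ i"
      using ut[of i1 i] ud[of i1] not_mid_less(1)[of i] by (cases "i = i1") (auto simp: col)
  qed
  have c2: "u *v e i2 = e i2"
  proof (subst vec_eq_iff, intro allI)
    fix i show "(u *v e i2) $ i = e i2 $ i"
      using ut[of i2 i] ud[of i2] not_mid_less(2)[of i] z(1) by (cases i i2 rule: linorder_cases) (auto simp: col)
  qed
  have ck: "u *v e k = e k" if k: "flip k = k" for k
  proof -
    have kn: "k \<noteq> i1" "k \<noteq> i2" "k \<noteq> j1" "k \<noteq> j2" using k flip_neq by auto
    define w where "w = u *v e k - e k"
    have "w $ i1 = 0" "w $ i2 = 0" using z k kn by (simp_all add: w_def col)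
    moreover have "w $ j1 = 0" "w $ j2 = 0" using ut[of k j1] ut[of k j2] midI[of k] kn by (simp_all add: w_def col)
    ultimately have "w \<in> Mid" by (rule MidI4)
    moreover have "w $ k = 0" using ud[of k] by (simp add: w_def col)
    moreover have "B (w + e k) (w + e k) = 1" using Bu[of k k] k by (simp add: w_def B_e_e)
    ultimately have "w = 0" using mid_norm_zero k by blast
    then show ?thesis by (simp add: w_def)
  qed
  have c3: "u *v e j2 = e j2"
  proof -
    define w where "w = u *v e j2"
    have w1: "w $ j2 = 1" "w $ i1 = 0" "w $ j1 = 0" using ud z(2) ut[of j2 j1] idxs_less by (simp_all add: w_def col)
    have wk: "w $ k = 0" if "flip k = k" for k
    proof -
      have "k \<noteq> i2" "j2 \<noteq> k" using that flip_neq by auto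
      then have "B w (e k) = 0" using Bu[of j2 k] ck[OF that] that by (auto simp: w_def B_e_e)
      then show ?thesis using that by (simp add: B_axis)
    qed
    define t where "t = w $ i2"
    have wt: "w = t *\<^sub>R e i2 + e j2"
    proof (subst vec_eq_iff, intro allI)
      fix i show "w $ i = (t *\<^sub>R e i2 + e j2) $ i" unfolding t_def
        using w1 wk[of i] flip_neq[of i] idxs_ne by (cases "flip i = i") auto
    qed
    have "B w w = 2 * t" unfolding wt by (simp add: B_bil)
    moreover have "B w w = 0" using Bu[of j2 j2] by (simp add: w_def)
    ultimately have "w = e j2" using wt by simp
    then show ?thesis by (simp add: w_def)
  qed
  have c4: "u *v e j1 = e j1"
  proof -
    define w where "w = u *v e j1"
    have call: "u *v e i = e i" if "i \<noteq> j1" for i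
      using that c1 c2 c3 ck[of i] flip_neq[of i] by auto
    have wi: "w $ flip i = (if i = i1 then 1 else 0)" if "i \<noteq> j1" for i
    proof -
      have "B w (e i) = B (e j1) (e i)" using Bu[of j1 i] call[OF that] by (simp add: w_def)
      then show ?thesis by (simp add: B_axis(1) B_e_e)
    qed
    define t where "t = w $ i1"
    have wt: "w = t *\<^sub>R e i1 + e j1"
    proof (subst vec_eq_iff, intro allI)
      fix i show "w $ i = (t *\<^sub>R e i1 + e j1) $ i" unfolding t_def
        using wi[of "flip i"] idxs_ne flip_neq[of i] by (cases "i = i1"; cases "i = j1") (auto simp: flip_flip)
    qed
    have "B w w = 2 * t" unfolding wt by (simp add: B_bil)
    moreover have "B w w = 0" using Bu[of j1 j1] by (simp add: w_def)
    ultimately have "w = e j1" using wt by simp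
    then show ?thesis by (simp add: w_def)
  qed
  have "u *v e i = e i" for i using c1 c2 c3 c4 ck[of i] flip_neq[of i] by auto
  then show ?thesis by (auto simp: vec_eq_iff entry_eq mat_def axis_def)
qed

definition mrow :: "(real, 'm) vec \<Rightarrow> (real, 'm) vec" where "mrow v = (\<chi> i. if flip i = i then v $ i else 0)"

lemma mrow_Mid [simp]: "mrow v \<in> Mid" by (simp add: mrow_def Mid_def)

lemma N_eich: "x \<in> Mid \<Longrightarrow> eich (e i1) (\<phi> *\<^sub>R e j2 + x + \<eta> *\<^sub>R e i2) \<in> Ngrp" "y \<in> Mid \<Longrightarrow> eich (e i2) y \<in> Ngrp"
proof -
  have UTz: "X \<in> UT" if "\<And>i j. X $ i $ j \<noteq> 0 \<Longrightarrow> i \<le> j" for X :: "'m sqmat"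
    using that by (force simp: UT_def)
  show "eich (e i1) (\<phi> *\<^sub>R e j2 + x + \<eta> *\<^sub>R e i2) \<in> Ngrp" if x: "x \<in> Mid"
  proof -
    have ut: "nn \<phi> x 0 \<eta> \<in> UT"
      using x idxs_less midI by (auto simp: UT_def nn_nth subspace_0[OF subspace_Mid] Mid_def not_mid_less dest: less_imp_neq) 
    have "nn \<phi> x 0 \<eta> $ i $ i = 0" for i using x idxs_ne by (auto simp: nn_nth subspace_0[OF subspace_Mid])
    then show ?thesis
      using exp_UT[OF ut] G_eich[of "e i1" "\<phi> *\<^sub>R e j2 + x + \<eta> *\<^sub>R e i2"] x unfolding exp_nn1[OF x] Ngrp_iff by (simp add: B_bil)
  qed
  show "eich (e i2) y \<in> Ngrp" if y: "y \<in> Mid"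
  proof -
    have ut: "nn 0 0 y 0 \<in> UT"
      using y idxs_less midI by (auto simp: UT_def nn_nth subspace_0[OF subspace_Mid] Mid_def not_mid_less dest: less_imp_neq)
    have "nn 0 0 y 0 $ i $ i = 0" for i using y idxs_ne by (auto simp: nn_nth subspace_0[OF subspace_Mid])
    then show ?thesis
      using exp_UT[OF ut] G_eich[of "e i2" "y"] y exp_nn2[OF y, of 0] unfolding Ngrp_iff by (simp add: B_bil)
  qed
qed

text \<open>Cancelling the \<open>e i1\<close> factor and then the \<open>e i2\<close> factor by
  right multiplication makes all coordinates vanish, so that \<open>N_trivial\<close>
  applies.\<close>

lemma N_param:
  assumes u: "u \<in> Ngrp"
  shows "u = eich (e i2) (mrow (u $ i2)) ** eich (e i1) (u $ i1 $ i2 *\<^sub>R e j2 + mrow (u $ i1) + u $ i1 $ j2 *\<^sub>R e i2)"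
proof -
  define x y \<phi> \<eta> where "x = mrow (u $ i1)" and "y = mrow (u $ i2)" and "\<phi> = u $ i1 $ i2" and "\<eta> = u $ i1 $ j2"
  have xy: "x \<in> Mid" "y \<in> Mid" by (simp_all add: x_def y_def)
  let ?m = "\<phi> *\<^sub>R e j2 + x + \<eta> *\<^sub>R e i2"
  have c: "(u *v e j) $ i = u $ i $ j" for i j by (simp add: entry_eq)
  have ut: "\<And>i j. j < i \<Longrightarrow> u $ i $ j = 0" "\<And>i. u $ i $ i = 1" using u by (auto simp: Ngrp_iff UT_def)
  have ue1: "u *v e i1 = e i1"
  proof (subst vec_eq_iff, intro allI)
    fix i show "(u *v e i1) $ i = e i1 $ i"
      using ut(1)[of i1 i] ut(2)[of i1] not_mid_less(1)[of i] by (cases "i = i1") (auto simp: c)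
  qed
  define v where "v = u ** eich (e i1) (- \<phi> *\<^sub>R e j2 + (- x) + (- \<eta>) *\<^sub>R e i2)"
  have mx: "- x \<in> Mid" "- y \<in> Mid" using xy by (auto intro: subspace_neg[OF subspace_Mid])
  have vN: "v \<in> Ngrp" unfolding v_def by (rule N_mult[OF u]) (rule N_eich(1)[OF mx(1)])
  have vcol: "v *v e j = u *v e j - B (e j) ?m *\<^sub>R e i1" if "j \<noteq> j1" for j
  proof -
    have "B (e j) (e i1) = 0" using that flip_idxs(4) flip_flip by (auto simp: B_e_e)
    then show ?thesis
      by (simp add: v_def eich_apply ue1 B_bil matrix_vector_mult_diff_distrib matrix_vector_right_distrib matrix_vector_mult_scaleR
          algebra_simps flip: matrix_vector_mul_assoc)
  qed
  have Bx: "B (e k) x = x $ k" if "flip k = k" for k using that by (simp add: B_axis)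
  have v0: "v $ i1 $ i2 = 0" "v $ i1 $ j2 = 0" "\<And>k. flip k = k \<Longrightarrow> v $ i1 $ k = 0" "\<And>k. flip k = k \<Longrightarrow> v $ i2 $ k = y $ k"
  proof -
    show "v $ i1 $ i2 = 0" "v $ i1 $ j2 = 0"
      using vcol[of i2] vcol[of j2] idxs_ne xy by (simp_all add: entry_eq B_bil c \<phi>_def \<eta>_def flip: c)
    fix k :: 'm assume k: "flip k = k"
    then have kn: "k \<noteq> i1" "k \<noteq> i2" "k \<noteq> j1" "k \<noteq> j2" using flip_neq by auto
    then have B0: "B (e k) (e j2) = 0" "B (e k) (e i2) = 0" using k by (auto simp: B_e_e)
    show "v $ i1 $ k = 0" "v $ i2 $ k = y $ k"
      using vcol[of k] kn idxs_ne k B0 Bx[OF k]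
      by (simp_all add: entry_eq B_bil x_def y_def mrow_def)
  qed
  have ve2: "v *v e i2 = e i2"
  proof (subst vec_eq_iff, intro allI)
    have vt: "\<And>i j. j < i \<Longrightarrow> v $ i $ j = 0" "\<And>i. v $ i $ i = 1" using vN by (auto simp: Ngrp_iff UT_def)
    fix i show "(v *v e i2) $ i = e i2 $ i"
      using vt(1)[of i2 i] vt(2)[of i2] not_mid_less(2)[of i] v0(1) by (cases i i2 rule: linorder_cases) (auto simp: entry_eq[symmetric])
  qed
  define w where "w = v ** eich (e i2) (- y)"
  have wN: "w \<in> Ngrp" unfolding w_def by (intro N_mult vN N_eich mx)
  have "w = mat 1"
  proof (rule N_trivial[OF wN])
    have w2: "w *v e i2 = e i2" using mx ve2 by (simp add: w_def eich_apply flip: matrix_vector_mul_assoc)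
    show "w $ i1 $ i2 = 0" using w2 idxs_ne by (simp add: entry_eq)
    have wk: "w *v e k = v *v e k - y $ k *\<^sub>R e i2" if k: "flip k = k" for k
    proof -
      have "k \<noteq> i2" "k \<noteq> j2" using k flip_neq by auto
      then have "B (e k) (e i2) = 0" "B (e k) y = y $ k" using k by (auto simp: B_e_e B_axis)
      then show ?thesis
        by (simp add: w_def eich_apply ve2 B_bil matrix_vector_mult_diff_distrib matrix_vector_mult_scaleR flip: matrix_vector_mul_assoc)
    qed
    show "w $ i1 $ k = 0" "w $ i2 $ k = 0" if "flip k = k" for k
      using wk[OF that] v0(3,4)[OF that] idxs_ne by (simp_all add: entry_eq)
    have "w *v e j2 = v *v e j2 + v *v y - (B y y / 2) *\<^sub>R e i2"
      using xy by (simp add: w_def eich_apply ve2 B_bil matrix_vector_mult_diff_distrib matrix_vector_right_distrib matrix_vector_mult_scaleR flip: matrix_vector_mul_assoc)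
    moreover have "(v *v y) $ i1 = 0"
    proof -
      have "v $ i1 $ j * y $ j = 0" for j using v0(3)[of j] xy(2) by (cases "flip j = j") (auto simp: Mid_def)
      then show ?thesis by (auto simp: matrix_vector_mult_def intro!: sum.neutral)
    qed
    ultimately show "w $ i1 $ j2 = 0" using v0(2) idxs_ne by (simp add: entry_eq)
  qed
  have "eich (e i2) (- y) ** eich (e i2) y = mat 1" using xy by (subst eich_add) (simp_all add: B_bil)
  moreover have "w ** eich (e i2) y = v ** (eich (e i2) (- y) ** eich (e i2) y)" by (simp add: w_def matrix_mul_assoc)
  ultimately have v1: "v = eich (e i2) y" using \<open>w = mat 1\<close> by simp
  have "eich (e i1) (- \<phi> *\<^sub>R e j2 + (- x) + (- \<eta>) *\<^sub>R e i2) ** eich (e i1) ?m = mat 1"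
    using xy by (subst eich_add) (simp_all add: B_bil)
  moreover have "v ** eich (e i1) ?m = u ** (eich (e i1) (- \<phi> *\<^sub>R e j2 + (- x) + (- \<eta>) *\<^sub>R e i2) ** eich (e i1) ?m)"
    by (simp add: v_def matrix_mul_assoc)
  ultimately have "u = v ** eich (e i1) ?m" by simp
  then show ?thesis using v1 unfolding x_def y_def \<phi>_def \<eta>_def by simp
qed

text \<open>The filtration of the matrix algebra by height: the part of height at least k of the Lie algebra
  of N spans its lower central series, and it is stable under conjugation by upper triangular matrices.\<close>

definition deg :: "'m \<Rightarrow> int" where
  "deg i = (if i = i1 then 2 else if i = i2 then 1 else if i = j2 then -1 else if i = j1 then -2 else 0)"

definition F :: "int \<Rightarrow> 'm sqmat set" where "F k = {M. \<forall>i j. M $ i $ j \<noteq> 0 \<longrightarrow> deg i - deg j \<ge> k}"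

lemma deg_simps [simp]: "deg i1 = 2" "deg i2 = 1" "deg j2 = -1" "deg j1 = -2"
  using idxs_ne by (simp_all add: deg_def)

lemma deg_mid: "flip i = i \<Longrightarrow> deg i = 0"
  using flip_neq[of i] by (auto simp: deg_def)

lemma subspace_F: "subspace (F k)"
  unfolding subspace_def F_def by (auto, metis add.right_neutral)

lemma F_mono: "M \<in> F k \<Longrightarrow> l \<le> k \<Longrightarrow> M \<in> F l"
  unfolding F_def by (auto intro: order_trans)

lemma F_mult: assumes "M \<in> F k" "N \<in> F l" shows "M ** N \<in> F (k + l)"
  unfolding F_def
proof (intro CollectI allI impI)
  fix i j assume "(M ** N) $ i $ j \<noteq> 0"
  then obtain a where "M $ i $ a * N $ a $ j \<noteq> 0"
    unfolding matrix_matrix_mult_def by (auto elim: sum.not_neutral_contains_not_neutral)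
  then have "deg i - deg a \<ge> k" "deg a - deg j \<ge> l" using assms by (auto simp: F_def)
  then show "deg i - deg j \<ge> k + l" by simp
qed

lemma F_mult0: "M \<in> F 0 \<Longrightarrow> N \<in> F k \<Longrightarrow> M ** N \<in> F k" "N \<in> F k \<Longrightarrow> M \<in> F 0 \<Longrightarrow> N ** M \<in> F k"
  using F_mult[of M 0 N k] F_mult[of N k M 0] by simp_all

lemma deg_antimono: "i \<le> j \<Longrightarrow> deg j \<le> deg i"
proof -
  assume "i \<le> j"
  moreover have "deg j \<le> deg i" if "i < j"
    using that midI[of i] midI[of j] not_mid_less[of i] not_mid_less[of j] idxs_less
    unfolding deg_def by (smt (verit, best) less_asym less_irrefl)
  ultimately show ?thesis by (cases "i = j") auto
qed

lemma UT_F0: "M \<in> UT \<Longrightarrow> M \<in> F 0"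
  unfolding UT_def F_def using deg_antimono by (force simp: not_less)

lemma five: "i = i1 \<or> i = i2 \<or> i = j2 \<or> i = j1 \<or> flip i = i" for i :: 'm
  using flip_neq[of i] by auto

lemma mid_ne: "k \<noteq> i1" "k \<noteq> i2" "k \<noteq> j2" "k \<noteq> j1" "i1 \<noteq> k" "i2 \<noteq> k" "j2 \<noteq> k" "j1 \<noteq> k" if "flip k = k" for k :: 'm
  using that flip_neq[of k] by auto

lemma F_nn:
  assumes "x \<in> Mid" "y \<in> Mid" "k \<le> 3" "k > 1 \<Longrightarrow> \<phi> = 0 \<and> y = 0" "k > 2 \<Longrightarrow> x = 0"
  shows "nn \<phi> x y \<eta> \<in> F k"
  unfolding F_def
proof (intro CollectI allI impI)
  fix i j assume nz: "nn \<phi> x y \<eta> $ i $ j \<noteq> 0"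
  show "k \<le> deg i - deg j"
  proof (rule ccontr)
    assume "\<not> ?thesis"
    then have lt: "deg i - deg j < k" by simp
    have "nn \<phi> x y \<eta> $ i $ j = 0"
      unfolding nn_nth[OF assms(1,2)]
      using five[of i] five[of j] lt assms idxs_ne
      by (elim disjE) (simp_all add: deg_mid[of i] deg_mid[of j] mid_ne[of i] mid_ne[of j])
    then show False using nz by simp
  qed
qed

lemma nn_F1: "x \<in> Mid \<Longrightarrow> y \<in> Mid \<Longrightarrow> nn \<phi> x y \<eta> \<in> F 1"
  by (rule F_nn) auto

text \<open>The roots alpha and beta have height 1, alpha + beta has height 2 and alpha + 2 beta has
  height 3.\<close>

lemma nn_F:
  assumes "x \<in> Mid" "y \<in> Mid"
  shows "nn \<phi> x y \<eta> \<in> F 2 \<longleftrightarrow> \<phi> = 0 \<and> y = 0" "nn \<phi> x y \<eta> \<in> F 3 \<longleftrightarrow> \<phi> = 0 \<and> y = 0 \<and> x = 0"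
    "nn \<phi> x y \<eta> \<in> F 4 \<longleftrightarrow> \<phi> = 0 \<and> y = 0 \<and> x = 0 \<and> \<eta> = 0"
proof -
  let ?M = "nn \<phi> x y \<eta>"
  have e: "?M $ i1 $ i2 = \<phi>" "?M $ i1 $ j2 = \<eta>" "\<And>k. flip k = k \<Longrightarrow> ?M $ i1 $ k = x $ k" "\<And>k. flip k = k \<Longrightarrow> ?M $ i2 $ k = y $ k"
    using assms idxs_ne flip_neq by (auto simp: nn_nth)
  have F: "?M $ i $ j = 0" if "?M \<in> F k" "deg i - deg j < k" for i j k
    using that unfolding F_def by force
  have v0: "v = 0" if "v \<in> Mid" "\<And>k. flip k = k \<Longrightarrow> v $ k = 0" for v
    using that unfolding Mid_def by (auto simp: vec_eq_iff)
  have 2: "?M \<in> F 2 \<Longrightarrow> \<phi> = 0 \<and> y = 0"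
  proof
    assume M: "?M \<in> F 2"
    show "\<phi> = 0" using F[OF M, of i1 i2] e(1) by simp
    show "y = 0" using F[OF M, of i2] e(4) deg_mid by (intro v0[OF assms(2)]) auto
  qed
  have 3: "?M \<in> F 3 \<Longrightarrow> x = 0"
    using e v0[OF assms(1)] F[of 3 i1] by (auto simp: deg_mid)
  have 4: "?M \<in> F 4 \<Longrightarrow> \<eta> = 0" using F[of 4 i1 j2] e by auto
  have m0: "0 \<in> Mid" by (rule subspace_0[OF subspace_Mid])
  have b2: "nn 0 x 0 \<eta> \<in> F 2" and b3: "nn 0 0 0 \<eta> \<in> F 3"
    using F_nn assms m0 by auto
  show "?M \<in> F 2 \<longleftrightarrow> \<phi> = 0 \<and> y = 0" using 2 b2 by auto
  show "?M \<in> F 3 \<longleftrightarrow> \<phi> = 0 \<and> y = 0 \<and> x = 0" using 2 3 F_mono[of ?M 3 2] b3 by auto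
  show "?M \<in> F 4 \<longleftrightarrow> \<phi> = 0 \<and> y = 0 \<and> x = 0 \<and> \<eta> = 0"
    using 2 3 4 F_mono[of ?M 4 2] F_mono[of ?M 4 3] subspace_0[OF subspace_F, of 4] by auto
qed

lemma eich_F1:
  assumes "B u u = 0" "B u v = 0" "wedge u v \<in> F 1" shows "eich u v - mat 1 \<in> F 1"
proof -
  have "wedge u v ** wedge u v \<in> F 1" using F_mono[OF F_mult[OF assms(3) assms(3)]] by simp
  then have "wedge u v + (1/2) *\<^sub>R (wedge u v ** wedge u v) \<in> F 1"
    by (intro subspace_add[OF subspace_F] subspace_scale[OF subspace_F] assms)
  then show ?thesis using eich_wedge(2)[OF assms(1,2)] by simp
qed

lemma N_F1: assumes "u \<in> Ngrp" shows "u - mat 1 \<in> F 1"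
proof -
  let ?y = "mrow (u $ i2)" and ?x = "mrow (u $ i1)" and ?f = "u $ i1 $ i2" and ?h = "u $ i1 $ j2"
  let ?Y = "eich (e i2) ?y" and ?M = "eich (e i1) (?f *\<^sub>R e j2 + ?x + ?h *\<^sub>R e i2)"
  have m0: "0 \<in> Mid" by (rule subspace_0[OF subspace_Mid])
  have 1: "?Y - mat 1 \<in> F 1"
    using nn_F1[OF m0, of ?y 0 0] by (intro eich_F1) (simp_all add: nn2_eq)
  have 2: "?M - mat 1 \<in> F 1"
    using nn_F1[OF _ m0, of ?x ?f ?h] by (intro eich_F1) (simp_all add: nn_def wedge_bil B_bil)
  have "u - mat 1 = (?Y - mat 1) ** (?M - mat 1) + ((?Y - mat 1) + (?M - mat 1))"
    using N_param[OF assms] by (simp add: bounded_bilinear.diff_left[OF bounded_bilinear_matrix_mult] bounded_bilinear.diff_right[OF bounded_bilinear_matrix_mult])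
  moreover have "(?Y - mat 1) ** (?M - mat 1) \<in> F 1" using F_mono[OF F_mult[OF 1 2]] by simp
  ultimately show ?thesis using 1 2 by (simp only:) (intro subspace_add[OF subspace_F])
qed

section \<open>Lie algebras of subgroups of AN\<close>

lemma bounded_linear_iv: "bounded_linear iv"
proof -
  have "linear iv" by (rule linearI) (simp_all add: iv_def vec_eq_iff)
  then show ?thesis by (rule linear_conv_bounded_linear[THEN iffD1])
qed

text \<open>The product of exp (t X) with its adjoint is constantly 1; the claim is the derivative
  of this at 0.\<close>

lemma lie_algebra_skew:
  assumes "\<And>t. matrix_exp (t *\<^sub>R X) \<in> G"
  shows "iv X = - X"
proof -
  let ?F = "\<lambda>t. iv (matrix_exp (t *\<^sub>R X)) ** matrix_exp (t *\<^sub>R X)"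
  have "?F = (\<lambda>t. mat 1)" using isom_iv_left[OF G_isom[OF assms]] by auto
  then have "(?F has_vector_derivative 0) (at 0)" by simp
  moreover have "iv (mat 1) = mat 1" using isom_iv_left[OF isom_one] by simp
  then have "(?F has_vector_derivative (X + iv X)) (at 0)"
    using bounded_bilinear.has_vector_derivative[OF bounded_bilinear_matrix_mult
        bounded_linear.has_vector_derivative[OF bounded_linear_iv matrix_exp_has_vector_derivative_0[of X]]
        matrix_exp_has_vector_derivative_0[of X]] by simp
  ultimately have "X + iv X = 0" by (rule vector_derivative_unique_at[rotated])
  then show ?thesis by (simp add: add_eq_0_iff)
qed

lemma lie_algebra_UT:
  assumes "\<And>t. matrix_exp (t *\<^sub>R X) \<in> UT"
  shows "X \<in> UT"
  by (rule subspace_has_vector_derivative[OF subspace_UT matrix_exp_has_vector_derivative_0])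
    (intro subspace_diff[OF subspace_UT] assms)

text \<open>Skewness ties each entry to its mirror image under \<open>flip\<close>. The middle block
  is both skew and upper triangular, hence zero, and the entries that are their own mirror images
  vanish.\<close>

lemma zz_nn_form:
  assumes "iv X = - X" "X \<in> UT"
  shows "X = zz (X $ i1 $ i1) (X $ i2 $ i2) + nn (X $ i1 $ i2) (mrow (X $ i1)) (mrow (X $ i2)) (X $ i1 $ j2)"
proof -
  have s: "X $ flip j $ flip i = - X $ i $ j" for i j
    using arg_cong[OF assms(1), of "\<lambda>M. M $ i $ j"] by (simp add: iv_def)
  have ut: "X $ i $ j = 0" if "j < i" for i j using assms(2) that by (simp add: UT_def)
  have mk: "i1 < k" "i2 < k" "k < j2" "k < j1" if "flip k = k" for k :: 'm using that midI[of k] flip_neq[of k] by auto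
  have mm: "X $ k $ l = 0" if "flip k = k" "flip l = l" for k l
    using s[of l k] s[of k l] that ut[of k l] ut[of l k] by (cases k l rule: linorder_cases) auto
  have sp: "X $ i1 $ j1 = 0" "X $ i2 $ j2 = 0" "X $ i2 $ j1 = - X $ i1 $ j2" "X $ j2 $ j2 = - X $ i2 $ i2"
    "X $ j1 $ j1 = - X $ i1 $ i1" "X $ j2 $ j1 = - X $ i1 $ i2"
  proof -
    have "X $ flip j1 $ flip i1 = - X $ i1 $ j1" "X $ flip j2 $ flip i2 = - X $ i2 $ j2" "X $ flip j2 $ flip i1 = - X $ i1 $ j2"
      "X $ flip i2 $ flip i2 = - X $ i2 $ i2" "X $ flip i1 $ flip i1 = - X $ i1 $ i1" "X $ flip i2 $ flip i1 = - X $ i1 $ i2"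
      by (rule s)+
    then show "X $ i1 $ j1 = 0" "X $ i2 $ j2 = 0" "X $ i2 $ j1 = - X $ i1 $ j2" "X $ j2 $ j2 = - X $ i2 $ i2"
      "X $ j1 $ j1 = - X $ i1 $ i1" "X $ j2 $ j1 = - X $ i1 $ i2" unfolding flip_idxs by linarith+
  qed
  have sk: "X $ k $ j2 = - X $ i2 $ k" "X $ k $ j1 = - X $ i1 $ k" if "flip k = k" for k
    using s[of j2 k] s[of j1 k] that by simp_all
  note low = ut[OF idxs_less(1)] ut[OF idxs_less(2)] ut[OF idxs_less(3)] ut[OF idxs_less(4)] ut[OF idxs_less(5)] ut[OF idxs_less(6)]
  have lk: "X $ k $ i1 = 0" "X $ k $ i2 = 0" "X $ j2 $ k = 0" "X $ j1 $ k = 0" if "flip k = k" for k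
    using ut mk[OF that] by blast+
  have r: "mrow v $ i1 = 0" "mrow v $ i2 = 0" "mrow v $ j1 = 0" "mrow v $ j2 = 0" "flip k = k \<Longrightarrow> mrow v $ k = v $ k" for v k
    using idxs_ne by (simp_all add: mrow_def)
  show ?thesis
  proof (subst vec_eq_iff, intro allI, subst vec_eq_iff, intro allI)
    fix i j :: 'm
    show "X $ i $ j = (zz (X $ i1 $ i1) (X $ i2 $ i2) + nn (X $ i1 $ i2) (mrow (X $ i1)) (mrow (X $ i2)) (X $ i1 $ j2)) $ i $ j"
      using five[of i] five[of j] sp low idxs_ne
      by (elim disjE) (simp_all add: zz_nth nn_nth r mid_ne[of i] mid_ne[of j] lk sk mm)
  qed
qed

end

section \<open>Subgroups with one-dimensional torus part\<close>

context so2 begin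

lemma N_iv: assumes n: "n \<in> Ngrp" shows "iv n \<in> Ngrp"
proof -
  have nG: "n \<in> G" using n by (simp add: Ngrp_iff)
  have y: "- mrow (n $ i2) \<in> Mid" "- mrow (n $ i1) \<in> Mid" by (auto intro: subspace_neg[OF subspace_Mid])
  let ?Y = "eich (e i2) (mrow (n $ i2))" and ?M = "eich (e i1) (n $ i1 $ i2 *\<^sub>R e j2 + mrow (n $ i1) + n $ i1 $ j2 *\<^sub>R e i2)"
  let ?Y' = "eich (e i2) (- mrow (n $ i2))" and ?M' = "eich (e i1) ((- n $ i1 $ i2) *\<^sub>R e j2 + (- mrow (n $ i1)) + (- n $ i1 $ j2) *\<^sub>R e i2)"
  have inv: "?Y ** ?Y' = mat 1" "?M ** ?M' = mat 1" by (subst eich_add; simp add: B_bil)+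
  have cancel: "A ** C ** (C' ** A') = mat 1" if "A ** A' = mat 1" "C ** C' = mat 1" for A A' C C' :: "'m sqmat"
    using that by (metis matrix_mul_assoc matrix_mul_rid)
  have "n ** (?M' ** ?Y') = mat 1"
    using cancel[OF inv] by (simp only: N_param[OF n, symmetric])
  then have "iv n = ?M' ** ?Y'" using matrix_inverse_unique isom_iv_left[OF G_isom[OF nG]] by metis
  then show ?thesis using N_mult N_eich y by metis
qed

lemma a2_inject: "a2 i1 i2 a b = a2 i1 i2 c d \<Longrightarrow> a = c \<and> b = d"
proof -
  assume eq: "a2 i1 i2 a b = a2 i1 i2 c d"
  have "a2 i1 i2 a b $ i1 $ i1 = a2 i1 i2 c d $ i1 $ i1" "a2 i1 i2 a b $ i2 $ i2 = a2 i1 i2 c d $ i2 $ i2"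
    using eq by simp_all
  then show ?thesis using idxs_ne by (simp add: a2_nth)
qed

lemma iv_F: "M \<in> F k \<Longrightarrow> iv M \<in> F k"
proof -
  have "deg (flip i) = - deg i" for i using five[of i] deg_mid[of i] by (elim disjE) simp_all
  then show "M \<in> F k \<Longrightarrow> iv M \<in> F k" by (force simp: F_def iv_def)
qed

lemma a2_e: "a2 i1 i2 a b *v e i1 = exp a *\<^sub>R e i1" "a2 i1 i2 a b *v e i2 = exp b *\<^sub>R e i2" "a2 i1 i2 a b *v e j2 = exp (- b) *\<^sub>R e j2"
  "v \<in> Mid \<Longrightarrow> a2 i1 i2 a b *v v = v"
  using idxs_ne by (simp_all add: a2_apply algebra_simps)

lemma a2_nn:
  assumes "x \<in> Mid" "y \<in> Mid"
  shows "a2 i1 i2 a b ** nn \<phi> x y \<eta> ** a2 i1 i2 (- a) (- b) = nn (exp (a - b) * \<phi>) (exp a *\<^sub>R x) (exp b *\<^sub>R y) (exp (a + b) * \<eta>)"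
proof -
  have i: "isom (a2 i1 i2 a b)" using G_a2 G_isom by blast
  have "a2 i1 i2 a b ** nn \<phi> x y \<eta> = nn (exp (a - b) * \<phi>) (exp a *\<^sub>R x) (exp b *\<^sub>R y) (exp (a + b) * \<eta>) ** a2 i1 i2 a b"
  proof -
    let ?A = "a2 i1 i2 a b" and ?m = "\<phi> *\<^sub>R e j2 + x + \<eta> *\<^sub>R e i2"
    have "?A ** nn \<phi> x y \<eta> = wedge (?A *v e i1) (?A *v ?m) ** ?A + wedge (?A *v e i2) (?A *v y) ** ?A"
      unfolding nn_def by (simp add: matrix_add_ldistrib conj_wedge[OF i])
    also have "\<dots> = (wedge (?A *v e i1) (?A *v ?m) + wedge (?A *v e i2) (?A *v y)) ** ?A"
      by (simp only: bounded_bilinear.add_left[OF bounded_bilinear_matrix_mult])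
    also have "wedge (?A *v e i1) (?A *v ?m) + wedge (?A *v e i2) (?A *v y)
        = nn (exp (a - b) * \<phi>) (exp a *\<^sub>R x) (exp b *\<^sub>R y) (exp (a + b) * \<eta>)"
      using assms unfolding nn_def
      by (simp add: a2_e matrix_vector_right_distrib matrix_vector_mult_scaleR wedge_bil exp_add exp_diff exp_minus divide_inverse mult_ac scaleR_right_distrib)
    finally show ?thesis .
  qed
  then have "a2 i1 i2 a b ** nn \<phi> x y \<eta> ** a2 i1 i2 (- a) (- b)
     = nn (exp (a - b) * \<phi>) (exp a *\<^sub>R x) (exp b *\<^sub>R y) (exp (a + b) * \<eta>) ** (a2 i1 i2 a b ** a2 i1 i2 (- a) (- b))"
    by (simp add: matrix_mul_assoc)
  then show ?thesis by (simp add: a2_add)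
qed

lemma zz_a2: "zz a b ** a2 i1 i2 c d = a2 i1 i2 c d ** zz a b"
  by (auto simp: vec_eq_iff matrix_matrix_mult_def zz_nth a2_nth if_distrib[of "\<lambda>c. c * _"] cong: if_cong)

end

text \<open>In the logarithmic coordinates ln a1, ln a2 the four directions in \<open>zcase\<close>
  span the kernels of alpha, beta, alpha + beta and alpha + 2 beta, in this order.\<close>

locale solv = so2 ty for ty :: "'m::{finite,linorder} itself" +
  fixes H :: "'m sqmat set" and z1 z2 :: real
  assumes sub: "subgroup H SO2" and AN: "H \<subseteq> ANgrp" and closedinH: "closedin (top_of_set ANgrp) H" and conn: "connected H"
    and zcase: "(z1, z2) \<in> {(1, 1), (1, 0), (0, 1), (1, -1)}"
    and T: "Tpart H = {a2 i1 i2 (s * z1) (s * z2) | s. True}"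
    and compat: "compatible_with_A H"
begin

lemma H_props: "mat 1 \<in> H" "\<And>a b. a \<in> H \<Longrightarrow> b \<in> H \<Longrightarrow> a ** b \<in> H" "\<And>a. a \<in> H \<Longrightarrow> iv a \<in> H"
  using sub unfolding subgroup_SO2_iff by blast+

lemma H_UT: "a \<in> H \<Longrightarrow> a \<in> UT" and H_G: "a \<in> H \<Longrightarrow> a \<in> G" and H_isom: "a \<in> H \<Longrightarrow> isom a"
  using AN AN_UT G_isom by blast+

sublocale closed_matrix_group H
proof
  show "closed H" using closedinH closed_AN closedin_closed_trans by blast
  show "\<exists>B\<in>H. A ** B = mat 1 \<and> B ** A = mat 1" if "A \<in> H" for A
    using H_props(3)[OF that] isom_iv_left[OF H_isom[OF that]] isom_iv_right[OF H_isom[OF that]] by blast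
qed (use H_props in auto)

abbreviation h where "h \<equiv> lie_algebra H"
text \<open>Plays the role of the Lie algebra of H \<inter> N; its exponentials generate that group
  by \<open>HN_gen\<close>.\<close>

definition u where "u = {X \<in> h. X $ i1 $ i1 = 0 \<and> X $ i2 $ i2 = 0}"
text \<open>The coordinate of the diagonal part along (z1, z2), written as an orthogonal projection
  so that one linear formula serves all four directions.\<close>

definition l where "l X = (z1 * X $ i1 $ i1 + z2 * X $ i2 $ i2) / (z1\<^sup>2 + z2\<^sup>2)"

lemma z_nz: "z1\<^sup>2 + z2\<^sup>2 \<noteq> 0" using zcase by auto

lemma h_UT: "X \<in> h \<Longrightarrow> X \<in> UT"
  using lie_algebra_UT H_UT lie_algebra_exp by blast

lemma h_form: "X \<in> h \<Longrightarrow> X = zz (X $ i1 $ i1) (X $ i2 $ i2) + nn (X $ i1 $ i2) (mrow (X $ i1)) (mrow (X $ i2)) (X $ i1 $ j2)"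
  using zz_nn_form[OF lie_algebra_skew h_UT] H_G lie_algebra_exp by blast

lemma T_of_H:
  assumes "g \<in> H"
  shows "\<exists>s n. n \<in> Ngrp \<and> g = a2 i1 i2 (s * z1) (s * z2) ** n \<and> ln (g $ i1 $ i1) = s * z1 \<and> ln (g $ i2 $ i2) = s * z2"
proof -
  obtain n where n: "n \<in> Ngrp" "g = a2 i1 i2 (ln (g $ i1 $ i1)) (ln (g $ i2 $ i2)) ** n"
    using AN_decomp assms AN by blast
  have nG: "n \<in> G" "n \<in> UT" "\<And>i. n $ i $ i = 1" using n by (auto simp: Ngrp_iff)
  have "g ** iv n = a2 i1 i2 (ln (g $ i1 $ i1)) (ln (g $ i2 $ i2)) ** (n ** iv n)" using n(2) by (metis matrix_mul_assoc)
  then have a: "a2 i1 i2 (ln (g $ i1 $ i1)) (ln (g $ i2 $ i2)) = g ** iv n" using isom_iv_right[OF G_isom[OF nG(1)]] by simp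
  have "iv n = a2 i1 i2 0 0 ** iv n" by simp
  have ivN: "iv n \<in> Ngrp" by (rule N_iv[OF n(1)])
  have "a2 i1 i2 (ln (g $ i1 $ i1)) (ln (g $ i2 $ i2)) \<in> Tpart H"
    unfolding Tpart_def
  proof
    show "a2 i1 i2 (ln (g $ i1 $ i1)) (ln (g $ i2 $ i2)) \<in> Agrp" unfolding Agrp_eq by blast
    show "a2 i1 i2 (ln (g $ i1 $ i1)) (ln (g $ i2 $ i2)) \<in> H <#>\<^bsub>SO2\<^esub> Ngrp"
      unfolding a using assms ivN by auto
  qed
  then obtain s where "a2 i1 i2 (ln (g $ i1 $ i1)) (ln (g $ i2 $ i2)) = a2 i1 i2 (s * z1) (s * z2)" unfolding T by blast
  then show ?thesis using n a2_inject by metis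
qed

lemma h_diag:
  assumes "X \<in> h"
  shows "X $ i1 $ i1 = l X * z1" "X $ i2 $ i2 = l X * z2"
proof -
  obtain s where s: "ln (matrix_exp X $ i1 $ i1) = s * z1" "ln (matrix_exp X $ i2 $ i2) = s * z2"
    using T_of_H[OF lie_algebra_exp1[OF assms]] by blast
  then have X: "X $ i1 $ i1 = s * z1" "X $ i2 $ i2 = s * z2" using exp_UT(2)[OF h_UT[OF assms]] by simp_all
  then have "l X = s" unfolding l_def X using z_nz by (simp add: field_simps power2_eq_square)
  then show "X $ i1 $ i1 = l X * z1" "X $ i2 $ i2 = l X * z2" using X by simp_all
qed

lemma linear_l: "linear l"
  unfolding l_def by (rule linearI) (simp_all add: field_simps add_divide_distrib)

lemma l_conj:
  assumes "P \<in> H" "P ** Q = mat 1" "X \<in> h"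
  shows "l (P ** X ** Q) = l X"
proof -
  have PU: "P \<in> UT" "Q \<in> UT" "X \<in> UT" using assms H_UT h_UT inverse_H by blast+
  have "P $ i $ i * Q $ i $ i = 1" for i using UT_mult(2)[OF PU(1,2), of i] assms(2) by (simp add: mat_def)
  then have "(P ** X ** Q) $ i $ i = X $ i $ i" for i
    using UT_mult PU by (simp add: mult.commute mult.left_commute)
  then show ?thesis by (simp add: l_def)
qed

text \<open>If \<open>l\<close> vanished on the Lie algebra, connectedness would give all elements
  of \<open>H\<close> the first two diagonal entries 1, against the description of T.\<close>

lemma l_surj: "\<exists>Z\<in>h. l Z = 1"
proof (rule ccontr)
  assume no: "\<not> ?thesis"
  have "l X = 0" if "X \<in> h" for X
  proof (rule ccontr)
    assume "l X \<noteq> 0"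
    then have "l ((1 / l X) *\<^sub>R X) = 1" by (simp add: linear_scale[OF linear_l])
    then show False using no that lie_algebra_scaleR by blast
  qed
  then have d: "X $ i1 $ i1 = 0" "X $ i2 $ i2 = 0" if "X \<in> h" for X using h_diag[OF that] that by auto
  have all: "g \<in> UT \<and> g $ i1 $ i1 = 1 \<and> g $ i2 $ i2 = 1" if "g \<in> mgen (matrix_exp ` h)" for g
    using that
  proof induction
    case one then show ?case using UT_one by (simp add: mat_def)
  next
    case (step A B)
    then obtain Y where "Y \<in> h" "B = matrix_exp Y" by blast
    then show ?case using step UT_mult exp_UT h_UT d by simp
  qed
  have "a2 i1 i2 (1 * z1) (1 * z2) \<in> Tpart H" unfolding T by blast
  then obtain g n where g: "g \<in> H" "n \<in> Ngrp" "a2 i1 i2 z1 z2 = g ** n" by (auto simp: Tpart_def)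
  have gU: "g \<in> UT" "g $ i1 $ i1 = 1" "g $ i2 $ i2 = 1" using all connected_generated[OF conn] g(1) by auto
  have nU: "n \<in> UT" "\<And>i. n $ i $ i = 1" using g(2) by (auto simp: Ngrp_iff)
  have "a2 i1 i2 z1 z2 $ i1 $ i1 = 1" "a2 i1 i2 z1 z2 $ i2 $ i2 = 1"
    unfolding g(3) using UT_mult(2)[OF gU(1) nU(1)] gU nU by simp_all
  then have "z1 = 0 \<and> z2 = 0" using idxs_ne by (simp add: a2_nth)
  then show False using z_nz by simp
qed

lemma u_eq: "u = {Y \<in> h. l Y = 0}"
proof (intro equalityI subsetI)
  fix X assume "X \<in> u" then show "X \<in> {Y \<in> h. l Y = 0}" by (simp add: u_def l_def)
next
  fix X assume X: "X \<in> {Y \<in> h. l Y = 0}"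
  then show "X \<in> u" using h_diag[of X] by (simp add: u_def)
qed

lemma subspace_u: "subspace u"
  unfolding u_eq
  using subspace_inter[OF subspace_lie_algebra linear_subspace_vimage[OF linear_l subspace_single_0]]
  by (simp add: vimage_def Int_def)

lemma H_gen:
  assumes "Z \<in> h" "l Z = 1"
  shows "H = {matrix_exp (s *\<^sub>R Z) ** w | s w. w \<in> mgen (matrix_exp ` u)}"
  unfolding u_eq by (rule connected_generated_ideal[OF conn linear_l assms l_conj])

lemma mgen_u_N: "w \<in> mgen (matrix_exp ` u) \<Longrightarrow> w \<in> H \<inter> Ngrp"
proof -
  assume w: "w \<in> mgen (matrix_exp ` u)"
  have uh: "u \<subseteq> h" by (auto simp: u_def)
  have wH: "w \<in> H" using w mgen_subset_H[OF uh] by blast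
  moreover have "w $ i $ i = 1" for i
    using w
  proof induction
    case one then show ?case by (simp add: mat_def)
  next
    case (step A B)
    then obtain Y where Y: "Y \<in> u" "B = matrix_exp Y" by blast
    have "A \<in> UT" "B \<in> UT" using step Y mgen_subset_H[OF uh] H_UT exp_UT(1) h_UT uh by blast+
    moreover have "Y $ i $ i = 0"
    proof -
      have Yh: "Y \<in> h" "Y $ i1 $ i1 = 0" "Y $ i2 $ i2 = 0" using Y by (auto simp: u_def)
      have "Y = zz 0 0 + nn (Y $ i1 $ i2) (mrow (Y $ i1)) (mrow (Y $ i2)) (Y $ i1 $ j2)"
        using h_form[OF Yh(1)] unfolding Yh(2,3) .
      then have "Y $ i $ i = (zz 0 0 + nn (Y $ i1 $ i2) (mrow (Y $ i1)) (mrow (Y $ i2)) (Y $ i1 $ j2)) $ i $ i" by simp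
      also have "\<dots> = 0" using idxs_ne mid_ne[of i] by (auto simp: zz_nth nn_nth mrow_def simp flip: mrow_def)
      finally show ?thesis .
    qed
    then have "B $ i $ i = 1" using exp_UT(2)[OF h_UT] Y uh by auto
    ultimately show ?case using UT_mult(2) step by simp
  qed
  ultimately show ?thesis using H_G H_UT by (simp add: Ngrp_iff)
qed

text \<open>In the factorization of \<open>H_gen\<close> the diagonal determines s, and elements of
  N have s = 0. In particular H \<inter> N is connected, as \<open>cartan_HN\<close>
  requires.\<close>

lemma HN_gen: "H \<inter> Ngrp = mgen (matrix_exp ` u)"
proof (intro equalityI subsetI)
  fix g assume g: "g \<in> H \<inter> Ngrp"
  obtain Z where Z: "Z \<in> h" "l Z = 1" using l_surj by blast
  obtain s w where sw: "g = matrix_exp (s *\<^sub>R Z) ** w" "w \<in> mgen (matrix_exp ` u)" using g H_gen[OF Z] by blast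
  have wN: "w \<in> UT" "\<And>i. w $ i $ i = 1" using mgen_u_N[OF sw(2)] by (auto simp: Ngrp_iff)
  have sZ: "s *\<^sub>R Z \<in> UT" using Z lie_algebra_scaleR h_UT by blast
  have "g $ i $ i = exp (s * Z $ i $ i)" for i
    using UT_mult(2)[OF exp_UT(1)[OF sZ] wN(1)] exp_UT(2)[OF sZ] wN(2) sw(1) by simp
  moreover have "g $ i $ i = 1" for i using g by (auto simp: Ngrp_iff)
  ultimately have "s * Z $ i1 $ i1 = 0" "s * Z $ i2 $ i2 = 0" by simp_all
  then have "s = 0" using h_diag[OF Z(1)] Z(2) z_nz by auto
  then show "g \<in> mgen (matrix_exp ` u)" using sw by simp
qed (use mgen_u_N in blast)

lemma cartan_H: "cartan_decomposition_subgroup H \<longleftrightarrow> ample H"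
  unfolding cartan_iff_ample using sub conn closed_H H_G by (auto simp: carrier_SO2 intro!: closed_subset)

lemma cartan_HN: "cartan_decomposition_subgroup (H \<inter> Ngrp) \<longleftrightarrow> ample (H \<inter> Ngrp)"
proof -
  have "connected (H \<inter> Ngrp)"
    unfolding HN_gen by (rule connected_mgen_exp) (use subspace_scale[OF subspace_u] in blast)
  moreover have "closed (H \<inter> Ngrp)" using closed_H closed_N by blast
  moreover have "subgroup (H \<inter> Ngrp) SO2"
    unfolding subgroup_SO2_iff
  proof (intro conjI ballI)
    show "H \<inter> Ngrp \<subseteq> G" using H_G by blast
    show "mat 1 \<in> H \<inter> Ngrp" unfolding HN_gen by (rule mgen.one)
    show "a ** b \<in> H \<inter> Ngrp" if "a \<in> H \<inter> Ngrp" "b \<in> H \<inter> Ngrp" for a b using that unfolding HN_gen by (rule mgen_mult)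
    show "iv a \<in> H \<inter> Ngrp" if a: "a \<in> H \<inter> Ngrp" for a
    proof -
      obtain b where "b \<in> H \<inter> Ngrp" "a ** b = mat 1"
        using mgen_inverse[OF matrix_exp_symmetric] a subspace_neg[OF subspace_u] unfolding HN_gen by blast
      moreover have "iv a ** a = mat 1" using a isom_iv_left H_isom by blast
      ultimately show ?thesis using matrix_inverse_unique by metis
    qed
  qed
  ultimately show ?thesis unfolding cartan_iff_ample using H_G by (auto simp: carrier_SO2 intro!: closed_subset)
qed

lemma u_form: "X \<in> u \<Longrightarrow> \<exists>\<phi> x y \<eta>. x \<in> Mid \<and> y \<in> Mid \<and> X = nn \<phi> x y \<eta>"
proof -
  assume "X \<in> u"
  then have X: "X \<in> h" "X $ i1 $ i1 = 0" "X $ i2 $ i2 = 0" by (auto simp: u_def)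
  then have "X = zz 0 0 + nn (X $ i1 $ i2) (mrow (X $ i1)) (mrow (X $ i2)) (X $ i1 $ j2)" using h_form[OF X(1)] by metis
  moreover have "zz 0 0 = 0" by (simp add: zz_def)
  ultimately have "X = nn (X $ i1 $ i2) (mrow (X $ i1)) (mrow (X $ i2)) (X $ i1 $ j2)" by simp
  then show ?thesis using mrow_Mid by blast
qed

lemma exp_u: "X \<in> u \<Longrightarrow> matrix_exp X \<in> H \<inter> Ngrp"
  unfolding HN_gen by (intro mgen_base) blast

text \<open>Membership in the root space centralized by T. The coordinates have weights z1 - z2, z1,
  z2 and z1 + z2, and those of nonzero weight must vanish; for each of the four directions exactly
  one coordinate survives.\<close>

definition rsp :: "real \<Rightarrow> (real, 'm) vec \<Rightarrow> (real, 'm) vec \<Rightarrow> real \<Rightarrow> bool" where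
  "rsp \<phi> x y \<eta> \<longleftrightarrow> x \<in> Mid \<and> y \<in> Mid \<and> (z1 \<noteq> z2 \<longrightarrow> \<phi> = 0) \<and> (z1 \<noteq> 0 \<longrightarrow> x = 0) \<and> (z2 \<noteq> 0 \<longrightarrow> y = 0) \<and> (z1 + z2 \<noteq> 0 \<longrightarrow> \<eta> = 0)"

lemma Mid0 [simp]: "0 \<in> Mid" by (rule subspace_0[OF subspace_Mid])

text \<open>The centralizer of T in N is the group of the surviving root, which is abelian, so its
  elements commute with root vectors of that root. The statement for \<open>zz z1 z2\<close> follows
  by differentiating along T.\<close>

lemma rsp_commute:
  assumes c: "c \<in> Ngrp" and comm: "\<And>t. t \<in> Tpart H \<Longrightarrow> c ** t = t ** c" and r: "rsp \<phi> x y \<eta>"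
  shows "c ** nn \<phi> x y \<eta> = nn \<phi> x y \<eta> ** c" "c ** zz z1 z2 = zz z1 z2 ** c"
proof -
  let ?t = "a2 i1 i2 z1 z2"
  have ct: "c ** a2 i1 i2 (s * z1) (s * z2) = a2 i1 i2 (s * z1) (s * z2) ** c" for s by (rule comm) (auto simp: T)
  have ent: "c $ i $ j * ?t $ j $ j = ?t $ i $ i * c $ i $ j" for i j
  proof -
    have "(c ** ?t) $ i $ j = (?t ** c) $ i $ j" using ct[of 1] by simp
    moreover have "(c ** ?t) $ i $ j = c $ i $ j * ?t $ j $ j"
      by (simp add: matrix_matrix_mult_def a2_nth if_distrib[of "\<lambda>b. _ * b"] cong: if_cong)
    moreover have "(?t ** c) $ i $ j = ?t $ i $ i * c $ i $ j"
      by (simp add: matrix_matrix_mult_def a2_nth if_distrib[of "\<lambda>b. b * _"] cong: if_cong)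
    ultimately show ?thesis by simp
  qed
  have tm: "?t $ k $ k = 1" if "flip k = k" for k using mid_ne[OF that] by (simp add: a2_nth)
  have e1: "z1 \<noteq> z2 \<Longrightarrow> c $ i1 $ i2 = 0" using ent[of i1 i2] idxs_ne by (auto simp: a2_nth)
  have e2: "z1 + z2 \<noteq> 0 \<Longrightarrow> c $ i1 $ j2 = 0" using ent[of i1 j2] idxs_ne by (auto simp: a2_nth)
  have e3: "z1 \<noteq> 0 \<Longrightarrow> mrow (c $ i1) = 0"
  proof -
    have "c $ i1 $ k = 0" if "flip k = k" "z1 \<noteq> 0" for k using ent[of i1 k] tm[OF that(1)] that idxs_ne by (auto simp: a2_nth)
    then show "z1 \<noteq> 0 \<Longrightarrow> mrow (c $ i1) = 0" by (simp add: mrow_def vec_eq_iff)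
  qed
  have e4: "z2 \<noteq> 0 \<Longrightarrow> mrow (c $ i2) = 0"
  proof -
    have "c $ i2 $ k = 0" if "flip k = k" "z2 \<noteq> 0" for k using ent[of i2 k] tm[OF that(1)] that idxs_ne by (auto simp: a2_nth)
    then show "z2 \<noteq> 0 \<Longrightarrow> mrow (c $ i2) = 0" by (simp add: mrow_def vec_eq_iff)
  qed
  have ci: "isom c" using c by (simp add: Ngrp_iff G_isom)
  have w: "c ** wedge a b = wedge a b ** c" if "c *v a = a" "c *v b = b" for a b
    using conj_wedge[OF ci, of a b] that by simp
  consider "z1 = 1 \<and> z2 = 1" | "z1 = 1 \<and> z2 = 0" | "z1 = 0 \<and> z2 = 1" | "z1 = 1 \<and> z2 = -1" using zcase by auto
  then show "c ** nn \<phi> x y \<eta> = nn \<phi> x y \<eta> ** c"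
  proof cases
    case 1
    then have "c = eich (e i1) (c $ i1 $ i2 *\<^sub>R e j2)" using N_param[OF c] e1 e2 e3 e4 by simp
    moreover have "eich (e i1) (a *\<^sub>R e j2) *v (b *\<^sub>R e j2) = b *\<^sub>R e j2" "eich (e i1) (a *\<^sub>R e j2) *v e i1 = e i1" for a b
      by (simp_all add: eich_apply B_bil)
    ultimately have "c *v e i1 = e i1" "c *v (\<phi> *\<^sub>R e j2) = \<phi> *\<^sub>R e j2" by metis+
    moreover have "nn \<phi> x y \<eta> = wedge (e i1) (\<phi> *\<^sub>R e j2)" using r[unfolded rsp_def] 1 by (simp add: nn_def wedge_bil)
    ultimately show ?thesis using w by simp
  next
    case 2
    then have "c = eich (e i2) (mrow (c $ i2))" using N_param[OF c] e1 e2 e3 e4 by simp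
    moreover have y: "y \<in> Mid" using r by (simp add: rsp_def)
    have "eich (e i2) v *v e i2 = e i2" if "v \<in> Mid" for v using that by (simp add: eich_apply B_bil)
    ultimately have c1: "c *v e i2 = e i2" by (metis mrow_Mid)
    have "nn \<phi> x y \<eta> = wedge (e i2) y" using r[unfolded rsp_def] 2 by (simp add: nn_def wedge_bil)
    moreover have "eich (e i2) v ** wedge (e i2) y = wedge (e i2) y ** eich (e i2) v" if "v \<in> Mid" for v
    proof -
      have iv: "isom (eich (e i2) v)" using that by (intro isom_eich) simp_all
      have "eich (e i2) v *v e i2 = e i2" "eich (e i2) v *v y = y + B y v *\<^sub>R e i2" using that y by (simp_all add: eich_apply B_bil)
      moreover have "wedge (e i2) (e i2) = 0" by (rule matrix_eq_vec) (simp add: wedge_apply)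
      ultimately show ?thesis using conj_wedge[OF iv, of "e i2" y] by (simp add: wedge_bil)
    qed
    ultimately show ?thesis using \<open>c = eich (e i2) (mrow (c $ i2))\<close> by (metis mrow_Mid)
  next
    case 3
    then have "c = eich (e i1) (mrow (c $ i1))" using N_param[OF c] e1 e2 e3 e4 by simp
    moreover have x: "x \<in> Mid" using r by (simp add: rsp_def)
    have "nn \<phi> x y \<eta> = wedge (e i1) x" using r[unfolded rsp_def] 3 by (simp add: nn_def wedge_bil)
    moreover have "eich (e i1) v ** wedge (e i1) x = wedge (e i1) x ** eich (e i1) v" if "v \<in> Mid" for v
    proof -
      have iv: "isom (eich (e i1) v)" using that by (intro isom_eich) simp_all
      have "eich (e i1) v *v e i1 = e i1" "eich (e i1) v *v x = x + B x v *\<^sub>R e i1" using that x by (simp_all add: eich_apply B_bil)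
      moreover have "wedge (e i1) (e i1) = 0" by (rule matrix_eq_vec) (simp add: wedge_apply)
      ultimately show ?thesis using conj_wedge[OF iv, of "e i1" x] by (simp add: wedge_bil)
    qed
    ultimately show ?thesis using \<open>c = eich (e i1) (mrow (c $ i1))\<close> by (metis mrow_Mid)
  next
    case 4
    then have "c = eich (e i1) (c $ i1 $ j2 *\<^sub>R e i2)" using N_param[OF c] e1 e2 e3 e4 by simp
    moreover have "eich (e i1) (a *\<^sub>R e i2) *v (b *\<^sub>R e i2) = b *\<^sub>R e i2" "eich (e i1) (a *\<^sub>R e i2) *v e i1 = e i1" for a b
      by (simp_all add: eich_apply B_bil)
    ultimately have "c *v e i1 = e i1" "c *v (\<eta> *\<^sub>R e i2) = \<eta> *\<^sub>R e i2" by metis+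
    moreover have "nn \<phi> x y \<eta> = wedge (e i1) (\<eta> *\<^sub>R e i2)" using r[unfolded rsp_def] 4 by (simp add: nn_def wedge_bil)
    ultimately show ?thesis using w by simp
  qed
  let ?S = "{M. c ** M - M ** c = 0}"
  have S: "subspace ?S"
    by (auto simp: subspace_def matrix_add_ldistrib bounded_bilinear.add_left[OF bounded_bilinear_matrix_mult] bounded_bilinear.zero_left[OF bounded_bilinear_matrix_mult] bounded_bilinear.zero_right[OF bounded_bilinear_matrix_mult])
  have "zz z1 z2 \<in> ?S"
    by (rule subspace_has_vector_derivative[OF S matrix_exp_has_vector_derivative_0])
      (intro subspace_diff[OF S]; simp add: zz_scale exp_zz ct)
  then show "c ** zz z1 z2 = zz z1 z2 ** c" by simp
qed

lemma exp_s: "a2 i1 i2 (s * z1) (s * z2) ** a2 i1 i2 (- (s * z1)) (- (s * z2)) = mat 1"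
  "a2 i1 i2 (- (s * z1)) (- (s * z2)) ** a2 i1 i2 (s * z1) (s * z2) = mat 1"
  by (simp_all add: a2_add)

end

section \<open>Compatibility on the Lie algebra\<close>

lemma matrix_exp_arg_commute: "matrix_exp X ** X = X ** matrix_exp (X :: 'n::finite sqmat)"
proof -
  have "endo_of (matrix_exp X ** X) = endo_of (X ** matrix_exp X)"
    by (simp add: endo_of_mult endo_of_matrix_exp exp_times_arg_commute)
  then have "mat_of (endo_of (matrix_exp X ** X)) = mat_of (endo_of (X ** matrix_exp X))" by (rule arg_cong)
  then show ?thesis by simp
qed

context solv begin

text \<open>The passage from group to Lie algebra. Let exp (s Z) = t u' c by compatibility. Since
  exp (s Z) commutes with Z, conjugating Z by c and then by u' gives t^-1 Z t. Now c commutes with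
  the part of Z other than \<open>M\<close>, and it differs from 1 by an element of height at least
  1, so it changes Z only within \<open>F (k + 1)\<close>. Hence Z - u' Z u'^-1, an element of
  \<open>u\<close>, agrees with M - t^-1 M t modulo \<open>F (k + 1)\<close>.\<close>

lemma comm_step:
  assumes Zh: "Z \<in> h" and Z: "Z = zz z1 z2 + nn \<phi>0 x0 y0 \<eta>0 + M" and r: "rsp \<phi>0 x0 y0 \<eta>0" and M: "M \<in> F k" "k \<ge> 1"
  shows "\<exists>v\<in>u. v - (M - a2 i1 i2 (- (s * z1)) (- (s * z2)) ** M ** a2 i1 i2 (s * z1) (s * z2)) \<in> F (k + 1)"
proof -
  let ?t = "a2 i1 i2 (s * z1) (s * z2)" and ?ti = "a2 i1 i2 (- (s * z1)) (- (s * z2))" and ?X0 = "nn \<phi>0 x0 y0 \<eta>0"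
  note bil = bounded_bilinear_matrix_mult
  note dist = bounded_bilinear.add_left[OF bil] bounded_bilinear.diff_left[OF bil] bounded_bilinear.add_right[OF bil] bounded_bilinear.diff_right[OF bil]
  define E where "E = matrix_exp (s *\<^sub>R Z)"
  have EH: "E \<in> H" unfolding E_def using Zh lie_algebra_exp by blast
  obtain t' u' c where tuc: "t' \<in> Tpart H" "u' \<in> H \<inter> Ngrp" "c \<in> centralizer_in Ngrp (Tpart H)" "E = t' ** u' ** c"
    using compat EH unfolding compatible_with_A_def by (auto 0 3)
  have cN: "c \<in> Ngrp" "\<And>t. t \<in> Tpart H \<Longrightarrow> c ** t = t ** c" using tuc(3) by (auto simp: centralizer_in_def)
  have uN: "u' \<in> Ngrp" "u' \<in> H" using tuc by auto
  have ci: "isom c" "isom u'" "isom E" using cN(1) uN(1) EH H_isom by (auto simp: Ngrp_iff G_isom)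
  obtain s' where s': "t' = a2 i1 i2 (s' * z1) (s' * z2)" using tuc(1) unfolding T by blast
  have dM: "M $ i $ i = 0" for i using M by (force simp: F_def)
  have Zd: "Z $ i1 $ i1 = z1" "Z $ i2 $ i2 = z2"
    using r dM idxs_ne unfolding Z rsp_def by (auto simp: nn_nth zz_nth)
  have ucN: "u' ** c \<in> UT" "\<And>i. (u' ** c) $ i $ i = 1" using N_mult[OF uN(1) cN(1)] by (auto simp: Ngrp_iff)
  have sZ: "s *\<^sub>R Z \<in> UT" using Zh lie_algebra_scaleR h_UT by blast
  have Ed: "E $ i $ i = exp (s * Z $ i $ i)" "E $ i $ i = t' $ i $ i" for i
    using exp_UT(2)[OF sZ, of i] UT_mult(2)[OF a2_UT ucN(1), of "s' * z1" "s' * z2" i] ucN(2)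
    by (simp_all add: E_def[symmetric] tuc(4) s' matrix_mul_assoc)
  \<comment> \<open>Comparison of diagonals identifies the torus factor, as the other two factors
    are unipotent.\<close>
  have "s' * z1 = s * z1" "s' * z2 = s * z2"
    using Ed[of i1] Ed[of i2] Zd idxs_ne by (simp_all add: s' a2_nth)
  then have t': "t' = ?t" unfolding s' by (simp only:)
  have w: "exp (- (s * z1) - - (s * z2)) * \<phi>0 = \<phi>0" "exp (- (s * z1)) *\<^sub>R x0 = x0" "exp (- (s * z2)) *\<^sub>R y0 = y0"
    "exp (- (s * z1) + - (s * z2)) * \<eta>0 = \<eta>0"
  proof -
    have "- (s * z1) + - (s * z2) = - (s * (z1 + z2))" by (simp add: algebra_simps)
    then show "exp (- (s * z1) + - (s * z2)) * \<eta>0 = \<eta>0" using r unfolding rsp_def by (cases "z1 + z2 = 0") simp_all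
  qed (use r in \<open>auto simp: rsp_def\<close>)
  have "x0 \<in> Mid" "y0 \<in> Mid" using r by (simp_all add: rsp_def)
  from a2_nn[OF this, of "- (s * z1)" "- (s * z2)" \<phi>0 \<eta>0] have tX: "?ti ** ?X0 ** ?t = ?X0"
    unfolding w minus_minus .
  have tT: "?ti ** zz z1 z2 ** ?t = zz z1 z2"
    by (simp add: zz_a2[symmetric] exp_s flip: matrix_mul_assoc)
  have tZ: "?ti ** Z ** ?t = zz z1 z2 + ?X0 + ?ti ** M ** ?t"
    unfolding Z by (simp only: dist tX tT)
  define \<delta> where "\<delta> = Z ** c - c ** Z"
  have "\<delta> = M ** (c - mat 1) - (c - mat 1) ** M"
    unfolding \<delta>_def Z using rsp_commute[OF cN r] by (simp add: dist)
  moreover have "c - mat 1 \<in> F 1" by (rule N_F1[OF cN(1)])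
  ultimately have \<delta>F: "\<delta> \<in> F (k + 1)"
    using F_mult[OF M(1), of "c - mat 1" 1] F_mult[of "c - mat 1" 1 M k] M(1) by (simp add: add.commute subspace_diff[OF subspace_F])
  have comm: "E ** Z = Z ** E"
    unfolding E_def using matrix_exp_arg_commute[of "s *\<^sub>R Z"] by (cases "s = 0") auto
  have "?ti ** (E ** Z) = ?ti ** (Z ** E)" unfolding comm ..
  then have "(?ti ** ?t) ** u' ** c ** Z = ?ti ** Z ** ?t ** u' ** c"
    unfolding tuc(4) t' by (simp only: matrix_mul_assoc)
  then have "u' ** (c ** Z) = ?ti ** Z ** ?t ** u' ** c" by (simp add: exp_s matrix_mul_assoc)
  then have "u' ** (Z ** c - \<delta>) = ?ti ** Z ** ?t ** u' ** c" by (simp add: \<delta>_def)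
  then have "u' ** Z ** c = ?ti ** Z ** ?t ** u' ** c + u' ** \<delta>" by (simp add: dist matrix_mul_assoc algebra_simps)
  then have "u' ** Z ** c ** iv c ** iv u' = (?ti ** Z ** ?t ** u' ** c + u' ** \<delta>) ** iv c ** iv u'" by simp
  then have "u' ** Z ** (c ** iv c) ** iv u' = ?ti ** Z ** ?t ** (u' ** (c ** iv c) ** iv u') + u' ** \<delta> ** iv c ** iv u'"
    by (simp only: dist matrix_mul_assoc)
  then have eq: "u' ** Z ** iv u' = ?ti ** Z ** ?t + u' ** \<delta> ** iv c ** iv u'"
    using isom_iv_right[OF ci(1)] isom_iv_right[OF ci(2)] by simp
  define v where "v = Z - u' ** Z ** iv u'"
  have uu: "u' ** iv u' = mat 1" by (rule isom_iv_right[OF ci(2)])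
  have "u' ** Z ** iv u' \<in> h" "l (u' ** Z ** iv u') = l Z"
    using lie_algebra_conj[OF uN(2) uu Zh] l_conj[OF uN(2) uu Zh] by blast+
  \<comment> \<open>Conjugation by elements of \<open>H\<close> preserves \<open>l\<close>, so the
    difference of Z and its conjugate lies in the kernel of \<open>l\<close>, which is
    \<open>u\<close>.\<close>
  then have vu: "v \<in> u" unfolding u_eq v_def using Zh subspace_diff[OF subspace_lie_algebra] by (simp add: linear_diff[OF linear_l])
  have "v - (M - ?ti ** M ** ?t) = - (u' ** \<delta> ** iv c ** iv u')"
    unfolding v_def eq tZ by (simp add: Z)
  moreover have "u' \<in> F 0" "c \<in> F 0" using uN cN by (auto simp: Ngrp_iff intro: UT_F0)
  then have "u' ** \<delta> ** iv c ** iv u' \<in> F (k + 1)" using \<delta>F iv_F F_mult0 by metis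
  ultimately have "v - (M - ?ti ** M ** ?t) \<in> F (k + 1)" using subspace_neg[OF subspace_F] by metis
  then show ?thesis using vu by blast
qed

text \<open>On weight w the map from M to M - t^-1 M t is multiplication by 1 - exp (- s w). It
  vanishes on weight 0, and combining s = 1 with s = -1 makes it the identity on two prescribed
  nonzero weights at once.\<close>

lemma weight_combination:
  fixes p q :: real
  shows "\<exists>a b. \<forall>w\<in>{p, q}. a * (1 - exp (- w)) + b * (1 - exp w) = (if w = 0 then 0 else 1)"
proof -
  have *: "a * (1 - exp (- w)) + b * (1 - exp w) = (a - b * exp w) * (1 - exp (- w))" for a b w :: real
    by (simp add: exp_minus field_simps)
  define f where "f w = 1 / (1 - exp (- w))" for w :: real
  have f: "f w * (1 - exp (- w)) = (if w = 0 then 0 else 1)" for w by (simp add: f_def)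
  consider "p = 0" | "q = 0" | "p = q" | "p \<noteq> 0" "q \<noteq> 0" "p \<noteq> q" by blast
  then show ?thesis
  proof cases
    case 1 then show ?thesis using f[of q] by (intro exI[of _ "f q"] exI[of _ 0]) simp
  next
    case 2 then show ?thesis using f[of p] by (intro exI[of _ "f p"] exI[of _ 0]) simp
  next
    case 3 then show ?thesis using f[of p] by (intro exI[of _ "f p"] exI[of _ 0]) simp
  next
    case 4
    \<comment> \<open>As 1 - exp w = - exp w (1 - exp (- w)), the task is to have a - b exp w equal
      to \<open>f w\<close> at w = p and w = q: linear interpolation in exp w.\<close>
    define b where "b = (f p - f q) / (exp q - exp p)"
    define a where "a = f p + b * exp p"
    have "b * (exp q - exp p) = f p - f q" using 4 by (simp add: b_def)
    then have "a - b * exp q = f q" by (simp add: a_def algebra_simps)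
    moreover have "a - b * exp p = f p" by (simp add: a_def)
    ultimately have "\<forall>w\<in>{p, q}. (a - b * exp w) * (1 - exp (- w)) = (if w = 0 then 0 else 1)" using f by simp
    then show ?thesis unfolding * by blast
  qed
qed

text \<open>\<open>comm_step\<close> for s = 1 and s = -1, combined with the coefficients a and b,
  multiplies each root component by \<open>c\<close> of its weight modulo
  \<open>F (k + 1)\<close>.\<close>

lemma nn_step:
  fixes a b :: real
  assumes Zh: "zz z1 z2 + nn \<phi>0 x0 y0 \<eta>0 + nn \<phi> x y \<eta> \<in> h" and r: "rsp \<phi>0 x0 y0 \<eta>0"
    and m: "x \<in> Mid" "y \<in> Mid" and M: "nn \<phi> x y \<eta> \<in> F k" "k \<ge> 1"
  defines "c \<equiv> \<lambda>w. a * (1 - exp (- w)) + b * (1 - exp w)"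
  shows "\<exists>\<phi>v xv yv \<eta>v. xv \<in> Mid \<and> yv \<in> Mid \<and> nn \<phi>v xv yv \<eta>v \<in> u \<and>
    nn (\<phi>v - c (z1 - z2) * \<phi>) (xv - c z1 *\<^sub>R x) (yv - c z2 *\<^sub>R y) (\<eta>v - c (z1 + z2) * \<eta>) \<in> F (k + 1)"
proof -
  let ?M = "nn \<phi> x y \<eta>" and ?c = "\<lambda>s w. 1 - exp (- (s * w))"
  have d: "?M - a2 i1 i2 (- (s * z1)) (- (s * z2)) ** ?M ** a2 i1 i2 (s * z1) (s * z2) =
     nn (?c s (z1 - z2) * \<phi>) (?c s z1 *\<^sub>R x) (?c s z2 *\<^sub>R y) (?c s (z1 + z2) * \<eta>)" for s
    using a2_nn[OF m, of "- (s * z1)" "- (s * z2)" \<phi> \<eta>] by (simp add: nn_diff algebra_simps)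
  have "\<exists>v\<in>u. v - nn (?c s (z1 - z2) * \<phi>) (?c s z1 *\<^sub>R x) (?c s z2 *\<^sub>R y) (?c s (z1 + z2) * \<eta>) \<in> F (k + 1)" for s
    using comm_step[OF Zh refl r M, of s] unfolding d .
  then obtain v where v: "\<And>s. v s \<in> u" "\<And>s. v s - nn (?c s (z1 - z2) * \<phi>) (?c s z1 *\<^sub>R x) (?c s z2 *\<^sub>R y) (?c s (z1 + z2) * \<eta>) \<in> F (k + 1)"
    by metis
  have "a *\<^sub>R v 1 + b *\<^sub>R v (-1) \<in> u" using v(1) subspace_u by (simp add: subspace_add subspace_scale)
  then obtain \<phi>v xv yv \<eta>v where V: "xv \<in> Mid" "yv \<in> Mid" "a *\<^sub>R v 1 + b *\<^sub>R v (-1) = nn \<phi>v xv yv \<eta>v" "nn \<phi>v xv yv \<eta>v \<in> u"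
    using u_form by metis
  have "a *\<^sub>R (v 1 - nn (?c 1 (z1 - z2) * \<phi>) (?c 1 z1 *\<^sub>R x) (?c 1 z2 *\<^sub>R y) (?c 1 (z1 + z2) * \<eta>))
      + b *\<^sub>R (v (-1) - nn (?c (-1) (z1 - z2) * \<phi>) (?c (-1) z1 *\<^sub>R x) (?c (-1) z2 *\<^sub>R y) (?c (-1) (z1 + z2) * \<eta>)) \<in> F (k + 1)"
    by (intro subspace_add[OF subspace_F] subspace_scale[OF subspace_F] v)
  also have "a *\<^sub>R (v 1 - nn (?c 1 (z1 - z2) * \<phi>) (?c 1 z1 *\<^sub>R x) (?c 1 z2 *\<^sub>R y) (?c 1 (z1 + z2) * \<eta>))
      + b *\<^sub>R (v (-1) - nn (?c (-1) (z1 - z2) * \<phi>) (?c (-1) z1 *\<^sub>R x) (?c (-1) z2 *\<^sub>R y) (?c (-1) (z1 + z2) * \<eta>))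
     = nn \<phi>v xv yv \<eta>v - nn (c (z1 - z2) * \<phi>) (c z1 *\<^sub>R x) (c z2 *\<^sub>R y) (c (z1 + z2) * \<eta>)"
    unfolding V(3)[symmetric] c_def using m
    by (simp add: scaleR_diff_right nn_scale algebra_simps)
      (simp add: nn_def wedge_bil algebra_simps)
  finally show ?thesis using V by (auto simp: nn_diff)
qed

text \<open>An element with \<open>l Z = 1\<close> is corrected three times, once for each height.
  The coefficients of \<open>weight_combination\<close> yield an element of \<open>u\<close> that
  agrees with the components of nonzero weight modulo greater height; subtracting it leaves weight 0
  there. Height 1 carries two roots, which is why two weights are handled together.\<close>

lemma compatible_generator: "\<exists>\<phi>0 x0 y0 \<eta>0. rsp \<phi>0 x0 y0 \<eta>0 \<and> zz z1 z2 + nn \<phi>0 x0 y0 \<eta>0 \<in> h"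
proof -
  have hd: "X - Y \<in> h" if "X \<in> h" "Y \<in> u" for X Y
    using that subspace_diff[OF subspace_lie_algebra] by (auto simp: u_def)
  obtain Z where Z: "Z \<in> h" "l Z = 1" using l_surj by blast
  define \<phi> x y \<eta> where "\<phi> = Z $ i1 $ i2" and "x = mrow (Z $ i1)" and "y = mrow (Z $ i2)" and "\<eta> = Z $ i1 $ j2"
  have m: "x \<in> Mid" "y \<in> Mid" by (simp_all add: x_def y_def)
  have Z1: "zz z1 z2 + nn 0 0 0 0 + nn \<phi> x y \<eta> \<in> h"
    using h_form[OF Z(1)] h_diag[OF Z(1)] Z by (simp add: \<phi>_def x_def y_def \<eta>_def)
  have r0: "rsp 0 0 0 0" by (simp add: rsp_def)
  obtain a b where ab: "\<And>w. w = z1 - z2 \<or> w = z2 \<Longrightarrow> a * (1 - exp (- w)) + b * (1 - exp w) = (if w = 0 then 0 else 1)"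
    using weight_combination[of "z1 - z2" z2] by blast
  have c: "a * (1 - exp (- (z1 - z2))) + b * (1 - exp (z1 - z2)) = (if z1 - z2 = 0 then 0 else 1)"
    "a * (1 - exp (- z2)) + b * (1 - exp z2) = (if z2 = 0 then 0 else 1)"
    using ab by blast+
  obtain \<phi>v xv yv \<eta>v where v: "xv \<in> Mid" "yv \<in> Mid" "nn \<phi>v xv yv \<eta>v \<in> u"
    "nn (\<phi>v - (if z1 - z2 = 0 then 0 else 1) * \<phi>) (xv - (a * (1 - exp (- z1)) + b * (1 - exp z1)) *\<^sub>R x)
      (yv - (if z2 = 0 then 0 else 1) *\<^sub>R y) (\<eta>v - (a * (1 - exp (- (z1 + z2))) + b * (1 - exp (z1 + z2))) * \<eta>) \<in> F 2"
    using nn_step[OF Z1 r0 m nn_F1[OF m], of a b] unfolding c by auto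
  have v1: "\<phi>v = (if z1 - z2 = 0 then 0 else 1) * \<phi>" "yv = (if z2 = 0 then 0 else 1) *\<^sub>R y"
    using v(4) m v(1,2) by (auto simp: nn_F(1) subspace_diff[OF subspace_Mid] subspace_scale[OF subspace_Mid])
  define \<phi>0 y0 x1 \<eta>1 where "\<phi>0 = \<phi> - \<phi>v" and "y0 = y - yv" and "x1 = x - xv" and "\<eta>1 = \<eta> - \<eta>v"
  have m1: "x1 \<in> Mid" "y0 \<in> Mid" using m v by (auto simp: x1_def y0_def subspace_diff[OF subspace_Mid])
  have Z2: "zz z1 z2 + nn \<phi>0 0 y0 0 + nn 0 x1 0 \<eta>1 \<in> h"
    using hd[OF Z1 v(3)] m1 by (simp add: \<phi>0_def y0_def x1_def \<eta>1_def add_diff_eq[symmetric] nn_diff nn_add add.assoc)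
  have r1: "rsp \<phi>0 0 y0 0" using m1 v1 by (auto simp: rsp_def \<phi>0_def y0_def)
  have F2: "nn 0 x1 0 \<eta>1 \<in> F 2" using m1 by (simp add: nn_F(1))
  obtain a b where ab: "a * (1 - exp (- z1)) + b * (1 - exp z1) = (if z1 = 0 then 0 else 1)"
    using weight_combination[of z1 z1] by auto
  obtain \<phi>v xv yv \<eta>v where v: "xv \<in> Mid" "yv \<in> Mid" "nn \<phi>v xv yv \<eta>v \<in> u"
    "nn \<phi>v (xv - (if z1 = 0 then 0 else 1) *\<^sub>R x1) yv (\<eta>v - (a * (1 - exp (- (z1 + z2))) + b * (1 - exp (z1 + z2))) * \<eta>1) \<in> F 3"
    using nn_step[OF Z2 r1 m1(1) Mid0 F2, of a b] unfolding ab by auto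
  have v1: "xv = (if z1 = 0 then 0 else 1) *\<^sub>R x1" "\<phi>v = 0" "yv = 0"
    using v(4) m1 v(1,2) by (auto simp: nn_F(2) subspace_diff[OF subspace_Mid] subspace_scale[OF subspace_Mid])
  define x0 \<eta>2 where "x0 = x1 - xv" and "\<eta>2 = \<eta>1 - \<eta>v"
  have m2: "x0 \<in> Mid" using m1 v by (auto simp: x0_def subspace_diff[OF subspace_Mid])
  have Z3: "zz z1 z2 + nn \<phi>0 x0 y0 0 + nn 0 0 0 \<eta>2 \<in> h"
    using hd[OF Z2 v(3)] m1 m2 by (simp add: v1(2,3) x0_def \<eta>2_def add_diff_eq[symmetric] nn_diff nn_add add.assoc)
  have r2: "rsp \<phi>0 x0 y0 0" using m2 r1 v1 by (auto simp: rsp_def x0_def)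
  have F3: "nn 0 0 0 \<eta>2 \<in> F 3" by (simp add: nn_F(2))
  obtain a b where ab: "a * (1 - exp (- (z1 + z2))) + b * (1 - exp (z1 + z2)) = (if z1 + z2 = 0 then 0 else 1)"
    using weight_combination[of "z1 + z2" "z1 + z2"] by auto
  obtain \<phi>v xv yv \<eta>v where v: "xv \<in> Mid" "yv \<in> Mid" "nn \<phi>v xv yv \<eta>v \<in> u"
    "nn \<phi>v xv yv (\<eta>v - (if z1 + z2 = 0 then 0 else 1) * \<eta>2) \<in> F 4"
    using nn_step[OF Z3 r2 Mid0 Mid0 F3, of a b] unfolding ab by auto
  have v1: "\<eta>v = (if z1 + z2 = 0 then 0 else 1) * \<eta>2" "\<phi>v = 0" "yv = 0" "xv = 0"
    using v(4) v(1,2) by (auto simp: nn_F(3))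
  have "zz z1 z2 + nn \<phi>0 x0 y0 (\<eta>2 - \<eta>v) \<in> h"
    using hd[OF Z3 v(3)] m1 m2 by (simp add: v1(2,3,4) add_diff_eq[symmetric] nn_diff nn_add add.assoc)
  moreover have "rsp \<phi>0 x0 y0 (\<eta>2 - \<eta>v)" using r2 v1 by (auto simp: rsp_def)
  ultimately show ?thesis by blast
qed

end

section \<open>A sheared form of the third family\<close>

context frame begin

lemma simI:
  assumes "isom h" "h = k \<or> iv h = k"
  shows "sim K_bound h k"
proof -
  have "iv (mat 1) = (mat 1 :: 'm sqmat)" using isom_iv_left[OF isom_one] by simp
  then show ?thesis unfolding sim_def using assms N1_one by (intro conjI exI[of _ "mat 1"]) auto
qed

text \<open>The nilpotent part may be a graph over part of the short root space. Conjugation by an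
  Eichler transformation at \<open>q\<close> along a bounded \<open>z\<close> in \<open>Mid\<close>
  shears off \<eta> \<open>e q\<close> and commutes with the torus and with the other factor at
  \<open>q\<close>, which leads back to \<open>M3\<close>.\<close>

lemma not_ample_M3_graph:
  assumes y: "y \<in> Mid" and S: "\<And>h. h \<in> S \<Longrightarrow> isom h \<and> (\<exists>s\<ge>0. \<exists>k. (\<exists>x\<in>Mid. \<exists>\<eta>. \<bar>\<eta>\<bar> \<le> L * norm x \<and>
    k = a2 p q s 0 ** eich (e q) (s *\<^sub>R y) ** eich (e p) (x + \<eta> *\<^sub>R e q)) \<and> (h = k \<or> iv h = k))"
  shows "\<not> ample S"
proof (rule not_ample_M3[OF y])
  fix h assume "h \<in> S"
  then obtain s x \<eta> where h: "isom h" "s \<ge> 0" "x \<in> Mid" "\<bar>\<eta>\<bar> \<le> L * norm x" and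
    k: "h = a2 p q s 0 ** eich (e q) (s *\<^sub>R y) ** eich (e p) (x + \<eta> *\<^sub>R e q) \<or> iv h = a2 p q s 0 ** eich (e q) (s *\<^sub>R y) ** eich (e p) (x + \<eta> *\<^sub>R e q)"
    using S by blast
  \<comment> \<open>The multiple of \<open>x\<close> whose inner product with \<open>x\<close> is -
    \<eta>. For \<open>x = 0\<close> the bound forces \<eta> = 0, and division by 0 gives
    \<open>z = 0\<close>.\<close>
  define z where "z = (- \<eta> / (x \<bullet> x)) *\<^sub>R x"
  have z: "z \<in> Mid" unfolding z_def by (rule subspace_scale[OF subspace_Mid h(3)])
  have xz: "x \<bullet> z = - \<eta>" and nz: "norm z \<le> \<bar>L\<bar>"
  proof -
    show "x \<bullet> z = - \<eta>" using h(4) by (cases "x = 0") (simp_all add: z_def)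
    show "norm z \<le> \<bar>L\<bar>"
    proof (cases "x = 0")
      case False
      have "norm z * norm x = \<bar>\<eta>\<bar>" using False by (simp add: z_def power2_norm_eq_inner[symmetric] power2_eq_square)
      then have "norm z * norm x \<le> \<bar>L\<bar> * norm x" using h(4) mult_right_mono[OF abs_ge_self[of L] norm_ge_zero[of x]] by linarith
      then show ?thesis using False by simp
    qed (simp add: z_def)
  qed
  let ?g = "eich (e q) z" and ?i = "eich (e q) (- z)"
  let ?A = "a2 p q s 0" and ?E = "eich (e q) (s *\<^sub>R y)"
  have mz: "- z \<in> Mid" using z by (simp add: subspace_neg[OF subspace_Mid])
  have gi: "isom ?g" "isom ?i" using z mz by (auto intro!: isom_eich)
  have ig: "?i ** ?g = mat 1" using z mz by (subst eich_add) simp_all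
  have iv: "iv ?g = ?i" using matrix_inverse_unique[OF isom_iv_right[OF gi(1)] ig] .
  have c1: "?A ** ?i = ?i ** ?A"
  proof (rule eich_commute)
    show "isom ?A" using G_a2 G_isom by blast
    have "z $ p = 0" "z $ \<tau> p = 0" using z by (simp_all add: Mid_def)
    then show "?A *v e q = e q" "?A *v - z = - z" using mz by (simp_all add: a2_apply)
  qed
  have c2: "?E ** ?i = ?i ** ?E"
  proof -
    have "B (e q) (s *\<^sub>R y) = 0" "B (e q) (- z) = 0" using y z by (simp_all add: B_bil)
    then show ?thesis by (simp only: eich_add B_frame add.commute)
  qed
  have c3: "?i ** eich (e p) x = eich (e p) (x + \<eta> *\<^sub>R e q) ** ?i"
  proof -
    have "?i *v e p = e p" "?i *v x = x + \<eta> *\<^sub>R e q"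
      using h(3) z xz B_Mid[of x z] by (simp_all add: eich_apply B_bil inner_commute)
    then show ?thesis using conj_eich[OF gi(2), of "e p" x] by simp
  qed
  have a: "C ** ?i ** ?E = C ** ?E ** ?i" "C ** ?i ** eich (e p) x = C ** eich (e p) (x + \<eta> *\<^sub>R e q) ** ?i" "C ** ?i ** ?g = C" for C
    using c2 c3 ig by (simp_all flip: matrix_mul_assoc)
  have e: "iv ?g ** M3 y s x ** ?g = ?A ** ?E ** eich (e p) (x + \<eta> *\<^sub>R e q)"
    unfolding iv M3_def by (simp only: matrix_mul_assoc c1[symmetric] a)
  have "K_bound * (1 + norm z)\<^sup>2 \<le> K_bound * (1 + \<bar>L\<bar>)\<^sup>2"
    using nz K_bound_ge by (intro mult_left_mono power_mono) auto
  then have "N1 ?g \<le> K_bound * (1 + \<bar>L\<bar>)\<^sup>2" using N1_eich[of q z] by linarith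
  then have "sim (K_bound * (1 + \<bar>L\<bar>)\<^sup>2) h (M3 y s x)"
    unfolding sim_def using h(1) gi(1) k e by metis
  then show "\<exists>s\<ge>0. \<exists>x\<in>Mid. sim (K_bound * (1 + \<bar>L\<bar>)\<^sup>2) h (M3 y s x)" using h by blast
qed

end

context so2 begin

text \<open>Images of the frame \<open>i1\<close>, \<open>i2\<close> under the Weyl group; they
  carry the remaining roots to the positions that the model families prescribe.\<close>

lemma frames: "full_frame flip i2 i1" "full_frame flip i1 j2" "full_frame flip i2 j1" "full_frame flip j2 i1"
proof -
  show 1: "full_frame flip i2 i1" by (rule swap)
  show 2: "full_frame flip i1 j2" using swap_sign by simp
  show "full_frame flip i2 j1" using full_frame.swap_sign[OF 1] by simp
  show "full_frame flip j2 i1" using full_frame.swap[OF 2] .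
qed

lemma nn_plus: "nn \<phi> x y \<eta> + nn \<phi>' x' y' \<eta>' = nn (\<phi> + \<phi>') (x + x') (y + y') (\<eta> + \<eta>')"
  by (simp add: nn_def wedge_bil algebra_simps)

end

text \<open>\<open>nsplit\<close> expresses that H is not a semidirect product: if \<open>X0\<close>
  were in \<open>u\<close>, then \<open>zz z1 z2\<close> would lie in the Lie algebra and the torus
  in H.\<close>

locale thin_solv = solv ty H z1 z2 for ty :: "'m::{finite,linorder} itself" and H :: "'m sqmat set" and z1 z2 +
  fixes f0 x0 y0 h0
  assumes thin: "\<not> ample (H \<inter> Ngrp)"
    and r0: "rsp f0 x0 y0 h0" and Z0: "zz z1 z2 + nn f0 x0 y0 h0 \<in> h" and nsplit: "nn f0 x0 y0 h0 \<notin> u"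
begin

abbreviation "X0 \<equiv> nn f0 x0 y0 h0"

lemma m0: "x0 \<in> Mid" "y0 \<in> Mid" using r0 by (auto simp: rsp_def)

lemma nn_in_u: "x \<in> Mid \<Longrightarrow> y \<in> Mid \<Longrightarrow> nn \<phi> x y \<eta> \<in> h \<Longrightarrow> nn \<phi> x y \<eta> \<in> u"
  using idxs_ne by (simp add: u_def nn_nth)

lemma Mid_intros: "x \<in> Mid \<Longrightarrow> r *\<^sub>R x \<in> Mid" "x \<in> Mid \<Longrightarrow> y \<in> Mid \<Longrightarrow> x + y \<in> Mid" "x \<in> Mid \<Longrightarrow> y \<in> Mid \<Longrightarrow> x - y \<in> Mid"
  "x \<in> Mid \<Longrightarrow> - x \<in> Mid"
  by (simp_all add: subspace_scale[OF subspace_Mid] subspace_add[OF subspace_Mid] subspace_diff[OF subspace_Mid] subspace_neg[OF subspace_Mid])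

lemma u_h: "X \<in> u \<Longrightarrow> X \<in> h" by (simp add: u_def)

text \<open>The action of ad (\<open>zz z1 z2 + X0\<close>) on \<open>u\<close>: the weights on the
  diagonal, and the terms with \<open>f0\<close>, \<open>x0\<close>, \<open>y0\<close> as its
  nilpotent part.\<close>

lemma uD:
  assumes "nn \<phi> x y \<eta> \<in> u" "x \<in> Mid" "y \<in> Mid"
  shows "nn ((z1 - z2) * \<phi>) (z1 *\<^sub>R x + f0 *\<^sub>R y - \<phi> *\<^sub>R y0) (z2 *\<^sub>R y) ((z1 + z2) * \<eta> + x \<bullet> y0 - x0 \<bullet> y) \<in> u"
proof -
  note bil = bounded_bilinear_matrix_mult
  have "(zz z1 z2 + X0) ** nn \<phi> x y \<eta> - nn \<phi> x y \<eta> ** (zz z1 z2 + X0) \<in> h"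
    using lie_algebra_bracket[OF Z0 u_h[OF assms(1)]] .
  also have "(zz z1 z2 + X0) ** nn \<phi> x y \<eta> - nn \<phi> x y \<eta> ** (zz z1 z2 + X0) =
     (zz z1 z2 ** nn \<phi> x y \<eta> - nn \<phi> x y \<eta> ** zz z1 z2) + (X0 ** nn \<phi> x y \<eta> - nn \<phi> x y \<eta> ** X0)"
    by (simp add: bounded_bilinear.add_left[OF bil] bounded_bilinear.add_right[OF bil])
  also have "\<dots> = nn ((z1 - z2) * \<phi>) (z1 *\<^sub>R x + f0 *\<^sub>R y - \<phi> *\<^sub>R y0) (z2 *\<^sub>R y) ((z1 + z2) * \<eta> + x \<bullet> y0 - x0 \<bullet> y)"
    unfolding bracket_zz_nn[OF assms(2,3)] bracket_nn[OF m0 assms(2,3)] nn_plus by (simp add: algebra_simps)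
  finally show ?thesis using assms m0 by (intro nn_in_u Mid_intros)
qed

lemma uB:
  assumes "nn \<phi> x y \<eta> \<in> u" "x \<in> Mid" "y \<in> Mid" "nn \<phi>' x' y' \<eta>' \<in> u" "x' \<in> Mid" "y' \<in> Mid"
  shows "nn 0 (\<phi> *\<^sub>R y' - \<phi>' *\<^sub>R y) 0 (x' \<bullet> y - x \<bullet> y') \<in> u"
  using lie_algebra_bracket[OF u_h[OF assms(1)] u_h[OF assms(4)]] assms
  unfolding bracket_nn[OF assms(2,3,5,6)] by (intro nn_in_u Mid_intros Mid0)

lemma u_diff: "nn \<phi> x y \<eta> \<in> u \<Longrightarrow> nn \<phi>' x' y' \<eta>' \<in> u \<Longrightarrow> nn (\<phi> - \<phi>') (x - x') (y - y') (\<eta> - \<eta>') \<in> u"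
  and u_add: "nn \<phi> x y \<eta> \<in> u \<Longrightarrow> nn \<phi>' x' y' \<eta>' \<in> u \<Longrightarrow> nn (\<phi> + \<phi>') (x + x') (y + y') (\<eta> + \<eta>') \<in> u"
  and u_scale: "nn \<phi> x y \<eta> \<in> u \<Longrightarrow> nn (r * \<phi>) (r *\<^sub>R x) (r *\<^sub>R y) (r * \<eta>) \<in> u"
  using subspace_diff[OF subspace_u] subspace_add[OF subspace_u] subspace_scale[OF subspace_u] by (metis nn_diff nn_plus nn_scale)+

lemma long_axis: "nn 0 0 0 \<eta> \<in> u \<Longrightarrow> \<eta> \<noteq> 0 \<Longrightarrow> nn 0 0 0 t \<in> u"
  and simple_axis: "nn \<phi> 0 0 0 \<in> u \<Longrightarrow> \<phi> \<noteq> 0 \<Longrightarrow> nn t 0 0 0 \<in> u"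
  using u_scale[of 0 0 0 \<eta> "t / \<eta>"] u_scale[of \<phi> 0 0 0 "t / \<phi>"] by simp_all

text \<open>Root vectors for alpha + beta and alpha + 2 beta would place the family of
  \<open>ample_short_long\<close> in H \<inter> N. The next three lemmas exclude other pairs in the
  same manner, each in the frame adapted to the pair.\<close>

lemma no_x_long:
  assumes "nn 0 x 0 0 \<in> u" "x \<in> Mid" "x \<noteq> 0" "nn 0 0 0 \<eta> \<in> u"
  shows "\<eta> = 0"
proof (rule ccontr)
  assume "\<eta> \<noteq> 0"
  then have "nn 0 (c *\<^sub>R x) 0 t \<in> u" for c t
    using u_add[OF u_scale[OF assms(1), of c] long_axis[OF assms(4), of t]] by simp
  then have "eich (e i1) (c *\<^sub>R x + t *\<^sub>R e i2) \<in> H \<inter> Ngrp" for c t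
    using exp_u exp_nn1[of "c *\<^sub>R x" 0 t] assms(2) by (simp add: Mid_intros) (metis)
  then show False using ample_short_long assms thin by blast
qed

lemma no_y_long:
  assumes "nn 0 0 y 0 \<in> u" "y \<in> Mid" "y \<noteq> 0" "nn 0 0 0 \<eta> \<in> u"
  shows "\<eta> = 0"
proof (rule ccontr)
  assume "\<eta> \<noteq> 0"
  then have "nn 0 0 (c *\<^sub>R y) (- t) \<in> u" for c t
    using u_add[OF u_scale[OF assms(1), of c] long_axis[OF assms(4), of "- t"]] by simp
  then have "eich (e i2) (c *\<^sub>R y + t *\<^sub>R e i1) \<in> H \<inter> Ngrp" for c t
    using exp_u exp_nn2[of "c *\<^sub>R y" "- t"] assms(2) by (simp add: Mid_intros) (metis)
  then show False using full_frame.ample_short_long[OF frames(1)] assms thin by blast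
qed

lemma no_phi_x:
  assumes "nn 0 x 0 0 \<in> u" "x \<in> Mid" "x \<noteq> 0" "nn \<phi> 0 0 0 \<in> u"
  shows "\<phi> = 0"
proof (rule ccontr)
  assume "\<phi> \<noteq> 0"
  then have "nn t (c *\<^sub>R x) 0 0 \<in> u" for c t
    using u_add[OF u_scale[OF assms(1), of c] simple_axis[OF assms(4), of t]] by simp
  then have "eich (e i1) (c *\<^sub>R x + t *\<^sub>R e j2) \<in> H \<inter> Ngrp" for c t
    using exp_u exp_nn1[of "c *\<^sub>R x" t 0] assms(2) by (simp add: Mid_intros add.commute) (metis)
  then show False using full_frame.ample_short_long[OF frames(2)] assms thin by blast
qed

lemma no_phi_long:
  assumes "nn \<phi> 0 0 0 \<in> u" "nn 0 0 0 \<eta> \<in> u" "\<phi> \<noteq> 0"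
  shows "\<eta> = 0"
proof (rule ccontr)
  assume "\<eta> \<noteq> 0"
  then have "nn b 0 0 a \<in> u" for a b
    using u_add[OF long_axis[OF assms(2), of a] simple_axis[OF assms(1,3), of b]] by simp
  then have "eich (e i1) (a *\<^sub>R e i2 + b *\<^sub>R e j2) \<in> H \<inter> Ngrp" for a b
    using exp_u exp_nn1[of 0 b a] by (simp add: add.commute) (metis)
  then show False using ample_long_pair thin by simp
qed

lemma HN_mult: "a \<in> H \<inter> Ngrp \<Longrightarrow> b \<in> H \<inter> Ngrp \<Longrightarrow> a ** b \<in> H \<inter> Ngrp"
  using N_mult H_props by blast

text \<open>Orthogonal short vectors would give the family of
  \<open>ample_orthogonal_shorts\<close>. That family tolerates a long tail on one of the two
  vectors; which one has the tail decides the frame.\<close>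

lemma no_x_y:
  assumes "nn 0 x 0 \<eta> \<in> u" "x \<in> Mid" "x \<noteq> 0" "nn 0 0 y \<eta>' \<in> u" "y \<in> Mid" "y \<noteq> 0" "\<eta> = 0 \<or> \<eta>' = 0"
  shows "x \<bullet> y \<noteq> 0"
proof
  assume xy: "x \<bullet> y = 0"
  have a: "eich (e i1) (c *\<^sub>R (x + \<eta> *\<^sub>R e i2)) \<in> H \<inter> Ngrp" "eich (e i2) (d *\<^sub>R (y + (- \<eta>') *\<^sub>R e i1)) \<in> H \<inter> Ngrp" for c d
    using exp_u[OF u_scale[OF assms(1), of c]] exp_u[OF u_scale[OF assms(4), of d]] assms(2,5)
    by (simp_all add: exp_nn1 exp_nn2 Mid_intros algebra_simps)
  show False
  proof (cases "\<eta>' = 0")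
    case True
    then have "eich (e i1) (c *\<^sub>R (x + \<eta> *\<^sub>R e i2)) ** eich (e i2) (d *\<^sub>R y) \<in> H \<inter> Ngrp" for c d
      using HN_mult[OF a, of c d] by simp
    then show False using ample_orthogonal_shorts[OF assms(2,3,5,6) xy] thin by blast
  next
    case False
    then have "eich (e i2) (c *\<^sub>R (y + (- \<eta>') *\<^sub>R e i1)) ** eich (e i1) (d *\<^sub>R x) \<in> H \<inter> Ngrp" for c d
      using HN_mult[OF a(2) a(1), of c d] assms(7) by simp
    then show False
      using full_frame.ample_orthogonal_shorts[OF frames(1) assms(5,6,2,3), of "- \<eta>'"] xy thin by (simp add: inner_commute)
  qed
qed

end

section \<open>Classification by roots\<close>

text \<open>The first projection is injective on the subspace, hence bounded below there by finite
  dimension.\<close>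

lemma subspace_graph_bound:
  fixes S :: "('a::euclidean_space \<times> real) set"
  assumes S: "subspace S" and inj: "\<And>t. (0, t) \<in> S \<Longrightarrow> t = 0"
  shows "\<exists>L. \<forall>x t. (x, t) \<in> S \<longrightarrow> \<bar>t\<bar> \<le> L * norm x"
proof -
  have "\<exists>e>0. \<forall>w\<in>S. e * norm w \<le> norm (fst w)"
    by (rule injective_imp_isometric[OF closed_subspace[OF S] S bounded_linear_fst]) (use inj in \<open>auto simp: zero_prod_def\<close>)
  then obtain e where e: "e > 0" "\<And>w. w \<in> S \<Longrightarrow> e * norm w \<le> norm (fst w)" by blast
  have "\<bar>t\<bar> \<le> (1 / e) * norm x" if "(x, t) \<in> S" for x t
  proof -
    have "e * \<bar>t\<bar> \<le> e * norm (x, t)" using e(1) norm_snd_le[of t x] by (intro mult_left_mono) auto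
    also have "\<dots> \<le> norm x" using e(2)[OF that] by simp
    finally show ?thesis using e(1) by (simp add: field_simps)
  qed
  then show ?thesis by blast
qed

section \<open>Elements of H as torus part, root part and nilpotent part\<close>

context thin_solv begin

abbreviation "Z0 \<equiv> zz z1 z2 + X0"

lemma exp_Z0: "matrix_exp (s *\<^sub>R Z0) = a2 i1 i2 (s * z1) (s * z2) ** matrix_exp (s *\<^sub>R X0)"
proof -
  have "nn ((z1 - z2) * f0) (z1 *\<^sub>R x0) (z2 *\<^sub>R y0) ((z1 + z2) * h0) = 0"
  proof -
    have "(z1 - z2) * f0 = 0" "z1 *\<^sub>R x0 = 0" "z2 *\<^sub>R y0 = 0" "(z1 + z2) * h0 = 0" using r0 by (auto simp: rsp_def)
    then show ?thesis by (simp only: nn_zero)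
  qed
  then have "zz z1 z2 ** X0 = X0 ** zz z1 z2" using bracket_zz_nn[OF m0, of z1 z2 f0 h0] by simp
  then have "(s *\<^sub>R zz z1 z2) ** (s *\<^sub>R X0) = (s *\<^sub>R X0) ** (s *\<^sub>R zz z1 z2)" by simp
  from matrix_exp_add_commuting[OF this] show ?thesis by (simp add: scaleR_right_distrib zz_scale exp_zz)
qed

lemma Z0_diag: "Z0 $ i1 $ i1 = z1" "Z0 $ i2 $ i2 = z2"
  using m0 idxs_ne by (simp_all add: zz_nth nn_nth)

text \<open>An element with the wrong sign of the parameter is inverted: w^-1 exp (- t Z0) equals
  exp (- t Z0) w' with w' a conjugate of w^-1, again in H \<inter> N. Both signs are offered because
  some frames reverse the torus.\<close>

lemma H_param:
  assumes g: "g \<in> H" and \<epsilon>: "\<epsilon> = 1 \<or> \<epsilon> = (-1 :: real)"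
  shows "\<exists>s\<ge>0. \<exists>w\<in>H \<inter> Ngrp. g = matrix_exp ((\<epsilon> * s) *\<^sub>R Z0) ** w \<or> iv g = matrix_exp ((\<epsilon> * s) *\<^sub>R Z0) ** w"
proof -
  have "l Z0 = 1" unfolding l_def Z0_diag using z_nz by (simp add: power2_eq_square)
  then obtain t w where tw: "g = matrix_exp (t *\<^sub>R Z0) ** w" "w \<in> mgen (matrix_exp ` u)" using H_gen[OF Z0] g by blast
  have w: "w \<in> H \<inter> Ngrp" using tw(2) HN_gen by simp
  show ?thesis
  proof (cases "\<epsilon> * t \<ge> 0")
    case True
    moreover have "\<epsilon> * (\<epsilon> * t) = t" using \<epsilon> by auto
    ultimately show ?thesis using tw w by metis
  next
    case False
    let ?P = "matrix_exp (t *\<^sub>R Z0)" and ?Q = "matrix_exp ((- t) *\<^sub>R Z0)"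
    have PQ: "?P ** ?Q = mat 1" "?Q ** ?P = mat 1" using matrix_exp_minus[of "t *\<^sub>R Z0"] by simp_all
    have PH: "?P \<in> H" "?Q \<in> H" using Z0 lie_algebra_exp by blast+
    have "iv ?P = ?Q" using matrix_inverse_unique[OF isom_iv_right[OF H_isom[OF PH(1)]] PQ(2)] .
    then have ivg: "iv g = iv w ** ?Q" using tw by (simp add: iv_mult)
    define w' where "w' = ?P ** iv w ** ?Q"
    have "?Q ** w' = (?Q ** ?P) ** iv w ** ?Q" unfolding w'_def by (simp only: matrix_mul_assoc)
    then have e: "iv g = ?Q ** w'" unfolding PQ ivg by simp
    have ivwH: "iv w \<in> H" using w H_props(3) by blast
    have wH: "w' \<in> H" "iv w \<in> H" unfolding w'_def
      by (rule H_props(2)[OF H_props(2)[OF PH(1) ivwH] PH(2)], rule ivwH)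
    have U: "?P \<in> UT" "iv w \<in> UT" "?Q \<in> UT" using PH wH H_UT by blast+
    have "?P $ i $ i * ?Q $ i $ i = 1" for i using UT_mult(2)[OF U(1,3), of i] PQ(1) by (simp add: mat_def)
    moreover have "iv w $ i $ i = 1" for i using w by (simp add: iv_def Ngrp_iff)
    moreover have "w' $ i $ i = ?P $ i $ i * iv w $ i $ i * ?Q $ i $ i" for i
      unfolding w'_def using UT_mult U by simp
    ultimately have "w' \<in> H \<inter> Ngrp" using wH H_G H_UT by (simp add: Ngrp_iff)
    moreover have "\<epsilon> * (- \<epsilon> * t) = - t" using \<epsilon> by auto
    then have "iv g = matrix_exp ((\<epsilon> * (- \<epsilon> * t)) *\<^sub>R Z0) ** w'" using e by (simp only:)
    moreover have "- \<epsilon> * t \<ge> 0" using False by simp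
    ultimately show ?thesis by blast
  qed
qed

lemma HN_exp:
  assumes "\<And>v w. v \<in> u \<Longrightarrow> w \<in> u \<Longrightarrow> v ** w = w ** v" "w \<in> H \<inter> Ngrp"
  shows "\<exists>v\<in>u. w = matrix_exp v"
proof -
  have "w \<in> mgen (matrix_exp ` u)" using assms(2) HN_gen by simp
  then show ?thesis
  proof induction
    case one show ?case using subspace_0[OF subspace_u] by force
  next
    case (step A B)
    then obtain a b where "a \<in> u" "b \<in> u" "A = matrix_exp a" "B = matrix_exp b" by blast
    then show ?case using assms(1) matrix_exp_add_commuting[of a b] subspace_add[OF subspace_u, of a b] by (intro bexI[of _ "a + b"]) auto
  qed
qed

lemma not_ampleI:
  assumes comm: "\<And>v w. v \<in> u \<Longrightarrow> w \<in> u \<Longrightarrow> v ** w = w ** v" and \<epsilon>: "\<epsilon> = 1 \<or> \<epsilon> = (-1 :: real)"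
    and k: "\<And>s v. s \<ge> 0 \<Longrightarrow> v \<in> u \<Longrightarrow> P s (a2 i1 i2 (\<epsilon> * s * z1) (\<epsilon> * s * z2) ** matrix_exp ((\<epsilon> * s) *\<^sub>R X0) ** matrix_exp v)"
    and g: "g \<in> H"
  shows "isom g \<and> (\<exists>s\<ge>0. \<exists>k. P s k \<and> (g = k \<or> iv g = k))"
proof -
  obtain s w where s: "s \<ge> 0" "w \<in> H \<inter> Ngrp" "g = matrix_exp ((\<epsilon> * s) *\<^sub>R Z0) ** w \<or> iv g = matrix_exp ((\<epsilon> * s) *\<^sub>R Z0) ** w"
    using H_param[OF g \<epsilon>] by blast
  obtain v where "v \<in> u" "w = matrix_exp v" using HN_exp[OF comm s(2)] by blast
  then show ?thesis using s k[OF s(1), of v] H_isom[OF g] unfolding exp_Z0 by metis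
qed

lemma subspace_x_graph: "subspace {(x, \<eta>). x \<in> Mid \<and> nn 0 x 0 \<eta> \<in> u}" (is "subspace ?S")
  unfolding subspace_def
proof (intro conjI ballI allI)
  show "0 \<in> ?S" by (simp add: zero_prod_def subspace_0[OF subspace_u])
  show "a + b \<in> ?S" if "a \<in> ?S" "b \<in> ?S" for a b
    using that u_add[of 0 "fst a" 0 "snd a" 0 "fst b" 0 "snd b"] by (simp add: split_beta Mid_intros)
  show "c *\<^sub>R a \<in> ?S" if "a \<in> ?S" for a c
    using that u_scale[of 0 "fst a" 0 "snd a" c] by (simp add: split_beta Mid_intros)
qed

lemma subspace_y_graph: "subspace {(y, \<eta>). y \<in> Mid \<and> nn 0 0 y \<eta> \<in> u}" (is "subspace ?S")
  unfolding subspace_def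
proof (intro conjI ballI allI)
  show "0 \<in> ?S" by (simp add: zero_prod_def subspace_0[OF subspace_u])
  show "a + b \<in> ?S" if "a \<in> ?S" "b \<in> ?S" for a b
    using that u_add[of 0 0 "fst a" "snd a" 0 0 "fst b" "snd b"] by (simp add: split_beta Mid_intros)
  show "c *\<^sub>R a \<in> ?S" if "a \<in> ?S" for a c
    using that u_scale[of 0 0 "fst a" "snd a" c] by (simp add: split_beta Mid_intros)
qed

lemma X0_nz: "X0 \<noteq> 0" using nsplit subspace_0[OF subspace_u] by metis

lemma commI:
  assumes "nn \<phi> x y \<eta> ** nn \<phi>' x' y' \<eta>' - nn \<phi>' x' y' \<eta>' ** nn \<phi> x y \<eta> = 0"
  shows "nn \<phi> x y \<eta> ** nn \<phi>' x' y' \<eta>' = nn \<phi>' x' y' \<eta>' ** nn \<phi> x y \<eta>"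
  using assms by simp

text \<open>Here ad \<open>Z0\<close> kills beta and is the identity plus a nilpotent map, given by
  \<open>y0\<close>, on the other roots. Differences of iterates isolate the powers of that map. A
  nonzero \<phi>, or a nonzero inner product of x with \<open>y0\<close>, would produce vectors for
  alpha + beta and alpha + 2 beta together, against \<open>no_x_long\<close>.\<close>

lemma beta_graded:
  assumes z: "z1 = 1" "z2 = 0" and v: "nn \<phi> x y \<eta> \<in> u" "x \<in> Mid" "y \<in> Mid"
  shows "\<phi> = 0 \<and> x \<bullet> y0 = 0 \<and> nn 0 x 0 \<eta> \<in> u \<and> nn 0 0 y 0 \<in> u"
proof -
  have X: "f0 = 0" "x0 = 0" "h0 = 0" using r0 z unfolding rsp_def by auto
  have y0: "y0 \<noteq> 0" using X0_nz X by auto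
  note M = Mid_intros Mid0 m0 v
  have p1: "nn \<phi> (x - \<phi> *\<^sub>R y0) 0 (\<eta> + x \<bullet> y0) \<in> u" using uD[OF v] X z by simp
  have p2: "nn \<phi> (x - \<phi> *\<^sub>R y0 - \<phi> *\<^sub>R y0) 0 (\<eta> + x \<bullet> y0 + (x - \<phi> *\<^sub>R y0) \<bullet> y0) \<in> u"
    using uD[OF p1] X z M by simp
  have p3: "nn 0 (- (\<phi> *\<^sub>R y0)) 0 (x \<bullet> y0 - \<phi> * (y0 \<bullet> y0)) \<in> u"
  proof -
    have eq: "x - a - a - (x - a) = - a" for a :: "(real, 'm) vec" by (simp add: vec_eq_iff)
    show ?thesis using u_diff[OF p2 p1] unfolding eq by (simp add: inner_diff_left)
  qed
  have p4: "nn 0 (- (\<phi> *\<^sub>R y0)) 0 (x \<bullet> y0 - \<phi> * (y0 \<bullet> y0) - \<phi> * (y0 \<bullet> y0)) \<in> u"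
    using uD[OF p3] X z M by simp
  have p5: "nn 0 0 0 (- (\<phi> * (y0 \<bullet> y0))) \<in> u" using u_diff[OF p4 p3] by simp
  have \<phi>: "\<phi> = 0"
  proof (rule ccontr)
    assume "\<phi> \<noteq> 0"
    then have "\<phi> * (y0 \<bullet> y0) \<noteq> 0" using y0 by simp
    moreover have "nn 0 (- (\<phi> *\<^sub>R y0)) 0 0 \<in> u"
      using u_diff[OF p3 long_axis[OF p5, of "x \<bullet> y0 - \<phi> * (y0 \<bullet> y0)"]] calculation by simp
    ultimately show False using no_x_long[OF _ _ _ p5, of "- (\<phi> *\<^sub>R y0)"] M \<open>\<phi> \<noteq> 0\<close> y0 by simp
  qed
  have ax: "nn 0 0 0 (x \<bullet> y0) \<in> u" using p3 \<phi> by simp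
  have p1': "nn 0 x 0 (\<eta> + x \<bullet> y0) \<in> u" using p1 \<phi> by simp
  have xy: "x \<bullet> y0 = 0"
  proof (rule ccontr)
    assume "x \<bullet> y0 \<noteq> 0"
    moreover from this have "x \<noteq> 0" "nn 0 x 0 0 \<in> u" using u_diff[OF p1' long_axis[OF ax, of "\<eta> + x \<bullet> y0"]] by auto
    ultimately show False using no_x_long[OF _ _ _ ax, of x] M by auto
  qed
  have "nn 0 x 0 \<eta> \<in> u" using p1' xy by simp
  moreover from u_diff[OF v(1) this] have "nn 0 0 y 0 \<in> u" using \<phi> by simp
  ultimately show ?thesis using \<phi> xy by blast
qed

text \<open>If alpha + beta occurs, pure long vectors and beta are excluded, so \<open>u\<close> is
  a graph over short vectors and the sheared \<open>M3\<close> contradicts ampleness. If beta occurs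
  alone, \<open>no_y_long\<close> leaves the asserted form. Otherwise \<open>u\<close> is contained
  in the long axis, and \<open>M4\<close> gives the contradiction.\<close>

lemma beta_classification:
  assumes z: "z1 = 1" "z2 = 0" and am: "ample H"
  shows "(\<exists>y\<in>Mid. y \<noteq> 0 \<and> nn 0 0 y 0 \<in> u) \<and> (\<forall>v\<in>u. \<exists>y\<in>Mid. v = nn 0 0 y 0)"
proof -
  have X: "f0 = 0" "x0 = 0" "h0 = 0" using r0 z unfolding rsp_def by auto
  have y0: "y0 \<noteq> 0" using X0_nz X by auto
  have eX: "matrix_exp (s *\<^sub>R X0) = eich (e i2) (s *\<^sub>R y0)" for s
    using exp_nn2[of "s *\<^sub>R y0" 0] m0 X by (simp add: nn_scale Mid_intros)
  have form: "\<exists>x\<in>Mid. \<exists>y\<in>Mid. \<exists>\<eta>. v = nn 0 x y \<eta> \<and> nn 0 x 0 \<eta> \<in> u \<and> nn 0 0 y 0 \<in> u" if "v \<in> u" for v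
    using u_form[OF that] beta_graded[OF z] that by metis
  consider (x) x \<eta> where "x \<in> Mid" "x \<noteq> 0" "nn 0 x 0 \<eta> \<in> u" | (y) y where "y \<in> Mid" "y \<noteq> 0" "nn 0 0 y 0 \<in> u"
      "\<And>x \<eta>. x \<in> Mid \<Longrightarrow> nn 0 x 0 \<eta> \<in> u \<Longrightarrow> x = 0"
    | (none) "\<And>x \<eta>. x \<in> Mid \<Longrightarrow> nn 0 x 0 \<eta> \<in> u \<Longrightarrow> x = 0" "\<And>y. y \<in> Mid \<Longrightarrow> nn 0 0 y 0 \<in> u \<Longrightarrow> y = 0" by blast
  then show ?thesis
  proof cases
    case x
    have noax: "t = 0" if "nn 0 0 0 t \<in> u" for t
    proof (rule ccontr)
      assume "t \<noteq> 0"
      then have "nn 0 x 0 0 \<in> u" using u_diff[OF x(3) long_axis[OF that, of \<eta>]] by simp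
      then show False using no_x_long[OF _ x(1,2) that] \<open>t \<noteq> 0\<close> by blast
    qed
    have noy: "y = 0" if "y \<in> Mid" "nn 0 0 y 0 \<in> u" for y
    proof (rule ccontr)
      assume "y \<noteq> 0"
      have "nn 0 0 0 (- (x \<bullet> y)) \<in> u" using uB[OF x(3,1) _ that(2) _ that(1)] by simp
      then have "x \<bullet> y = 0" using noax by fastforce
      then show False using no_x_y[OF x(3,1,2) that(2,1) \<open>y \<noteq> 0\<close>] by blast
    qed
    have uf: "\<exists>x\<in>Mid. \<exists>\<eta>. v = nn 0 x 0 \<eta>" if "v \<in> u" for v using form[OF that] noy by metis
    let ?S = "{(x, \<eta>). x \<in> Mid \<and> nn 0 x 0 \<eta> \<in> u}"
    have "subspace ?S"
      by (rule subspace_x_graph)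
    then obtain L where L: "\<And>x \<eta>. x \<in> Mid \<Longrightarrow> nn 0 x 0 \<eta> \<in> u \<Longrightarrow> \<bar>\<eta>\<bar> \<le> L * norm x"
      using subspace_graph_bound[of ?S] noax by auto
    have comm: "v ** w = w ** v" if vw: "v \<in> u" "w \<in> u" for v w
    proof -
      obtain x \<eta> x' \<eta>' where "x \<in> Mid" "x' \<in> Mid" "v = nn 0 x 0 \<eta>" "w = nn 0 x' 0 \<eta>'" using uf[OF vw(1)] uf[OF vw(2)] by blast
      then show ?thesis by (auto intro!: commI simp: bracket_nn)
    qed
    have "\<not> ample H"
    proof (rule not_ample_M3_graph[OF m0(2), of H L])
      fix g assume g: "g \<in> H"
      show "isom g \<and> (\<exists>s\<ge>0. \<exists>k. (\<exists>x\<in>Mid. \<exists>\<eta>. \<bar>\<eta>\<bar> \<le> L * norm x \<and>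
        k = a2 i1 i2 s 0 ** eich (e i2) (s *\<^sub>R y0) ** eich (e i1) (x + \<eta> *\<^sub>R e i2)) \<and> (g = k \<or> iv g = k))"
      proof (rule not_ampleI[OF comm _ _ g, where \<epsilon> = 1])
        fix s v assume "v \<in> u"
        then obtain x \<eta> where x: "x \<in> Mid" "v = nn 0 x 0 \<eta>" "nn 0 x 0 \<eta> \<in> u" using uf by blast
        have "a2 i1 i2 (1 * s * z1) (1 * s * z2) ** matrix_exp ((1 * s) *\<^sub>R X0) ** matrix_exp v
          = a2 i1 i2 s 0 ** eich (e i2) (s *\<^sub>R y0) ** eich (e i1) (x + \<eta> *\<^sub>R e i2)"
          using x exp_nn1[of x 0 \<eta>] by (simp add: eX z)
        then show "\<exists>x\<in>Mid. \<exists>\<eta>. \<bar>\<eta>\<bar> \<le> L * norm x \<and> a2 i1 i2 (1 * s * z1) (1 * s * z2) ** matrix_exp ((1 * s) *\<^sub>R X0) ** matrix_exp v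
          = a2 i1 i2 s 0 ** eich (e i2) (s *\<^sub>R y0) ** eich (e i1) (x + \<eta> *\<^sub>R e i2)" using L[OF x(1,3)] x(1) by blast
      qed auto
    qed
    then show ?thesis using am by blast
  next
    case y
    have noax: "t = 0" if "nn 0 0 0 t \<in> u" for t using no_y_long[OF y(3,1,2) that] .
    have "\<exists>y\<in>Mid. v = nn 0 0 y 0" if "v \<in> u" for v
      using form[OF that] y(4) noax by metis
    then show ?thesis using y by blast
  next
    case none
    have uf: "\<exists>\<eta>. v = nn 0 0 0 \<eta>" if "v \<in> u" for v using form[OF that] none by metis
    have comm: "v ** w = w ** v" if vw: "v \<in> u" "w \<in> u" for v w
      using uf[OF vw(1)] uf[OF vw(2)] by (auto intro!: commI simp: bracket_nn)
    have "\<not> ample H"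
    proof (rule not_ample_M4[OF m0(2) y0])
      fix g assume g: "g \<in> H"
      have k: "\<exists>\<eta>. a2 i1 i2 (1 * s * z1) (1 * s * z2) ** matrix_exp ((1 * s) *\<^sub>R X0) ** matrix_exp v = M4 y0 s \<eta>" if "v \<in> u" for v s
        using uf[OF that] exp_nn1[of 0 0] by (auto simp: M4_def eX z)
      show "\<exists>s\<ge>0. \<exists>\<eta>. sim K_bound g (M4 y0 s \<eta>)"
        using not_ampleI[OF comm _ _ g, of 1 "\<lambda>s k. \<exists>\<eta>. k = M4 y0 s \<eta>"] k simI by blast
    qed
    then show ?thesis using am by blast
  qed
qed

end

section \<open>Tori and long root elements in other frames\<close>

context so2 begin

lemma tor_swap: "tor v u b = tor u v (- b)"
  by (rule matrix_eq_vec) (simp add: tor_apply algebra_simps)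

lemma a2_swaps: "a2 i2 i1 r s = a2 i1 i2 s r" "a2 i1 j2 r s = a2 i1 i2 r (- s)"
  "a2 i2 j1 r s = a2 i1 i2 (- s) r" "a2 j2 i1 r s = a2 i1 i2 s (- r)"
  using Tp_Tq tor_swap[of "e j1" "e i1"] tor_swap[of "e j2" "e i2"] by (simp_all add: a2_def)

lemma eich_swap:
  assumes "B u u = 0" "B v v = 0" "B u v = 0"
  shows "eich u (r *\<^sub>R v) = eich v (- r *\<^sub>R u)"
  using assms by (intro matrix_eq_vec) (simp add: eich_apply B_bil mult.commute)

end

section \<open>The kernels of alpha + beta, alpha and alpha + 2 beta\<close>

context thin_solv begin

text \<open>The weights on alpha, alpha + beta, beta, alpha + 2 beta are -1, 0, 1, 1, and
  \<open>x0\<close> maps beta to alpha + 2 beta through the number \<open>c\<close>. Three iterates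
  isolate \<open>c\<close> on the long axis; if it were nonzero, beta and the long axis would both
  occur, against \<open>no_y_long\<close>.\<close>

lemma alpha_beta_graded:
  assumes z: "z1 = 0" "z2 = 1" and v: "nn \<phi> x y \<eta> \<in> u" "x \<in> Mid" "y \<in> Mid"
  shows "nn \<phi> 0 0 0 \<in> u \<and> nn 0 x 0 0 \<in> u \<and> nn 0 0 y \<eta> \<in> u"
proof -
  have X: "f0 = 0" "y0 = 0" "h0 = 0" using r0 z unfolding rsp_def by auto
  note M = Mid_intros Mid0 m0 v
  define c where "c = x0 \<bullet> y"
  have p1: "nn (- \<phi>) 0 y (\<eta> - c) \<in> u" using uD[OF v] X z by (simp add: c_def)
  have p2: "nn \<phi> 0 y (\<eta> - c - c) \<in> u" using uD[OF p1] X z M by (simp add: c_def)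
  have p3: "nn (- \<phi>) 0 y (\<eta> - c - c - c) \<in> u" using uD[OF p2] X z M by (simp add: c_def)
  have ax: "nn 0 0 0 (2 * c) \<in> u" using u_diff[OF p1 p3] by simp
  have yh: "nn 0 0 y (\<eta> - 3 / 2 * c) \<in> u"
  proof -
    have "(1 / 2) *\<^sub>R (y + y) = y" by (simp add: scaleR_2[symmetric])
    then show ?thesis using u_scale[OF u_add[OF p1 p2], of "1/2"] by (simp add: algebra_simps)
  qed
  have c: "c = 0"
  proof (rule ccontr)
    assume c: "c \<noteq> 0"
    then have "nn 0 0 y 0 \<in> u" using u_diff[OF yh long_axis[OF ax, of "\<eta> - 3 / 2 * c"]] by simp
    moreover have "y \<noteq> 0" using c by (auto simp: c_def)
    ultimately show False using no_y_long[OF _ v(3) _ ax] c by simp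
  qed
  have "nn 0 0 y \<eta> \<in> u" using yh c by simp
  moreover have "nn 0 x 0 0 \<in> u" using u_diff[OF v(1) p2] c by simp
  moreover have "nn \<phi> 0 0 0 \<in> u" using u_diff[OF p2 \<open>nn 0 0 y \<eta> \<in> u\<close>] c by simp
  ultimately show ?thesis by blast
qed

text \<open>Parallel to the case of beta, but now alpha may occur as well. It excludes all other
  roots and leads to \<open>M4\<close> in the frame \<open>j2\<close>, \<open>i1\<close>, where the
  torus parameter enters with the opposite sign.\<close>

lemma alpha_beta_classification:
  assumes z: "z1 = 0" "z2 = 1" and am: "ample H"
  shows "(\<exists>x\<in>Mid. x \<noteq> 0 \<and> nn 0 x 0 0 \<in> u) \<and> (\<forall>v\<in>u. \<exists>x\<in>Mid. v = nn 0 x 0 0)"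
proof -
  have X: "f0 = 0" "y0 = 0" "h0 = 0" using r0 z unfolding rsp_def by auto
  have x0: "x0 \<noteq> 0" using X0_nz X by auto
  have eX: "matrix_exp (s *\<^sub>R X0) = eich (e i1) (s *\<^sub>R x0)" for s
    using exp_nn1[of "s *\<^sub>R x0" 0 0] m0 X by (simp add: nn_scale Mid_intros)
  have form: "\<exists>x\<in>Mid. \<exists>y\<in>Mid. \<exists>\<phi> \<eta>. v = nn \<phi> x y \<eta> \<and> nn \<phi> 0 0 0 \<in> u \<and> nn 0 x 0 0 \<in> u \<and> nn 0 0 y \<eta> \<in> u" if "v \<in> u" for v
    using u_form[OF that] alpha_beta_graded[OF z] that by metis
  consider (\<phi>) \<phi> where "\<phi> \<noteq> 0" "nn \<phi> 0 0 0 \<in> u"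
    | (y) y \<eta> where "y \<in> Mid" "y \<noteq> 0" "nn 0 0 y \<eta> \<in> u" "\<And>\<phi>. nn \<phi> 0 0 0 \<in> u \<Longrightarrow> \<phi> = 0"
    | (x) x where "x \<in> Mid" "x \<noteq> 0" "nn 0 x 0 0 \<in> u" "\<And>\<phi>. nn \<phi> 0 0 0 \<in> u \<Longrightarrow> \<phi> = 0"
      "\<And>y \<eta>. y \<in> Mid \<Longrightarrow> nn 0 0 y \<eta> \<in> u \<Longrightarrow> y = 0"
    | (none) "\<And>\<phi>. nn \<phi> 0 0 0 \<in> u \<Longrightarrow> \<phi> = 0" "\<And>x. x \<in> Mid \<Longrightarrow> nn 0 x 0 0 \<in> u \<Longrightarrow> x = 0"
      "\<And>y \<eta>. y \<in> Mid \<Longrightarrow> nn 0 0 y \<eta> \<in> u \<Longrightarrow> y = 0" by blast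
  then show ?thesis
  proof cases
    case \<phi>
    have nox: "x = 0" if "x \<in> Mid" "nn 0 x 0 0 \<in> u" for x using no_phi_x[OF that(2,1) _ \<phi>(2)] \<phi>(1) by blast
    have noy: "y = 0" if "y \<in> Mid" "nn 0 0 y \<eta> \<in> u" for y \<eta>
    proof -
      have "nn 0 (\<phi> *\<^sub>R y) 0 0 \<in> u" using uB[OF \<phi>(2) Mid0 Mid0 that(2) Mid0 that(1)] by simp
      then show ?thesis using nox[of "\<phi> *\<^sub>R y"] that \<phi>(1) by (simp add: Mid_intros)
    qed
    have uf: "\<exists>\<phi>. v = nn \<phi> 0 0 0" if v: "v \<in> u" for v
    proof -
      obtain x y \<psi> \<eta> where w: "x \<in> Mid" "y \<in> Mid" "v = nn \<psi> x y \<eta>" "nn 0 x 0 0 \<in> u" "nn 0 0 y \<eta> \<in> u" using form[OF v] by blast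
      have xy: "x = 0" "y = 0" using nox[OF w(1,4)] noy[OF w(2,5)] by simp_all
      then have "nn 0 0 0 \<eta> \<in> u" using w by simp
      then show ?thesis using no_phi_long[OF \<phi>(2) _ \<phi>(1)] w xy by blast
    qed
    have comm: "v ** w = w ** v" if vw: "v \<in> u" "w \<in> u" for v w
      using uf[OF vw(1)] uf[OF vw(2)] by (auto intro!: commI simp: bracket_nn)
    have fr: "frame flip j2 i1" using frames(4) by (rule full_frame.axioms)
    have "\<not> ample H"
    proof (rule frame.not_ample_M4[OF fr])
      show "- x0 \<in> Mid" "- x0 \<noteq> 0" using m0 x0 by (simp_all add: Mid_intros)
      fix g assume g: "g \<in> H"
      have k: "\<exists>\<eta>. a2 i1 i2 (- 1 * s * z1) (- 1 * s * z2) ** matrix_exp ((- 1 * s) *\<^sub>R X0) ** matrix_exp v = frame.M4 flip j2 i1 (- x0) s \<eta>" if v: "v \<in> u" for v s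
      proof -
        obtain \<psi> where "v = nn \<psi> 0 0 0" using uf[OF v] by blast
        moreover have "eich (e i1) (\<psi> *\<^sub>R e j2) = eich (e j2) (- \<psi> *\<^sub>R e i1)" by (rule eich_swap) simp_all
        ultimately show ?thesis
          using exp_nn1[of 0 \<psi> 0] eX[of "- s"] by (intro exI[of _ "- \<psi>"]) (simp add: frame.M4_def[OF fr] z a2_swaps)
      qed
      show "\<exists>s\<ge>0. \<exists>\<eta>. sim K_bound g (frame.M4 flip j2 i1 (- x0) s \<eta>)"
        using not_ampleI[OF comm _ _ g, of "-1" "\<lambda>s k. \<exists>\<eta>. k = frame.M4 flip j2 i1 (- x0) s \<eta>"] k simI by blast
    qed
    then show ?thesis using am by blast
  next
    case y
    have noax: "t = 0" if "nn 0 0 0 t \<in> u" for t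
    proof (rule ccontr)
      assume "t \<noteq> 0"
      then have "nn 0 0 y 0 \<in> u" using u_diff[OF y(3) long_axis[OF that, of \<eta>]] by simp
      then show False using no_y_long[OF _ y(1,2) that] \<open>t \<noteq> 0\<close> by blast
    qed
    have nox: "x = 0" if "x \<in> Mid" "nn 0 x 0 0 \<in> u" for x
    proof (rule ccontr)
      assume "x \<noteq> 0"
      have "nn 0 0 0 (- (x \<bullet> y)) \<in> u" using uB[OF that(2,1) _ y(3) _ y(1)] by simp
      then have "x \<bullet> y = 0" using noax by fastforce
      then show False using no_x_y[OF that(2,1) \<open>x \<noteq> 0\<close> y(3,1,2)] by blast
    qed
    have uf: "\<exists>y\<in>Mid. \<exists>\<eta>. v = nn 0 0 y \<eta>" if "v \<in> u" for v using form[OF that] nox y(4) by metis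
    obtain L where L: "\<And>y \<eta>. y \<in> Mid \<Longrightarrow> nn 0 0 y \<eta> \<in> u \<Longrightarrow> \<bar>\<eta>\<bar> \<le> L * norm y"
      using subspace_graph_bound[OF subspace_y_graph] noax by auto
    have comm: "v ** w = w ** v" if vw: "v \<in> u" "w \<in> u" for v w
    proof -
      obtain y \<eta> y' \<eta>' where "y \<in> Mid" "y' \<in> Mid" "v = nn 0 0 y \<eta>" "w = nn 0 0 y' \<eta>'" using uf[OF vw(1)] uf[OF vw(2)] by blast
      then show ?thesis by (auto intro!: commI simp: bracket_nn)
    qed
    have fr: "frame flip i2 i1" using frames(1) by (rule full_frame.axioms)
    have "\<not> ample H"
    proof (rule frame.not_ample_M3_graph[OF fr m0(1), of H L])
      fix g assume g: "g \<in> H"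
      show "isom g \<and> (\<exists>s\<ge>0. \<exists>k. (\<exists>x\<in>Mid. \<exists>\<eta>. \<bar>\<eta>\<bar> \<le> L * norm x \<and>
        k = a2 i2 i1 s 0 ** eich (e i1) (s *\<^sub>R x0) ** eich (e i2) (x + \<eta> *\<^sub>R e i1)) \<and> (g = k \<or> iv g = k))"
      proof (rule not_ampleI[OF comm _ _ g, where \<epsilon> = 1])
        fix s v assume "v \<in> u"
        then obtain y \<eta> where y: "y \<in> Mid" "v = nn 0 0 y \<eta>" "nn 0 0 y \<eta> \<in> u" using uf by blast
        have "a2 i1 i2 (1 * s * z1) (1 * s * z2) ** matrix_exp ((1 * s) *\<^sub>R X0) ** matrix_exp v
          = a2 i2 i1 s 0 ** eich (e i1) (s *\<^sub>R x0) ** eich (e i2) (y + (- \<eta>) *\<^sub>R e i1)"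
          using y exp_nn2[of y \<eta>] by (simp add: eX z a2_swaps)
        moreover have "\<bar>- \<eta>\<bar> \<le> L * norm y" using L[OF y(1,3)] by simp
        ultimately show "\<exists>x\<in>Mid. \<exists>\<eta>. \<bar>\<eta>\<bar> \<le> L * norm x \<and> a2 i1 i2 (1 * s * z1) (1 * s * z2) ** matrix_exp ((1 * s) *\<^sub>R X0) ** matrix_exp v
          = a2 i2 i1 s 0 ** eich (e i1) (s *\<^sub>R x0) ** eich (e i2) (x + \<eta> *\<^sub>R e i1)" using y(1) by blast
      qed auto
    qed
    then show ?thesis using am by blast
  next
    case x
    have "\<exists>x\<in>Mid. v = nn 0 x 0 0" if v: "v \<in> u" for v
    proof -
      obtain x' y \<psi> \<eta> where w: "x' \<in> Mid" "y \<in> Mid" "v = nn \<psi> x' y \<eta>" "nn \<psi> 0 0 0 \<in> u" "nn 0 0 y \<eta> \<in> u" using form[OF v] by blast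
      have xy: "\<psi> = 0" "y = 0" using x(4)[OF w(4)] x(5)[OF w(2,5)] by simp_all
      then have "\<eta> = 0" using no_x_long[OF x(3,1,2)] w by simp
      then show ?thesis using w xy by blast
    qed
    then show ?thesis using x by blast
  next
    case none
    have uf: "\<exists>\<eta>. v = nn 0 0 0 \<eta>" if "v \<in> u" for v using form[OF that] none by metis
    have comm: "v ** w = w ** v" if vw: "v \<in> u" "w \<in> u" for v w
      using uf[OF vw(1)] uf[OF vw(2)] by (auto intro!: commI simp: bracket_nn)
    have fr: "frame flip i2 i1" using frames(1) by (rule full_frame.axioms)
    have "\<not> ample H"
    proof (rule frame.not_ample_M4[OF fr m0(1) x0])
      fix g assume g: "g \<in> H"
      have k: "\<exists>\<eta>. a2 i1 i2 (1 * s * z1) (1 * s * z2) ** matrix_exp ((1 * s) *\<^sub>R X0) ** matrix_exp v = frame.M4 flip i2 i1 x0 s \<eta>" if v: "v \<in> u" for v s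
      proof -
        obtain \<eta> where "v = nn 0 0 0 \<eta>" using uf[OF v] by blast
        then show ?thesis using exp_nn2[of 0 \<eta>] by (intro exI[of _ "- \<eta>"]) (simp add: frame.M4_def[OF fr] eX z a2_swaps)
      qed
      show "\<exists>s\<ge>0. \<exists>\<eta>. sim K_bound g (frame.M4 flip i2 i1 x0 s \<eta>)"
        using not_ampleI[OF comm _ _ g, of 1 "\<lambda>s k. \<exists>\<eta>. k = frame.M4 flip i2 i1 x0 s \<eta>"] k simI by blast
    qed
    then show ?thesis using am by blast
  qed
qed

text \<open>The weights on alpha, beta, alpha + beta, alpha + 2 beta are 0, 1, 1, 2, and
  \<open>f0\<close> maps beta to alpha + beta. A vector of alpha would put \<open>X0\<close> into
  \<open>u\<close>. A component y would yield \<open>w\<close> in alpha + beta and, by a bracket, a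
  long vector, against \<open>no_x_long\<close>.\<close>

lemma alpha_graded:
  assumes z: "z1 = 1" "z2 = 1" and v: "nn \<phi> x y \<eta> \<in> u" "x \<in> Mid" "y \<in> Mid"
  shows "\<phi> = 0 \<and> y = 0 \<and> nn 0 x 0 0 \<in> u \<and> nn 0 0 0 \<eta> \<in> u"
proof -
  have X: "x0 = 0" "y0 = 0" "h0 = 0" using r0 z unfolding rsp_def by auto
  have f0: "f0 \<noteq> 0" using X0_nz X by auto
  note M = Mid_intros Mid0 m0 v
  define w where "w = f0 *\<^sub>R y"
  have wM: "w \<in> Mid" using v by (simp add: w_def Mid_intros)
  have D: "nn 0 (x' + w) y (2 * \<eta>') \<in> u" if "nn 0 x' y \<eta>' \<in> u" "x' \<in> Mid" for x' \<eta>'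
    using uD[OF that v(3)] X z by (simp add: w_def)
  have p1: "nn 0 (x + w) y (2 * \<eta>) \<in> u" using uD[OF v] X z by (simp add: w_def)
  have p2: "nn 0 (x + w + w) y (4 * \<eta>) \<in> u" using D[OF p1] v wM by (simp add: Mid_intros)
  have p3: "nn 0 (x + w + w + w) y (8 * \<eta>) \<in> u" using D[OF p2 Mid_intros(2)[OF Mid_intros(2)[OF v(2) wM] wM]] by simp
  have q1: "nn 0 w 0 (2 * \<eta>) \<in> u" and q2: "nn 0 w 0 (4 * \<eta>) \<in> u"
    using u_diff[OF p2 p1] u_diff[OF p3 p2] by simp_all
  have ax: "nn 0 0 0 (2 * \<eta>) \<in> u" using u_diff[OF q2 q1] by simp
  have ax1: "nn 0 0 0 \<eta> \<in> u" using u_scale[OF ax, of "1/2"] by simp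
  have w: "nn 0 w 0 0 \<in> u" using u_diff[OF q1 ax] by simp
  have xy: "nn 0 x y 0 \<in> u" using u_diff[OF p1 q1] by simp
  have "nn \<phi> 0 0 0 \<in> u" using u_diff[OF u_diff[OF v(1) xy] ax1] by simp
  then have \<phi>: "\<phi> = 0" using simple_axis nsplit X by blast
  have y: "y = 0"
  proof (rule ccontr)
    assume y: "y \<noteq> 0"
    have "nn 0 0 0 (w \<bullet> y) \<in> u" using uB[OF xy v(2,3) w] M by (simp add: w_def)
    moreover have "w \<noteq> 0" using y f0 by (simp add: w_def)
    ultimately have "w \<bullet> y = 0" using no_x_long[OF w wM] by blast
    then show False using y f0 by (simp add: w_def)
  qed
  then show ?thesis using \<phi> xy ax1 by simp
qed

text \<open>By \<open>no_x_long\<close> at most one of alpha + beta and alpha + 2 beta occurs, which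
  leaves \<open>M1\<close> or \<open>M2\<close>.\<close>

lemma alpha_classification:
  assumes z: "z1 = 1" "z2 = 1"
  shows "\<not> ample H"
proof -
  have X: "x0 = 0" "y0 = 0" "h0 = 0" using r0 z unfolding rsp_def by auto
  have f0: "f0 \<noteq> 0" using X0_nz X by auto
  have eX: "matrix_exp (s *\<^sub>R X0) = eich (e i1) ((s * f0) *\<^sub>R e j2)" for s
    using exp_nn1[of 0 "s * f0" 0] X by (simp add: nn_scale)
  have form: "\<exists>x\<in>Mid. \<exists>\<eta>. v = nn 0 x 0 \<eta> \<and> nn 0 x 0 0 \<in> u \<and> nn 0 0 0 \<eta> \<in> u" if "v \<in> u" for v
    using u_form[OF that] alpha_graded[OF z] that by metis
  have comm: "v ** w = w ** v" if vw: "v \<in> u" "w \<in> u" for v w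
  proof -
    obtain x \<eta> x' \<eta>' where "x \<in> Mid" "x' \<in> Mid" "v = nn 0 x 0 \<eta>" "w = nn 0 x' 0 \<eta>'" using form[OF vw(1)] form[OF vw(2)] by blast
    then show ?thesis by (auto intro!: commI simp: bracket_nn)
  qed
  show ?thesis
  proof (cases "\<exists>x\<in>Mid. x \<noteq> 0 \<and> nn 0 x 0 0 \<in> u")
    case True
    then have uf: "\<exists>x\<in>Mid. v = nn 0 x 0 0" if "v \<in> u" for v using form[OF that] no_x_long by metis
    show ?thesis
    proof (rule not_ample_M1[OF f0])
      fix g assume g: "g \<in> H"
      have k: "\<exists>x\<in>Mid. a2 i1 i2 (1 * s * z1) (1 * s * z2) ** matrix_exp ((1 * s) *\<^sub>R X0) ** matrix_exp v = M1 f0 s x" if v: "v \<in> u" for v s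
      proof -
        obtain x where "x \<in> Mid" "v = nn 0 x 0 0" using uf[OF v] by blast
        then show ?thesis using exp_nn1[of x 0 0] by (intro bexI[of _ x]) (simp_all add: M1_def eX z)
      qed
      show "\<exists>s\<ge>0. \<exists>x\<in>Mid. sim K_bound g (M1 f0 s x)"
        using not_ampleI[OF comm _ _ g, of 1 "\<lambda>s k. \<exists>x\<in>Mid. k = M1 f0 s x"] k simI by blast
    qed
  next
    case False
    then have uf: "\<exists>\<eta>. v = nn 0 0 0 \<eta>" if "v \<in> u" for v using form[OF that] by metis
    show ?thesis
    proof (rule not_ample_M2)
      fix g assume g: "g \<in> H"
      have k: "\<exists>\<eta>. a2 i1 i2 (1 * s * z1) (1 * s * z2) ** matrix_exp ((1 * s) *\<^sub>R X0) ** matrix_exp v = M2 f0 s \<eta>" if v: "v \<in> u" for v s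
      proof -
        obtain \<eta> where "v = nn 0 0 0 \<eta>" using uf[OF v] by blast
        then show ?thesis using exp_nn1[of 0 0 \<eta>] by (intro exI[of _ \<eta>]) (simp_all add: M2_def eX z)
      qed
      show "\<exists>s\<ge>0. \<exists>\<eta>. sim K_bound g (M2 f0 s \<eta>)"
        using not_ampleI[OF comm _ _ g, of 1 "\<lambda>s k. \<exists>\<eta>. k = M2 f0 s \<eta>"] k simI by blast
    qed
  qed
qed

text \<open>\<open>X0\<close> is central among the \<open>nn\<close> matrices, so ad
  \<open>Z0\<close> is diagonal on \<open>u\<close>, with the distinct weights 2, 1, -1, 0 on alpha,
  alpha + beta, beta, alpha + 2 beta. A component of weight 0 would put \<open>X0\<close> into
  \<open>u\<close>.\<close>

lemma alpha_2beta_graded: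
  assumes z: "z1 = 1" "z2 = -1" and v: "nn \<phi> x y \<eta> \<in> u" "x \<in> Mid" "y \<in> Mid"
  shows "nn \<phi> 0 0 0 \<in> u \<and> nn 0 x 0 0 \<in> u \<and> nn 0 0 y 0 \<in> u \<and> \<eta> = 0"
proof -
  have X: "x0 = 0" "y0 = 0" "f0 = 0" using r0 z unfolding rsp_def by auto
  note M = Mid_intros Mid0 m0 v
  have p1: "nn (2 * \<phi>) x (- y) 0 \<in> u" using uD[OF v] X z by simp
  have p2: "nn (4 * \<phi>) x y 0 \<in> u" using uD[OF p1] X z M by simp
  have p3: "nn (8 * \<phi>) x (- y) 0 \<in> u" using uD[OF p2] X z M by simp
  have \<phi>: "nn t 0 0 0 \<in> u" if "\<phi> = 0 \<Longrightarrow> t = 0" for t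
    using u_scale[OF u_diff[OF p3 p1], of "t / (6 * \<phi>)"] that subspace_0[OF subspace_u] by (cases "\<phi> = 0") simp_all
  have x: "nn 0 x 0 0 \<in> u"
  proof -
    have "(1 / 2) *\<^sub>R (x + x) = x" by (simp add: scaleR_2[symmetric])
    then show ?thesis using u_scale[OF u_diff[OF u_add[OF p1 p2] \<phi>[of "2 * \<phi> + 4 * \<phi>"]], of "1/2"] by simp
  qed
  have y: "nn 0 0 y 0 \<in> u" using u_diff[OF u_diff[OF p2 x] \<phi>[of "4 * \<phi>"]] by simp
  have "nn 0 0 0 \<eta> \<in> u" using u_diff[OF u_diff[OF u_diff[OF v(1) x] y] \<phi>[of \<phi>]] by simp
  then have "\<eta> = 0" using long_axis nsplit X by blast
  then show ?thesis using x y \<phi> by blast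
qed

text \<open>Exchanging \<open>i2\<close> and \<open>j2\<close> turns alpha + 2 beta into alpha, so
  \<open>M1\<close> and \<open>M2\<close> serve again in other frames. When beta occurs the frame is
  \<open>i2\<close>, \<open>j1\<close> with the torus reversed.\<close>

lemma alpha_2beta_classification:
  assumes z: "z1 = 1" "z2 = -1"
  shows "\<not> ample H"
proof -
  have X: "x0 = 0" "y0 = 0" "f0 = 0" using r0 z unfolding rsp_def by auto
  have h0: "h0 \<noteq> 0" using X0_nz X by auto
  have eX: "matrix_exp (s *\<^sub>R X0) = eich (e i1) ((s * h0) *\<^sub>R e i2)" "matrix_exp (s *\<^sub>R X0) = eich (e i2) (- (s * h0) *\<^sub>R e i1)" for s
    using exp_nn1[of 0 0 "s * h0"] exp_nn2[of 0 "s * h0"] X by (simp_all add: nn_scale)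
  have form: "\<exists>x\<in>Mid. \<exists>y\<in>Mid. \<exists>\<phi>. v = nn \<phi> x y 0 \<and> nn \<phi> 0 0 0 \<in> u \<and> nn 0 x 0 0 \<in> u \<and> nn 0 0 y 0 \<in> u" if "v \<in> u" for v
    using u_form[OF that] alpha_2beta_graded[OF z] that by metis
  have noax: "t = 0" if "nn 0 0 0 t \<in> u" for t using long_axis[OF that, of h0] nsplit X by blast
  have fr: "frame flip i1 j2" "frame flip i2 j1" using frames(2,3) full_frame.axioms(1) by blast+
  consider (x) x where "x \<in> Mid" "x \<noteq> 0" "nn 0 x 0 0 \<in> u" | (y) y where "y \<in> Mid" "y \<noteq> 0" "nn 0 0 y 0 \<in> u" "\<And>x. x \<in> Mid \<Longrightarrow> nn 0 x 0 0 \<in> u \<Longrightarrow> x = 0"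
    | (\<phi>) "\<And>x. x \<in> Mid \<Longrightarrow> nn 0 x 0 0 \<in> u \<Longrightarrow> x = 0" "\<And>y. y \<in> Mid \<Longrightarrow> nn 0 0 y 0 \<in> u \<Longrightarrow> y = 0" by blast
  then show ?thesis
  proof cases
    case x
    have noy: "y = 0" if "y \<in> Mid" "nn 0 0 y 0 \<in> u" for y
    proof (rule ccontr)
      assume "y \<noteq> 0"
      have "nn 0 0 0 (- (x \<bullet> y)) \<in> u" using uB[OF x(3,1) _ that(2) _ that(1)] by simp
      then have "x \<bullet> y = 0" using noax by fastforce
      then show False using no_x_y[OF x(3,1,2) that(2,1) \<open>y \<noteq> 0\<close>] by blast
    qed
    have uf: "\<exists>x\<in>Mid. v = nn 0 x 0 0" if "v \<in> u" for v using form[OF that] noy no_phi_x[OF x(3,1,2)] by metis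
    have comm: "v ** w = w ** v" if vw: "v \<in> u" "w \<in> u" for v w
    proof -
      obtain x x' where "x \<in> Mid" "x' \<in> Mid" "v = nn 0 x 0 0" "w = nn 0 x' 0 0" using uf[OF vw(1)] uf[OF vw(2)] by blast
      then show ?thesis by (auto intro!: commI simp: bracket_nn)
    qed
    show ?thesis
    proof (rule frame.not_ample_M1[OF fr(1) h0])
      fix g assume g: "g \<in> H"
      have k: "\<exists>x\<in>Mid. a2 i1 i2 (1 * s * z1) (1 * s * z2) ** matrix_exp ((1 * s) *\<^sub>R X0) ** matrix_exp v = frame.M1 flip i1 j2 h0 s x" if v: "v \<in> u" for v s
      proof -
        obtain x where "x \<in> Mid" "v = nn 0 x 0 0" using uf[OF v] by blast
        then show ?thesis using exp_nn1[of x 0 0] by (intro bexI[of _ x]) (simp_all add: frame.M1_def[OF fr(1)] eX(1) z a2_swaps)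
      qed
      show "\<exists>s\<ge>0. \<exists>x\<in>Mid. sim K_bound g (frame.M1 flip i1 j2 h0 s x)"
        using not_ampleI[OF comm _ _ g, of 1 "\<lambda>s k. \<exists>x\<in>Mid. k = frame.M1 flip i1 j2 h0 s x"] k simI by blast
    qed
  next
    case y
    have no\<phi>: "\<phi> = 0" if "nn \<phi> 0 0 0 \<in> u" for \<phi>
    proof (rule ccontr)
      assume "\<phi> \<noteq> 0"
      moreover have "nn 0 (\<phi> *\<^sub>R y) 0 0 \<in> u" using uB[OF that Mid0 Mid0 y(3) Mid0 y(1)] by simp
      ultimately show False using y by (metis Mid_intros(1) scaleR_eq_0_iff)
    qed
    have uf: "\<exists>y\<in>Mid. v = nn 0 0 y 0" if "v \<in> u" for v using form[OF that] y(4) no\<phi> by metis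
    have comm: "v ** w = w ** v" if vw: "v \<in> u" "w \<in> u" for v w
    proof -
      obtain y y' where "y \<in> Mid" "y' \<in> Mid" "v = nn 0 0 y 0" "w = nn 0 0 y' 0" using uf[OF vw(1)] uf[OF vw(2)] by blast
      then show ?thesis by (auto intro!: commI simp: bracket_nn)
    qed
    show ?thesis
    proof (rule frame.not_ample_M1[OF fr(2) h0])
      fix g assume g: "g \<in> H"
      have k: "\<exists>x\<in>Mid. a2 i1 i2 (- 1 * s * z1) (- 1 * s * z2) ** matrix_exp ((- 1 * s) *\<^sub>R X0) ** matrix_exp v = frame.M1 flip i2 j1 h0 s x" if v: "v \<in> u" for v s
      proof -
        obtain y where "y \<in> Mid" "v = nn 0 0 y 0" using uf[OF v] by blast
        then show ?thesis using exp_nn2[of y 0] eX(2)[of "- s"] by (intro bexI[of _ y]) (simp_all add: frame.M1_def[OF fr(2)] z a2_swaps)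
      qed
      show "\<exists>s\<ge>0. \<exists>x\<in>Mid. sim K_bound g (frame.M1 flip i2 j1 h0 s x)"
        using not_ampleI[OF comm _ _ g, of "- 1" "\<lambda>s k. \<exists>x\<in>Mid. k = frame.M1 flip i2 j1 h0 s x"] k simI by blast
    qed
  next
    case \<phi>
    have uf: "\<exists>\<phi>. v = nn \<phi> 0 0 0" if "v \<in> u" for v using form[OF that] \<phi> by metis
    have comm: "v ** w = w ** v" if vw: "v \<in> u" "w \<in> u" for v w
      using uf[OF vw(1)] uf[OF vw(2)] by (auto intro!: commI simp: bracket_nn)
    show ?thesis
    proof (rule frame.not_ample_M2[OF fr(1)])
      fix g assume g: "g \<in> H"
      have k: "\<exists>\<eta>. a2 i1 i2 (1 * s * z1) (1 * s * z2) ** matrix_exp ((1 * s) *\<^sub>R X0) ** matrix_exp v = frame.M2 flip i1 j2 h0 s \<eta>" if v: "v \<in> u" for v s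
      proof -
        obtain \<psi> where "v = nn \<psi> 0 0 0" using uf[OF v] by blast
        then show ?thesis using exp_nn1[of 0 \<psi> 0] by (intro exI[of _ \<psi>]) (simp_all add: frame.M2_def[OF fr(1)] eX(1) z a2_swaps)
      qed
      show "\<exists>s\<ge>0. \<exists>\<eta>. sim K_bound g (frame.M2 flip i1 j2 h0 s \<eta>)"
        using not_ampleI[OF comm _ _ g, of 1 "\<lambda>s k. \<exists>\<eta>. k = frame.M2 flip i1 j2 h0 s \<eta>"] k simI by blast
    qed
  qed
qed

end

section \<open>The torus part and the theorem\<close>

lemma mgen_commute:
  assumes E: "\<And>A B. A \<in> E \<Longrightarrow> B \<in> E \<Longrightarrow> A ** B = B ** A" and "A \<in> mgen E" "B \<in> mgen E"
  shows "A ** B = B ** A"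
proof -
  have 1: "C ** B = B ** C" if "C \<in> E" "B \<in> mgen E" for B C
    using that(2)
  proof induction
    case (step A B) then show ?case using E[OF that(1) step(2)] by (metis matrix_mul_assoc)
  qed simp
  show ?thesis
    using assms(2)
  proof induction
    case (step A C) then show ?case using 1[OF step(2) assms(3)] by (metis matrix_mul_assoc)
  qed simp
qed

context so2 begin

lemma root_ker_a2:
  "root_ker Root_beta = {a2 i1 i2 s 0 | s. True}" "root_ker Root_alpha_beta = {a2 i1 i2 0 s | s. True}"
proof -
  have c: "root_char Root_beta (a2 i1 i2 a b) = exp b" "root_char Root_alpha_beta (a2 i1 i2 a b) = exp a" for a b
    unfolding root_char.simps i1_def[symmetric] i2_def[symmetric] using idxs_ne by (simp_all add: a2_nth)
  show "root_ker Root_beta = {a2 i1 i2 s 0 | s. True}" "root_ker Root_alpha_beta = {a2 i1 i2 0 s | s. True}"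
    unfolding root_ker_def Agrp_eq using c by (auto simp del: root_char.simps)
qed

end

section \<open>Splitting and commutativity of H\<close>

context solv begin

text \<open>Subtracting X leaves the torus generator in the Lie algebra, and \<open>H_gen\<close>
  for this generator writes every element as torus times unipotent with both factors in H.\<close>

lemma split_if_generator_in_u:
  assumes Z: "zz z1 z2 + X \<in> h" and X: "X \<in> u"
  shows "H = (H \<inter> Agrp) <#>\<^bsub>SO2\<^esub> (H \<inter> Ngrp)"
proof (intro equalityI subsetI)
  fix g assume g: "g \<in> H"
  have T0: "zz z1 z2 \<in> h" using subspace_diff[OF subspace_lie_algebra Z, of X] X by (simp add: u_def)
  have l0: "l (zz z1 z2) = 1" using z_nz idxs_ne by (simp add: l_def zz_nth power2_eq_square)
  obtain s w where g': "g = matrix_exp (s *\<^sub>R zz z1 z2) ** w" "w \<in> mgen (matrix_exp ` u)" using H_gen[OF T0 l0] g by blast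
  have "matrix_exp (s *\<^sub>R zz z1 z2) \<in> H \<inter> Agrp" using lie_algebra_exp[OF T0, of s] unfolding Agrp_eq by (auto simp: zz_scale exp_zz)
  then show "g \<in> (H \<inter> Agrp) <#>\<^bsub>SO2\<^esub> (H \<inter> Ngrp)" using g' HN_gen by (simp only: SO2_mult) blast
next
  fix g assume "g \<in> (H \<inter> Agrp) <#>\<^bsub>SO2\<^esub> (H \<inter> Ngrp)"
  then show "g \<in> H" using H_props(2) by (simp only: SO2_mult) blast
qed

lemma comm_group_H:
  assumes "\<And>X Y. X \<in> h \<Longrightarrow> Y \<in> h \<Longrightarrow> X ** Y = Y ** X"
  shows "comm_group (SO2\<lparr>carrier := H\<rparr>)"
proof (rule comm_groupI)
  have comm: "A ** B = B ** A" if "A \<in> H" "B \<in> H" for A B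
  proof (rule mgen_commute[of "matrix_exp ` h"])
    show "A ** B = B ** A" if "A \<in> matrix_exp ` h" "B \<in> matrix_exp ` h" for A B
      using that assms matrix_exp_add_commuting by (metis (no_types, lifting) add.commute imageE)
  qed (use that connected_generated[OF conn] in auto)
  show "x \<otimes>\<^bsub>SO2\<lparr>carrier := H\<rparr>\<^esub> y = y \<otimes>\<^bsub>SO2\<lparr>carrier := H\<rparr>\<^esub> x" if "x \<in> carrier (SO2\<lparr>carrier := H\<rparr>)" "y \<in> carrier (SO2\<lparr>carrier := H\<rparr>)" for x y
    using that comm by simp
  show "\<exists>y\<in>carrier (SO2\<lparr>carrier := H\<rparr>). y \<otimes>\<^bsub>SO2\<lparr>carrier := H\<rparr>\<^esub> x = \<one>\<^bsub>SO2\<lparr>carrier := H\<rparr>\<^esub>" if "x \<in> carrier (SO2\<lparr>carrier := H\<rparr>)" for x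
    using that inv_H by auto
qed (auto simp: one_H mult_H matrix_mul_assoc)

end

context thin_solv begin

lemma Z0_split: "X \<in> h \<Longrightarrow> \<exists>v\<in>u. X = l X *\<^sub>R Z0 + v"
proof
  assume X: "X \<in> h"
  have "l Z0 = 1" unfolding l_def Z0_diag using z_nz by (simp add: power2_eq_square)
  then have "l (X - l X *\<^sub>R Z0) = 0" by (simp add: linear_diff[OF linear_l] linear_scale[OF linear_l])
  then show "X - l X *\<^sub>R Z0 \<in> u" unfolding u_eq
    using subspace_diff[OF subspace_lie_algebra X lie_algebra_scaleR[OF Z0]] by simp
qed simp

lemma zz_in_lie_T: "c *\<^sub>R zz z1 z2 \<in> lie_algebra (Tpart H)"
  unfolding lie_algebra_def T by (auto simp: zz_scale exp_zz) (metis mult.assoc)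

text \<open>Common end of the cases beta and alpha + beta. The Lie algebra lies in the Lie algebra
  of T plus the short root space, so the component for alpha + 2 beta is taken to be 0.\<close>

lemma abelian_conclusion:
  assumes \<omega>: "\<omega> \<in> {Root_beta, Root_alpha_beta}" "Tpart H = root_ker \<omega>"
    and R: "subspace (root_space \<omega> :: 'm sqmat set)" "X0 \<in> root_space \<omega>" "u \<subseteq> root_space \<omega>" "v \<in> u" "v \<noteq> 0"
    and comm: "\<And>v. v \<in> u \<Longrightarrow> Z0 ** v = v ** Z0" "\<And>v w. v \<in> u \<Longrightarrow> w \<in> u \<Longrightarrow> v ** w = w ** v"
  shows "comm_group (SO2\<lparr>carrier := H\<rparr>) \<and>
    (\<exists>\<omega> \<in> {Root_beta, Root_alpha_beta}. Tpart H = root_ker \<omega> \<and> h \<inter> root_space \<omega> \<noteq> {0} \<and>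
        h \<subseteq> {X + Y + Z |X Y Z. X \<in> lie_algebra (Tpart H) \<and> Y \<in> root_space \<omega> \<and> Z \<in> root_space Root_alpha_2beta})"
proof (intro conjI bexI[OF _ \<omega>(1)] \<omega>(2))
  note bil = bounded_bilinear_matrix_mult
  show "comm_group (SO2\<lparr>carrier := H\<rparr>)"
  proof (rule comm_group_H)
    fix X Y assume "X \<in> h" "Y \<in> h"
    then obtain v w where v: "v \<in> u" "X = l X *\<^sub>R Z0 + v" and w: "w \<in> u" "Y = l Y *\<^sub>R Z0 + w" using Z0_split by blast
    have "(a *\<^sub>R Z + v) ** (b *\<^sub>R Z + w) = (b *\<^sub>R Z + w) ** (a *\<^sub>R Z + v)"
      if "Z ** v = v ** Z" "Z ** w = w ** Z" "v ** w = w ** v" for a b and Z v w :: "'m sqmat"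
      using that by (simp add: bounded_bilinear.add_left[OF bil] bounded_bilinear.add_right[OF bil] mult.commute scaleR_right_distrib add_ac)
    from this[OF comm(1)[OF v(1)] comm(1)[OF w(1)] comm(2)[OF v(1) w(1)]]
    show "X ** Y = Y ** X" using v(2) w(2) by metis
  qed
  show "h \<inter> root_space \<omega> \<noteq> {0}" using R u_h by blast
  show "h \<subseteq> {X + Y + Z |X Y Z. X \<in> lie_algebra (Tpart H) \<and> Y \<in> root_space \<omega> \<and> Z \<in> root_space Root_alpha_2beta}"
  proof
    fix X assume "X \<in> h"
    then obtain v where v: "v \<in> u" "X = l X *\<^sub>R Z0 + v" using Z0_split by blast
    have "X = l X *\<^sub>R zz z1 z2 + (l X *\<^sub>R X0 + v) + 0" by (subst v(2)) (simp add: scaleR_right_distrib)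
    moreover have "l X *\<^sub>R X0 + v \<in> root_space \<omega>" using R v by (intro subspace_add subspace_scale) auto
    moreover have "0 \<in> (root_space Root_alpha_2beta :: 'm sqmat set)" unfolding root_space_nn by (auto intro!: exI[of _ 0])
    ultimately show "X \<in> {X + Y + Z |X Y Z. X \<in> lie_algebra (Tpart H) \<and> Y \<in> root_space \<omega> \<and> Z \<in> root_space Root_alpha_2beta}"
      using zz_in_lie_T by blast
  qed
qed

lemma subspace_short_root_space:
  "subspace (root_space Root_beta :: 'm sqmat set)" "subspace (root_space Root_alpha_beta :: 'm sqmat set)"
proof -
  have 0: "\<exists>x. 0 = nn 0 0 x 0 \<and> x \<in> Mid" "\<exists>x. 0 = nn 0 x 0 0 \<and> x \<in> Mid" by (intro exI[of _ 0]; simp)+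
  have 1: "\<exists>z. nn 0 0 (x + y) 0 = nn 0 0 z 0 \<and> z \<in> Mid" "\<exists>z. nn 0 (x + y) 0 0 = nn 0 z 0 0 \<and> z \<in> Mid" if "x \<in> Mid" "y \<in> Mid" for x y
    using Mid_intros(2)[OF that] by blast+
  have 2: "\<exists>z. nn 0 0 (r *\<^sub>R x) 0 = nn 0 0 z 0 \<and> z \<in> Mid" "\<exists>z. nn 0 (r *\<^sub>R x) 0 0 = nn 0 z 0 0 \<and> z \<in> Mid" if "x \<in> Mid" for x r
    using Mid_intros(1)[OF that] by blast+
  show "subspace (root_space Root_beta :: 'm sqmat set)" "subspace (root_space Root_alpha_beta :: 'm sqmat set)"
    unfolding root_space_nn subspace_def using 0 1 2 by (auto simp: nn_plus nn_scale)
qed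

lemma Z0_commute:
  assumes "nn \<phi> x y \<eta> \<in> u" "x \<in> Mid" "y \<in> Mid"
    and "(z1 - z2) * \<phi> = 0" "z1 *\<^sub>R x + f0 *\<^sub>R y - \<phi> *\<^sub>R y0 = 0" "z2 *\<^sub>R y = 0" "(z1 + z2) * \<eta> + x \<bullet> y0 - x0 \<bullet> y = 0"
  shows "Z0 ** nn \<phi> x y \<eta> = nn \<phi> x y \<eta> ** Z0"
proof -
  note bil = bounded_bilinear_matrix_mult
  have "Z0 ** nn \<phi> x y \<eta> - nn \<phi> x y \<eta> ** Z0 =
     (zz z1 z2 ** nn \<phi> x y \<eta> - nn \<phi> x y \<eta> ** zz z1 z2) + (X0 ** nn \<phi> x y \<eta> - nn \<phi> x y \<eta> ** X0)"
    by (simp add: bounded_bilinear.add_left[OF bil] bounded_bilinear.add_right[OF bil])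
  also have "\<dots> = nn ((z1 - z2) * \<phi>) (z1 *\<^sub>R x + f0 *\<^sub>R y - \<phi> *\<^sub>R y0) (z2 *\<^sub>R y) ((z1 + z2) * \<eta> + x \<bullet> y0 - x0 \<bullet> y)"
    unfolding bracket_zz_nn[OF assms(2,3)] bracket_nn[OF m0 assms(2,3)] nn_plus by (simp add: algebra_simps)
  also have "\<dots> = 0" using assms(4-7) by (simp only: nn_zero)
  finally show ?thesis by simp
qed

lemma ample_imp_abelian:
  assumes "ample H"
  shows "comm_group (SO2\<lparr>carrier := H\<rparr>) \<and>
    (\<exists>\<omega> \<in> {Root_beta, Root_alpha_beta}. Tpart H = root_ker \<omega> \<and> h \<inter> root_space \<omega> \<noteq> {0} \<and>
        h \<subseteq> {X + Y + Z |X Y Z. X \<in> lie_algebra (Tpart H) \<and> Y \<in> root_space \<omega> \<and> Z \<in> root_space Root_alpha_2beta})"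
proof -
  consider (b) "z1 = 1" "z2 = 0" | (ab) "z1 = 0" "z2 = 1"
    using zcase alpha_classification alpha_2beta_classification assms by auto
  then show ?thesis
  proof cases
    case b
    have X: "f0 = 0" "x0 = 0" "h0 = 0" using r0 b unfolding rsp_def by auto
    obtain y where y: "y \<in> Mid" "y \<noteq> 0" "nn 0 0 y 0 \<in> u" and uf: "\<And>v. v \<in> u \<Longrightarrow> \<exists>y\<in>Mid. v = nn 0 0 y 0"
      using beta_classification[OF b assms] by blast
    show ?thesis
    proof (rule abelian_conclusion)
      show "Root_beta \<in> {Root_beta, Root_alpha_beta}" by simp
      show "Tpart H = root_ker Root_beta" unfolding T root_ker_a2 b by simp
      show "subspace (root_space Root_beta :: 'm sqmat set)" by (rule subspace_short_root_space)
      show "X0 \<in> root_space Root_beta" unfolding root_space_nn X using m0 by blast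
      show "u \<subseteq> root_space Root_beta" unfolding root_space_nn using uf by blast
      show "nn 0 0 y 0 \<in> u" by fact
      show "nn 0 0 y 0 \<noteq> 0" using nn_inject[OF Mid0 y(1) Mid0 Mid0, of 0 0 0 0] y(2) by auto
      fix v assume v: "v \<in> u"
      then obtain y where y: "y \<in> Mid" "v = nn 0 0 y 0" using uf by blast
      show "Z0 ** v = v ** Z0" unfolding y(2) using v y b X by (intro Z0_commute) auto
      fix w assume "w \<in> u"
      then obtain y' where "y' \<in> Mid" "w = nn 0 0 y' 0" using uf by blast
      then show "v ** w = w ** v" using y by (auto intro!: commI simp: bracket_nn)
    qed
  next
    case ab
    have X: "f0 = 0" "y0 = 0" "h0 = 0" using r0 ab unfolding rsp_def by auto
    obtain x where x: "x \<in> Mid" "x \<noteq> 0" "nn 0 x 0 0 \<in> u" and uf: "\<And>v. v \<in> u \<Longrightarrow> \<exists>x\<in>Mid. v = nn 0 x 0 0"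
      using alpha_beta_classification[OF ab assms] by blast
    show ?thesis
    proof (rule abelian_conclusion)
      show "Root_alpha_beta \<in> {Root_beta, Root_alpha_beta}" by simp
      show "Tpart H = root_ker Root_alpha_beta" unfolding T root_ker_a2 ab by simp
      show "subspace (root_space Root_alpha_beta :: 'm sqmat set)" by (rule subspace_short_root_space)
      show "X0 \<in> root_space Root_alpha_beta" unfolding root_space_nn X using m0 by blast
      show "u \<subseteq> root_space Root_alpha_beta" unfolding root_space_nn using uf by blast
      show "nn 0 x 0 0 \<in> u" by fact
      show "nn 0 x 0 0 \<noteq> 0" using nn_inject[OF x(1) Mid0 Mid0 Mid0, of 0 0 0 0] x(2) by auto
      fix v assume v: "v \<in> u"
      then obtain x where x: "x \<in> Mid" "v = nn 0 x 0 0" using uf by blast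
      show "Z0 ** v = v ** Z0" unfolding x(2) using v x ab X by (intro Z0_commute) auto
      fix w assume "w \<in> u"
      then obtain x' where "x' \<in> Mid" "w = nn 0 x' 0 0" using uf by blast
      then show "v ** w = w ** v" using x by (auto intro!: commI simp: bracket_nn)
    qed
  qed
qed

text \<open>T is the kernel of \<omega>, so \<open>X0\<close> lies in the same root space as
  \<open>v\<close>. The exponents in exp (s Z0) exp (c v) therefore add, which gives the family of
  \<open>ample_torus_short\<close>.\<close>

lemma short_root_imp_ample:
  assumes \<omega>: "\<omega> \<in> {Root_beta, Root_alpha_beta}" "Tpart H = root_ker \<omega>" and R: "h \<inter> root_space \<omega> \<noteq> {0}"
  shows "ample H"
proof -
  obtain v where v: "v \<in> h" "v \<in> root_space \<omega>" "v \<noteq> 0"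
    using R lie_algebra_0 subspace_0[OF subspace_short_root_space(1)] subspace_0[OF subspace_short_root_space(2)] \<omega>(1) by blast
  have "a2 i1 i2 (1 * z1) (1 * z2) \<in> Tpart H" unfolding T by blast
  then have z: "a2 i1 i2 z1 z2 \<in> root_ker \<omega>" using \<omega>(2) by simp
  have EH: "a2 i1 i2 (s * z1) (s * z2) ** matrix_exp (s *\<^sub>R X0) ** matrix_exp (c *\<^sub>R v) \<in> H" for s c
    using lie_algebra_exp[OF Z0, of s] lie_algebra_exp[OF v(1), of c] mult_H unfolding exp_Z0 by blast
  from \<omega>(1) consider (b) "\<omega> = Root_beta" | (ab) "\<omega> = Root_alpha_beta" by blast
  then show ?thesis
  proof cases
    case b
    then obtain s where s: "a2 i1 i2 z1 z2 = a2 i1 i2 s 0" using z root_ker_a2(1) by auto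
    have z: "z1 = 1" "z2 = 0" using a2_inject[OF s] zcase by auto
    have X: "f0 = 0" "x0 = 0" "h0 = 0" using r0 z unfolding rsp_def by auto
    obtain y where y: "y \<in> Mid" "v = nn 0 0 y 0" using v(2)[unfolded b root_space_nn] by blast
    have "y \<noteq> 0" using v(3) y by auto
    then show ?thesis
    proof (rule full_frame.ample_torus_short[OF frames(1) y(1) _ m0(2)])
      fix s c
      have "matrix_exp (s *\<^sub>R X0) = eich (e i2) (s *\<^sub>R y0)" "matrix_exp (c *\<^sub>R v) = eich (e i2) (c *\<^sub>R y)"
        using exp_nn2[of "s *\<^sub>R y0" 0] exp_nn2[of "c *\<^sub>R y" 0] m0 y X by (simp_all add: nn_scale Mid_intros)
      moreover have "eich (e i2) (s *\<^sub>R y0) ** eich (e i2) (c *\<^sub>R y) = eich (e i2) (s *\<^sub>R y0 + c *\<^sub>R y)"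
        using m0 y by (intro eich_add) (simp_all add: B_bil)
      moreover have "a2 i1 i2 s 0 = tor (e i1) (e (flip i1)) s" by (simp add: a2_def)
      ultimately show "tor (e i1) (e (flip i1)) s ** eich (e i2) (s *\<^sub>R y0 + c *\<^sub>R y) \<in> H"
        using EH[of s c] by (simp add: z flip: matrix_mul_assoc)
    qed
  next
    case ab
    then obtain s where s: "a2 i1 i2 z1 z2 = a2 i1 i2 0 s" using z root_ker_a2(2) by auto
    have z: "z1 = 0" "z2 = 1" using a2_inject[OF s] zcase by auto
    have X: "f0 = 0" "y0 = 0" "h0 = 0" using r0 z unfolding rsp_def by auto
    obtain x where x: "x \<in> Mid" "v = nn 0 x 0 0" using v(2)[unfolded ab root_space_nn] by blast
    have "x \<noteq> 0" using v(3) x by auto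
    then show ?thesis
    proof (rule ample_torus_short[OF x(1) _ m0(1)])
      fix s c
      have "matrix_exp (s *\<^sub>R X0) = eich (e i1) (s *\<^sub>R x0)" "matrix_exp (c *\<^sub>R v) = eich (e i1) (c *\<^sub>R x)"
        using exp_nn1[of "s *\<^sub>R x0" 0 0] exp_nn1[of "c *\<^sub>R x" 0 0] m0 x X by (simp_all add: nn_scale Mid_intros)
      moreover have "eich (e i1) (s *\<^sub>R x0) ** eich (e i1) (c *\<^sub>R x) = eich (e i1) (s *\<^sub>R x0 + c *\<^sub>R x)"
        using m0 x by (intro eich_add) (simp_all add: B_bil)
      moreover have "a2 i1 i2 0 s = tor (e i2) (e (flip i2)) s" by (simp add: a2_def)
      ultimately show "tor (e i2) (e (flip i2)) s ** eich (e i1) (s *\<^sub>R x0 + c *\<^sub>R x) \<in> H"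
        using EH[of s c] by (simp add: z flip: matrix_mul_assoc)
    qed
  qed
qed

end

section \<open>The torus part is a root kernel\<close>

context so2 begin

lemma Tpart_eq:
  assumes "H \<subseteq> ANgrp"
  shows "Tpart H = {a2 i1 i2 (ln (g $ i1 $ i1)) (ln (g $ i2 $ i2)) | g. g \<in> H}"
proof (intro equalityI subsetI)
  fix t assume "t \<in> Tpart H"
  then obtain g n where tg: "t \<in> Agrp" "g \<in> H" "n \<in> Ngrp" "t = g ** n" unfolding Tpart_def by auto
  then obtain a b where t: "t = a2 i1 i2 a b" "g \<in> H" "n \<in> Ngrp" "t = g ** n" using Agrp_eq by blast
  have "t $ i $ i = g $ i $ i" for i
    using UT_mult(2)[OF AN_UT(1), of g n i] t assms by (auto simp: Ngrp_iff)
  from this[of i1] this[of i2] have "exp a = g $ i1 $ i1" "exp b = g $ i2 $ i2" using idxs_ne by (simp_all add: t(1) a2_nth flip: t(4))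
  then have "ln (g $ i1 $ i1) = a" "ln (g $ i2 $ i2) = b" by (metis ln_exp)+
  then show "t \<in> {a2 i1 i2 (ln (g $ i1 $ i1)) (ln (g $ i2 $ i2)) | g. g \<in> H}" using t by blast
next
  fix t assume "t \<in> {a2 i1 i2 (ln (g $ i1 $ i1)) (ln (g $ i2 $ i2)) | g. g \<in> H}"
  then obtain g where g: "g \<in> H" "t = a2 i1 i2 (ln (g $ i1 $ i1)) (ln (g $ i2 $ i2))" by blast
  then obtain n where n: "n \<in> Ngrp" "g = t ** n" using AN_decomp assms by blast
  have "t ** (n ** iv n) = g ** iv n" unfolding n(2) by (simp only: matrix_mul_assoc)
  then have "t = g ** iv n" using isom_iv_right n(1) by (simp add: Ngrp_iff G_isom)
  then have "t \<in> H <#>\<^bsub>SO2\<^esub> Ngrp" using N_iv[OF n(1)] g(1) by (simp only: SO2_mult) blast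
  moreover have "t \<in> Agrp" using g Agrp_eq by blast
  ultimately show "t \<in> Tpart H" by (simp add: Tpart_def)
qed

text \<open>Each coordinate of \<open>c\<close> belongs to a root; commuting with an element of
  \<open>Tset\<close> on which this root is nontrivial forces the coordinate to vanish.\<close>

lemma centralizer_trivial:
  assumes "\<And>z1 z2 :: real. (z1, z2) \<in> {(1, 1), (1, 0), (0, 1), (1, -1)} \<Longrightarrow> \<exists>a b. a2 i1 i2 a b \<in> Tset \<and> z2 * a \<noteq> z1 * b"
    and c: "c \<in> centralizer_in Ngrp Tset"
  shows "c = mat 1"
proof -
  have cN: "c \<in> Ngrp" "\<And>t. t \<in> Tset \<Longrightarrow> c ** t = t ** c" using c by (auto simp: centralizer_in_def)
  have ent: "c $ i $ j * a2 i1 i2 a b $ j $ j = a2 i1 i2 a b $ i $ i * c $ i $ j" if "a2 i1 i2 a b \<in> Tset" for i j a b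
  proof -
    let ?t = "a2 i1 i2 a b"
    have "(c ** ?t) $ i $ j = (?t ** c) $ i $ j" using cN(2)[OF that] by simp
    moreover have "(c ** ?t) $ i $ j = c $ i $ j * ?t $ j $ j"
      by (simp add: matrix_matrix_mult_def a2_nth if_distrib[of "\<lambda>b. _ * b"] cong: if_cong)
    moreover have "(?t ** c) $ i $ j = ?t $ i $ i * c $ i $ j"
      by (simp add: matrix_matrix_mult_def a2_nth if_distrib[of "\<lambda>b. b * _"] cong: if_cong)
    ultimately show ?thesis by simp
  qed
  obtain a b where 1: "a2 i1 i2 a b \<in> Tset" "a \<noteq> b" using assms(1)[of 1 1] by auto
  obtain a' b' where 2: "a2 i1 i2 a' b' \<in> Tset" "b' \<noteq> 0" using assms(1)[of 1 0] by auto
  obtain a'' b'' where 3: "a2 i1 i2 a'' b'' \<in> Tset" "a'' \<noteq> 0" using assms(1)[of 0 1] by auto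
  obtain a3 b3 where 4: "a2 i1 i2 a3 b3 \<in> Tset" "a3 \<noteq> - b3" using assms(1)[of 1 "-1"] by auto
  show ?thesis
  proof (rule N_trivial[OF cN(1)])
    show "c $ i1 $ i2 = 0" using ent[OF 1(1), of i1 i2] 1(2) idxs_ne by (auto simp: a2_nth)
    show "c $ i1 $ j2 = 0" using ent[OF 4(1), of i1 j2] 4(2) idxs_ne by (auto simp: a2_nth)
    show "c $ i1 $ k = 0" if k: "flip k = k" for k using ent[OF 3(1), of i1 k] 3(2) mid_ne[OF k] by (auto simp: a2_nth)
    show "c $ i2 $ k = 0" if k: "flip k = k" for k using ent[OF 2(1), of i2 k] 2(2) mid_ne[OF k] idxs_ne by (auto simp: a2_nth)
  qed
qed

text \<open>Multiples of a nonzero element are unbounded in both directions, and a connected set of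
  reals is an interval.\<close>

lemma connected_additive_real:
  fixes S :: "real set"
  assumes "connected S" "\<And>a b. a \<in> S \<Longrightarrow> b \<in> S \<Longrightarrow> a + b \<in> S" "\<And>a. a \<in> S \<Longrightarrow> - a \<in> S" "s \<in> S" "s \<noteq> 0"
  shows "S = UNIV"
proof -
  have n: "real (Suc n) * s \<in> S" for n
  proof (induction n)
    case (Suc n)
    have "real (Suc (Suc n)) * s = real (Suc n) * s + s" by (simp add: algebra_simps)
    then show ?case using assms(2)[OF Suc assms(4)] by (simp only:)
  qed (simp add: assms(4))
  have "x \<in> S" for x
  proof -
    obtain m where m: "\<bar>x\<bar> < real m * \<bar>s\<bar>" using reals_Archimedean3[of "\<bar>s\<bar>"] assms(5) by auto
    let ?b = "\<bar>real (Suc m) * s\<bar>"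
    have "\<bar>x\<bar> \<le> ?b" using m assms(5) by (simp add: abs_mult distrib_right)
    moreover have "?b \<in> S" "- ?b \<in> S" using n[of m] assms(3)[OF n[of m]] assms(3)[of "- (real (Suc m) * s)"] by (auto simp: abs_if)
    ultimately show ?thesis using assms(1) unfolding connected_iff_interval by (metis abs_le_iff minus_le_iff)
  qed
  then show ?thesis by blast
qed

text \<open>If no root were trivial on T, its centralizer would be trivial and compatibility would
  split H. So T lies on one of the four lines. The parameter along it is continuous and additive on
  the connected group H, and not constantly 0, since otherwise H would lie in N and split again;
  hence it takes all real values.\<close>

lemma torus_part_is_root_kernel:
  assumes sub: "subgroup H SO2" and AN: "H \<subseteq> ANgrp" and conn: "connected H" and compat: "compatible_with_A H"
    and ne: "H \<noteq> (H \<inter> Agrp) <#>\<^bsub>SO2\<^esub> (H \<inter> Ngrp)"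
  shows "\<exists>z1 z2 :: real. (z1, z2) \<in> {(1, 1), (1, 0), (0, 1), (1, -1)} \<and> Tpart H = {a2 i1 i2 (s * z1) (s * z2) | s. True}"
proof -
  have H: "H \<subseteq> G" "mat 1 \<in> H" "\<And>a b. a \<in> H \<Longrightarrow> b \<in> H \<Longrightarrow> a ** b \<in> H" "\<And>a. a \<in> H \<Longrightarrow> iv a \<in> H"
    using sub unfolding subgroup_SO2_iff by blast+
  have HU: "H \<subseteq> UT" using AN AN_UT(1) by blast
  have split: "H = (H \<inter> Agrp) <#>\<^bsub>SO2\<^esub> (H \<inter> Ngrp)" if fac: "\<And>g. g \<in> H \<Longrightarrow> \<exists>a n. a \<in> Agrp \<and> n \<in> H \<inter> Ngrp \<and> g = a ** n"
  proof (intro equalityI subsetI)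
    fix g assume g: "g \<in> H"
    then obtain a n where an: "a \<in> Agrp" "n \<in> H \<inter> Ngrp" "g = a ** n" using fac[OF g] by blast
    have "a ** (n ** iv n) = g ** iv n" unfolding an(3) by (simp only: matrix_mul_assoc)
    then have "a = g ** iv n" using isom_iv_right an(2) by (simp add: Ngrp_iff G_isom)
    then have "a \<in> H" using H(3,4) g an(2) by blast
    then show "g \<in> (H \<inter> Agrp) <#>\<^bsub>SO2\<^esub> (H \<inter> Ngrp)" using an by (simp only: SO2_mult) blast
  next
    fix g assume "g \<in> (H \<inter> Agrp) <#>\<^bsub>SO2\<^esub> (H \<inter> Ngrp)"
    then show "g \<in> H" using H(3) by (simp only: SO2_mult) blast
  qed
  define p q where "p g = ln (g $ i1 $ i1)" and "q g = ln (g $ i2 $ i2)" for g :: "'m sqmat"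
  have T: "Tpart H = {a2 i1 i2 (p g) (q g) | g. g \<in> H}" using Tpart_eq[OF AN] by (simp add: p_def q_def)
  have pos: "g $ i1 $ i1 > 0" "g $ i2 $ i2 > 0" if "g \<in> H" for g
  proof -
    have "0 \<le> g $ i $ i \<and> g $ i $ i * g $ flip i $ flip i = 1" for i using that AN AN_eq by blast
    then show "g $ i1 $ i1 > 0" "g $ i2 $ i2 > 0" by (metis less_eq_real_def mult_zero_left zero_neq_one)+
  qed
  have pq: "p (g ** k) = p g + p k" "q (g ** k) = q g + q k" if "g \<in> H" "k \<in> H" for g k
    using UT_mult(2)[of g k] that HU pos[OF that(1)] pos[OF that(2)] by (auto simp: p_def q_def ln_mult subset_iff)
  have pq1: "p (mat 1) = 0" "q (mat 1) = 0" by (simp_all add: p_def q_def mat_def)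
  have "\<exists>z1 z2 :: real. (z1, z2) \<in> {(1, 1), (1, 0), (0, 1), (1, -1)} \<and> (\<forall>g\<in>H. z2 * p g = z1 * q g)"
  proof (rule ccontr)
    assume no: "\<not> ?thesis"
    have triv: "c = mat 1" if "c \<in> centralizer_in Ngrp (Tpart H)" for c
      using no T by (intro centralizer_trivial[OF _ that]) blast
    have "\<exists>a n. a \<in> Agrp \<and> n \<in> H \<inter> Ngrp \<and> g = a ** n" if "g \<in> H" for g
    proof -
      have "g \<in> Tpart H <#>\<^bsub>SO2\<^esub> (H \<inter> Ngrp) <#>\<^bsub>SO2\<^esub> centralizer_in Ngrp (Tpart H)" using compat that unfolding compatible_with_A_def by blast
      then obtain a n c where "a \<in> Tpart H" "n \<in> H \<inter> Ngrp" "c \<in> centralizer_in Ngrp (Tpart H)" "g = a ** n ** c" by auto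
      moreover have "a \<in> Agrp" using \<open>a \<in> Tpart H\<close> unfolding Tpart_def by blast
      ultimately show ?thesis using triv[of c] by auto
    qed
    then show False using ne split by blast
  qed
  then obtain z1 z2 :: real where z: "(z1, z2) \<in> {(1, 1), (1, 0), (0, 1), (1, -1)}" "\<And>g. g \<in> H \<Longrightarrow> z2 * p g = z1 * q g" by blast
  define f where "f g = (if z1 = 0 then q g else p g)" for g
  have f: "p g = f g * z1" "q g = f g * z2" if "g \<in> H" for g
    using z(1) z(2)[OF that] by (auto simp: f_def)
  have "f ` H = UNIV"
  proof -
    have "continuous_on H p" "continuous_on H q" unfolding p_def q_def
      by (intro continuous_on_ln continuous_intros; use pos in force)+
    then have "continuous_on H f" unfolding f_def by (cases "z1 = 0") simp_all
    then have 1: "connected (f ` H)" using conn connected_continuous_image by blast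
    have fm: "f (g ** k) = f g + f k" if "g \<in> H" "k \<in> H" for g k using pq[OF that] by (simp add: f_def)
    have "a + b \<in> f ` H" if "a \<in> f ` H" "b \<in> f ` H" for a b
      using that fm H(3) by (metis (no_types, lifting) imageE imageI)
    moreover have "- a \<in> f ` H" if af: "a \<in> f ` H" for a
    proof -
      obtain g where g: "g \<in> H" "a = f g" using af by blast
      have gi: "g ** iv g = mat 1" using g H(1) isom_iv_right G_isom by blast
      have f1: "f (mat 1) = 0" using pq1 by (simp add: f_def)
      have "f g + f (iv g) = f (g ** iv g)" by (simp only: fm[OF g(1) H(4)[OF g(1)]])
      also have "\<dots> = 0" by (simp only: gi f1)
      finally have "- a = f (iv g)" using g by simp
      then show ?thesis using H(4)[OF g(1)] by blast
    qed
    moreover have "\<exists>g\<in>H. f g \<noteq> 0"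
    proof (rule ccontr)
      assume "\<not> ?thesis"
      then have z0: "p g = 0" "q g = 0" if "g \<in> H" for g using f that by auto
      have "\<exists>a n. a \<in> Agrp \<and> n \<in> H \<inter> Ngrp \<and> g = a ** n" if g: "g \<in> H" for g
      proof -
        obtain n where n: "n \<in> Ngrp" "g = a2 i1 i2 (p g) (q g) ** n" using AN_decomp g AN unfolding p_def q_def by blast
        then have "g \<in> Ngrp" using z0[OF g] by simp
        moreover have "mat 1 \<in> (Agrp :: 'm sqmat set)" unfolding Agrp_eq using a2_00 by (metis (mono_tags, lifting) mem_Collect_eq)
        ultimately show ?thesis using g by (intro exI[of _ "mat 1"] exI[of _ g]) simp
      qed
      then show False using ne split by blast
    qed
    ultimately show ?thesis using connected_additive_real[OF 1] by blast
  qed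
  then have "\<exists>g\<in>H. f g = s" for s by (metis (no_types, lifting) UNIV_I imageE)
  then have "Tpart H = {a2 i1 i2 (s * z1) (s * z2) | s. True}" unfolding T using f by (auto) (metis)+
  then show ?thesis using z(1) by blast
qed

end

theorem theorem6p3:
  fixes n :: nat and H :: "'m::{finite,linorder} sqmat set"
  assumes "CARD('m) = n + 2" and "n \<ge> 3"
    and "subgroup H SO2" and "H \<subseteq> ANgrp"
    and "closedin (top_of_set ANgrp) H" and "connected H"
    and "compatible_with_A H"
    and "H \<noteq> (H \<inter> Agrp) <#>\<^bsub>SO2\<^esub> (H \<inter> Ngrp)"
    and "\<not> cartan_decomposition_subgroup (H \<inter> Ngrp)"
  shows "cartan_decomposition_subgroup H \<longleftrightarrow>
    comm_group (SO2\<lparr>carrier := H\<rparr>) \<and>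
    (\<exists>\<omega> \<in> {Root_beta, Root_alpha_beta}.
        Tpart H = root_ker \<omega> \<and>
        lie_algebra H \<inter> root_space \<omega> \<noteq> {0} \<and>
        lie_algebra H \<subseteq>
          {X + Y + Z |X Y Z. X \<in> lie_algebra (Tpart H) \<and> Y \<in> root_space \<omega>
                             \<and> Z \<in> root_space Root_alpha_2beta})"
proof -
  have so2: "so2 TYPE('m)" by unfold_locales (use assms in simp)
  interpret so2 "TYPE('m)" by (rule so2)
  obtain z1 z2 :: real where z: "(z1, z2) \<in> {(1, 1), (1, 0), (0, 1), (1, -1)}" "Tpart H = {a2 i1 i2 (s * z1) (s * z2) | s. True}"
    using torus_part_is_root_kernel[OF assms(3,4,6,7,8)] by blast
  have solv: "solv H z1 z2" by (rule solv.intro[OF so2 solv_axioms.intro[OF assms(3-6) z assms(7)]])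
  interpret solv "TYPE('m)" H z1 z2 by (rule solv)
  obtain \<phi> x y \<eta> where g: "rsp \<phi> x y \<eta>" "zz z1 z2 + nn \<phi> x y \<eta> \<in> lie_algebra H" using compatible_generator by blast
  have ns: "nn \<phi> x y \<eta> \<notin> u" using split_if_generator_in_u[OF g(2)] assms(8) by blast
  have th: "\<not> ample (H \<inter> Ngrp)" using assms(9) cartan_HN by blast
  interpret thin_solv "TYPE('m)" H z1 z2 \<phi> x y \<eta>
    by (rule thin_solv.intro[OF solv thin_solv_axioms.intro[OF th g ns]])
  show ?thesis unfolding cartan_H using ample_imp_abelian short_root_imp_ample by blast
qed

end
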